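(* Let $F$ be a field of characteristic $p=2$ and suppose the scalars $t_1,t_2\in F$ are $p$-independent. Let $F\subset E$ be the field extension obtained by adjoining the root $\sqrt{t_1}$. Then the cubic surface $X\subset\mathbb{P}^3_F=\operatorname{Proj}F[x_1,x_2,y_1,y_2]$ defined by the equation $y_1^3+t_1x_1^2y_1+y_2^3+t_2x_2^2y_2=0$ has the following properties: (i) The scheme $X$ is regular. (ii) There is no dominant rational map $\mathbb{P}^2\dashrightarrow X$ over $F$. (iii) The base-change $X\otimes_FE$ is birational to $\mathbb{P}^2\otimes_FE$. (iv) The set of rational points $X(F)$ is infinite. (v) If $F$ is separably closed, the rational points are Zariski dense in $X$.
   Context: For a field $F$ of characteristic $p>0$, scalars $t_1,\ldots,t_n\in F$ are called $p$-independent if the differentials $dt_1,\ldots,dt_n$ are linearly independent in the $F$-vector space of absolute Kähler differentials $\Omega^1_F=\Omega^1_{F/\mathbb{Z}}$. *)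

theory Defs
  imports
    "HOL-Analysis.Abstract_Topology"
    "HOL-Algebra.Algebra"
    "HOL-Algebra.Algebraic_Closure_Type"
    "HOL-Library.Poly_Mapping"
    "HOL-Library.Extended_Nat"
    "HOL-Library.Numeral_Type"
begin

section \<open>Absolute Kaehler differentials and p-independence\<close>

text \<open>The module of differentials over the integers is the free module on symbols \<open>da\<close>
  (encoded as \<open>Poly_Mapping.single a 1\<close>) modulo additivity, the Leibniz rule, and the vanishing
  of the symbols of integers.\<close>

definition free_scale :: "'a::field \<Rightarrow> ('a \<Rightarrow>\<^sub>0 'a) \<Rightarrow> ('a \<Rightarrow>\<^sub>0 'a)" where
  "free_scale c p = Poly_Mapping.map ((*) c) p"

lemma lookup_free_scale: "Poly_Mapping.lookup (free_scale c p) k = c * Poly_Mapping.lookup p k"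
  by (simp add: free_scale_def map.rep_eq when_def)

global_interpretation free_mod: vector_space "free_scale :: 'a::field \<Rightarrow> ('a \<Rightarrow>\<^sub>0 'a) \<Rightarrow> _"
  by unfold_locales
    (auto intro!: poly_mapping_eqI simp: lookup_free_scale lookup_add algebra_simps)

definition kaehler_generators :: "('a::field \<Rightarrow>\<^sub>0 'a) set" where
  "kaehler_generators =
     {Poly_Mapping.single (a + b) 1 - Poly_Mapping.single a 1 - Poly_Mapping.single b 1 | a b. True} \<union>
     {Poly_Mapping.single (a * b) 1 - free_scale a (Poly_Mapping.single b 1)
        - free_scale b (Poly_Mapping.single a 1) | a b. True} \<union>
     {Poly_Mapping.single (of_int n) 1 | n. True}"

abbreviation kaehler_relations :: "('a::field \<Rightarrow>\<^sub>0 'a) set" where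
  "kaehler_relations \<equiv> free_mod.span kaehler_generators"

definition kaehler_equiv :: "('a::field \<Rightarrow>\<^sub>0 'a) \<Rightarrow> ('a \<Rightarrow>\<^sub>0 'a) \<Rightarrow> bool" where
  "kaehler_equiv x y \<longleftrightarrow> x - y \<in> kaehler_relations"

lemma equivp_kaehler_equiv: "equivp kaehler_equiv"
proof (rule equivpI)
  show "reflp kaehler_equiv"
    by (auto simp: reflp_def kaehler_equiv_def free_mod.span_zero)
  show "symp kaehler_equiv"
    unfolding symp_def kaehler_equiv_def using free_mod.span_neg by fastforce
  show "transp kaehler_equiv"
    unfolding transp_def kaehler_equiv_def using free_mod.span_add by fastforce
qed

quotient_type (overloaded) 'a kaehler = "'a::field \<Rightarrow>\<^sub>0 'a" / kaehler_equiv
  by (rule equivp_kaehler_equiv)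

instantiation kaehler :: (field) ab_group_add
begin

lift_definition zero_kaehler :: "'a kaehler" is 0 .

lift_definition plus_kaehler :: "'a kaehler \<Rightarrow> 'a kaehler \<Rightarrow> 'a kaehler" is "(+)"
  unfolding kaehler_equiv_def by (metis add_diff_add free_mod.span_add)

lift_definition uminus_kaehler :: "'a kaehler \<Rightarrow> 'a kaehler" is uminus
  unfolding kaehler_equiv_def by (metis free_mod.span_neg minus_diff_minus)

definition minus_kaehler :: "'a kaehler \<Rightarrow> 'a kaehler \<Rightarrow> 'a kaehler" where
  "minus_kaehler x y = x + - y"

instance
  by standard
    (unfold minus_kaehler_def,
     (transfer, simp add: kaehler_equiv_def algebra_simps free_mod.span_zero)+)

end

lift_definition kaehler_scale :: "'a::field \<Rightarrow> 'a kaehler \<Rightarrow> 'a kaehler" is free_scale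
  unfolding kaehler_equiv_def
  by (metis free_mod.scale_right_diff_distrib free_mod.span_scale)

lift_definition kaehler_d :: "'a::field \<Rightarrow> 'a kaehler" is "\<lambda>a. Poly_Mapping.single a 1" .

global_interpretation kaehler: vector_space "kaehler_scale :: 'a::field \<Rightarrow> 'a kaehler \<Rightarrow> _"
  by unfold_locales
    (transfer, simp add: kaehler_equiv_def free_mod.span_zero free_mod.scale_right_distrib
      free_mod.scale_left_distrib)+

text \<open>Linear independence of the family \<open>dt\<^sub>1, \<dots>, dt\<^sub>n\<close>; distinctness is needed because
  \<open>kaehler.independent\<close> speaks about sets rather than families.\<close>

definition p_independent :: "'a::field list \<Rightarrow> bool" where
  "p_independent ts \<longleftrightarrow>
     distinct (map kaehler_d ts) \<and> kaehler.independent (set (map kaehler_d ts))"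


section \<open>Fields\<close>

definition separably_closed :: "'a::field itself \<Rightarrow> bool" where
  "separably_closed _ \<longleftrightarrow>
     (\<forall>p :: 'a poly. Factorial_Ring.irreducible p \<and> coprime p (pderiv p) \<longrightarrow> degree p = 1)"

text \<open>\<open>\<iota>\<close> exhibits the type \<open>'e\<close> as the extension field generated by a square root \<open>s\<close>
  of \<open>t\<close>.\<close>

definition adjoins_sqrt :: "('f::field \<Rightarrow> 'e::field) \<Rightarrow> 'f \<Rightarrow> 'e \<Rightarrow> bool" where
  "adjoins_sqrt \<iota> t s \<longleftrightarrow>
     \<iota> \<in> ring_hom ring_of_type_algebra ring_of_type_algebra \<and>
     s ^ 2 = \<iota> t \<and>
     generate_field ring_of_type_algebra (insert s (\<iota> ` UNIV)) = UNIV"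


section \<open>Regular local rings\<close>

definition krull_dim :: "('a, 'b) ring_scheme \<Rightarrow> enat" where
  "krull_dim R = Sup {enat n | n. \<exists>P :: nat \<Rightarrow> 'a set.
     (\<forall>i\<le>n. primeideal (P i) R) \<and> (\<forall>i<n. P i \<subset> P (Suc i))}"

definition regular_local_ring :: "('a, 'b) ring_scheme \<Rightarrow> bool" where
  "regular_local_ring R \<longleftrightarrow>
     cring R \<and> noetherian_ring R \<and>
     (\<exists>M. (\<forall>M'. maximalideal M' R \<longleftrightarrow> M' = M) \<and>
          (\<exists>A \<subseteq> carrier R. finite A \<and> enat (card A) = krull_dim R \<and> genideal R A = M))"


section \<open>Ringed spaces over a field and their morphisms\<close>

text \<open>The structure morphism to the spectrum of \<open>k\<close> is given by the map \<open>scalar\<close> from \<open>k\<close> to the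
  global sections. Only the values of \<open>sections\<close> and \<open>restr\<close> on open sets are meaningful.\<close>

record ('k, 'p, 's) ringed_space =
  ptop :: "'p topology"
  sections :: "'p set \<Rightarrow> 's ring"
  restr :: "'p set \<Rightarrow> 'p set \<Rightarrow> 's \<Rightarrow> 's"
  scalar :: "'k \<Rightarrow> 's"

abbreviation points :: "('k, 'p, 's) ringed_space \<Rightarrow> 'p set" where
  "points Z \<equiv> topspace (ptop Z)"

definition germ :: "('k, 'p, 's) ringed_space \<Rightarrow> 'p \<Rightarrow> 'p set \<Rightarrow> 's \<Rightarrow> ('p set \<times> 's) set" where
  "germ Z x U \<sigma> = {(V, \<tau>). openin (ptop Z) V \<and> x \<in> V \<and> \<tau> \<in> carrier (sections Z V) \<and>
     (\<exists>W. openin (ptop Z) W \<and> x \<in> W \<and> W \<subseteq> U \<inter> V \<and> restr Z U W \<sigma> = restr Z V W \<tau>)}"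

definition stalk :: "('k, 'p, 's) ringed_space \<Rightarrow> 'p \<Rightarrow> ('p set \<times> 's) set ring" where
  "stalk Z x = \<lparr>
     carrier = {germ Z x U \<sigma> | U \<sigma>. openin (ptop Z) U \<and> x \<in> U \<and> \<sigma> \<in> carrier (sections Z U)},
     monoid.mult = (\<lambda>A B. \<Union>(U, \<sigma>)\<in>A. \<Union>(V, \<tau>)\<in>B.
        germ Z x (U \<inter> V)
          (restr Z U (U \<inter> V) \<sigma> \<otimes>\<^bsub>sections Z (U \<inter> V)\<^esub> restr Z V (U \<inter> V) \<tau>)),
     one = germ Z x (points Z) \<one>\<^bsub>sections Z (points Z)\<^esub>,
     ring.zero = germ Z x (points Z) \<zero>\<^bsub>sections Z (points Z)\<^esub>,
     add = (\<lambda>A B. \<Union>(U, \<sigma>)\<in>A. \<Union>(V, \<tau>)\<in>B.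
        germ Z x (U \<inter> V)
          (restr Z U (U \<inter> V) \<sigma> \<oplus>\<^bsub>sections Z (U \<inter> V)\<^esub> restr Z V (U \<inter> V) \<tau>))\<rparr>"

definition regular_scheme :: "('k, 'p, 's) ringed_space \<Rightarrow> bool" where
  "regular_scheme Z \<longleftrightarrow> (\<forall>x\<in>points Z. regular_local_ring (stalk Z x))"

definition residue_field ::
  "('k, 'p, 's) ringed_space \<Rightarrow> 'p \<Rightarrow> ('p set \<times> 's) set set ring" where
  "residue_field Z x = stalk Z x Quot (carrier (stalk Z x) - Units (stalk Z x))"

text \<open>The rational points are the points whose residue field is \<open>k\<close>.\<close>

definition rational_points :: "('k, 'p, 's) ringed_space \<Rightarrow> 'p set" where
  "rational_points Z = {x \<in> points Z.
     bij_betw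
       (\<lambda>c. (carrier (stalk Z x) - Units (stalk Z x)) +>\<^bsub>stalk Z x\<^esub> germ Z x (points Z) (scalar Z c))
       UNIV (carrier (residue_field Z x))}"

definition open_subspace ::
  "('k, 'p, 's) ringed_space \<Rightarrow> 'p set \<Rightarrow> ('k, 'p, 's) ringed_space" where
  "open_subspace Z U = \<lparr>
     ptop = subtopology (ptop Z) U,
     sections = sections Z,
     restr = restr Z,
     scalar = (\<lambda>c. restr Z (points Z) U (scalar Z c))\<rparr>"

definition preim ::
  "('k, 'p, 's) ringed_space \<Rightarrow> ('p \<Rightarrow> 'q) \<Rightarrow> 'q set \<Rightarrow> 'p set" where
  "preim Z f V = {x \<in> points Z. f x \<in> V}"

text \<open>A morphism over \<open>k\<close> from \<open>Z\<close> to \<open>Y\<close> is a continuous map \<open>f\<close> together with a comorphism \<open>g\<close>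
  of sheaves of \<open>k\<close>-algebras inducing local homomorphisms on the (local) stalks.\<close>

definition morphism_over ::
  "('k, 'p, 's) ringed_space \<Rightarrow> ('k, 'q, 't) ringed_space \<Rightarrow>
   ('p \<Rightarrow> 'q) \<Rightarrow> ('q set \<Rightarrow> 't \<Rightarrow> 's) \<Rightarrow> bool" where
  "morphism_over Z Y f g \<longleftrightarrow>
     continuous_map (ptop Z) (ptop Y) f \<and>
     (\<forall>V. openin (ptop Y) V \<longrightarrow> g V \<in> ring_hom (sections Y V) (sections Z (preim Z f V))) \<and>
     (\<forall>V W. openin (ptop Y) V \<and> openin (ptop Y) W \<and> W \<subseteq> V \<longrightarrow>
        (\<forall>\<tau>\<in>carrier (sections Y V).
           g W (restr Y V W \<tau>) = restr Z (preim Z f V) (preim Z f W) (g V \<tau>))) \<and>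
     (\<forall>c. g (points Y) (scalar Y c) = scalar Z c) \<and>
     (\<forall>x\<in>points Z. \<forall>V. openin (ptop Y) V \<and> f x \<in> V \<longrightarrow>
        (\<forall>\<tau>\<in>carrier (sections Y V).
           germ Z x (preim Z f V) (g V \<tau>) \<in> Units (stalk Z x) \<longrightarrow>
           germ Y (f x) V \<tau> \<in> Units (stalk Y (f x))))"

definition isomorphism_over ::
  "('k, 'p, 's) ringed_space \<Rightarrow> ('k, 'q, 't) ringed_space \<Rightarrow>
   ('p \<Rightarrow> 'q) \<Rightarrow> ('q set \<Rightarrow> 't \<Rightarrow> 's) \<Rightarrow> bool" where
  "isomorphism_over Z Y f g \<longleftrightarrow>
     morphism_over Z Y f g \<and> homeomorphic_map (ptop Z) (ptop Y) f \<and>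
     (\<forall>V. openin (ptop Y) V \<longrightarrow> g V \<in> ring_iso (sections Y V) (sections Z (preim Z f V)))"

definition dense_open :: "('k, 'p, 's) ringed_space \<Rightarrow> 'p set \<Rightarrow> bool" where
  "dense_open Z U \<longleftrightarrow> openin (ptop Z) U \<and> ptop Z closure_of U = points Z"

text \<open>A rational map is an equivalence class of triples as below; dominance does not depend on the
  representative.\<close>

definition represents_rational_map ::
  "('k, 'p, 's) ringed_space \<Rightarrow> ('k, 'q, 't) ringed_space \<Rightarrow>
   'p set \<Rightarrow> ('p \<Rightarrow> 'q) \<Rightarrow> ('q set \<Rightarrow> 't \<Rightarrow> 's) \<Rightarrow> bool" where
  "represents_rational_map Z Y U f g \<longleftrightarrow> dense_open Z U \<and> morphism_over (open_subspace Z U) Y f g"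

definition ex_dominant_rational_map ::
  "('k, 'p, 's) ringed_space \<Rightarrow> ('k, 'q, 't) ringed_space \<Rightarrow> bool" where
  "ex_dominant_rational_map Z Y \<longleftrightarrow>
     (\<exists>U f g. represents_rational_map Z Y U f g \<and> ptop Y closure_of (f ` U) = points Y)"

definition birational_over ::
  "('k, 'p, 's) ringed_space \<Rightarrow> ('k, 'q, 't) ringed_space \<Rightarrow> bool" where
  "birational_over Z Y \<longleftrightarrow>
     (\<exists>U V f g. dense_open Z U \<and> dense_open Y V \<and>
        isomorphism_over (open_subspace Z U) (open_subspace Y V) f g)"


section \<open>The homogeneous spectrum of a graded algebra\<close>

record ('a, 'k) graded_algebra = "'a ring" +
  hpart :: "nat \<Rightarrow> 'a set"
  algmap :: "'k \<Rightarrow> 'a"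

definition homogeneous :: "('a, 'k) graded_algebra \<Rightarrow> 'a set" where
  "homogeneous R = (\<Union>n. hpart R n)"

definition proj_points :: "('a, 'k) graded_algebra \<Rightarrow> 'a set set" where
  "proj_points R = {p. primeideal p R \<and> p = genideal R (p \<inter> homogeneous R) \<and>
     \<not> (\<Union>n\<in>{0<..}. hpart R n) \<subseteq> p}"

definition proj_top :: "('a, 'k) graded_algebra \<Rightarrow> 'a set topology" where
  "proj_top R = topology_generated_by {{p \<in> proj_points R. h \<notin> p} | h. h \<in> homogeneous R}"

text \<open>\<open>hfrac R p a s\<close> is the class of the fraction \<open>a/s\<close> in the degree zero part of the
  localization of \<open>R\<close> at the homogeneous elements outside \<open>p\<close>.\<close>

definition hfrac :: "('a, 'k) graded_algebra \<Rightarrow> 'a set \<Rightarrow> 'a \<Rightarrow> 'a \<Rightarrow> ('a \<times> 'a) set" where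
  "hfrac R p a s = {(b, t). (\<exists>n. b \<in> hpart R n \<and> t \<in> hpart R n) \<and> t \<notin> p \<and>
     (\<exists>u\<in>homogeneous R - p. u \<otimes>\<^bsub>R\<^esub> (a \<otimes>\<^bsub>R\<^esub> t \<ominus>\<^bsub>R\<^esub> b \<otimes>\<^bsub>R\<^esub> s) = \<zero>\<^bsub>R\<^esub>)}"

definition hlocalization :: "('a, 'k) graded_algebra \<Rightarrow> 'a set \<Rightarrow> ('a \<times> 'a) set ring" where
  "hlocalization R p = \<lparr>
     carrier = {hfrac R p a s | a s. (\<exists>n. a \<in> hpart R n \<and> s \<in> hpart R n) \<and> s \<notin> p},
     monoid.mult = (\<lambda>A B. \<Union>(a, s)\<in>A. \<Union>(b, t)\<in>B. hfrac R p (a \<otimes>\<^bsub>R\<^esub> b) (s \<otimes>\<^bsub>R\<^esub> t)),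
     one = hfrac R p \<one>\<^bsub>R\<^esub> \<one>\<^bsub>R\<^esub>,
     ring.zero = hfrac R p \<zero>\<^bsub>R\<^esub> \<one>\<^bsub>R\<^esub>,
     add = (\<lambda>A B. \<Union>(a, s)\<in>A. \<Union>(b, t)\<in>B.
        hfrac R p (a \<otimes>\<^bsub>R\<^esub> t \<oplus>\<^bsub>R\<^esub> b \<otimes>\<^bsub>R\<^esub> s) (s \<otimes>\<^bsub>R\<^esub> t))\<rparr>"

text \<open>Sections are functions into the local rings that locally are given by one fraction; they are
  extensional, so that equal sections are equal as HOL functions.\<close>

definition proj_sections ::
  "('a, 'k) graded_algebra \<Rightarrow> 'a set set \<Rightarrow> ('a set \<Rightarrow> ('a \<times> 'a) set) ring" where
  "proj_sections R U = \<lparr>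
     carrier = {\<sigma> \<in> extensional U. \<forall>p\<in>U. \<exists>V. openin (proj_top R) V \<and> p \<in> V \<and> V \<subseteq> U \<and>
        (\<exists>n. \<exists>a\<in>hpart R n. \<exists>s\<in>hpart R n. \<forall>q\<in>V. s \<notin> q \<and> \<sigma> q = hfrac R q a s)},
     monoid.mult = (\<lambda>\<sigma> \<tau>. \<lambda>p\<in>U. \<sigma> p \<otimes>\<^bsub>hlocalization R p\<^esub> \<tau> p),
     one = (\<lambda>p\<in>U. \<one>\<^bsub>hlocalization R p\<^esub>),
     ring.zero = (\<lambda>p\<in>U. \<zero>\<^bsub>hlocalization R p\<^esub>),
     add = (\<lambda>\<sigma> \<tau>. \<lambda>p\<in>U. \<sigma> p \<oplus>\<^bsub>hlocalization R p\<^esub> \<tau> p)\<rparr>"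

definition Proj ::
  "('a, 'k) graded_algebra \<Rightarrow> ('k, 'a set, 'a set \<Rightarrow> ('a \<times> 'a) set) ringed_space" where
  "Proj R = \<lparr>
     ptop = proj_top R,
     sections = proj_sections R,
     restr = (\<lambda>U V \<sigma>. restrict \<sigma> V),
     scalar = (\<lambda>c. \<lambda>p\<in>proj_points R. hfrac R p (algmap R c) \<one>\<^bsub>R\<^esub>)\<rparr>"


section \<open>Projective spaces and hypersurfaces\<close>

type_synonym ('v, 'k) mpoly = "('v \<Rightarrow>\<^sub>0 nat) \<Rightarrow>\<^sub>0 'k"

definition Const :: "'k::comm_ring_1 \<Rightarrow> ('v, 'k) mpoly" where
  "Const c = Poly_Mapping.single 0 c"

definition Var :: "'v \<Rightarrow> ('v, 'k::comm_ring_1) mpoly" where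
  "Var v = Poly_Mapping.single (Poly_Mapping.single v 1) 1"

definition polynomial_algebra :: "(('v, 'k::comm_ring_1) mpoly, 'k) graded_algebra" where
  "polynomial_algebra = ring.extend ring_of_type_algebra
     (graded_algebra.fields
        (\<lambda>n. {p. \<forall>m\<in>Poly_Mapping.keys p. (\<Sum>v\<in>Poly_Mapping.keys m. Poly_Mapping.lookup m v) = n})
        Const)"

definition quotient_algebra ::
  "('a, 'k) graded_algebra \<Rightarrow> 'a set \<Rightarrow> ('a set, 'k) graded_algebra" where
  "quotient_algebra R I = ring.extend (R Quot I)
     (graded_algebra.fields
        (\<lambda>n. (\<lambda>a. I +>\<^bsub>R\<^esub> a) ` hpart R n)
        (\<lambda>c. I +>\<^bsub>R\<^esub> algmap R c))"

definition projective_plane ::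
  "('k::field, (3, 'k) mpoly set,
    (3, 'k) mpoly set \<Rightarrow> ((3, 'k) mpoly \<times> (3, 'k) mpoly) set) ringed_space" where
  "projective_plane = Proj polynomial_algebra"

definition hypersurface ::
  "('v, 'k::field) mpoly \<Rightarrow>
   ('k, ('v, 'k) mpoly set set,
    ('v, 'k) mpoly set set \<Rightarrow> (('v, 'k) mpoly set \<times> ('v, 'k) mpoly set) set) ringed_space" where
  "hypersurface f = Proj (quotient_algebra polynomial_algebra (PIdl\<^bsub>polynomial_algebra\<^esub> f))"

text \<open>Base change of a hypersurface along a field extension: the same equation over the larger
  field.\<close>

definition hypersurface_base_change ::
  "('k::field \<Rightarrow> 'e::field) \<Rightarrow> ('v, 'k) mpoly \<Rightarrow>
   ('e, ('v, 'e) mpoly set set,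
    ('v, 'e) mpoly set set \<Rightarrow> (('v, 'e) mpoly set \<times> ('v, 'e) mpoly set) set) ringed_space" where
  "hypersurface_base_change \<iota> f = hypersurface (Poly_Mapping.map \<iota> f)"

datatype coord = X1 | X2 | Y1 | Y2

definition cubic :: "'k::field \<Rightarrow> 'k \<Rightarrow> (coord, 'k) mpoly" where
  "cubic t1 t2 =
     Var Y1 ^ 3 + Const t1 * Var X1 ^ 2 * Var Y1 + Var Y2 ^ 3 + Const t2 * Var X2 ^ 2 * Var Y2"

end

theory Submission imports Defs begin

text \<open>All rings of sections and stalks occurring here are computed inside a function field, where a
  stalk is the ring of fractions \<open>a/t\<close> of forms of equal degree with \<open>t\<close> nonvanishing at the point.

  Regularity: each chart is a monic cubic \<open>g = 0\<close> over \<open>F[u,v]\<close>. If a derivation \<open>D\<close> (possibly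
  nontrivial on \<open>F\<close>) satisfies \<open>Dg \<notin> Q\<close> for a prime \<open>Q\<close> containing \<open>g\<close>, then \<open>g\<close> can serve as one of
  the generators of \<open>Q\<close> locally. Such derivations come from \<open>p\<close>-independence, which supplies
  derivations \<open>D\<^sub>1, D\<^sub>2\<close> of \<open>F\<close> dual to \<open>dt\<^sub>1, dt\<^sub>2\<close>.

  No dominant map: put \<open>A = y\<^sub>1\<^sup>2 + t\<^sub>1x\<^sub>1\<^sup>2\<close> and \<open>B = y\<^sub>2\<^sup>2 + t\<^sub>2x\<^sub>2\<^sup>2\<close>. For a primitive solution of \<open>y\<^sub>1A = y\<^sub>2B\<close> in
  polynomials over \<open>F\<close>, the extensions of \<open>D\<^sub>1\<close> and \<open>D\<^sub>2\<close> show that \<open>A\<close> divides \<open>y\<^sub>2\<close> and \<open>B\<close> divides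
  \<open>y\<^sub>1\<close>, which by degrees forces the solution to be constant. Hence \<open>y\<^sub>1/x\<^sub>1\<close> is constant along every
  rational map from the plane, whose image therefore lies in a plane section.

  Over \<open>E\<close> the coordinate \<open>z = y\<^sub>1 + \<surd>t\<^sub>1 x\<^sub>1\<close> makes the cubic linear in \<open>y\<^sub>1\<close>, so that \<open>z \<noteq> 0\<close> is an affine
  plane. Rational points are found on the line \<open>y\<^sub>1 = y\<^sub>2 = 0\<close> and, over a separably closed field, on
  the fibres of a separable projection.\<close>

section \<open>Ideals and polynomial rings over a type\<close>

text \<open>Partial derivatives over F cannot prove regularity: they all vanish along
  \<open>y1^2 + t1 x1^2 = y2^2 + t2 x2^2 = 0\<close>, and this locus lies on the surface. This is
  why derivations moving t1 and t2 are indispensable. Regularity moreover compares a number of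
  generators with the exact Krull dimension. Each chart is monic in one variable, so primes can be
  projected to F[u,v], where heights are counted fibre by fibre; this bounds chains from above,
  while a chain of the right length has to be exhibited.

  The divisibility argument for rational maps compares degrees and so needs a single variable,
  whereas functions on the plane are treated as rational functions in three. The gap is closed by
  restriction to lines through a fixed point. This needs F to be infinite, which holds because a
  finite field of characteristic two consists of squares and has no nonzero derivation.

  Over E the function fields of the surface and of the plane are realised inside the same field
  E(z,x2,y2), so that the isomorphism of open sets is the identity on the values of
  sections.\<close>

definition rhom :: "('a::comm_ring_1 \<Rightarrow> 'b::comm_ring_1) \<Rightarrow> bool" where
  "rhom h \<longleftrightarrow> h 1 = 1 \<and> (\<forall>x y. h (x + y) = h x + h y) \<and> (\<forall>x y. h (x * y) = h x * h y)"

lemma rhomI: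
  assumes "h 1 = 1" "\<And>x y. h (x + y) = h x + h y" "\<And>x y. h (x * y) = h x * h y"
  shows "rhom h"
  using assms by (simp add: rhom_def)

lemma rhom_1: "rhom h \<Longrightarrow> h 1 = 1"
  and rhom_add: "rhom h \<Longrightarrow> h (x + y) = h x + h y"
  and rhom_mult: "rhom h \<Longrightarrow> h (x * y) = h x * h y"
  by (simp_all add: rhom_def)

lemma rhom_0: assumes "rhom h" shows "h 0 = 0"
  using rhom_add[OF assms, of 0 0] by simp

lemma rhom_minus: assumes "rhom h" shows "h (- x) = - h x"
  using rhom_add[OF assms, of x "- x"] rhom_0[OF assms] by (simp add: eq_neg_iff_add_eq_0 add.commute)

lemma rhom_diff: assumes "rhom h" shows "h (x - y) = h x - h y"
  using rhom_add[OF assms, of x "- y"] rhom_minus[OF assms, of y] by simp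

lemma rhom_power: assumes "rhom h" shows "h (x ^ n) = h x ^ n"
  by (induction n) (simp_all add: rhom_1[OF assms] rhom_mult[OF assms])

lemma rhom_sum: assumes "rhom h" shows "h (sum f A) = (\<Sum>x\<in>A. h (f x))"
  by (induction A rule: infinite_finite_induct) (simp_all add: rhom_0[OF assms] rhom_add[OF assms])

lemmas rhom_simps = rhom_0 rhom_1 rhom_add rhom_mult rhom_minus rhom_diff rhom_power

lemma rhom_comp: "rhom g \<Longrightarrow> rhom h \<Longrightarrow> rhom (\<lambda>x. g (h x))"
  by (simp add: rhom_def)

lemma rhom_inj_field:
  fixes h :: "'a::field \<Rightarrow> 'b::comm_ring_1"
  assumes "rhom h" "h x = 0" shows "x = 0"
proof (rule ccontr)
  assume "x \<noteq> 0"
  then have "h (x * inverse x) = 1" using rhom_1[OF assms(1)] by simp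
  then show False using assms by (simp add: rhom_mult)
qed

lemma rhom_const_poly: "rhom (\<lambda>c::'a::comm_ring_1. [:c:])"
  by (rule rhomI) (simp_all add: one_pCons)

text \<open>Coefficients are sent through \<open>h\<close> and the variable to \<open>r\<close>: the
  map out of a polynomial ring given by its universal property. Iterating it serves all nested
  polynomial rings below.\<close>

definition pev :: "('a::comm_ring_1 \<Rightarrow> 'b::comm_ring_1) \<Rightarrow> 'b \<Rightarrow> 'a poly \<Rightarrow> 'b" where
  "pev h r p = poly (map_poly h p) r"

lemma pev_0 [simp]: "pev h r 0 = 0"
  by (simp add: pev_def)

lemma pev_pCons: "rhom h \<Longrightarrow> pev h r (pCons c p) = h c + r * pev h r p"
  by (simp add: pev_def map_poly_pCons rhom_0)

lemma pev_const: "rhom h \<Longrightarrow> pev h r [:c:] = h c"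
  by (simp add: pev_pCons)

lemma pev_var: "rhom h \<Longrightarrow> pev h r [:0, 1:] = r"
  by (simp add: pev_pCons rhom_0 rhom_1)

lemma rhom_pev: assumes h: "rhom h" shows "rhom (pev h r)"
proof (rule rhomI)
  show "pev h r 1 = 1" by (simp add: one_pCons pev_const[OF h] rhom_1[OF h])
  show add: "pev h r (x + y) = pev h r x + pev h r y" for x y
  proof (induction x arbitrary: y)
    case (pCons a p)
    obtain b q where y: "y = pCons b q" by (cases y)
    have "pev h r (p + q) = pev h r p + pev h r q" by (rule pCons.IH)
    then show ?case
      by (simp add: y pev_pCons[OF h] rhom_add[OF h] distrib_left)
  qed simp
  have sm: "pev h r (smult c x) = h c * pev h r x" for c x
    by (induction x) (simp_all add: pev_pCons[OF h] rhom_mult[OF h] algebra_simps)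
  show "pev h r (x * y) = pev h r x * pev h r y" for x y
    by (induction x) (simp_all add: pev_pCons[OF h] add sm rhom_0[OF h] algebra_simps)
qed

text \<open>Constants and the variable generate the polynomial ring, so a property stable under sums
  and products needs checking only there.\<close>

lemma poly_closed_induct:
  fixes p :: "'a::comm_ring_1 poly"
  assumes "\<And>c. P [:c:]" "P [:0, 1:]" "\<And>x y. P x \<Longrightarrow> P y \<Longrightarrow> P (x + y)" "\<And>x y. P x \<Longrightarrow> P y \<Longrightarrow> P (x * y)"
  shows "P p"
proof (induction p)
  case 0 then show ?case using assms(1)[of 0] by simp
next
  case (pCons a p)
  have "pCons a p = [:a:] + [:0, 1:] * p" by simp
  then show ?case using pCons.IH assms(1)[of a] assms(2) assms(3)[of "[:a:]" "[:0, 1:] * p"]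
      assms(4)[of "[:0, 1:]" p] by (simp only:)
qed

section \<open>Ideals, finite generation and the Hilbert basis theorem\<close>

definition idl :: "'a::comm_ring_1 set \<Rightarrow> bool" where
  "idl I \<longleftrightarrow> 0 \<in> I \<and> (\<forall>x\<in>I. \<forall>y\<in>I. x + y \<in> I) \<and> (\<forall>r. \<forall>x\<in>I. r * x \<in> I)"

lemma idlI: "0 \<in> I \<Longrightarrow> (\<And>x y. x \<in> I \<Longrightarrow> y \<in> I \<Longrightarrow> x + y \<in> I) \<Longrightarrow> (\<And>r x. x \<in> I \<Longrightarrow> r * x \<in> I) \<Longrightarrow> idl I"
  by (simp add: idl_def)

lemma idl_0: "idl I \<Longrightarrow> 0 \<in> I"
  and idl_add: "idl I \<Longrightarrow> x \<in> I \<Longrightarrow> y \<in> I \<Longrightarrow> x + y \<in> I"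
  and idl_mult: "idl I \<Longrightarrow> x \<in> I \<Longrightarrow> r * x \<in> I"
  and idl_mult_r: "idl I \<Longrightarrow> x \<in> I \<Longrightarrow> x * r \<in> I"
  by (simp_all add: idl_def mult.commute[of x])

lemma idl_minus: "idl I \<Longrightarrow> x \<in> I \<Longrightarrow> - x \<in> I"
  using idl_mult[of I x "- 1"] by simp

lemma idl_diff: "idl I \<Longrightarrow> x \<in> I \<Longrightarrow> y \<in> I \<Longrightarrow> x - y \<in> I"
  using idl_add[of I x "- y"] idl_minus[of I y] by simp

lemma idl_sum: "idl I \<Longrightarrow> (\<And>x. x \<in> A \<Longrightarrow> f x \<in> I) \<Longrightarrow> sum f A \<in> I"
  by (induction A rule: infinite_finite_induct) (auto intro: idl_0 idl_add)

lemma idl_vimage: "rhom h \<Longrightarrow> idl I \<Longrightarrow> idl {x. h x \<in> I}"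
  by (rule idlI) (auto simp: rhom_simps intro: idl_0 idl_add idl_mult)

lemma idl_coeffs_mem:
  assumes "idl (I :: 'a::comm_ring_1 poly set)" "\<And>i. [:coeff p i:] \<in> I"
  shows "p \<in> I"
  using assms(2)
proof (induction p)
  case 0 then show ?case using assms(1) idl_0 by blast
next
  case (pCons a p)
  have "[:coeff p i:] \<in> I" for i using pCons(3)[of "Suc i"] by simp
  then have "p \<in> I" using pCons by blast
  moreover have "[:a:] \<in> I" using pCons(3)[of 0] by simp
  moreover have "pCons a p = [:a:] + [:0, 1:] * p" by simp
  ultimately show ?case using idl_add[OF assms(1), of "[:a:]" "[:0, 1:] * p"]
      idl_mult[OF assms(1), of p "[:0, 1:]"] by (simp only:)
qed

text \<open>Generation is tested against all ideals \<open>J\<close> containing \<open>A\<close>,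
  which avoids handling linear combinations.\<close>

definition fin_gen :: "'a::comm_ring_1 set \<Rightarrow> bool" where
  "fin_gen I \<longleftrightarrow> (\<exists>A. finite A \<and> A \<subseteq> I \<and> (\<forall>J. idl J \<and> A \<subseteq> J \<longrightarrow> I \<subseteq> J))"

lemma fin_genE:
  assumes "fin_gen I"
  obtains A where "finite A" "A \<subseteq> I" "\<And>J. idl J \<Longrightarrow> A \<subseteq> J \<Longrightarrow> I \<subseteq> J"
proof -
  obtain A where "finite A \<and> A \<subseteq> I \<and> (\<forall>J. idl J \<and> A \<subseteq> J \<longrightarrow> I \<subseteq> J)"
    using assms unfolding fin_gen_def by (rule exE)
  then show ?thesis by (intro that[of A]) simp_all
qed

lemma field_fin_gen:
  fixes I :: "'a::field set"
  assumes "idl I" shows "fin_gen I"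
proof (cases "\<exists>x\<in>I. x \<noteq> 0")
  case True
  then obtain x where x: "x \<in> I" "x \<noteq> 0" by blast
  have "I \<subseteq> J" if "idl J" "{x} \<subseteq> J" for J
  proof
    fix y
    have "(y / x) * x \<in> J" using that idl_mult by blast
    then show "y \<in> J" using x by simp
  qed
  then show ?thesis unfolding fin_gen_def using x by (intro exI[of _ "{x}"]) auto
next
  case False
  then have "I \<subseteq> {0}" by auto
  then show ?thesis unfolding fin_gen_def by (intro exI[of _ "{}"]) (auto intro: idl_0)
qed

text \<open>The union of the chain is an ideal, and its finitely many generators already occur in
  one member.\<close>

lemma fin_gen_chain_stable:
  fixes L :: "nat \<Rightarrow> 'a::comm_ring_1 set"
  assumes noeth: "\<And>I :: 'a set. idl I \<Longrightarrow> fin_gen I"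
    and L: "\<And>n. idl (L n)" and mono: "\<And>m n. m \<le> n \<Longrightarrow> L m \<subseteq> L n"
  obtains N where "\<And>n. L n \<subseteq> L N"
proof -
  have "idl (\<Union>n. L n)"
  proof (rule idlI)
    show "0 \<in> (\<Union>n. L n)" using idl_0[OF L] by blast
    fix x y assume "x \<in> (\<Union>n. L n)" "y \<in> (\<Union>n. L n)"
    then obtain m n where "x \<in> L m" "y \<in> L n" by blast
    then have "x \<in> L (max m n)" "y \<in> L (max m n)" using mono[of m "max m n"] mono[of n "max m n"] by auto
    then show "x + y \<in> (\<Union>n. L n)" using idl_add[OF L] by blast
  next
    fix r x assume "x \<in> (\<Union>n. L n)"
    then show "r * x \<in> (\<Union>n. L n)" using idl_mult[OF L] by blast
  qed
  then obtain A where A: "finite A" "A \<subseteq> (\<Union>n. L n)" "\<And>J. idl J \<Longrightarrow> A \<subseteq> J \<Longrightarrow> (\<Union>n. L n) \<subseteq> J"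
    using fin_genE[OF noeth] by metis
  have "\<exists>N. A \<subseteq> L N" using A(1,2)
  proof (induction A)
    case (insert a A)
    then obtain M N where "a \<in> L M" "A \<subseteq> L N" by blast
    then have "insert a A \<subseteq> L (max M N)" using mono[of M "max M N"] mono[of N "max M N"] by auto
    then show ?case by blast
  qed simp
  then obtain N where "A \<subseteq> L N" by blast
  then have "(\<Union>n. L n) \<subseteq> L N" using A(3) L by blast
  then show ?thesis using that by blast
qed

text \<open>\<open>L K n\<close> is the ideal of coefficients of \<open>x^n\<close> in members of
  \<open>K\<close> of degree at most \<open>n\<close>. The chain \<open>L I n\<close> stabilises at
  some \<open>N\<close>; lifts of generators of \<open>L I 0, ..., L I N\<close> generate
  \<open>I\<close>, because the leading term of any member of \<open>I\<close> can be cancelled with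
  their help.\<close>

lemma hilbert_basis:
  assumes noeth: "\<And>I :: 'a::comm_ring_1 set. idl I \<Longrightarrow> fin_gen I"
    and I: "idl (I :: 'a poly set)"
  shows "fin_gen I"
proof -
  define L where "L K n = {c. \<exists>p\<in>K. degree p \<le> n \<and> coeff p n = c}" for K :: "'a poly set" and n
  have idlL: "idl (L K n)" if K: "idl K" for K n
  proof (rule idlI)
    show "0 \<in> L K n" unfolding L_def using idl_0[OF K] by force
    fix x y assume "x \<in> L K n" "y \<in> L K n"
    then obtain p q where "p \<in> K" "q \<in> K" "degree p \<le> n" "degree q \<le> n" "x = coeff p n" "y = coeff q n"
      unfolding L_def by blast
    then show "x + y \<in> L K n" unfolding L_def using idl_add[OF K]
      by (auto intro!: bexI[of _ "p + q"] degree_add_le)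
  next
    fix r x assume "x \<in> L K n"
    then obtain p where "p \<in> K" "degree p \<le> n" "x = coeff p n" unfolding L_def by blast
    then show "r * x \<in> L K n" unfolding L_def using idl_mult[OF K, of p "[:r:]"]
      by (auto intro!: bexI[of _ "smult r p"] order.trans[OF degree_smult_le])
  qed
  have monoL: "L I m \<subseteq> L I n" if "m \<le> n" for m n
  proof
    fix c assume "c \<in> L I m"
    then obtain p where p: "p \<in> I" "degree p \<le> m" "c = coeff p m" unfolding L_def by blast
    have "monom 1 (n - m) * p \<in> I" using idl_mult[OF I] p by blast
    moreover have "degree (monom 1 (n - m) * p) \<le> n"
      using degree_mult_le[of "monom 1 (n - m)" p] degree_monom_le[of "1::'a" "n - m"] p(2) that by linarith
    moreover have "coeff (monom 1 (n - m) * p) n = c" using that p by (simp add: coeff_monom_mult)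
    ultimately show "c \<in> L I n" unfolding L_def by blast
  qed
  obtain N where N: "\<And>n. L I n \<subseteq> L I N"
    using fin_gen_chain_stable[of "L I"] noeth idlL[OF I] monoL by blast
  \<comment> \<open>All that is needed of the lifts \<open>B\<close>: an ideal containing them
    attains every coefficient in \<open>L I n\<close>, by members that still lie in
    \<open>I\<close>.\<close>
  have "\<exists>B. finite B \<and> B \<subseteq> I \<and> (\<forall>J. idl J \<and> B \<subseteq> J \<longrightarrow> L I n \<subseteq> L (J \<inter> I) n)" for n
  proof -
    obtain A where A: "finite A" "A \<subseteq> L I n" "\<And>J. idl J \<Longrightarrow> A \<subseteq> J \<Longrightarrow> L I n \<subseteq> J"
      using fin_genE[OF noeth[OF idlL[OF I, of n]]] by metis
    have "\<forall>a\<in>A. \<exists>p. p \<in> I \<and> degree p \<le> n \<and> coeff p n = a" using A(2) unfolding L_def by blast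
    then obtain f where f: "\<And>a. a \<in> A \<Longrightarrow> f a \<in> I \<and> degree (f a) \<le> n \<and> coeff (f a) n = a" by metis
    have "L I n \<subseteq> L (J \<inter> I) n" if "idl J" "f ` A \<subseteq> J" for J
    proof -
      have "idl (J \<inter> I)" using that(1) I by (auto simp: idl_def)
      moreover have "A \<subseteq> L (J \<inter> I) n" using f that(2) unfolding L_def by blast
      ultimately show ?thesis using A(3) idlL by blast
    qed
    then show ?thesis using A(1) f by (intro exI[of _ "f ` A"]) auto
  qed
  then obtain B where B: "\<And>n. finite (B n)" "\<And>n. B n \<subseteq> I"
    "\<And>n J. idl J \<Longrightarrow> B n \<subseteq> J \<Longrightarrow> L I n \<subseteq> L (J \<inter> I) n" by metis
  have "I \<subseteq> J" if J: "idl J" "(\<Union>n\<le>N. B n) \<subseteq> J" for J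
  proof
    fix p assume "p \<in> I"
    then show "p \<in> J"
    \<comment> \<open>The zero polynomial gets its own value below the nonzero constants, since
      \<open>degree 0\<close> is also \<open>0\<close>.\<close>
    proof (induction "if p = 0 then 0 else Suc (degree p)" arbitrary: p rule: less_induct)
      case less
      show ?case
      proof (cases "p = 0")
        case True then show ?thesis using J idl_0 by blast
      next
        case False
        define n where "n = min (degree p) N"
        have "coeff p (degree p) \<in> L I (degree p)" using less.prems unfolding L_def by blast
        then have "coeff p (degree p) \<in> L I n" using N unfolding n_def min_def by auto
        moreover have "n \<le> N" by (simp add: n_def)
        then have "B n \<subseteq> J" using J(2) by blast
        ultimately have "coeff p (degree p) \<in> L (J \<inter> I) n" using B(3)[OF J(1)] by blast
        then obtain q where q: "q \<in> J" "q \<in> I" "degree q \<le> n" "coeff q n = coeff p (degree p)"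
          unfolding L_def by blast
        define r where "r = monom 1 (degree p - n) * q"
        have nd: "n \<le> degree p" by (simp add: n_def)
        have r: "r \<in> J" "r \<in> I" using q idl_mult J I r_def by blast+
        have dr: "degree r \<le> degree p"
          using degree_mult_le[of "monom 1 (degree p - n)" q] degree_monom_le[of "1::'a" "degree p - n"] q(3) nd
          unfolding r_def by linarith
        have cr: "coeff r (degree p) = coeff p (degree p)"
          using q(4) nd by (simp add: r_def coeff_monom_mult)
        have "p - r \<in> J"
        proof (rule less.hyps)
          show "p - r \<in> I" using less.prems r I idl_diff by blast
          show "(if p - r = 0 then 0 else Suc (degree (p - r))) < (if p = 0 then 0 else Suc (degree p))"
          proof (cases "p - r = 0")
            case False': False
            have "degree (p - r) \<le> degree p" using dr by (simp add: degree_diff_le)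
            moreover have "coeff (p - r) (degree p) = 0" using cr by simp
            ultimately have "degree (p - r) < degree p"
              by (metis False' le_neq_implies_less leading_coeff_0_iff)
            then show ?thesis using False by auto
          qed (use False in auto)
        qed
        then show ?thesis using r(1) J(1) idl_add[of J "p - r" r] by simp
      qed
    qed
  qed
  moreover have "(\<Union>n\<le>N. B n) \<subseteq> I" using B(2) by blast
  ultimately show ?thesis unfolding fin_gen_def
    using B(1) by (intro exI[of _ "\<Union>n\<le>N. B n"]) simp
qed

section \<open>Prime ideals of a polynomial ring over their contractions\<close>

definition prime_idl :: "'a::comm_ring_1 set \<Rightarrow> bool" where
  "prime_idl P \<longleftrightarrow> idl P \<and> 1 \<notin> P \<and> (\<forall>x y. x * y \<in> P \<longrightarrow> x \<in> P \<or> y \<in> P)"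

lemma prime_idl_idl: "prime_idl P \<Longrightarrow> idl P"
  and prime_idl_1: "prime_idl P \<Longrightarrow> 1 \<notin> P"
  and prime_idl_mult: "prime_idl P \<Longrightarrow> x * y \<in> P \<Longrightarrow> x \<in> P \<or> y \<in> P"
  by (simp_all add: prime_idl_def)

lemma prime_idl_power: "prime_idl P \<Longrightarrow> x ^ n \<in> P \<Longrightarrow> x \<in> P"
  by (induction n) (auto dest: prime_idl_1 prime_idl_mult)

lemma prime_idl_vimage: "rhom h \<Longrightarrow> prime_idl P \<Longrightarrow> prime_idl {x. h x \<in> P}"
  unfolding prime_idl_def using idl_vimage[of h P] by (auto simp: rhom_simps)

definition contr :: "'a::comm_ring_1 poly set \<Rightarrow> 'a set" where
  "contr Q = {r. [:r:] \<in> Q}"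

text \<open>The extension \<open>q R[x]\<close> of an ideal \<open>q\<close> of \<open>R\<close>,
  described through coefficients.\<close>

definition extd :: "'a::comm_ring_1 set \<Rightarrow> 'a poly set" where
  "extd q = {p. \<forall>i. coeff p i \<in> q}"

lemma prime_contr: "prime_idl Q \<Longrightarrow> prime_idl (contr Q)"
  unfolding contr_def using prime_idl_vimage[OF rhom_const_poly] .

lemma extd_contr_subset: "idl Q \<Longrightarrow> extd (contr Q) \<subseteq> Q"
  using idl_coeffs_mem[of Q] by (auto simp: extd_def contr_def)

lemma idl_extd: assumes q: "idl q" shows "idl (extd q)"
  by (rule idlI) (auto simp: extd_def coeff_mult intro!: idl_0[OF q] idl_add[OF q] idl_sum[OF q] idl_mult[OF q])

text \<open>Over the fraction field of \<open>R\<close> modulo \<open>contr Q\<close> the ideal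
  becomes principal, and \<open>k\<close> is a generator of least degree. Denominators are avoided
  by pseudo-division, since powers of \<open>lead_coeff k\<close> stay outside the prime
  \<open>contr Q\<close>.\<close>

lemma prime_idl_minimal_degree:
  fixes Q :: "'a::idom poly set"
  assumes Q: "prime_idl Q" and ne: "\<not> Q \<subseteq> extd (contr Q)"
  obtains k where "k \<in> Q" "lead_coeff k \<notin> contr Q" "0 < degree k"
    "\<And>b. b \<in> Q \<Longrightarrow> degree b < degree k \<Longrightarrow> b \<in> extd (contr Q)"
    "\<And>a. \<exists>c w r. c \<notin> contr Q \<and> smult c a = k * w + r \<and> (r = 0 \<or> degree r < degree k)"
proof -
  have I: "idl Q" and q: "prime_idl (contr Q)" using Q prime_idl_idl prime_contr by blast+
  note qi = prime_idl_idl[OF q]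
  define S where "S = {k \<in> Q. k \<notin> extd (contr Q)}"
  obtain k where k: "k \<in> S" and min: "\<And>b. b \<in> S \<Longrightarrow> degree k \<le> degree b"
    using ne arg_min_nat_lemma[of "\<lambda>b. b \<in> S" _ degree] unfolding S_def by (metis (no_types, lifting) mem_Collect_eq subsetI)
  have kQ: "k \<in> Q" and ke: "k \<notin> extd (contr Q)" using k by (auto simp: S_def)
  have below: "b \<in> extd (contr Q)" if "b \<in> Q" "degree b < degree k" for b
    using min[of b] that by (auto simp: S_def)
  \<comment> \<open>Otherwise removing the leading term of \<open>k\<close> would leave zero or a
    member of \<open>Q\<close> of smaller degree, which is extended by minimality; then
    \<open>k\<close> would be extended as well.\<close>
  have lc: "lead_coeff k \<notin> contr Q"
  proof
    assume lc: "lead_coeff k \<in> contr Q"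
    let ?m = "monom (lead_coeff k) (degree k)"
    have m: "?m \<in> extd (contr Q)" using lc idl_0[OF qi] by (auto simp: extd_def)
    then have mQ: "k - ?m \<in> Q" using kQ I extd_contr_subset idl_diff by blast
    have "k - ?m \<in> extd (contr Q)"
    proof (cases "degree k = 0")
      case True
      then have "k - ?m = 0" by (auto simp: poly_eq_iff coeff_eq_0)
      then show ?thesis using idl_0[OF idl_extd[OF qi]] by simp
    next
      case False
      have "degree (k - ?m) \<le> degree k" by (simp add: degree_diff_le degree_monom_le)
      moreover have "coeff (k - ?m) (degree k) = 0" by simp
      ultimately have "degree (k - ?m) < degree k"
        using False by (metis degree_0 gr0I le_neq_implies_less leading_coeff_0_iff)
      then show ?thesis using below mQ by blast
    qed
    then have "k \<in> extd (contr Q)" using idl_add[OF idl_extd[OF qi], of "k - ?m" ?m] m by simp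
    then show False using ke by blast
  qed
  have deg: "0 < degree k"
  proof (rule ccontr)
    assume "\<not> 0 < degree k"
    then have "k = [:lead_coeff k:]" by (auto elim: degree_eq_zeroE)
    then have "lead_coeff k \<in> contr Q" using kQ by (simp add: contr_def)
    then show False using lc by blast
  qed
  have "\<exists>c w r. c \<notin> contr Q \<and> smult c a = k * w + r \<and> (r = 0 \<or> degree r < degree k)" for a
  proof -
    have k0: "k \<noteq> 0" using deg by auto
    obtain w r where wr: "pseudo_divmod a k = (w, r)" by force
    let ?c = "lead_coeff k ^ (Suc (degree a) - degree k)"
    have "?c \<notin> contr Q" using lc prime_idl_power[OF q] by blast
    then show ?thesis using pseudo_divmod[OF k0 wr] by blast
  qed
  then show ?thesis using that kQ lc deg below by blast
qed

text \<open>Up to factors outside the contraction, \<open>Q\<close> is generated by its extended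
  part and one further element. The value \<open>k = 0\<close> covers the extended primes, so that
  the same form is available in every case.\<close>

lemma prime_idl_generator:
  fixes Q :: "'a::idom poly set"
  assumes Q: "prime_idl Q"
  obtains k where "k \<in> Q" "k = 0 \<longleftrightarrow> Q \<subseteq> extd (contr Q)" "k \<noteq> 0 \<Longrightarrow> lead_coeff k \<notin> contr Q"
    "\<And>a. a \<in> Q \<Longrightarrow> \<exists>c w r. c \<notin> contr Q \<and> [:c:] * a = k * w + r \<and> r \<in> extd (contr Q)"
proof (cases "Q \<subseteq> extd (contr Q)")
  case True
  have "\<exists>c w r. c \<notin> contr Q \<and> [:c:] * a = 0 * w + r \<and> r \<in> extd (contr Q)" if "a \<in> Q" for a
    using True that prime_idl_1[OF prime_contr[OF Q]]
    by (intro exI[of _ 1] exI[of _ 0] exI[of _ a]) (auto simp: one_pCons[symmetric])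
  then show ?thesis using that[of 0] True idl_0[OF prime_idl_idl[OF Q]] by blast
next
  case False
  obtain k where k: "k \<in> Q" "lead_coeff k \<notin> contr Q" "0 < degree k"
    "\<And>b. b \<in> Q \<Longrightarrow> degree b < degree k \<Longrightarrow> b \<in> extd (contr Q)"
    "\<And>a. \<exists>c w r. c \<notin> contr Q \<and> smult c a = k * w + r \<and> (r = 0 \<or> degree r < degree k)"
    using prime_idl_minimal_degree[OF Q False] by metis
  have "\<exists>c w r. c \<notin> contr Q \<and> [:c:] * a = k * w + r \<and> r \<in> extd (contr Q)" if a: "a \<in> Q" for a
  proof -
    obtain c w r where r: "c \<notin> contr Q" "smult c a = k * w + r" "r = 0 \<or> degree r < degree k"
      using k(5)[of a] by blast
    note I = prime_idl_idl[OF Q]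
    have "r = smult c a - k * w" using r by simp
    also have "\<dots> \<in> Q" using idl_diff[OF I] idl_mult[OF I a, of "[:c:]"] idl_mult_r[OF I k(1)] by simp
    finally have "r \<in> extd (contr Q)" using r(3) k(4) idl_0[OF idl_extd[OF prime_idl_idl[OF prime_contr[OF Q]]]] by blast
    then show ?thesis using r by auto
  qed
  moreover have "k \<noteq> 0" using k(3) by auto
  ultimately show ?thesis using that[of k] k(1,2) False by blast
qed

text \<open>The fibres of \<open>Spec R[x] \<rightarrow> Spec R\<close> are one-dimensional: a prime that is properly contained
  in another one over the same prime of \<open>R\<close> is extended from \<open>R\<close>.\<close>

lemma prime_idl_fibre:
  fixes P P' :: "'a::idom poly set"
  assumes P: "prime_idl P" and P': "prime_idl P'" and sub: "P \<subset> P'" and eq: "contr P = contr P'"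
  shows "P \<subseteq> extd (contr P)"
proof (rule ccontr)
  assume neP: "\<not> P \<subseteq> extd (contr P)"
  have neP': "\<not> P' \<subseteq> extd (contr P')" using neP sub eq by auto
  obtain k where k: "k \<in> P" "lead_coeff k \<notin> contr P"
    "\<And>b. b \<in> P \<Longrightarrow> degree b < degree k \<Longrightarrow> b \<in> extd (contr P)"
    using prime_idl_minimal_degree[OF P neP] by metis
  obtain k' where k': "k' \<in> P'" "lead_coeff k' \<notin> contr P'" "0 < degree k'"
    "\<And>b. b \<in> P' \<Longrightarrow> degree b < degree k' \<Longrightarrow> b \<in> extd (contr P')"
    "\<And>a. \<exists>c w r. c \<notin> contr P' \<and> smult c a = k' * w + r \<and> (r = 0 \<or> degree r < degree k')"
    using prime_idl_minimal_degree[OF P' neP'] by metis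
  note I = prime_idl_idl[OF P] and I' = prime_idl_idl[OF P']
  have p: "prime_idl (contr P)" using prime_contr[OF P] .
  note E = idl_extd[OF prime_idl_idl[OF p]]
  have red: "\<exists>c w r. c \<notin> contr P \<and> smult c a = k' * w + r \<and> r \<in> extd (contr P) \<and> (r = 0 \<or> degree r < degree k')"
    if a: "a \<in> P'" for a
  proof -
    obtain c w r where r: "c \<notin> contr P'" "smult c a = k' * w + r" "r = 0 \<or> degree r < degree k'"
      using k'(5) by blast
    have "r = smult c a - k' * w" using r by simp
    also have "\<dots> \<in> P'" using idl_diff[OF I'] idl_mult[OF I' a, of "[:c:]"] idl_mult_r[OF I' k'(1)] by simp
    finally have "r \<in> extd (contr P)" using r(3) k'(4) idl_0[OF E] eq by auto
    then show ?thesis using r eq by auto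
  qed
  have kk: "degree k' \<le> degree k"
  proof (rule ccontr)
    assume "\<not> degree k' \<le> degree k"
    then have "k \<in> extd (contr P')" using k(1) k'(4) sub by auto
    then show False using k(2) eq by (auto simp: extd_def)
  qed
  obtain c w r where cw: "c \<notin> contr P" "smult c k = k' * w + r" "r \<in> extd (contr P)" "r = 0 \<or> degree r < degree k'"
    using red[of k] k(1) sub by blast
  \<comment> \<open>The generator \<open>k\<close> of \<open>P\<close> is a multiple of
    \<open>k'\<close> up to an extended term lying in \<open>P\<close>, so primality puts
    \<open>k'\<close> or \<open>w\<close> into \<open>P\<close>; both are impossible.\<close>
  have "k' * w = smult c k - r" using cw by simp
  also have "\<dots> \<in> P" using idl_diff[OF I] idl_mult[OF I k(1), of "[:c:]"] cw(3) extd_contr_subset[OF I] by auto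
  finally have "k' \<in> P \<or> w \<in> P" using P prime_idl_mult by blast
  then show False
  proof
    assume k'P: "k' \<in> P"
    have "P' \<subseteq> P"
    proof
      fix b assume "b \<in> P'"
      then obtain c w r where r: "c \<notin> contr P" "smult c b = k' * w + r" "r \<in> extd (contr P)" using red by blast
      have "[:c:] * b \<in> P" using r k'P idl_add[OF I] idl_mult_r[OF I] extd_contr_subset[OF I] by auto
      then show "b \<in> P" using r(1) prime_idl_mult[OF P, of "[:c:]" b] by (simp add: contr_def)
    qed
    then show False using sub by blast
  next
    assume wP: "w \<in> P"
    \<comment> \<open>Since \<open>degree k'\<close> is positive, a nonzero \<open>w\<close> has
      smaller degree than \<open>k\<close>, and members of \<open>P\<close> below that degree are
      extended.\<close>
    have "w \<in> extd (contr P)"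
    proof (cases "w = 0")
      case False
      have "degree (k' * w) = degree k' + degree w" using False k'(3) by (intro degree_mult_eq) auto
      moreover have "k' * w = smult c k - r" using cw by simp
      moreover have "degree (smult c k - r) \<le> degree k"
        using cw(4) kk by (intro degree_diff_le) (auto simp: degree_smult_le)
      ultimately have "degree w < degree k" using k'(3) by simp
      then show ?thesis using wP k(3) by blast
    qed (use idl_0[OF E] in simp)
    then have "smult c k \<in> extd (contr P)" using cw idl_add[OF E] idl_mult[OF E, of w k'] by auto
    then have "c * lead_coeff k \<in> contr P" by (auto simp: extd_def)
    then show False using prime_idl_mult[OF p] cw(1) k(2) by blast
  qed
qed

section \<open>Derivations\<close>

definition derivn :: "('a::comm_ring_1 \<Rightarrow> 'a) \<Rightarrow> bool" where
  "derivn D \<longleftrightarrow> (\<forall>x y. D (x + y) = D x + D y) \<and> (\<forall>x y. D (x * y) = x * D y + y * D x)"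

lemma derivn_add: "derivn D \<Longrightarrow> D (x + y) = D x + D y"
  and derivn_mult: "derivn D \<Longrightarrow> D (x * y) = x * D y + y * D x"
  by (simp_all add: derivn_def)

lemma derivn_0: "derivn D \<Longrightarrow> D 0 = 0"
  using derivn_add[of D 0 0] by simp

lemma derivn_1: "derivn D \<Longrightarrow> D 1 = 0"
  using derivn_mult[of D 1 1] by simp

lemma derivn_sum: "derivn D \<Longrightarrow> D (sum f A) = (\<Sum>x\<in>A. D (f x))"
  by (induction A rule: infinite_finite_induct) (simp_all add: derivn_0 derivn_add)

lemma derivn_power2: "derivn D \<Longrightarrow> D (x ^ 2) = 2 * x * D x"
  by (simp add: derivn_mult power2_eq_square)

lemma derivn_pderiv: "derivn (pderiv :: 'a::idom poly \<Rightarrow> _)"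
  by (simp add: derivn_def pderiv_add pderiv_mult)

text \<open>Acting on coefficients and killing the variable extends a derivation of the base ring.
  In this way a derivation that is nontrivial on the ground field reaches the polynomial
  ring.\<close>

lemma derivn_map_poly:
  assumes D: "derivn D" shows "derivn (map_poly D)"
  unfolding derivn_def
proof (intro conjI allI)
  fix x y :: "'a poly"
  show "map_poly D (x + y) = map_poly D x + map_poly D y"
    by (intro poly_eqI) (simp add: coeff_map_poly derivn_0[OF D] derivn_add[OF D])
  show "map_poly D (x * y) = x * map_poly D y + y * map_poly D x"
  proof (rule poly_eqI)
    fix n
    have "coeff (map_poly D (x * y)) n = (\<Sum>i\<le>n. D (coeff x i * coeff y (n - i)))"
      by (simp add: coeff_map_poly derivn_0[OF D] coeff_mult derivn_sum[OF D])
    also have "\<dots> = (\<Sum>i\<le>n. coeff x i * D (coeff y (n - i))) + (\<Sum>i\<le>n. D (coeff x i) * coeff y (n - i))"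
      by (simp add: derivn_mult[OF D] sum.distrib mult.commute)
    also have "\<dots> = coeff (x * map_poly D y) n + coeff (map_poly D x * y) n"
      by (simp add: coeff_mult coeff_map_poly derivn_0[OF D])
    finally show "coeff (map_poly D (x * y)) n = coeff (x * map_poly D y + y * map_poly D x) n"
      by (simp add: mult.commute)
  qed
qed

section \<open>Regularity of local rings on a monic hypersurface in three-space\<close>

text \<open>The height of a prime of \<open>F[u][v]\<close>, counted along the projection to
  \<open>F[u]\<close>: one for a nonzero contraction, and one for not being extended from
  it.\<close>

definition height2 :: "'a::field poly poly set \<Rightarrow> nat" where
  "height2 p = (if contr p \<subseteq> {0} then 0 else 1) + (if p \<subseteq> extd (contr p) then 0 else 1)"

lemma prime_idl_field: "prime_idl (P :: 'a::field set) \<Longrightarrow> P = {0}"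
proof -
  assume P: "prime_idl P"
  have "x = 0" if "x \<in> P" for x
  proof (rule ccontr)
    assume "x \<noteq> 0"
    then have "inverse x * x = 1" by simp
    then show False using idl_mult[OF prime_idl_idl[OF P] that, of "inverse x"] prime_idl_1[OF P] by simp
  qed
  then show ?thesis using idl_0[OF prime_idl_idl[OF P]] by blast
qed

lemma extd_zero: "extd {0} = {0}"
  by (auto simp: extd_def poly_eq_iff)

lemma prime_idl_field_poly_subset:
  assumes "prime_idl (p :: 'a::field poly set)" "prime_idl p'" "p \<subset> p'"
  shows "p = {0}"
proof -
  have "contr p = {0}" "contr p' = {0}" using assms prime_idl_field prime_contr by blast+
  then have "p \<subseteq> {0}" using prime_idl_fibre[OF assms] by (simp add: extd_zero)
  then show ?thesis using idl_0[OF prime_idl_idl[OF assms(1)]] by blast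
qed

text \<open>When \<open>p'\<close> is extended from a nonzero prime \<open>(h)\<close> of
  \<open>F[u]\<close>, every member of \<open>p\<close> is divisible by \<open>h\<close>. As
  \<open>h\<close> is not in \<open>p\<close>, the quotient is in \<open>p\<close> again, and
  infinite descent leaves only zero.\<close>

lemma prime_idl_poly_over_zero_extended:
  fixes p :: "'a::field poly poly set"
  assumes p: "prime_idl p" and c: "contr p \<subseteq> {0}" and p': "prime_idl p'"
    and sub: "p \<subseteq> p'" and ext: "p' \<subseteq> extd (contr p')"
  shows "p \<subseteq> {0}"
proof (cases "contr p' \<subseteq> {0}")
  case True
  then have "p' \<subseteq> extd {0}" using ext by (auto simp: extd_def)
  then show ?thesis using sub extd_zero by blast
next
  case False
  have q': "prime_idl (contr p')" using prime_contr[OF p'] .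
  obtain h where h: "h \<in> contr p'" "h = 0 \<longleftrightarrow> contr p' \<subseteq> extd (contr (contr p'))"
    "\<And>a. a \<in> contr p' \<Longrightarrow> \<exists>c w r. c \<notin> contr (contr p') \<and> [:c:] * a = h * w + r \<and> r \<in> extd (contr (contr p'))"
    using prime_idl_generator[OF q'] by metis
  have cc: "contr (contr p') = {0}" using prime_idl_field prime_contr q' by blast
  have h0: "h \<noteq> 0" using h(2) False cc extd_zero by metis
  have hdvd: "h dvd a" if a: "a \<in> contr p'" for a
  proof -
    obtain c w where "c \<noteq> 0" "[:c:] * a = h * w" using h(3)[OF a] by (auto simp: cc extd_zero)
    then have "h dvd [:c:] * a" "is_unit [:c:]" by (auto simp: is_unit_const_poly_iff dvd_field_iff)
    then show ?thesis by (metis dvd_mult_unit_iff' )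
  qed
  have "degree h \<noteq> 0"
  proof
    assume "degree h = 0"
    then obtain c where c: "h = [:c:]" by (rule degree_eq_zeroE)
    then have "c \<in> contr (contr p')" using h(1) by (simp add: contr_def)
    then show False using cc h0 c by simp
  qed
  have "x = 0" if "x \<in> p" for x
    using that
  \<comment> \<open>Division by \<open>h\<close> keeps the degree in the outer variable but lowers
    the degree of the leading coefficient in the inner one.\<close>
  proof (induction "degree (lead_coeff x)" arbitrary: x rule: less_induct)
    case less
    show ?case
    proof (rule ccontr)
      assume x0: "x \<noteq> 0"
      have "\<forall>i. coeff x i \<in> contr p'" using less.prems sub ext by (auto simp: extd_def)
      then have "[:h:] dvd x" using hdvd by (simp add: const_poly_dvd_iff)
      then obtain y where y: "x = [:h:] * y" by (elim dvdE)
      have "h \<notin> contr p" using c h0 by blast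
      then have "[:h:] \<notin> p" by (simp add: contr_def)
      then have yp: "y \<in> p" using y less.prems prime_idl_mult[OF p] by blast
      have y0: "y \<noteq> 0" using x0 y by auto
      have "lead_coeff x = h * lead_coeff y" using y h0 by simp
      then have "degree (lead_coeff x) = degree h + degree (lead_coeff y)"
        using h0 y0 by (simp add: degree_mult_eq)
      then have "degree (lead_coeff y) < degree (lead_coeff x)" using \<open>degree h \<noteq> 0\<close> by simp
      then show False using less.hyps yp y0 by blast
    qed
  qed
  then show ?thesis by blast
qed

text \<open>For equal contractions the fibre bound applies. Otherwise the smaller contraction is
  zero, and the count could fail to grow only with \<open>p'\<close> extended and \<open>p\<close>
  not, which the preceding descent excludes.\<close>

lemma height2_strict_mono:
  assumes p: "prime_idl p" and p': "prime_idl p'" and sub: "p \<subset> p'"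
  shows "height2 p < height2 p'"
proof (cases "contr p = contr p'")
  case True
  have pe: "p \<subseteq> extd (contr p)" using prime_idl_fibre[OF p p' sub True] .
  moreover have "\<not> p' \<subseteq> extd (contr p')"
    using sub True extd_contr_subset[OF prime_idl_idl[OF p]] by auto
  ultimately show ?thesis using True by (simp add: height2_def)
next
  case False
  then have "contr p \<subset> contr p'" using sub by (auto simp: contr_def)
  then have c: "contr p = {0}" using prime_idl_field_poly_subset prime_contr p p' by blast
  then have c': "\<not> contr p' \<subseteq> {0}" using \<open>contr p \<subset> contr p'\<close> by blast
  show ?thesis
  proof (cases "p' \<subseteq> extd (contr p')")
    case True
    have "p \<subseteq> {0}" using prime_idl_poly_over_zero_extended[OF p _ p' _ True] c sub by blast
    then have "p \<subseteq> extd (contr p)" using c extd_zero by metis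
    then show ?thesis using c c' True by (simp add: height2_def)
  qed (use c c' in \<open>simp add: height2_def\<close>)
qed

lemma monic_division:
  fixes g :: "'a::idom poly"
  assumes "lead_coeff g = 1"
  obtains w r where "p = g * w + r" "r = 0 \<or> degree r < degree g"
proof -
  have g: "g \<noteq> 0" using assms by auto
  obtain w r where wr: "pseudo_divmod p g = (w, r)" by force
  have "p = g * w + r" "r = 0 \<or> degree r < degree g" using pseudo_divmod[OF g wr] assms by simp_all
  then show ?thesis using that by blast
qed

text \<open>A stalk is a record with operations on germs. An injection into a field that respects
  these operations turns ring axioms, units, ideals and primes into statements about a subset of
  that field.\<close>

locale embedded_ring =
  fixes R :: "('r, 'm) ring_scheme" (structure) and \<epsilon> :: "'r \<Rightarrow> 'g::field"
  assumes emb_inj: "inj_on \<epsilon> (carrier R)"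
    and emb_mult: "\<And>x y. x \<in> carrier R \<Longrightarrow> y \<in> carrier R \<Longrightarrow> x \<otimes> y \<in> carrier R \<and> \<epsilon> (x \<otimes> y) = \<epsilon> x * \<epsilon> y"
    and emb_add: "\<And>x y. x \<in> carrier R \<Longrightarrow> y \<in> carrier R \<Longrightarrow> x \<oplus> y \<in> carrier R \<and> \<epsilon> (x \<oplus> y) = \<epsilon> x + \<epsilon> y"
    and emb_one: "\<one> \<in> carrier R" "\<epsilon> \<one> = 1"
    and emb_zero: "\<zero> \<in> carrier R" "\<epsilon> \<zero> = 0"
    and emb_neg: "\<And>x. x \<in> carrier R \<Longrightarrow> \<exists>y\<in>carrier R. \<epsilon> y = - \<epsilon> x"
begin

lemma emb_eq: "x \<in> carrier R \<Longrightarrow> y \<in> carrier R \<Longrightarrow> \<epsilon> x = \<epsilon> y \<Longrightarrow> x = y"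
  using emb_inj by (auto dest: inj_onD)

lemma cring_embedded: "cring R"
proof (rule cringI)
  show "abelian_group R"
  proof (rule abelian_groupI)
    fix x assume x: "x \<in> carrier R"
    obtain y where "y \<in> carrier R" "\<epsilon> y = - \<epsilon> x" using emb_neg[OF x] by blast
    then show "\<exists>y\<in>carrier R. y \<oplus> x = \<zero>" using x by (auto intro!: bexI[of _ y] emb_eq simp: emb_add emb_zero)
  qed (auto intro: emb_eq simp: emb_add emb_zero algebra_simps)
  show "comm_monoid R"
    by (rule comm_monoidI) (auto intro: emb_eq simp: emb_mult emb_one algebra_simps)
qed (auto intro: emb_eq simp: emb_mult emb_add algebra_simps)

section \<open>Ideals and primes as subsets of the field\<close>

definition \<O> :: "'g set" where "\<O> = \<epsilon> ` carrier R"

lemma O_E: assumes "x \<in> \<O>" obtains a where "a \<in> carrier R" "x = \<epsilon> a"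
  using assms by (auto simp: \<O>_def)

lemma emb_O: "a \<in> carrier R \<Longrightarrow> \<epsilon> a \<in> \<O>"
  by (simp add: \<O>_def)

lemma O_simps: "0 \<in> \<O>" "1 \<in> \<O>" "x \<in> \<O> \<Longrightarrow> y \<in> \<O> \<Longrightarrow> x + y \<in> \<O>"
  "x \<in> \<O> \<Longrightarrow> y \<in> \<O> \<Longrightarrow> x * y \<in> \<O>" "x \<in> \<O> \<Longrightarrow> - x \<in> \<O>"
proof -
  show "0 \<in> \<O>" "1 \<in> \<O>"
    using emb_O[OF emb_zero(1)] emb_O[OF emb_one(1)] emb_zero(2) emb_one(2) by simp_all
  show "x + y \<in> \<O>" if x: "x \<in> \<O>" and y: "y \<in> \<O>" for x y
  proof -
    obtain a where a: "a \<in> carrier R" "x = \<epsilon> a" using x by (rule O_E)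
    obtain b where b: "b \<in> carrier R" "y = \<epsilon> b" using y by (rule O_E)
    show ?thesis using emb_add[OF a(1) b(1)] emb_O[of "a \<oplus> b"] a(2) b(2) by simp
  qed
  show "x * y \<in> \<O>" if x: "x \<in> \<O>" and y: "y \<in> \<O>" for x y
  proof -
    obtain a where a: "a \<in> carrier R" "x = \<epsilon> a" using x by (rule O_E)
    obtain b where b: "b \<in> carrier R" "y = \<epsilon> b" using y by (rule O_E)
    show ?thesis using emb_mult[OF a(1) b(1)] emb_O[of "a \<otimes> b"] a(2) b(2) by simp
  qed
  show "- x \<in> \<O>" if x: "x \<in> \<O>" for x
  proof -
    obtain a where a: "a \<in> carrier R" "x = \<epsilon> a" using x by (rule O_E)
    obtain b where "b \<in> carrier R" "\<epsilon> b = - \<epsilon> a" using emb_neg[OF a(1)] by blast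
    then show ?thesis using emb_O[of b] a by simp
  qed
qed

lemma O_power: "x \<in> \<O> \<Longrightarrow> x ^ n \<in> \<O>"
  by (induction n) (auto intro: O_simps)

lemma Units_embedded: "Units R = {x \<in> carrier R. \<epsilon> x \<noteq> 0 \<and> inverse (\<epsilon> x) \<in> \<O>}"
proof -
  interpret cring R by (rule cring_embedded)
  show ?thesis
  proof (intro equalityI subsetI)
    fix x assume x: "x \<in> Units R"
    then have c: "x \<in> carrier R" "inv x \<in> carrier R" "x \<otimes> inv x = \<one>" by auto
    then have "\<epsilon> x * \<epsilon> (inv x) = 1" using emb_mult emb_one by metis
    then have "\<epsilon> x \<noteq> 0" "inverse (\<epsilon> x) = \<epsilon> (inv x)" by (auto simp: inverse_unique)
    then show "x \<in> {x \<in> carrier R. \<epsilon> x \<noteq> 0 \<and> inverse (\<epsilon> x) \<in> \<O>}" using c emb_O by simp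
  next
    fix x assume "x \<in> {x \<in> carrier R. \<epsilon> x \<noteq> 0 \<and> inverse (\<epsilon> x) \<in> \<O>}"
    then obtain y where y: "x \<in> carrier R" "\<epsilon> x \<noteq> 0" "y \<in> carrier R" "inverse (\<epsilon> x) = \<epsilon> y"
      by (auto elim: O_E)
    have "\<epsilon> x * \<epsilon> y = 1" using y by (metis right_inverse)
    then have "\<epsilon> (x \<otimes> y) = \<epsilon> \<one>" "\<epsilon> (y \<otimes> x) = \<epsilon> \<one>" using y emb_mult emb_one by (simp_all add: mult.commute)
    then have "x \<otimes> y = \<one>" "y \<otimes> x = \<one>" using y emb_eq emb_mult emb_one by blast+
    then show "x \<in> Units R" unfolding Units_def using y by blast
  qed
qed

definition oidl :: "'g set \<Rightarrow> bool" where
  "oidl J \<longleftrightarrow> J \<subseteq> \<O> \<and> 0 \<in> J \<and> (\<forall>x\<in>J. \<forall>y\<in>J. x + y \<in> J) \<and> (\<forall>r\<in>\<O>. \<forall>x\<in>J. r * x \<in> J)"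

lemma oidlD: assumes "oidl J"
  shows "J \<subseteq> \<O>" "0 \<in> J" "x \<in> J \<Longrightarrow> y \<in> J \<Longrightarrow> x + y \<in> J" "r \<in> \<O> \<Longrightarrow> x \<in> J \<Longrightarrow> r * x \<in> J"
    "x \<in> J \<Longrightarrow> r \<in> \<O> \<Longrightarrow> x * r \<in> J"
  using assms unfolding oidl_def by (auto simp: mult.commute)

lemma oidl_neg: "oidl J \<Longrightarrow> x \<in> J \<Longrightarrow> - x \<in> J"
  using oidlD(4)[of J "- 1" x] O_simps(2,5) by force

definition oprime :: "'g set \<Rightarrow> bool" where
  "oprime P \<longleftrightarrow> oidl P \<and> 1 \<notin> P \<and> (\<forall>x\<in>\<O>. \<forall>y\<in>\<O>. x * y \<in> P \<longrightarrow> x \<in> P \<or> y \<in> P)"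

lemma ideal_oidl: assumes "ideal I R" shows "oidl (\<epsilon> ` I)"
proof -
  interpret ideal I R by fact
  show ?thesis unfolding oidl_def
  proof (intro conjI ballI)
    show "\<epsilon> ` I \<subseteq> \<O>" using emb_O by auto
    show "0 \<in> \<epsilon> ` I" using emb_zero(2) by (metis additive_subgroup.zero_closed imageI is_additive_subgroup)
    fix x y assume "x \<in> \<epsilon> ` I" "y \<in> \<epsilon> ` I"
    then obtain a b where ab: "a \<in> I" "x = \<epsilon> a" "b \<in> I" "y = \<epsilon> b" by blast
    then have "x + y = \<epsilon> (a \<oplus> b)" "a \<oplus> b \<in> I" using emb_add by (auto simp: a_closed)
    then show "x + y \<in> \<epsilon> ` I" by blast
  next
    fix r x assume "r \<in> \<O>" "x \<in> \<epsilon> ` I"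
    then obtain a b where ab: "a \<in> carrier R" "r = \<epsilon> a" "b \<in> I" "x = \<epsilon> b" by (auto elim: O_E)
    then have "r * x = \<epsilon> (a \<otimes> b)" "a \<otimes> b \<in> I" using emb_mult by (auto simp: I_l_closed)
    then show "r * x \<in> \<epsilon> ` I" by blast
  qed
qed

lemma oidl_ideal: assumes J: "oidl J" shows "ideal {x \<in> carrier R. \<epsilon> x \<in> J} R"
proof -
  interpret cring R by (rule cring_embedded)
  show ?thesis
  proof (rule idealI)
    show "ring R" by (rule ring_axioms)
    show "subgroup {x \<in> carrier R. \<epsilon> x \<in> J} (add_monoid R)"
    proof (rule group.subgroupI)
      show "group (add_monoid R)" using a_group by simp
      show "{x \<in> carrier R. \<epsilon> x \<in> J} \<noteq> {}" using emb_zero oidlD(2)[OF J] by auto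
      fix a assume a: "a \<in> {x \<in> carrier R. \<epsilon> x \<in> J}"
      have "\<epsilon> (\<ominus> a) + \<epsilon> a = 0" using a emb_add[of "\<ominus> a" a] emb_zero l_neg by simp
      then have "\<epsilon> (\<ominus> a) = - \<epsilon> a" by (simp add: eq_neg_iff_add_eq_0)
      then have "\<ominus> a \<in> {x \<in> carrier R. \<epsilon> x \<in> J}" using a oidl_neg[OF J] by simp
      then show "inv\<^bsub>add_monoid R\<^esub> a \<in> {x \<in> carrier R. \<epsilon> x \<in> J}" by (simp add: a_inv_def)
      fix b assume "b \<in> {x \<in> carrier R. \<epsilon> x \<in> J}"
      then show "a \<otimes>\<^bsub>add_monoid R\<^esub> b \<in> {x \<in> carrier R. \<epsilon> x \<in> J}"
        using a emb_add oidlD(3)[OF J] by simp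
    qed auto
  qed (use emb_mult oidlD(4,5)[OF J] emb_O in auto)
qed

lemma ideal_image_mem: "ideal I R \<Longrightarrow> x \<in> carrier R \<Longrightarrow> \<epsilon> x \<in> \<epsilon> ` I \<longleftrightarrow> x \<in> I"
  using emb_eq by (metis additive_subgroup.a_Hcarr ideal.axioms(1) imageE imageI)

lemma prime_oprime: assumes "primeideal P R" shows "oprime (\<epsilon> ` P)"
proof -
  interpret primeideal P R by fact
  have I: "ideal P R" by (rule is_ideal)
  have "1 \<notin> \<epsilon> ` P"
  proof
    assume "1 \<in> \<epsilon> ` P"
    then have "\<one> \<in> P" using emb_one ideal_image_mem[OF I] by metis
    then show False using one_imp_carrier I_notcarr by simp
  qed
  moreover have "x \<in> \<epsilon> ` P \<or> y \<in> \<epsilon> ` P" if xy: "x \<in> \<O>" "y \<in> \<O>" "x * y \<in> \<epsilon> ` P" for x y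
  proof -
    obtain a b where ab: "a \<in> carrier R" "x = \<epsilon> a" "b \<in> carrier R" "y = \<epsilon> b" using xy by (auto elim!: O_E)
    then have "\<epsilon> (a \<otimes> b) \<in> \<epsilon> ` P" using xy(3) emb_mult by metis
    then have "a \<otimes> b \<in> P" using ab emb_mult ideal_image_mem[OF I] by blast
    then show ?thesis using I_prime ab by blast
  qed
  ultimately show ?thesis unfolding oprime_def using ideal_oidl[OF I] by blast
qed

lemma oprime_prime: assumes P: "oprime P" shows "primeideal {x \<in> carrier R. \<epsilon> x \<in> P} R"
proof -
  have J: "oidl P" using P by (simp add: oprime_def)
  show ?thesis
  proof (rule primeidealI)
    show "ideal {x \<in> carrier R. \<epsilon> x \<in> P} R" using oidl_ideal[OF J] .
    show "cring R" by (rule cring_embedded)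
    have "\<one> \<notin> {x \<in> carrier R. \<epsilon> x \<in> P}" using P emb_one by (simp add: oprime_def)
    then show "carrier R \<noteq> {x \<in> carrier R. \<epsilon> x \<in> P}" using emb_one by blast
    show "a \<in> {x \<in> carrier R. \<epsilon> x \<in> P} \<or> b \<in> {x \<in> carrier R. \<epsilon> x \<in> P}"
      if "a \<in> carrier R" "b \<in> carrier R" "a \<otimes> b \<in> {x \<in> carrier R. \<epsilon> x \<in> P}" for a b
      using that P emb_mult emb_O unfolding oprime_def by auto
  qed
qed

lemma genideal_oidl:
  assumes A: "A \<subseteq> carrier R" and J: "oidl J" and AJ: "\<epsilon> ` A \<subseteq> J"
    and min: "\<And>K. oidl K \<Longrightarrow> \<epsilon> ` A \<subseteq> K \<Longrightarrow> J \<subseteq> K"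
  shows "genideal R A = {x \<in> carrier R. \<epsilon> x \<in> J}"
proof -
  interpret cring R by (rule cring_embedded)
  have G: "ideal (genideal R A) R" using genideal_ideal[OF A] .
  show ?thesis
  proof
    show "genideal R A \<subseteq> {x \<in> carrier R. \<epsilon> x \<in> J}"
      by (rule genideal_minimal[OF oidl_ideal[OF J]]) (use A AJ in auto)
    have "\<epsilon> ` A \<subseteq> \<epsilon> ` genideal R A" using genideal_self[OF A] by blast
    then have "J \<subseteq> \<epsilon> ` genideal R A" using min ideal_oidl[OF G] by blast
    then show "{x \<in> carrier R. \<epsilon> x \<in> J} \<subseteq> genideal R A" using ideal_image_mem[OF G] by blast
  qed
qed

lemma zero_oprime: "oprime {0}"
  unfolding oprime_def oidl_def using O_simps by auto

text \<open>Zorn's lemma on the ideals that contain \<open>x1\<close> and no power of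
  \<open>x2\<close>; a maximal one is prime. It will provide a prime of intermediate height without
  proving any explicit ideal prime.\<close>

lemma exists_oprime_avoiding:
  assumes x1: "x1 \<in> \<O>" and x2: "x2 \<in> \<O>" and no: "\<And>n y. y \<in> \<O> \<Longrightarrow> x2 ^ n \<noteq> x1 * y"
  obtains P where "oprime P" "x1 \<in> P" "x2 \<notin> P"
proof -
  define \<F> where "\<F> = {J. oidl J \<and> x1 \<in> J \<and> (\<forall>n. x2 ^ n \<notin> J)}"
  have "(\<lambda>y. x1 * y) ` \<O> \<in> \<F>"
  proof -
    have "oidl ((\<lambda>y. x1 * y) ` \<O>)" unfolding oidl_def
    proof (intro conjI ballI)
      show "(\<lambda>y. x1 * y) ` \<O> \<subseteq> \<O>" using O_simps(4)[OF x1] by blast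
      show "0 \<in> (\<lambda>y. x1 * y) ` \<O>" using O_simps(1) by force
      fix x y assume "x \<in> (\<lambda>y. x1 * y) ` \<O>" "y \<in> (\<lambda>y. x1 * y) ` \<O>"
      then obtain a b where ab: "a \<in> \<O>" "b \<in> \<O>" "x = x1 * a" "y = x1 * b" by blast
      then have "x + y = x1 * (a + b)" by (simp add: algebra_simps)
      then show "x + y \<in> (\<lambda>y. x1 * y) ` \<O>" using O_simps(3) ab(1,2) by blast
    next
      fix r x assume "r \<in> \<O>" "x \<in> (\<lambda>y. x1 * y) ` \<O>"
      then obtain a where a: "a \<in> \<O>" "x = x1 * a" by blast
      then have "r * x = x1 * (r * a)" by (simp add: algebra_simps)
      then show "r * x \<in> (\<lambda>y. x1 * y) ` \<O>" using O_simps(4) a(1) \<open>r \<in> \<O>\<close> by blast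
    qed
    moreover have "x1 \<in> (\<lambda>y. x1 * y) ` \<O>" using O_simps(2) by force
    ultimately show ?thesis unfolding \<F>_def using no by blast
  qed
  then have "\<F> \<noteq> {}" by blast
  then have "Bex \<F> (\<lambda>P. Ball \<F> (\<lambda>Z. P \<subseteq> Z \<longrightarrow> Z = P))"
  proof (rule subset_Zorn_nonempty)
    fix C assume C: "C \<noteq> {}" "subset.chain \<F> C"
    have CF: "C \<subseteq> \<F>" and tot: "\<And>Xs Y. Xs \<in> C \<Longrightarrow> Y \<in> C \<Longrightarrow> Xs \<subseteq> Y \<or> Y \<subseteq> Xs"
      using C(2) by (auto simp: subset.chain_def)
    have "oidl (\<Union>C)" unfolding oidl_def
    proof (intro conjI ballI)
      show "\<Union>C \<subseteq> \<O>" using CF oidlD(1) unfolding \<F>_def by blast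
      show "0 \<in> \<Union>C" using C(1) CF oidlD(2) unfolding \<F>_def by blast
      fix x y assume "x \<in> \<Union>C" "y \<in> \<Union>C"
      then obtain Z where "Z \<in> C" "x \<in> Z" "y \<in> Z" using tot by blast
      moreover have "oidl Z" using CF \<open>Z \<in> C\<close> unfolding \<F>_def by blast
      ultimately show "x + y \<in> \<Union>C" using oidlD(3) by blast
    next
      fix r x assume "r \<in> \<O>" "x \<in> \<Union>C"
      then obtain Z where "Z \<in> C" "x \<in> Z" by blast
      moreover have "oidl Z" using CF \<open>Z \<in> C\<close> unfolding \<F>_def by blast
      ultimately show "r * x \<in> \<Union>C" using oidlD(4) \<open>r \<in> \<O>\<close> by blast
    qed
    then show "\<Union>C \<in> \<F>" using C(1) CF unfolding \<F>_def by blast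
  qed
  then obtain P where P: "P \<in> \<F>" and max: "\<And>Xs. Xs \<in> \<F> \<Longrightarrow> P \<subseteq> Xs \<Longrightarrow> Xs = P" by blast
  have PF: "oidl P \<and> x1 \<in> P \<and> (\<forall>n. x2 ^ n \<notin> P)" using P unfolding \<F>_def by (rule CollectD)
  then have J: "oidl P" and x1P: "x1 \<in> P" by blast+
  have pw: "x2 ^ n \<notin> P" for n using PF by (elim conjE) (erule spec)
  \<comment> \<open>Maximality in usable form: adjoining an element outside \<open>P\<close> makes
    some power of \<open>x2\<close> appear.\<close>
  have enlarge: "\<exists>n. \<exists>p\<in>P. \<exists>a\<in>\<O>. x2 ^ n = p + a * x" if x: "x \<in> \<O>" "x \<notin> P" for x
  proof (rule ccontr)
    assume neg: "\<not> (\<exists>n. \<exists>p\<in>P. \<exists>a\<in>\<O>. x2 ^ n = p + a * x)"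
    define Xs where "Xs = {p + a * x | p a. p \<in> P \<and> a \<in> \<O>}"
    have "oidl Xs" unfolding oidl_def
    proof (intro conjI ballI)
      show "Xs \<subseteq> \<O>"
      proof
        fix u assume "u \<in> Xs"
        then obtain p a where *: "p \<in> P" "a \<in> \<O>" "u = p + a * x" unfolding Xs_def by blast
        have "p \<in> \<O>" using *(1) oidlD(1)[OF J] by blast
        then show "u \<in> \<O>" unfolding *(3) using *(2) x(1) by (intro O_simps(3,4))
      qed
      show "0 \<in> Xs" unfolding Xs_def using oidlD(2)[OF J] O_simps(1) by force
      fix u v assume "u \<in> Xs" "v \<in> Xs"
      then obtain p a p' a' where *: "p \<in> P" "a \<in> \<O>" "p' \<in> P" "a' \<in> \<O>" "u = p + a * x" "v = p' + a' * x"
        unfolding Xs_def by blast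
      have "u + v = (p + p') + (a + a') * x" using * by (simp add: algebra_simps)
      moreover have "p + p' \<in> P" "a + a' \<in> \<O>" using * oidlD(3)[OF J] O_simps(3) by simp_all
      ultimately show "u + v \<in> Xs" unfolding Xs_def by blast
    next
      fix r u assume r: "r \<in> \<O>" and "u \<in> Xs"
      then obtain p a where *: "p \<in> P" "a \<in> \<O>" "u = p + a * x" unfolding Xs_def by blast
      have "r * u = r * p + (r * a) * x" using * by (simp add: algebra_simps)
      moreover have "r * p \<in> P" "r * a \<in> \<O>" using * r oidlD(4)[OF J] O_simps(4) by simp_all
      ultimately show "r * u \<in> Xs" unfolding Xs_def by blast
    qed
    moreover have PX: "P \<subseteq> Xs" unfolding Xs_def using O_simps(1) by force
    ultimately have "Xs \<in> \<F>" unfolding \<F>_def using x1P neg unfolding Xs_def by blast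
    then have "Xs = P" using max PX by blast
    moreover have "x \<in> Xs" unfolding Xs_def using oidlD(2)[OF J] O_simps(2) by force
    ultimately show False using x by blast
  qed
  have "oprime P" unfolding oprime_def
  proof (intro conjI ballI impI)
    show "oidl P" by fact
    show "1 \<notin> P" using pw[of 0] by simp
    fix x y assume xy: "x \<in> \<O>" "y \<in> \<O>" "x * y \<in> P"
    show "x \<in> P \<or> y \<in> P"
    proof (rule ccontr)
      assume "\<not> (x \<in> P \<or> y \<in> P)"
      then obtain n p a m p' a' where *: "p \<in> P" "a \<in> \<O>" "x2 ^ n = p + a * x" "p' \<in> P" "a' \<in> \<O>" "x2 ^ m = p' + a' * y"
        using enlarge[of x] enlarge[of y] xy by blast
      \<comment> \<open>The product of the two representations, sorted so that every summand has a
        factor in \<open>P\<close>: \<open>p\<close>, \<open>p'\<close> or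
        \<open>x * y\<close>.\<close>
      have "x2 ^ (n + m) = (p' + a' * y) * p + ((a * x) * p' + (a * a') * (x * y))"
        using * by (simp add: power_add algebra_simps)
      moreover have "(p' + a' * y) * p \<in> P"
        using * xy oidlD(1)[OF J] by (intro oidlD(4)[OF J] O_simps) auto
      moreover have "(a * x) * p' \<in> P" using * xy by (intro oidlD(4)[OF J] O_simps) auto
      moreover have "(a * a') * (x * y) \<in> P" using * xy(3) O_simps(4) oidlD(4)[OF J] by simp
      ultimately have "x2 ^ (n + m) \<in> P" using oidlD(3)[OF J] by simp
      then show False using pw by blast
    qed
  qed
  then show ?thesis using that x1P pw[of 1] by simp
qed

end

section \<open>Regularity of localizations of a monic hypersurface\<close>

lemma primeideal_proper_subset: "primeideal P R \<Longrightarrow> P \<subseteq> carrier R"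
  by (simp add: additive_subgroup.a_subset ideal_def primeideal_def)

text \<open>\<open>\<chi>\<close> presents the ring as the localization of
  \<open>F[u,v,y]/(g)\<close> at the elements mapping to nonunits: \<open>ker\<close> gives the
  relations, \<open>frac\<close> the fractions, and \<open>local_add\<close> says that nonunits are
  closed under addition. The derivation \<open>D\<close> may act nontrivially on the
  coefficients.\<close>

locale regular_chart = embedded_ring R \<epsilon>
  for R :: "('r, 'm) ring_scheme" (structure) and \<epsilon> :: "'r \<Rightarrow> 'g::field" +
  fixes \<chi> :: "'a::field poly poly poly \<Rightarrow> 'g" and g :: "'a poly poly poly" and D
  assumes chi: "rhom \<chi>"
    and chi_mem: "\<chi> b \<in> \<O>"
    and frac: "x \<in> \<O> \<Longrightarrow> \<exists>b t. x * \<chi> t = \<chi> b \<and> \<chi> t \<noteq> 0 \<and> inverse (\<chi> t) \<in> \<O>"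
    and local_add: "\<chi> a = 0 \<or> inverse (\<chi> a) \<notin> \<O> \<Longrightarrow> \<chi> b = 0 \<or> inverse (\<chi> b) \<notin> \<O> \<Longrightarrow>
      \<chi> (a + b) = 0 \<or> inverse (\<chi> (a + b)) \<notin> \<O>"
    and ker: "\<chi> b = 0 \<longleftrightarrow> g dvd b"
    and monic: "lead_coeff g = 1" "0 < degree g"
    and D: "derivn D" "\<chi> (D g) \<noteq> 0" "inverse (\<chi> (D g)) \<in> \<O>"
begin

definition Q :: "'a poly poly poly set" where
  "Q = {b. \<chi> b = 0 \<or> inverse (\<chi> b) \<notin> \<O>}"

definition \<M> :: "'g set" where
  "\<M> = {x \<in> \<O>. x = 0 \<or> inverse x \<notin> \<O>}"

lemma Q_iff: "b \<in> Q \<longleftrightarrow> \<chi> b \<in> \<M>"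
  using chi_mem by (simp add: Q_def \<M>_def)

lemma unit_mult_iff:
  assumes "x \<in> \<O>" "y \<in> \<O>"
  shows "x * y \<in> \<M> \<longleftrightarrow> x \<in> \<M> \<or> y \<in> \<M>"
proof -
  have *: "inverse x \<in> \<O>" if "x * y \<noteq> 0" "inverse (x * y) \<in> \<O>" "y \<in> \<O>" for x y
  proof -
    have "inverse x = inverse (x * y) * y" using that by (simp add: field_simps)
    then show ?thesis using that O_simps(4) by metis
  qed
  have M: "z \<notin> \<M> \<longleftrightarrow> z \<noteq> 0 \<and> inverse z \<in> \<O>" if "z \<in> \<O>" for z
    using that by (simp add: \<M>_def)
  have "x * y \<notin> \<M> \<longleftrightarrow> x \<notin> \<M> \<and> y \<notin> \<M>"
    unfolding M[OF assms(1)] M[OF assms(2)] M[OF O_simps(4)[OF assms]]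
  proof safe
    assume xy: "x * y \<noteq> 0" "inverse (x * y) \<in> \<O>"
    show "inverse x \<in> \<O>" using *[OF xy assms(2)] .
    show "inverse y \<in> \<O>" by (rule *[of y x]) (use xy assms(1) in \<open>simp_all add: mult.commute\<close>)
  next
    assume "inverse x \<in> \<O>" "inverse y \<in> \<O>"
    then show "inverse (x * y) \<in> \<O>" using O_simps(4) by simp
  qed auto
  then show ?thesis by blast
qed

lemma prime_Q: "prime_idl Q"
  unfolding prime_idl_def
proof (intro conjI allI impI idlI)
  show "0 \<in> Q" by (simp add: Q_def rhom_0[OF chi])
  show "x + y \<in> Q" if "x \<in> Q" "y \<in> Q" for x y
    using local_add[of x y] that by (simp add: Q_def)
  show "r * x \<in> Q" if "x \<in> Q" for r x
    using that chi_mem unit_mult_iff by (simp add: Q_iff rhom_mult[OF chi])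
  show "1 \<notin> Q" using O_simps(2) by (simp add: Q_def rhom_1[OF chi])
  show "x \<in> Q \<or> y \<in> Q" if "x * y \<in> Q" for x y
    using that chi_mem unit_mult_iff by (simp add: Q_iff rhom_mult[OF chi])
qed

lemmas idl_Q = prime_idl_idl[OF prime_Q]

lemma fracE:
  assumes "x \<in> \<O>"
  obtains b t where "t \<notin> Q" "x * \<chi> t = \<chi> b" "x = inverse (\<chi> t) * \<chi> b" "inverse (\<chi> t) \<in> \<O>"
proof -
  obtain b t where bt: "x * \<chi> t = \<chi> b" "\<chi> t \<noteq> 0" "inverse (\<chi> t) \<in> \<O>" using frac[OF assms] by blast
  then have "x = inverse (\<chi> t) * \<chi> b" by (metis mult.commute mult.left_commute mult_1 right_inverse)
  then show ?thesis using that bt by (simp add: Q_def)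
qed

lemma unit_notin_Q: "t \<notin> Q \<Longrightarrow> \<chi> t \<noteq> 0 \<and> inverse (\<chi> t) \<in> \<O>"
  by (simp add: Q_def)

definition pre :: "'g set \<Rightarrow> 'a poly poly poly set" where
  "pre J = {b. \<chi> b \<in> J}"

lemma idl_pre: "oidl J \<Longrightarrow> idl (pre J)"
  by (rule idlI) (auto simp: pre_def rhom_simps[OF chi] chi_mem intro: oidlD)

text \<open>Elements outside \<open>Q\<close> become units, so contracted ideals are saturated. This
  is how division by denominators is expressed inside the polynomial ring.\<close>

lemma pre_saturated:
  assumes "oidl J" "c \<notin> Q" "c * b \<in> pre J" shows "b \<in> pre J"
proof -
  have "inverse (\<chi> c) * \<chi> (c * b) \<in> J"
    using assms unit_notin_Q[OF assms(2)] by (intro oidlD(4)) (auto simp: pre_def)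
  then show ?thesis using unit_notin_Q[OF assms(2)] by (simp add: pre_def rhom_mult[OF chi] mult.assoc[symmetric])
qed

lemma oidl_subset_pre:
  assumes "oidl J" "oidl K" "pre J \<subseteq> pre K" shows "J \<subseteq> K"
proof
  fix x assume x: "x \<in> J"
  then obtain b t where bt: "t \<notin> Q" "x * \<chi> t = \<chi> b" "x = inverse (\<chi> t) * \<chi> b" "inverse (\<chi> t) \<in> \<O>"
    using fracE oidlD(1)[OF assms(1)] by blast
  have "b \<in> pre J" using bt(2) x oidlD(5)[OF assms(1)] chi_mem by (metis pre_def mem_Collect_eq)
  then have "\<chi> b \<in> K" using assms(3) by (auto simp: pre_def)
  then show "x \<in> K" using bt(3,4) oidlD(4)[OF assms(2)] by metis
qed

lemma oidl_M: "oidl \<M>"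
  unfolding oidl_def
proof (intro conjI ballI)
  show "\<M> \<subseteq> \<O>" by (auto simp: \<M>_def)
  show "0 \<in> \<M>" using O_simps(1) by (simp add: \<M>_def)
  show "r * x \<in> \<M>" if "r \<in> \<O>" "x \<in> \<M>" for r x
    using that unit_mult_iff[of r x] by (auto simp: \<M>_def)
  fix x y assume x: "x \<in> \<M>" and y: "y \<in> \<M>"
  have xyO: "x \<in> \<O>" "y \<in> \<O>" using x y by (auto simp: \<M>_def)
  obtain b t where bt: "t \<notin> Q" "x * \<chi> t = \<chi> b" using fracE[OF xyO(1)] by metis
  obtain b' t' where bt': "t' \<notin> Q" "y * \<chi> t' = \<chi> b'" using fracE[OF xyO(2)] by metis
  have "b \<in> Q" "b' \<in> Q" using x y bt bt' unit_mult_iff xyO chi_mem by (metis Q_iff)+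
  then have "b * t' + b' * t \<in> Q" using idl_add[OF idl_Q] idl_mult_r[OF idl_Q] by blast
  moreover have "\<chi> (b * t' + b' * t) = (x + y) * \<chi> (t * t')"
    using bt bt' by (simp add: rhom_simps[OF chi] flip: bt(2) bt'(2)) (simp add: algebra_simps)
  ultimately have "(x + y) * \<chi> (t * t') \<in> \<M>" by (simp add: Q_iff)
  moreover have "\<chi> (t * t') \<notin> \<M>" using bt bt' prime_idl_mult[OF prime_Q] by (auto simp flip: Q_iff)
  ultimately show "x + y \<in> \<M>" using unit_mult_iff O_simps(3)[OF xyO] chi_mem by blast
qed

lemma one_notin_M: "1 \<notin> \<M>"
  using O_simps(2) by (simp add: \<M>_def)

lemma pre_M: "pre \<M> = Q"
  using Q_iff by (auto simp: pre_def)

lemma proper_oidl_subset_M: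
  assumes J: "oidl J" and "1 \<notin> J" shows "J \<subseteq> \<M>"
proof
  fix x assume x: "x \<in> J"
  have "x = 0 \<or> inverse x \<notin> \<O>"
  proof (rule ccontr)
    assume "\<not> ?thesis"
    then have x0: "x \<noteq> 0" and xi: "inverse x \<in> \<O>" by auto
    have "inverse x * x \<in> J" by (rule oidlD(4)[OF J xi x])
    then have "1 \<in> J" using x0 by simp
    then show False using assms(2) by simp
  qed
  then show "x \<in> \<M>" using x oidlD(1)[OF J] by (auto simp: \<M>_def)
qed

lemma oprime_M: "oprime \<M>"
  unfolding oprime_def using oidl_M one_notin_M unit_mult_iff by blast

lemma oprime_pre: assumes P: "oprime P" shows "prime_idl (pre P)" "pre P \<subseteq> Q" "g \<in> pre P"
proof -
  have J: "oidl P" using P by (simp add: oprime_def)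
  show "prime_idl (pre P)" unfolding prime_idl_def
    using idl_pre[OF J] P chi_mem by (auto simp: pre_def oprime_def rhom_simps[OF chi])
  show "pre P \<subseteq> Q" using proper_oidl_subset_M[OF J] P unfolding pre_M[symmetric] by (auto simp: pre_def oprime_def)
  have "\<chi> g = 0" using ker by simp
  then show "g \<in> pre P" using oidlD(2)[OF J] by (simp add: pre_def)
qed

lemma g_notin_extd: assumes "prime_idl P" shows "g \<notin> extd (contr P)"
proof
  assume "g \<in> extd (contr P)"
  then have "lead_coeff g \<in> contr P" by (auto simp: extd_def)
  then show False using monic(1) prime_idl_1[OF prime_contr[OF assms]] by simp
qed

text \<open>The monic \<open>g\<close> lies in every contracted prime but in no extended one, so
  equal contractions to \<open>F[u,v]\<close> would contradict one-dimensionality of the fibres: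
  incomparability for the finite projection of the hypersurface.\<close>

lemma contr_pre_strict:
  assumes P: "oprime P" and P': "oprime P'" and sub: "P \<subset> P'"
  shows "contr (pre P) \<subset> contr (pre P')"
proof -
  have "pre P \<subseteq> pre P'" using sub by (auto simp: pre_def)
  moreover have "\<not> pre P' \<subseteq> pre P" using oidl_subset_pre[of P' P] P P' sub by (auto simp: oprime_def)
  ultimately have s: "pre P \<subset> pre P'" by blast
  have "contr (pre P) \<noteq> contr (pre P')"
    using prime_idl_fibre[OF oprime_pre(1)[OF P] oprime_pre(1)[OF P'] s] oprime_pre(3)[OF P]
      g_notin_extd[OF oprime_pre(1)[OF P]] by blast
  then show ?thesis using s by (auto simp: contr_def)
qed

text \<open>Projected to \<open>F[u,v]\<close> the chain stays strict, so \<open>height2\<close>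
  grows by at least one at each step and ends below the value at \<open>contr Q\<close>.\<close>

lemma chain_bound:
  fixes P :: "nat \<Rightarrow> 'g set"
  assumes "\<And>i. i \<le> n \<Longrightarrow> oprime (P i)" "\<And>i. i < n \<Longrightarrow> P i \<subset> P (Suc i)"
  shows "n \<le> height2 (contr Q)"
proof -
  have ge: "i \<le> n \<Longrightarrow> i \<le> height2 (contr (pre (P i)))" for i
  proof (induction i)
    case (Suc i)
    have "height2 (contr (pre (P i))) < height2 (contr (pre (P (Suc i))))"
      using Suc.prems assms by (intro height2_strict_mono prime_contr oprime_pre contr_pre_strict) auto
    then show ?case using Suc by simp
  qed simp
  have "contr (pre (P n)) \<subseteq> contr Q" using oprime_pre(2)[OF assms(1)[of n]] by (auto simp: contr_def)
  then have "height2 (contr (pre (P n))) \<le> height2 (contr Q)"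
    using height2_strict_mono[OF prime_contr[OF oprime_pre(1)[OF assms(1)[of n]]] prime_contr[OF prime_Q]]
    by (metis order.refl less_imp_le psubsetI)
  then show ?thesis using ge[of n] by simp
qed

text \<open>A nonzero multiple of the monic \<open>g\<close> has positive degree in the last
  variable, so \<open>F[u,v]\<close> meets the kernel only in zero.\<close>

lemma chi_const_inj: "\<chi> [:b:] = 0 \<Longrightarrow> b = 0"
proof (rule ccontr)
  assume "\<chi> [:b:] = 0" "b \<noteq> 0"
  then have "g dvd [:b:]" "[:b:] \<noteq> 0" using ker by auto
  then have "degree g \<le> degree [:b:]" by (rule dvd_imp_degree_le)
  then show False using monic(2) by simp
qed

text \<open>Ideals are determined by their contractions to the polynomial ring, which is noetherian
  by three uses of the Hilbert basis theorem.\<close>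

lemma noetherian_embedded: "noetherian_ring R"
proof -
  interpret cring R by (rule cring_embedded)
  have noeth: "fin_gen I" if "idl (I :: 'a poly poly poly set)" for I
    using hilbert_basis[OF hilbert_basis[OF hilbert_basis[OF field_fin_gen]]] that by blast
  show ?thesis
  proof (rule noetherian_ringI)
    fix I assume I: "ideal I R"
    have J: "oidl (\<epsilon> ` I)" using ideal_oidl[OF I] .
    obtain A where A: "finite A" "A \<subseteq> pre (\<epsilon> ` I)" "\<And>K. idl K \<Longrightarrow> A \<subseteq> K \<Longrightarrow> pre (\<epsilon> ` I) \<subseteq> K"
      using fin_genE[OF noeth[OF idl_pre[OF J]]] by metis
    define B where "B = {x \<in> I. \<epsilon> x \<in> \<chi> ` A}"
    have IR: "I \<subseteq> carrier R" using I by (simp add: additive_subgroup.a_subset ideal_def)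
    have BR: "B \<subseteq> carrier R" using IR by (auto simp: B_def)
    have eB: "\<epsilon> ` B = \<chi> ` A"
    proof
      show "\<epsilon> ` B \<subseteq> \<chi> ` A" by (auto simp: B_def)
      show "\<chi> ` A \<subseteq> \<epsilon> ` B"
      proof
        fix y assume y: "y \<in> \<chi> ` A"
        then have "y \<in> \<epsilon> ` I" using A(2) by (auto simp: pre_def)
        then obtain x where "x \<in> I" "y = \<epsilon> x" by blast
        then show "y \<in> \<epsilon> ` B" using y by (auto simp: B_def)
      qed
    qed
    have "inj_on \<epsilon> B" using emb_inj BR by (rule inj_on_subset)
    then have "finite B" using eB A(1) by (metis finite_imageD finite_imageI)
    moreover have "genideal R B = {x \<in> carrier R. \<epsilon> x \<in> \<epsilon> ` I}"
    proof (rule genideal_oidl[OF BR J])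
      show "\<epsilon> ` B \<subseteq> \<epsilon> ` I" by (auto simp: B_def)
      fix K assume K: "oidl K" "\<epsilon> ` B \<subseteq> K"
      then have "A \<subseteq> pre K" using eB by (auto simp: pre_def)
      then have "pre (\<epsilon> ` I) \<subseteq> pre K" using A(3) idl_pre[OF K(1)] by blast
      then show "\<epsilon> ` I \<subseteq> K" using oidl_subset_pre J K(1) by blast
    qed
    then have "I = genideal R B" using ideal_image_mem[OF I] IR by blast
    ultimately show "\<exists>A\<subseteq>carrier R. finite A \<and> I = genideal R A" using BR by blast
  qed
qed

lemma maximal_iff: "maximalideal M' R \<longleftrightarrow> M' = {x \<in> carrier R. \<epsilon> x \<in> \<M>}"
proof -
  interpret cring R by (rule cring_embedded)
  let ?M = "{x \<in> carrier R. \<epsilon> x \<in> \<M>}"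
  have M: "ideal ?M R" using oidl_ideal[OF oidl_M] .
  have ne: "\<one> \<notin> ?M" using emb_one one_notin_M by simp
  have below: "J \<subseteq> ?M" if J: "ideal J R" "J \<noteq> carrier R" for J
  proof -
    interpret J: ideal J R by fact
    have "1 \<notin> \<epsilon> ` J" using ideal_image_mem[OF J(1), of \<one>] emb_one J.one_imp_carrier J(2) by metis
    then have "\<epsilon> ` J \<subseteq> \<M>" using proper_oidl_subset_M ideal_oidl[OF J(1)] by blast
    then show ?thesis using J.a_subset by blast
  qed
  show ?thesis
  proof
    assume "maximalideal M' R"
    then interpret M': maximalideal M' R .
    have "M' \<subseteq> ?M" using below M'.is_ideal M'.I_notcarr by blast
    moreover have "?M \<noteq> carrier R" using ne by blast
    ultimately show "M' = ?M" using M'.I_maximal[OF M] by blast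
  next
    assume M': "M' = ?M"
    show "maximalideal M' R" unfolding M'
    proof (rule maximalidealI[OF M])
      show "carrier R \<noteq> ?M" using ne by blast
      show "J = ?M \<or> J = carrier R" if "ideal J R" "?M \<subseteq> J" "J \<subseteq> carrier R" for J
        using below that by blast
    qed
  qed
qed

text \<open>A generating system of the localized \<open>Q\<close> with one element per variable,
  zero where a variable contributes nothing. Testing against saturated ideals encodes the
  localization; the last clause records the shape of the first two generators for the construction
  of a prime of intermediate height.\<close>

definition gens :: "(nat \<Rightarrow> 'a poly poly poly) \<Rightarrow> bool" where
  "gens H \<longleftrightarrow> (\<forall>i<3. H i \<in> Q) \<and> card {i. i < 3 \<and> H i \<noteq> 0} = Suc (height2 (contr Q)) \<and>
     (\<forall>J. idl J \<longrightarrow> (\<forall>c b. c \<notin> Q \<longrightarrow> c * b \<in> J \<longrightarrow> b \<in> J) \<longrightarrow> (\<forall>i<3. H i \<in> J) \<longrightarrow> Q \<subseteq> J) \<and>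
     (height2 (contr Q) = 2 \<longrightarrow> (\<exists>h1 h2. H 0 = [:[:h1:]:] \<and> H 1 = [:h2:] \<and> prime_elem [:h1:] \<and> \<not> [:h1:] dvd h2))"

text \<open>\<open>prime_idl_generator\<close> is applied to \<open>Q\<close> and its two successive
  contractions. The third generator never vanishes, because \<open>g\<close> lies in
  \<open>Q\<close> and is not extended; this accounts for the successor in the count.\<close>

lemma ex_gens: obtains H where "gens H"
proof -
  let ?q = "contr Q" let ?q1 = "contr ?q"
  have pq: "prime_idl ?q" using prime_contr[OF prime_Q] .
  have pq1: "prime_idl ?q1" using prime_contr[OF pq] .
  have q0: "contr ?q1 = {0}" using prime_idl_field[OF prime_contr[OF pq1]] .
  obtain h3 where h3: "h3 \<in> Q" "h3 = 0 \<longleftrightarrow> Q \<subseteq> extd ?q"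
    "\<And>a. a \<in> Q \<Longrightarrow> \<exists>c w r. c \<notin> ?q \<and> [:c:] * a = h3 * w + r \<and> r \<in> extd ?q"
    using prime_idl_generator[OF prime_Q] by metis
  obtain h2 where h2: "h2 \<in> ?q" "h2 = 0 \<longleftrightarrow> ?q \<subseteq> extd ?q1" "h2 \<noteq> 0 \<Longrightarrow> lead_coeff h2 \<notin> ?q1"
    "\<And>a. a \<in> ?q \<Longrightarrow> \<exists>c w r. c \<notin> ?q1 \<and> [:c:] * a = h2 * w + r \<and> r \<in> extd ?q1"
    using prime_idl_generator[OF pq] by metis
  obtain h1 where h1: "h1 \<in> ?q1" "h1 = 0 \<longleftrightarrow> ?q1 \<subseteq> {0}"
    and h1r: "\<And>a. a \<in> ?q1 \<Longrightarrow> \<exists>c w. c \<noteq> 0 \<and> [:c:] * a = h1 * w"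
    using prime_idl_generator[OF pq1] unfolding q0 extd_zero
    by (metis (no_types, lifting) add.right_neutral singletonD insertI1)
  have h3n: "h3 \<noteq> 0"
    using h3(2) g_notin_extd[OF prime_Q] oprime_pre(2,3)[OF oprime_M] by blast
  have h1d: "h1 dvd a" if a: "a \<in> ?q1" for a
  proof -
    obtain c w where "c \<noteq> 0" "[:c:] * a = h1 * w" using h1r[OF a] by blast
    then have "h1 dvd [:c:] * a" "is_unit [:c:]" by (auto simp: is_unit_const_poly_iff dvd_field_iff)
    then show ?thesis by (metis dvd_mult_unit_iff')
  qed
  define H where "H = (\<lambda>i::nat. if i = 0 then [:[:h1:]:] else if i = 1 then [:h2:] else h3)"
  have three: "{i. i < 3 \<and> H i \<noteq> 0} = (if h1 = 0 then {} else {0}) \<union> (if h2 = 0 then {} else {1}) \<union> {2}"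
    using h3n by (auto simp: H_def less_Suc_eq numeral_3_eq_3)
  have hgt: "height2 ?q = (if h1 = 0 then 0 else 1) + (if h2 = 0 then 0 else 1)"
    using h1(2) h2(2) by (simp add: height2_def)
  have "gens H" unfolding gens_def
  proof (intro conjI allI impI)
    show "H i \<in> Q" if "i < 3" for i
      using h1(1) h2(1) h3(1) by (simp add: H_def contr_def)
    show "card {i. i < 3 \<and> H i \<noteq> 0} = Suc (height2 (contr Q))"
      unfolding three hgt by auto
    show "\<exists>h1 h2. H 0 = [:[:h1:]:] \<and> H 1 = [:h2:] \<and> prime_elem [:h1:] \<and> \<not> [:h1:] dvd h2"
      if "height2 (contr Q) = 2"
    proof -
      have n: "h1 \<noteq> 0" "h2 \<noteq> 0" using that hgt by (auto split: if_splits)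
      have "prime_elem h1"
      proof (rule prime_elemI)
        show "h1 \<noteq> 0" by fact
        show "\<not> is_unit h1"
          using h1(1) idl_mult_r[OF prime_idl_idl[OF pq1]] prime_idl_1[OF pq1] by (metis dvd_def)
        show "h1 dvd a \<or> h1 dvd b" if ab: "h1 dvd a * b" for a b
        proof -
          have "a * b \<in> ?q1" using ab h1(1) idl_mult_r[OF prime_idl_idl[OF pq1]] by (metis dvd_def)
          then show ?thesis using prime_idl_mult[OF pq1] h1d by blast
        qed
      qed
      then have p: "prime_elem [:h1:]" by (rule lift_prime_elem_poly)
      have "\<not> [:h1:] dvd h2"
      proof
        assume "[:h1:] dvd h2"
        then have "h1 dvd lead_coeff h2" by (simp add: const_poly_dvd_iff)
        then have "lead_coeff h2 \<in> ?q1" using h1(1) idl_mult_r[OF prime_idl_idl[OF pq1]] by (metis dvd_def)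
        then show False using h2(3) n by blast
      qed
      then show ?thesis using p by (auto simp: H_def)
    qed
    fix J assume J: "idl J" and sat: "\<forall>c b. c \<notin> Q \<longrightarrow> c * b \<in> J \<longrightarrow> b \<in> J" and HJ: "\<forall>i<3. H i \<in> J"
    have hJ: "[:[:h1:]:] \<in> J" "[:h2:] \<in> J" "h3 \<in> J"
      using HJ[rule_format, of 0] HJ[rule_format, of 1] HJ[rule_format, of 2] by (simp_all add: H_def)
    have J2: "idl (contr J)" unfolding contr_def by (rule idl_vimage[OF rhom_const_poly J])
    have J1: "idl (contr (contr J))" unfolding contr_def[of "contr J"] by (rule idl_vimage[OF rhom_const_poly J2])
    \<comment> \<open>In each of the three layers, a factor outside a contraction of
      \<open>Q\<close> is a constant outside \<open>Q\<close>, so saturation of \<open>J\<close>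
      cancels it.\<close>
    have s1: "?q1 \<subseteq> contr (contr J)"
    proof
      fix b assume b: "b \<in> ?q1"
      obtain c w where cw: "c \<noteq> 0" "[:c:] * b = h1 * w" using h1r[OF b] by blast
      have "h1 * w \<in> contr (contr J)" using hJ(1) idl_mult_r[OF J1] by (simp add: contr_def)
      then have "[:[:[:c:]:]:] * [:[:b:]:] \<in> J" using cw(2) by (simp add: contr_def)
      moreover have "[:[:[:c:]:]:] \<notin> Q" using cw(1) q0 by (auto simp: contr_def)
      ultimately show "b \<in> contr (contr J)" using sat by (auto simp: contr_def)
    qed
    have s2: "?q \<subseteq> contr J"
    proof
      fix b assume b: "b \<in> ?q"
      obtain c w r where cw: "c \<notin> ?q1" "[:c:] * b = h2 * w + r" "r \<in> extd ?q1" using h2(4)[OF b] by blast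
      have "coeff r i \<in> contr (contr J)" for i using cw(3) s1 unfolding extd_def by blast
      then have "[:coeff r i:] \<in> contr J" for i by (simp add: contr_def[of "contr J"])
      then have "r \<in> contr J" by (rule idl_coeffs_mem[OF J2])
      moreover have "h2 * w \<in> contr J" using hJ(2) idl_mult_r[OF J2] by (simp add: contr_def)
      ultimately have "[:c:] * b \<in> contr J" using cw(2) idl_add[OF J2] by simp
      then have "[:[:c:]:] * [:b:] \<in> J" by (simp add: contr_def)
      moreover have "[:[:c:]:] \<notin> Q" using cw(1) by (auto simp: contr_def)
      ultimately show "b \<in> contr J" using sat by (auto simp: contr_def)
    qed
    show "Q \<subseteq> J"
    proof
      fix b assume b: "b \<in> Q"
      obtain c w r where cw: "c \<notin> ?q" "[:c:] * b = h3 * w + r" "r \<in> extd ?q" using h3(3)[OF b] by blast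
      have "coeff r i \<in> contr J" for i using cw(3) s2 unfolding extd_def by blast
      then have "[:coeff r i:] \<in> J" for i by (simp add: contr_def[of J])
      then have "r \<in> J" by (rule idl_coeffs_mem[OF J])
      moreover have "h3 * w \<in> J" using hJ(3) idl_mult_r[OF J] by simp
      ultimately have "[:c:] * b \<in> J" using cw(2) idl_add[OF J] by simp
      moreover have "[:c:] \<notin> Q" using cw(1) by (auto simp: contr_def)
      ultimately show "b \<in> J" using sat by blast
    qed
  qed
  then show ?thesis using that by blast
qed

text \<open>The elements that become combinations of the \<open>H i\<close> after multiplication by
  some \<open>c\<close> outside \<open>Q\<close> form a saturated ideal containing the generators,
  so the abstract generation property applies to it.\<close>

lemma gens_combination:
  assumes H: "gens H" and b: "b \<in> Q"
  obtains c \<alpha> where "c \<notin> Q" "c * b = (\<Sum>i<3. \<alpha> i * H i)"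
proof -
  define J where "J = {b. \<exists>c \<alpha>. c \<notin> Q \<and> c * b = (\<Sum>i<(3::nat). \<alpha> i * H i)}"
  have one: "1 \<notin> Q" using prime_idl_1[OF prime_Q] .
  have "idl J"
  proof (rule idlI)
    show "0 \<in> J" unfolding J_def using one by (auto intro!: exI[of _ 1] exI[of _ "\<lambda>_. 0"])
    fix x y assume "x \<in> J" "y \<in> J"
    then obtain c \<alpha> c' \<alpha>' where *: "c \<notin> Q" "c * x = (\<Sum>i<(3::nat). \<alpha> i * H i)" "c' \<notin> Q" "c' * y = (\<Sum>i<(3::nat). \<alpha>' i * H i)"
      unfolding J_def by blast
    have "(c * c') * (x + y) = c' * (c * x) + c * (c' * y)" by (simp add: algebra_simps)
    also have "\<dots> = (\<Sum>i<(3::nat). (c' * \<alpha> i + c * \<alpha>' i) * H i)"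
      unfolding *(2) *(4) by (simp add: sum_distrib_left sum.distrib algebra_simps)
    finally show "x + y \<in> J" unfolding J_def using * prime_idl_mult[OF prime_Q]
      by (auto intro!: exI[of _ "c * c'"] exI[of _ "\<lambda>i. c' * \<alpha> i + c * \<alpha>' i"])
  next
    fix r x assume "x \<in> J"
    then obtain c \<alpha> where *: "c \<notin> Q" "c * x = (\<Sum>i<(3::nat). \<alpha> i * H i)" unfolding J_def by blast
    have "c * (r * x) = r * (c * x)" by (simp add: algebra_simps)
    also have "\<dots> = (\<Sum>i<(3::nat). (r * \<alpha> i) * H i)"
      unfolding *(2) by (simp add: sum_distrib_left algebra_simps)
    finally show "r * x \<in> J" unfolding J_def using * by (auto intro!: exI[of _ c] exI[of _ "\<lambda>i. r * \<alpha> i"])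
  qed
  moreover have "b \<in> J" if cb: "c \<notin> Q" "c * b \<in> J" for c b
  proof -
    obtain c' \<alpha> where *: "c' \<notin> Q" "c' * (c * b) = (\<Sum>i<(3::nat). \<alpha> i * H i)" using cb unfolding J_def by blast
    have "c' * c \<notin> Q" "(c' * c) * b = (\<Sum>i<(3::nat). \<alpha> i * H i)"
      using *(1) cb(1) prime_idl_mult[OF prime_Q] *(2) by (auto simp: mult.assoc)
    then show ?thesis unfolding J_def by blast
  qed
  moreover have "H i \<in> J" if i: "i < 3" for i
  proof -
    have "1 * H i = (\<Sum>j<(3::nat). (if j = i then 1 else 0) * H j)"
    proof -
      have "(\<Sum>j<(3::nat). (if j = i then 1 else 0) * H j) = (\<Sum>j<(3::nat). if j = i then H j else 0)"
        by (rule sum.cong) auto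
      then show ?thesis using i by simp
    qed
    then show ?thesis unfolding J_def using one
      by (intro CollectI exI[of _ 1] exI[of _ "\<lambda>j. if j = i then 1 else 0"] conjI)
  qed
  ultimately have "Q \<subseteq> J" using H unfolding gens_def by blast
  then show ?thesis using b that unfolding J_def by blast
qed

text \<open>The Jacobian criterion: in the relation expressing \<open>g\<close> by the generators
  some coefficient is a unit of the local ring. Modulo \<open>g\<close> the corresponding generator
  is redundant, and \<open>height2 (contr Q)\<close> of them suffice.\<close>

lemma M_generators:
  obtains A where "A \<subseteq> \<M>" "finite A" "card A \<le> height2 (contr Q)" "\<And>J. oidl J \<Longrightarrow> A \<subseteq> J \<Longrightarrow> \<M> \<subseteq> J"
proof -
  obtain H where H: "gens H" using ex_gens .
  have gQ: "g \<in> Q" using oprime_pre(2,3)[OF oprime_M] by blast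
  obtain c \<alpha> where c: "c \<notin> Q" "c * g = (\<Sum>i<(3::nat). \<alpha> i * H i)" using gens_combination[OF H gQ] .
  have HQ: "H i \<in> Q" if "i < 3" for i using H that by (simp add: gens_def)
  have DgQ: "D g \<notin> Q" using D by (simp add: Q_def)
  \<comment> \<open>If all relevant coefficients were in \<open>Q\<close>, applying \<open>D\<close>
    to the relation and reducing modulo \<open>Q\<close> would put \<open>c * D g\<close> into
    \<open>Q\<close>.\<close>
  have "\<exists>i<3. \<alpha> i \<notin> Q \<and> H i \<noteq> 0"
  proof (rule ccontr)
    assume no: "\<not> ?thesis"
    have t: "\<alpha> i * D (H i) + H i * D (\<alpha> i) \<in> Q" if i: "i < 3" for i
    proof (rule idl_add[OF idl_Q])
      show "H i * D (\<alpha> i) \<in> Q" using HQ[OF i] idl_mult_r[OF idl_Q] by blast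
      show "\<alpha> i * D (H i) \<in> Q"
      proof (cases "H i = 0")
        case True then show ?thesis using derivn_0[OF D(1)] idl_0[OF idl_Q] by simp
      next
        case False then show ?thesis using no i idl_mult_r[OF idl_Q] by blast
      qed
    qed
    have "D (c * g) = (\<Sum>i<(3::nat). \<alpha> i * D (H i) + H i * D (\<alpha> i))"
      unfolding c(2) by (simp add: derivn_sum[OF D(1)] derivn_mult[OF D(1)])
    also have "\<dots> \<in> Q" using t by (intro idl_sum[OF idl_Q]) simp
    finally have "c * D g + g * D c \<in> Q" by (simp add: derivn_mult[OF D(1)])
    then have "(c * D g + g * D c) - g * D c \<in> Q" using idl_diff[OF idl_Q] idl_mult_r[OF idl_Q gQ] by blast
    then show False using c(1) DgQ prime_idl_mult[OF prime_Q] by auto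
  qed
  then obtain k where k: "k < 3" "\<alpha> k \<notin> Q" "H k \<noteq> 0" by blast
  let ?I = "{i. i < 3 \<and> H i \<noteq> 0} - {k}"
  let ?A = "(\<lambda>i. \<chi> (H i)) ` ?I"
  have fin: "finite ?I" by simp
  have "card ?I = height2 (contr Q)" using H k by (simp add: gens_def)
  then have "card ?A \<le> height2 (contr Q)" using card_image_le[OF fin] by metis
  moreover have "?A \<subseteq> \<M>" using HQ Q_iff by auto
  moreover have "\<M> \<subseteq> J" if J: "oidl J" "?A \<subseteq> J" for J
  proof -
    have Hp: "H i \<in> pre J" if "i < 3" "i \<noteq> k" for i
      using that J oidlD(2)[OF J(1)] by (cases "H i = 0") (auto simp: pre_def rhom_0[OF chi])
    \<comment> \<open>\<open>g\<close> maps to zero and the other generators lie in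
      \<open>pre J\<close>, hence so does \<open>H k\<close> once the unit \<open>\<alpha> k\<close>
      is cancelled.\<close>
    have "\<alpha> k * H k = c * g - (\<Sum>i\<in>{..<3} - {k}. \<alpha> i * H i)"
      unfolding c(2) using k(1) by (simp add: sum.remove[of "{..<3}" k])
    moreover have "c * g \<in> pre J" using ker[of "c * g"] oidlD(2)[OF J(1)] by (simp add: pre_def)
    moreover have "(\<Sum>i\<in>{..<3} - {k}. \<alpha> i * H i) \<in> pre J"
      using Hp idl_mult[OF idl_pre[OF J(1)]] by (intro idl_sum[OF idl_pre[OF J(1)]]) auto
    ultimately have "\<alpha> k * H k \<in> pre J" using idl_diff[OF idl_pre[OF J(1)]] by simp
    then have "H k \<in> pre J" using pre_saturated[OF J(1) k(2)] by blast
    then have "\<forall>i<3. H i \<in> pre J" using Hp by blast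
    moreover have "Q \<subseteq> K" if "idl K" "\<And>c b. c \<notin> Q \<Longrightarrow> c * b \<in> K \<Longrightarrow> b \<in> K" "\<forall>i<3. H i \<in> K" for K
      using H that unfolding gens_def by blast
    ultimately have "Q \<subseteq> pre J" using idl_pre[OF J(1)] pre_saturated[OF J(1)] by blast
    then show ?thesis using oidl_subset_pre[OF oidl_M J(1)] pre_M by simp
  qed
  ultimately show ?thesis using that[of ?A] fin by simp
qed

text \<open>In height two the first generator is a prime \<open>h1\<close> of \<open>F[u]\<close>
  and the second is not divisible by it. A prime containing the image of the first and avoiding that
  of the second lies strictly between zero and \<open>\<M>\<close>.\<close>

lemma middle_prime:
  assumes "height2 (contr Q) = 2"
  obtains P where "oprime P" "{0} \<subset> P" "P \<subset> \<M>"
proof -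
  obtain H where H: "gens H" using ex_gens .
  obtain h1 h2 where h: "H 0 = [:[:h1:]:]" "H 1 = [:h2:]" "prime_elem [:h1:]" "\<not> [:h1:] dvd h2"
    using H assms unfolding gens_def by blast
  have HQ: "H 0 \<in> Q" "H 1 \<in> Q" using H by (auto simp: gens_def)
  have no: "\<chi> (H 1) ^ n \<noteq> \<chi> (H 0) * y" if y: "y \<in> \<O>" for n y
  proof
    assume eq: "\<chi> (H 1) ^ n = \<chi> (H 0) * y"
    obtain b t where bt: "t \<notin> Q" "y * \<chi> t = \<chi> b" using fracE[OF y] by metis
    have "\<chi> (H 1 ^ n * t - H 0 * b) = \<chi> (H 1) ^ n * \<chi> t - \<chi> (H 0) * (y * \<chi> t)"
      by (simp add: rhom_simps[OF chi] bt(2))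
    also have "\<dots> = (\<chi> (H 1) ^ n - \<chi> (H 0) * y) * \<chi> t" by (simp only: algebra_simps)
    also have "\<dots> = 0" unfolding eq by simp
    finally have gd: "g dvd H 1 ^ n * t - H 0 * b" by (simp add: ker)
    \<comment> \<open>Reduction modulo the monic \<open>g\<close> turns divisibility by
      \<open>g\<close> into an equality of polynomials of smaller degree, which can be compared
      coefficient by coefficient.\<close>
    obtain w t' where t': "t = g * w + t'" "t' = 0 \<or> degree t' < degree g" using monic_division[OF monic(1)] .
    obtain w' b' where b': "b = g * w' + b'" "b' = 0 \<or> degree b' < degree g" using monic_division[OF monic(1)] .
    have H1n: "H 1 ^ n = [:h2 ^ n:]" by (simp only: h(2) rhom_power[OF rhom_const_poly])
    have "smult (h2 ^ n) t' - smult [:h1:] b' = (H 1 ^ n * t - H 0 * b) - g * (H 1 ^ n * w - H 0 * w')"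
      by (simp add: t'(1) b'(1) H1n h(1) smult_add_right algebra_simps del: One_nat_def)
    then have gd': "g dvd smult (h2 ^ n) t' - smult [:h1:] b'" using gd by simp
    have "degree (smult (h2 ^ n) t' - smult [:h1:] b') < degree g"
    proof (rule degree_diff_less)
      have "degree t' < degree g" "degree b' < degree g" using t'(2) b'(2) monic(2) by auto
      then show "degree (smult (h2 ^ n) t') < degree g" "degree (smult [:h1:] b') < degree g"
        using degree_smult_le le_less_trans by blast+
    qed
    then have z: "smult (h2 ^ n) t' - smult [:h1:] b' = 0"
      using dvd_imp_degree_le[OF gd'] by (meson not_le)
    \<comment> \<open>The prime \<open>h1\<close> does not divide \<open>h2\<close>, so it divides
      every coefficient of \<open>t'\<close>; this will put the denominator \<open>t\<close> into
      \<open>Q\<close>.\<close>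
    have "[:h1:] dvd coeff t' i" for i
    proof -
      have "coeff (smult (h2 ^ n) t') i = coeff (smult [:h1:] b') i" using z by simp
      then have "h2 ^ n * coeff t' i = [:h1:] * coeff b' i" by (simp only: coeff_smult)
      then have "[:h1:] dvd h2 ^ n * coeff t' i" by (simp only: dvd_triv_left)
      then show ?thesis using h(3,4) by (metis prime_elem_dvd_mult_iff prime_elem_dvd_power)
    qed
    then have hd: "[:h1:] dvd coeff t' i" for i .
    have hq: "[:h1:] \<in> contr Q" using HQ(1) h(1) by (simp add: contr_def)
    have "coeff t' i \<in> contr Q" for i
    proof -
      obtain v where "coeff t' i = [:h1:] * v" using hd by (rule dvdE)
      then show ?thesis using idl_mult_r[OF prime_idl_idl[OF prime_contr[OF prime_Q]] hq] by simp
    qed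
    then have "t' \<in> extd (contr Q)" by (simp add: extd_def)
    then have "t' \<in> Q" using extd_contr_subset[OF idl_Q] by blast
    moreover have "g \<in> Q" using oprime_pre(2,3)[OF oprime_M] by blast
    ultimately have "t \<in> Q" using t'(1) idl_add[OF idl_Q] idl_mult_r[OF idl_Q] by simp
    then show False using bt(1) by blast
  qed
  obtain P where P: "oprime P" "\<chi> (H 0) \<in> P" "\<chi> (H 1) \<notin> P"
    using exists_oprime_avoiding[OF chi_mem chi_mem no] by metis
  have "\<chi> (H 0) \<noteq> 0" using chi_const_inj[of "[:h1:]"] h(1,3) by auto
  then have "{0} \<subset> P" using P(1,2) oidlD(2) unfolding oprime_def by blast
  moreover have "P \<subset> \<M>" using P proper_oidl_subset_M HQ(2) Q_iff unfolding oprime_def by blast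
  ultimately show ?thesis using that P(1) by blast
qed

lemma oprime_chain_krull:
  assumes P: "\<And>i. i \<le> n \<Longrightarrow> oprime (P i)" "\<And>i. i < n \<Longrightarrow> P i \<subset> P (Suc i)"
  shows "enat n \<le> krull_dim R"
proof -
  let ?P = "\<lambda>i. {x \<in> carrier R. \<epsilon> x \<in> P i}"
  have "?P i \<subset> ?P (Suc i)" if i: "i < n" for i
  proof -
    obtain y where y: "y \<in> P (Suc i)" "y \<notin> P i" using P(2)[OF i] by blast
    have "oidl (P (Suc i))" using P(1)[of "Suc i"] i by (simp add: oprime_def)
    then have "y \<in> \<O>" using y(1) oidlD(1) by blast
    then obtain x where "x \<in> carrier R" "y = \<epsilon> x" by (rule O_E)
    then have "x \<in> ?P (Suc i)" "x \<notin> ?P i" using y by simp_all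
    moreover have "?P i \<subseteq> ?P (Suc i)" using P(2)[OF i] by blast
    ultimately show ?thesis by blast
  qed
  then have "enat n \<in> {enat n | n. \<exists>P. (\<forall>i\<le>n. primeideal (P i) R) \<and> (\<forall>i<n. P i \<subset> P (Suc i))}"
    using P(1) oprime_prime by (intro CollectI exI[of _ n] exI[of _ ?P] conjI) auto
  then show ?thesis unfolding krull_dim_def by (rule Sup_upper)
qed

lemma height2_le: "height2 (p :: 'a poly poly set) \<le> 2"
  by (simp add: height2_def)

lemma M_nonzero: assumes "height2 (contr Q) \<noteq> 0" shows "{0} \<subset> \<M>"
proof -
  have "\<exists>b\<in>contr Q. b \<noteq> 0"
  proof (rule ccontr)
    assume no: "\<not> ?thesis"
    then have "contr Q \<subseteq> {0}" by blast
    then have "contr (contr Q) \<subseteq> {0}" "contr Q \<subseteq> extd (contr (contr Q))"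
      using idl_0[OF prime_idl_idl[OF prime_contr[OF prime_contr[OF prime_Q]]]]
      by (auto simp: contr_def extd_def)
    then show False using assms by (simp add: height2_def)
  qed
  then obtain b where "[:b:] \<in> Q" "b \<noteq> 0" by (auto simp: contr_def)
  then have "\<chi> [:b:] \<in> \<M>" "\<chi> [:b:] \<noteq> 0" using Q_iff chi_const_inj by blast+
  then show ?thesis using oidlD(2)[OF oidl_M] by blast
qed

lemma krull_dim_eq: "krull_dim R = enat (height2 (contr Q))"
proof (rule antisym)
  show "krull_dim R \<le> enat (height2 (contr Q))"
    unfolding krull_dim_def
  proof (rule Sup_least, clarsimp)
    fix n and P :: "nat \<Rightarrow> 'r set"
    assume P: "\<forall>i\<le>n. primeideal (P i) R" "\<forall>i<n. P i \<subset> P (Suc i)"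
    have op: "oprime (\<epsilon> ` P i)" if "i \<le> n" for i using prime_oprime P(1) that by blast
    have st: "\<epsilon> ` P i \<subset> \<epsilon> ` P (Suc i)" if "i < n" for i
    proof -
      have s: "P i \<subset> P (Suc i)" and I: "primeideal (P i) R" "primeideal (P (Suc i)) R" using P that by auto
      obtain x where x: "x \<in> P (Suc i)" "x \<notin> P i" using s by blast
      then have "\<epsilon> x \<notin> \<epsilon> ` P i"
        using ideal_image_mem[of "P i" x] I primeideal_proper_subset by (auto simp: primeideal_def)
      then show ?thesis using s x by blast
    qed
    show "n \<le> height2 (contr Q)" 
      by (rule chain_bound[of n "\<lambda>i. \<epsilon> ` P i"]) (rule op st, assumption)+
  qed
  consider "height2 (contr Q) = 0" | "height2 (contr Q) = 1" | "height2 (contr Q) = 2"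
    using height2_le[of "contr Q"] by linarith
  then show "enat (height2 (contr Q)) \<le> krull_dim R"
  proof cases
    case 1
    then show ?thesis using oprime_chain_krull[of 0 "\<lambda>_. {0}"] zero_oprime by simp
  next
    case 2
    then have "{0} \<subset> \<M>" using M_nonzero by simp
    then have "enat 1 \<le> krull_dim R"
      by (intro oprime_chain_krull[of 1 "\<lambda>i. if i = 0 then {0} else \<M>"]) (use zero_oprime oprime_M in auto)
    then show ?thesis using 2 by simp
  next
    case 3
    obtain P where P: "oprime P" "{0} \<subset> P" "P \<subset> \<M>" using middle_prime[OF 3] .
    have "enat 2 \<le> krull_dim R"
      by (intro oprime_chain_krull[of 2 "\<lambda>i. if i = 0 then {0} else if i = 1 then P else \<M>"])
        (use zero_oprime oprime_M P in \<open>auto simp: less_Suc_eq numeral_2_eq_2\<close>)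
    then show ?thesis using 3 by simp
  qed
qed

text \<open>Used to pad generating sets. The powers of a nonzero nonunit are distinct, as a
  coincidence would make one of them equal to one.\<close>

lemma infinite_M: assumes "{0} \<subset> \<M>" shows "infinite \<M>"
proof
  assume fin: "finite \<M>"
  obtain x where x: "x \<in> \<M>" "x \<noteq> 0" using assms by blast
  have xO: "x \<in> \<O>" using x oidlD(1)[OF oidl_M] by blast
  have mem: "x ^ Suc n \<in> \<M>" for n
    using oidlD(5)[OF oidl_M x(1) O_power[OF xO]] by simp
  have "inj (\<lambda>n. x ^ Suc n)"
  proof (rule linorder_injI)
    fix m n :: nat assume mn: "m < n"
    show "x ^ Suc m \<noteq> x ^ Suc n"
    proof
      assume "x ^ Suc m = x ^ Suc n"
      also have "\<dots> = x ^ Suc m * x ^ Suc (n - Suc m)" using mn by (simp flip: power_add power_Suc)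
      finally have "x ^ Suc (n - Suc m) = 1" using x(2) by simp
      then show False using mem[of "n - Suc m"] one_notin_M by simp
    qed
  qed
  moreover have "range (\<lambda>n. x ^ Suc n) \<subseteq> \<M>" using mem by blast
  ultimately show False using fin by (meson finite_imageD finite_subset infinite_UNIV_nat)
qed

theorem regular_local_ring_embedded: "regular_local_ring R"
proof -
  let ?d = "height2 (contr Q)"
  let ?M = "{x \<in> carrier R. \<epsilon> x \<in> \<M>}"
  obtain A where A: "A \<subseteq> \<M>" "finite A" "card A \<le> ?d" "\<And>J. oidl J \<Longrightarrow> A \<subseteq> J \<Longrightarrow> \<M> \<subseteq> J"
    using M_generators by blast
  \<comment> \<open>Regularity asks for a generating set of exactly \<open>krull_dim R\<close>
    elements, while \<open>A\<close> may be smaller; further elements of \<open>\<M>\<close> fill it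
    up.\<close>
  obtain B where B: "A \<subseteq> B" "B \<subseteq> \<M>" "finite B" "card B = ?d"
  proof (cases "?d = 0")
    case True
    then show ?thesis using that[of A] A by simp
  next
    case False
    then have "infinite (\<M> - A)" using infinite_M M_nonzero A(2) by simp
    then obtain C where C: "finite C" "card C = ?d - card A" "C \<subseteq> \<M> - A"
      using infinite_arbitrarily_large by metis
    then have "card (A \<union> C) = ?d" using A(2,3) by (subst card_Un_disjoint) auto
    then show ?thesis using that[of "A \<union> C"] A(1,2) C by blast
  qed
  let ?B = "{x \<in> carrier R. \<epsilon> x \<in> B}"
  have MO: "\<M> \<subseteq> \<O>" using oidlD(1)[OF oidl_M] .
  have eB: "\<epsilon> ` ?B = B"
  proof
    show "B \<subseteq> \<epsilon> ` ?B"
    proof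
      fix y assume y: "y \<in> B"
      then have "y \<in> \<O>" using B(2) MO by blast
      then obtain x where "x \<in> carrier R" "y = \<epsilon> x" by (rule O_E)
      then show "y \<in> \<epsilon> ` ?B" using y by simp
    qed
  qed auto
  have inj: "inj_on \<epsilon> ?B" using emb_inj by (rule inj_on_subset) auto
  have "finite ?B" "card ?B = ?d" using eB inj B(3,4) by (metis finite_imageD) (metis card_image eB inj B(4))
  moreover have "genideal R ?B = ?M"
    by (rule genideal_oidl) (use oidl_M eB A B in auto)
  ultimately have "\<exists>A\<subseteq>carrier R. finite A \<and> enat (card A) = krull_dim R \<and> genideal R A = ?M"
    using krull_dim_eq by (intro exI[of _ ?B]) auto
  then show ?thesis unfolding regular_local_ring_def
    using cring_embedded noetherian_embedded maximal_iff by blast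
qed

end

section \<open>Homogeneous spectra of graded domains embedded in a field\<close>

text \<open>A graded domain embedded in a field. Quotients of elements of equal degree then live in
  that field, so local rings and rings of sections become subsets of it. The assumption
  \<open>irrelevant\<close> makes the zero ideal a point.\<close>

locale proj_model =
  fixes R :: "('a, 'k) graded_algebra" (structure) and emb :: "'a \<Rightarrow> 'g::field" and ct :: "'k \<Rightarrow> 'g"
  assumes cring_R: "cring R"
    and inj: "inj_on emb (carrier R)"
    and em_mult: "x \<in> carrier R \<Longrightarrow> y \<in> carrier R \<Longrightarrow> emb (x \<otimes> y) = emb x * emb y"
    and em_add: "x \<in> carrier R \<Longrightarrow> y \<in> carrier R \<Longrightarrow> emb (x \<oplus> y) = emb x + emb y"
    and em_one: "emb \<one> = 1"
    and hpart_sub: "hpart R n \<subseteq> carrier R"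
    and hpart_zero: "\<zero> \<in> hpart R n"
    and hpart_add: "a \<in> hpart R n \<Longrightarrow> b \<in> hpart R n \<Longrightarrow> a \<oplus> b \<in> hpart R n"
    and hpart_neg: "a \<in> hpart R n \<Longrightarrow> \<ominus> a \<in> hpart R n"
    and hpart_mult: "a \<in> hpart R m \<Longrightarrow> b \<in> hpart R n \<Longrightarrow> a \<otimes> b \<in> hpart R (m + n)"
    and hpart_one: "\<one> \<in> hpart R 0"
    and irrelevant: "\<exists>n>0. \<exists>a\<in>hpart R n. a \<noteq> \<zero>"
    and algmap_mem: "algmap R c \<in> hpart R 0"
    and em_algmap: "emb (algmap R c) = ct c"
begin

sublocale cring R by (rule cring_R)

lemma hc [simp]: "a \<in> hpart R n \<Longrightarrow> a \<in> carrier R"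
  using hpart_sub by blast

lemma em_zero [simp]: "emb \<zero> = 0"
proof -
  have "emb \<zero> + emb \<zero> = emb \<zero> + 0" using em_add[of \<zero> \<zero>] by simp
  then show ?thesis by (rule add_left_imp_eq)
qed

lemma em_eq: "x \<in> carrier R \<Longrightarrow> y \<in> carrier R \<Longrightarrow> emb x = emb y \<longleftrightarrow> x = y"
  using inj by (auto dest: inj_onD)

lemma em_eq_0: "x \<in> carrier R \<Longrightarrow> emb x = 0 \<longleftrightarrow> x = \<zero>"
  using em_eq[of x \<zero>] by simp

lemma em_neg: "x \<in> carrier R \<Longrightarrow> emb (\<ominus> x) = - emb x"
  using em_add[of "\<ominus> x" x] by (simp add: l_neg eq_neg_iff_add_eq_0)

lemma em_minus: "x \<in> carrier R \<Longrightarrow> y \<in> carrier R \<Longrightarrow> emb (x \<ominus> y) = emb x - emb y"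
  by (simp add: a_minus_def em_add em_neg)

lemma integral_emb: "x \<in> carrier R \<Longrightarrow> y \<in> carrier R \<Longrightarrow> x \<otimes> y = \<zero> \<Longrightarrow> x = \<zero> \<or> y = \<zero>"
  using em_mult[of x y] em_eq_0 by auto

lemma homogeneous_carrier: "h \<in> homogeneous R \<Longrightarrow> h \<in> carrier R"
  by (auto simp: homogeneous_def)

abbreviation "pts \<equiv> proj_points R"

lemma pts_prime: "p \<in> pts \<Longrightarrow> primeideal p R"
  by (simp add: proj_points_def)

lemma pts_mult:
  assumes "p \<in> pts" "x \<in> carrier R" "y \<in> carrier R"
  shows "x \<otimes> y \<in> p \<longleftrightarrow> x \<in> p \<or> y \<in> p"
proof -
  interpret primeideal p R by (rule pts_prime[OF assms(1)])
  show ?thesis using assms I_prime I_l_closed I_r_closed by blast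
qed

lemma pts_zero: assumes "p \<in> pts" shows "\<zero> \<in> p"
proof -
  interpret primeideal p R by (rule pts_prime[OF assms])
  show ?thesis by simp
qed

lemma pts_one: assumes "p \<in> pts" shows "\<one> \<notin> p"
proof -
  interpret primeideal p R by (rule pts_prime[OF assms])
  show ?thesis using one_imp_carrier I_notcarr by blast
qed

lemma pts_carrier: "p \<in> pts \<Longrightarrow> p \<subseteq> carrier R"
  using primeideal_proper_subset pts_prime by blast

lemma pts_add: assumes "p \<in> pts" "x \<in> p" "y \<in> p" shows "x \<oplus> y \<in> p" "\<ominus> x \<in> p" "x \<ominus> y \<in> p"
proof -
  interpret primeideal p R by (rule pts_prime[OF assms(1)])
  show "x \<oplus> y \<in> p" "\<ominus> x \<in> p" "x \<ominus> y \<in> p" using assms by (simp_all add: a_minus_def)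
qed

lemma notin_pt_emb: "p \<in> pts \<Longrightarrow> s \<in> carrier R \<Longrightarrow> s \<notin> p \<Longrightarrow> emb s \<noteq> 0"
  using pts_zero em_eq_0 by metis

definition Dp :: "'a \<Rightarrow> 'a set set" where "Dp h = {p \<in> pts. h \<notin> p}"

text \<open>Homogeneous elements are closed under products, so the sets \<open>Dp h\<close> are
  stable under intersection: the generating sets form a basis, not merely a subbasis.\<close>

lemma openin_proj_iff:
  "openin (proj_top R) U \<longleftrightarrow> U \<subseteq> pts \<and> (\<forall>p\<in>U. \<exists>h\<in>homogeneous R. h \<notin> p \<and> Dp h \<subseteq> U)"
proof
  assume "openin (proj_top R) U"
  then have "generate_topology_on {{p \<in> pts. h \<notin> p} | h. h \<in> homogeneous R} U"
    by (simp add: proj_top_def openin_topology_generated_by_iff)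
  then show "U \<subseteq> pts \<and> (\<forall>p\<in>U. \<exists>h\<in>homogeneous R. h \<notin> p \<and> Dp h \<subseteq> U)"
  proof induction
    case (Int a b)
    show ?case
    proof (intro conjI ballI)
      show "a \<inter> b \<subseteq> pts" using Int by blast
      fix p assume p: "p \<in> a \<inter> b"
      obtain g where g: "g \<in> homogeneous R" "g \<notin> p" "Dp g \<subseteq> a" using Int.IH(1) p by auto
      obtain h where h: "h \<in> homogeneous R" "h \<notin> p" "Dp h \<subseteq> b" using Int.IH(2) p by auto
      have pp: "p \<in> pts" using Int p by blast
      have gh: "g \<otimes> h \<in> homogeneous R" using g(1) h(1) hpart_mult unfolding homogeneous_def by blast
      have "Dp (g \<otimes> h) \<subseteq> a \<inter> b"
        using g h pts_mult[of _ g h] homogeneous_carrier unfolding Dp_def by auto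
      moreover have "g \<otimes> h \<notin> p" using g h pts_mult[OF pp, of g h] homogeneous_carrier by simp
      ultimately show "\<exists>h\<in>homogeneous R. h \<notin> p \<and> Dp h \<subseteq> a \<inter> b" using gh by blast
    qed
  next
    case (UN K) then show ?case by (meson Union_iff Union_least Sup_upper subset_trans)
  next
    case (Basis s) then show ?case unfolding Dp_def by blast
  qed simp
next
  assume *: "U \<subseteq> pts \<and> (\<forall>p\<in>U. \<exists>h\<in>homogeneous R. h \<notin> p \<and> Dp h \<subseteq> U)"
  let ?K = "{Dp h | h. h \<in> homogeneous R \<and> Dp h \<subseteq> U}"
  have "U = \<Union>?K"
  proof
    show "U \<subseteq> \<Union>?K"
    proof
      fix p assume p: "p \<in> U"
      obtain h where "h \<in> homogeneous R" "h \<notin> p" "Dp h \<subseteq> U" using * p by blast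
      moreover have "p \<in> Dp h" using * p \<open>h \<notin> p\<close> by (auto simp: Dp_def)
      ultimately show "p \<in> \<Union>?K" by blast
    qed
  qed blast
  moreover have "openin (proj_top R) (\<Union>?K)"
  proof (rule openin_Union)
    fix S assume "S \<in> ?K"
    then show "openin (proj_top R) S"
      unfolding proj_top_def Dp_def openin_topology_generated_by_iff
      by (auto intro!: generate_topology_on.Basis)
  qed
  ultimately show "openin (proj_top R) U" by simp
qed

lemma homogeneous_one: "\<one> \<in> homogeneous R"
  using hpart_one by (auto simp: homogeneous_def)

lemma Dp_subset: "Dp h \<subseteq> pts"
  by (auto simp: Dp_def)

lemma Dp_iff: "p \<in> Dp h \<longleftrightarrow> p \<in> pts \<and> h \<notin> p"
  by (simp add: Dp_def)

lemma openin_Dp: "h \<in> homogeneous R \<Longrightarrow> openin (proj_top R) (Dp h)"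
  unfolding openin_proj_iff by (auto simp: Dp_def)

lemma openin_pts: "openin (proj_top R) pts"
  unfolding openin_proj_iff using homogeneous_one pts_one Dp_subset by blast

lemma topspace_proj: "topspace (proj_top R) = pts"
  using openin_pts openin_proj_iff by (metis openin_topspace openin_subset subset_antisym)

section \<open>Generic point, local rings and sections\<close>

definition \<eta> :: "'a set" where "\<eta> = {\<zero>}"

lemma eta_pts: "\<eta> \<in> pts"
proof -
  have "\<one> \<noteq> \<zero>" using em_one em_zero by (metis zero_neq_one)
  then have "primeideal \<eta> R" unfolding \<eta>_def
    using integral_emb by (intro primeidealI zeroideal cring_R) auto
  moreover have "\<eta> \<inter> homogeneous R = {\<zero>}" using hpart_zero by (auto simp: \<eta>_def homogeneous_def)
  then have "\<eta> = genideal R (\<eta> \<inter> homogeneous R)" by (simp add: \<eta>_def genideal_zero)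
  moreover have "\<not> (\<Union>n\<in>{0<..}. hpart R n) \<subseteq> \<eta>" using irrelevant by (auto simp: \<eta>_def)
  ultimately show ?thesis unfolding proj_points_def by blast
qed

lemma eta_Dp: "h \<noteq> \<zero> \<Longrightarrow> \<eta> \<in> Dp h"
  by (simp add: Dp_iff eta_pts) (simp add: \<eta>_def)

lemma eta_open: assumes U: "openin (proj_top R) U" "U \<noteq> {}" shows "\<eta> \<in> U"
proof -
  obtain p where p: "p \<in> U" using U by blast
  then obtain h where h: "h \<notin> p" "Dp h \<subseteq> U" and pp: "p \<in> pts" using U(1) unfolding openin_proj_iff by blast
  then have "h \<noteq> \<zero>" using pts_zero by blast
  then show ?thesis using eta_Dp h(2) by blast
qed

definition Oc :: "'a set \<Rightarrow> 'g set" where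
  "Oc p = {emb a / emb s | a s n. a \<in> hpart R n \<and> s \<in> hpart R n \<and> s \<notin> p}"

text \<open>The equivalence class of all fractions with value \<open>x\<close>; it is what
  \<open>hfrac\<close> becomes once fractions are evaluated in the field.\<close>

definition fr :: "'a set \<Rightarrow> 'g \<Rightarrow> ('a \<times> 'a) set" where
  "fr p x = {(b, t). (\<exists>n. b \<in> hpart R n \<and> t \<in> hpart R n) \<and> t \<notin> p \<and> emb b / emb t = x}"

lemma Oc_I: "a \<in> hpart R n \<Longrightarrow> s \<in> hpart R n \<Longrightarrow> s \<notin> p \<Longrightarrow> emb a / emb s \<in> Oc p"
  unfolding Oc_def by blast

lemma Oc_E: assumes "x \<in> Oc p"
  obtains a s n where "a \<in> hpart R n" "s \<in> hpart R n" "s \<notin> p" "x = emb a / emb s"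
  using assms unfolding Oc_def by blast

text \<open>In a domain the multiplier \<open>u\<close> of the definition of \<open>hfrac\<close>
  cancels, so equivalence of fractions is equality of values.\<close>

lemma hfrac_eq:
  assumes p: "p \<in> pts" and a: "a \<in> hpart R n" "s \<in> hpart R n" "s \<notin> p"
  shows "hfrac R p a s = fr p (emb a / emb s)"
proof -
  have "(\<exists>u\<in>homogeneous R - p. u \<otimes> (a \<otimes> t \<ominus> b \<otimes> s) = \<zero>) \<longleftrightarrow> emb b / emb t = emb a / emb s"
    if t: "b \<in> hpart R m" "t \<in> hpart R m" "t \<notin> p" for b t m
  proof -
    have n0: "emb s \<noteq> 0" "emb t \<noteq> 0" using notin_pt_emb p a t hc by metis+
    have "(\<exists>u\<in>homogeneous R - p. u \<otimes> (a \<otimes> t \<ominus> b \<otimes> s) = \<zero>) \<longleftrightarrow> a \<otimes> t \<ominus> b \<otimes> s = \<zero>"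
    proof
      assume "\<exists>u\<in>homogeneous R - p. u \<otimes> (a \<otimes> t \<ominus> b \<otimes> s) = \<zero>"
      then obtain u where "u \<in> homogeneous R" "u \<notin> p" "u \<otimes> (a \<otimes> t \<ominus> b \<otimes> s) = \<zero>" by blast
      moreover have "u \<noteq> \<zero>" using \<open>u \<notin> p\<close> pts_zero[OF p] by blast
      ultimately show "a \<otimes> t \<ominus> b \<otimes> s = \<zero>"
        using integral_emb[of u "a \<otimes> t \<ominus> b \<otimes> s"] homogeneous_carrier a t by (simp add: minus_closed)
    next
      assume "a \<otimes> t \<ominus> b \<otimes> s = \<zero>"
      then show "\<exists>u\<in>homogeneous R - p. u \<otimes> (a \<otimes> t \<ominus> b \<otimes> s) = \<zero>"
        using homogeneous_one pts_one[OF p] by (intro bexI[of _ \<one>]) auto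
    qed
    also have "\<dots> \<longleftrightarrow> emb (a \<otimes> t \<ominus> b \<otimes> s) = 0" using a t by (intro em_eq_0[symmetric]) (simp add: minus_closed)
    also have "\<dots> \<longleftrightarrow> emb a * emb t = emb b * emb s" using a t by (simp add: em_minus em_mult)
    also have "\<dots> \<longleftrightarrow> emb b / emb t = emb a / emb s" using n0 by (auto simp: field_simps)
    finally show ?thesis .
  qed
  then show ?thesis unfolding hfrac_def fr_def by (intro Collect_cong) blast
qed

lemma fr_nonempty: "x \<in> Oc p \<Longrightarrow> fr p x \<noteq> {}"
  unfolding Oc_def fr_def by blast

lemma fr_inj: "x \<in> Oc p \<Longrightarrow> fr p x = fr p y \<Longrightarrow> x = y"
  using fr_nonempty unfolding fr_def by fastforce

lemma Oc_simps:
  assumes p: "p \<in> pts"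
  shows "0 \<in> Oc p" "1 \<in> Oc p" "ct c \<in> Oc p" "x \<in> Oc p \<Longrightarrow> y \<in> Oc p \<Longrightarrow> x + y \<in> Oc p"
    "x \<in> Oc p \<Longrightarrow> y \<in> Oc p \<Longrightarrow> x * y \<in> Oc p" "x \<in> Oc p \<Longrightarrow> - x \<in> Oc p"
proof -
  show "0 \<in> Oc p" using Oc_I[OF hpart_zero hpart_one pts_one[OF p]] by simp
  show "1 \<in> Oc p" using Oc_I[OF hpart_one hpart_one pts_one[OF p]] by (simp add: em_one)
  show "ct c \<in> Oc p" using Oc_I[OF algmap_mem[of c] hpart_one pts_one[OF p]] by (simp add: em_one em_algmap)
  show "x + y \<in> Oc p" if xy: "x \<in> Oc p" "y \<in> Oc p"
  proof -
    obtain a s n where 1: "a \<in> hpart R n" "s \<in> hpart R n" "s \<notin> p" "x = emb a / emb s" using xy(1) by (rule Oc_E)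
    obtain b t m where 2: "b \<in> hpart R m" "t \<in> hpart R m" "t \<notin> p" "y = emb b / emb t" using xy(2) by (rule Oc_E)
    have "emb s \<noteq> 0" "emb t \<noteq> 0" using notin_pt_emb p 1 2 hc by metis+
    then have "x + y = emb (a \<otimes> t \<oplus> b \<otimes> s) / emb (s \<otimes> t)"
      using 1 2 by (simp add: em_add em_mult field_simps)
    moreover have "a \<otimes> t \<oplus> b \<otimes> s \<in> hpart R (n + m)" "s \<otimes> t \<in> hpart R (n + m)"
      using hpart_mult[OF 1(1) 2(2)] hpart_mult[OF 2(1) 1(2)] hpart_mult[OF 1(2) 2(2)] hpart_add
      by (simp_all add: add.commute)
    moreover have "s \<otimes> t \<notin> p" using pts_mult[OF p] 1 2 by simp
    ultimately show ?thesis using Oc_I by metis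
  qed
  show "x * y \<in> Oc p" if xy: "x \<in> Oc p" "y \<in> Oc p"
  proof -
    obtain a s n where 1: "a \<in> hpart R n" "s \<in> hpart R n" "s \<notin> p" "x = emb a / emb s" using xy(1) by (rule Oc_E)
    obtain b t m where 2: "b \<in> hpart R m" "t \<in> hpart R m" "t \<notin> p" "y = emb b / emb t" using xy(2) by (rule Oc_E)
    have "x * y = emb (a \<otimes> b) / emb (s \<otimes> t)" using 1 2 by (simp add: em_mult)
    moreover have "a \<otimes> b \<in> hpart R (n + m)" "s \<otimes> t \<in> hpart R (n + m)" using 1 2 hpart_mult by auto
    moreover have "s \<otimes> t \<notin> p" using pts_mult[OF p] 1 2 by simp
    ultimately show ?thesis using Oc_I by metis
  qed
  show "- x \<in> Oc p" if x: "x \<in> Oc p"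
  proof -
    obtain a s n where 1: "a \<in> hpart R n" "s \<in> hpart R n" "s \<notin> p" "x = emb a / emb s" using x by (rule Oc_E)
    have "- x = emb (\<ominus> a) / emb s" using 1 by (simp add: em_neg)
    then show ?thesis using Oc_I[OF hpart_neg[OF 1(1)] 1(2,3)] by simp
  qed
qed

text \<open>Operations on classes are defined as unions over all representatives; such a union
  collapses because every pair of representatives yields the same class.\<close>

lemma UN_const_eq: "A \<noteq> {} \<Longrightarrow> B \<noteq> {} \<Longrightarrow> (\<And>a b. a \<in> A \<Longrightarrow> b \<in> B \<Longrightarrow> f a b = c) \<Longrightarrow> (\<Union>a\<in>A. \<Union>b\<in>B. f a b) = c"
  by auto

lemma hloc_ops:
  assumes p: "p \<in> pts" and x: "x \<in> Oc p" and y: "y \<in> Oc p"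
  shows "fr p x \<otimes>\<^bsub>hlocalization R p\<^esub> fr p y = fr p (x * y)"
    and "fr p x \<oplus>\<^bsub>hlocalization R p\<^esub> fr p y = fr p (x + y)"
proof -
  have e: "(case a of (a, s) \<Rightarrow> \<Union>(b, t)\<in>B. f a s b t) = (\<Union>bt\<in>B. f (fst a) (snd a) (fst bt) (snd bt))"
    for a and B and f :: "'a \<Rightarrow> 'a \<Rightarrow> 'a \<Rightarrow> 'a \<Rightarrow> ('a \<times> 'a) set"
    by (simp add: case_prod_beta)
  have *: "hfrac R p (fst a \<otimes> fst b) (snd a \<otimes> snd b) = fr p (x * y)"
    "hfrac R p (fst a \<otimes> snd b \<oplus> fst b \<otimes> snd a) (snd a \<otimes> snd b) = fr p (x + y)"
    if ab: "a \<in> fr p x" "b \<in> fr p y" for a b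
  proof -
    obtain n where 1: "fst a \<in> hpart R n" "snd a \<in> hpart R n" "snd a \<notin> p" "emb (fst a) / emb (snd a) = x"
      using ab(1) by (auto simp: fr_def)
    obtain m where 2: "fst b \<in> hpart R m" "snd b \<in> hpart R m" "snd b \<notin> p" "emb (fst b) / emb (snd b) = y"
      using ab(2) by (auto simp: fr_def)
    have n0: "emb (snd a) \<noteq> 0" "emb (snd b) \<noteq> 0" using notin_pt_emb p 1 2 hc by metis+
    have s: "snd a \<otimes> snd b \<in> hpart R (n + m)" "snd a \<otimes> snd b \<notin> p"
      using 1 2 hpart_mult pts_mult[OF p] by auto
    have "fst a \<otimes> fst b \<in> hpart R (n + m)" using 1 2 hpart_mult by auto
    from hfrac_eq[OF p this s] show "hfrac R p (fst a \<otimes> fst b) (snd a \<otimes> snd b) = fr p (x * y)"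
      using 1 2 by (simp add: em_mult flip: 1(4) 2(4))
    have "fst a \<otimes> snd b \<oplus> fst b \<otimes> snd a \<in> hpart R (n + m)"
      using 1 2 hpart_mult[of "fst a" n "snd b" m] hpart_mult[of "fst b" m "snd a" n] hpart_add by (simp add: add.commute)
    from hfrac_eq[OF p this s]
    show "hfrac R p (fst a \<otimes> snd b \<oplus> fst b \<otimes> snd a) (snd a \<otimes> snd b) = fr p (x + y)"
      using 1 2 n0 by (simp add: em_mult em_add field_simps flip: 1(4) 2(4))
  qed
  show "fr p x \<otimes>\<^bsub>hlocalization R p\<^esub> fr p y = fr p (x * y)"
    unfolding hlocalization_def by (simp add: case_prod_beta) (intro UN_const_eq fr_nonempty x y *(1))
  show "fr p x \<oplus>\<^bsub>hlocalization R p\<^esub> fr p y = fr p (x + y)"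
    unfolding hlocalization_def by (simp add: case_prod_beta) (intro UN_const_eq fr_nonempty x y *(2))
qed

lemma hloc_one: "p \<in> pts \<Longrightarrow> \<one>\<^bsub>hlocalization R p\<^esub> = fr p 1"
  using hfrac_eq[OF _ hpart_one hpart_one] pts_one by (simp add: hlocalization_def em_one)

lemma hloc_zero: "p \<in> pts \<Longrightarrow> \<zero>\<^bsub>hlocalization R p\<^esub> = fr p 0"
  using hfrac_eq[OF _ hpart_zero hpart_one] pts_one by (simp add: hlocalization_def em_one)

definition sec :: "'a set set \<Rightarrow> 'g \<Rightarrow> 'a set \<Rightarrow> ('a \<times> 'a) set" where
  "sec U x = (\<lambda>p\<in>U. fr p x)"

definition OU :: "'a set set \<Rightarrow> 'g set" where
  "OU U = {x. \<forall>p\<in>U. x \<in> Oc p}"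

lemma OU_mono: "V \<subseteq> U \<Longrightarrow> x \<in> OU U \<Longrightarrow> x \<in> OU V"
  by (auto simp: OU_def)

lemma OU_simps:
  assumes U: "U \<subseteq> pts"
  shows "0 \<in> OU U" "1 \<in> OU U" "ct c \<in> OU U" "x \<in> OU U \<Longrightarrow> y \<in> OU U \<Longrightarrow> x + y \<in> OU U"
    "x \<in> OU U \<Longrightarrow> y \<in> OU U \<Longrightarrow> x * y \<in> OU U" "x \<in> OU U \<Longrightarrow> - x \<in> OU U"
  using U Oc_simps unfolding OU_def by blast+

lemma restrict_sec: "V \<subseteq> U \<Longrightarrow> restrict (sec U x) V = sec V x"
  by (auto simp: sec_def restrict_def fun_eq_iff)

text \<open>All local fractions of a section can be compared at the generic point, which lies in
  every nonempty open set. Hence a section is one field element that is regular at all points of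
  \<open>U\<close>.\<close>

lemma sections_carrier:
  assumes U: "openin (proj_top R) U"
  shows "carrier (proj_sections R U) = sec U ` OU U"
proof (intro equalityI subsetI)
  have Up: "U \<subseteq> pts" using U by (simp add: openin_proj_iff)
  fix \<sigma> assume "\<sigma> \<in> carrier (proj_sections R U)"
  then have ext: "\<sigma> \<in> extensional U" and loc: "\<And>p. p \<in> U \<Longrightarrow> \<exists>V. openin (proj_top R) V \<and> p \<in> V \<and> V \<subseteq> U \<and>
        (\<exists>n. \<exists>a\<in>hpart R n. \<exists>s\<in>hpart R n. \<forall>q\<in>V. s \<notin> q \<and> \<sigma> q = hfrac R q a s)"
    by (simp_all add: proj_sections_def)
  have ex: "\<exists>x. x \<in> Oc p \<and> \<sigma> p = fr p x \<and> x \<in> Oc \<eta> \<and> \<sigma> \<eta> = fr \<eta> x" if p: "p \<in> U" for p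
  proof -
    obtain V n a s where V: "openin (proj_top R) V" "p \<in> V" "V \<subseteq> U" and a: "a \<in> hpart R n" "s \<in> hpart R n"
      and q: "\<And>q. q \<in> V \<Longrightarrow> s \<notin> q \<and> \<sigma> q = hfrac R q a s" using loc[OF p] by meson
    have *: "emb a / emb s \<in> Oc q \<and> \<sigma> q = fr q (emb a / emb s)" if qV: "q \<in> V" for q
      using Oc_I[OF a] q[OF qV] hfrac_eq[OF _ a] qV V(3) Up by auto
    have "\<eta> \<in> V" using eta_open V by blast
    then show ?thesis using * V(2) by blast
  qed
  show "\<sigma> \<in> sec U ` OU U"
  proof (cases "U = {}")
    \<comment> \<open>Over the empty set all field elements give the same section, the everywhere
      undefined function.\<close>
    case True
    then have "\<sigma> = sec U 0" "0 \<in> OU U" using ext by (auto simp: sec_def OU_def extensional_def)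
    then show ?thesis by blast
  next
    case False
    then have "\<eta> \<in> U" using eta_open U by blast
    then obtain x where x: "x \<in> Oc \<eta>" "\<sigma> \<eta> = fr \<eta> x" using ex by blast
    have "x \<in> Oc p \<and> \<sigma> p = fr p x" if p: "p \<in> U" for p
      using ex[OF p] x fr_inj by metis
    then have "x \<in> OU U" "\<sigma> = sec U x" using ext unfolding OU_def sec_def
      by (auto simp: extensional_def fun_eq_iff)
    then show ?thesis by blast
  qed
next
  have Up: "U \<subseteq> pts" using U by (simp add: openin_proj_iff)
  fix \<sigma> assume "\<sigma> \<in> sec U ` OU U"
  then obtain x where x: "x \<in> OU U" "\<sigma> = sec U x" by blast
  have "\<exists>V. openin (proj_top R) V \<and> p \<in> V \<and> V \<subseteq> U \<and>
        (\<exists>n. \<exists>a\<in>hpart R n. \<exists>s\<in>hpart R n. \<forall>q\<in>V. s \<notin> q \<and> \<sigma> q = hfrac R q a s)" if p: "p \<in> U" for p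
  proof -
    have "x \<in> Oc p" using x(1) p by (simp add: OU_def)
    then obtain a s n where a: "a \<in> hpart R n" "s \<in> hpart R n" "s \<notin> p" "x = emb a / emb s" by (rule Oc_E)
    have s: "s \<in> homogeneous R" using a by (auto simp: homogeneous_def)
    define V where "V = U \<inter> Dp s"
    have 1: "openin (proj_top R) V" using U openin_Dp[OF s] by (auto simp: V_def)
    have 2: "p \<in> V" "V \<subseteq> U" using p a(3) Up by (auto simp: Dp_iff V_def)
    have 3: "s \<notin> q \<and> \<sigma> q = hfrac R q a s" if "q \<in> V" for q
      using that hfrac_eq[OF _ a(1,2)] x(2) a(4) by (auto simp: Dp_iff sec_def V_def)
    show ?thesis
      by (intro exI[of _ V] exI[of _ n] conjI 1 2 bexI[OF _ a(1)] bexI[OF _ a(2)] ballI 3)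
  qed
  then show "\<sigma> \<in> carrier (proj_sections R U)"
    using x(2) by (simp add: proj_sections_def sec_def)
qed

lemma sections_ops:
  assumes U: "U \<subseteq> pts" and x: "x \<in> OU U" and y: "y \<in> OU U"
  shows "sec U x \<otimes>\<^bsub>proj_sections R U\<^esub> sec U y = sec U (x * y)"
    and "sec U x \<oplus>\<^bsub>proj_sections R U\<^esub> sec U y = sec U (x + y)"
  using U x y hloc_ops by (auto simp: proj_sections_def sec_def OU_def fun_eq_iff restrict_def)

lemma sections_one: "U \<subseteq> pts \<Longrightarrow> \<one>\<^bsub>proj_sections R U\<^esub> = sec U 1"
  using hloc_one by (auto simp: proj_sections_def sec_def fun_eq_iff restrict_def)

lemma sections_zero: "U \<subseteq> pts \<Longrightarrow> \<zero>\<^bsub>proj_sections R U\<^esub> = sec U 0"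
  using hloc_zero by (auto simp: proj_sections_def sec_def fun_eq_iff restrict_def)

lemma scalar_sec: "scalar (Proj R) c = sec pts (ct c)"
  using hfrac_eq[OF _ algmap_mem hpart_one] pts_one
  by (auto simp: Proj_def sec_def fun_eq_iff restrict_def em_algmap em_one)

lemma ptop_Proj: "ptop (Proj R) = proj_top R" and sections_Proj: "sections (Proj R) = proj_sections R"
  and restr_Proj: "restr (Proj R) U V f = restrict f V"
  by (simp_all add: Proj_def)

lemma open_subspace_pts: "open_subspace (Proj R) pts = Proj R"
proof -
  have "subtopology (proj_top R) pts = proj_top R" using topspace_proj by (metis subtopology_topspace)
  moreover have "restrict (scalar (Proj R) c) pts = scalar (Proj R) c" for c
    unfolding scalar_sec by (simp add: restrict_sec)
  ultimately show ?thesis by (simp add: open_subspace_def Proj_def topspace_proj)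
qed

section \<open>Germs and stalks\<close>

definition Gm :: "'a set set \<Rightarrow> 'a set \<Rightarrow> 'g \<Rightarrow> ('a set set \<times> ('a set \<Rightarrow> ('a \<times> 'a) set)) set" where
  "Gm U0 p x = {(V, sec V x) | V. openin (proj_top R) V \<and> V \<subseteq> U0 \<and> p \<in> V \<and> x \<in> OU V}"

text \<open>Stalks are computed for an arbitrary open subspace, as rational maps require; by
  \<open>open_subspace_pts\<close> the choice \<open>U0 = pts\<close> recovers the whole
  space.\<close>

context
  fixes U0 assumes U0: "openin (proj_top R) U0"
begin

lemma openin_sub: "openin (ptop (open_subspace (Proj R) U0)) V \<longleftrightarrow> openin (proj_top R) V \<and> V \<subseteq> U0"
  by (simp add: open_subspace_def ptop_Proj openin_open_subtopology[OF U0])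

lemma points_sub: "points (open_subspace (Proj R) U0) = U0"
  using U0 by (simp add: open_subspace_def ptop_Proj openin_proj_iff topspace_proj) blast

lemma sections_sub: "sections (open_subspace (Proj R) U0) = proj_sections R"
  and restr_sub: "restr (open_subspace (Proj R) U0) U V f = restrict f V"
  by (simp_all add: open_subspace_def Proj_def)

lemma scalar_sub: "scalar (open_subspace (Proj R) U0) c = sec U0 (ct c)"
proof -
  have "U0 \<subseteq> pts" using U0 by (simp add: openin_proj_iff)
  then show ?thesis using scalar_sec by (simp add: open_subspace_def restr_Proj restrict_sec)
qed

lemma open_subset_pts: "openin (proj_top R) V \<Longrightarrow> V \<subseteq> pts"
  by (simp add: openin_proj_iff)

text \<open>Sections that agree near \<open>p\<close> have the same value in the field, so a germ is
  determined by this value.\<close>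

lemma germ_sec:
  assumes V: "openin (proj_top R) V" "V \<subseteq> U0" "p \<in> V" and x: "x \<in> OU V"
  shows "germ (open_subspace (Proj R) U0) p V (sec V x) = Gm U0 p x"
proof -
  have pp: "p \<in> pts" using V open_subset_pts by blast
  have "(\<exists>W. openin (proj_top R) W \<and> W \<subseteq> U0 \<and> p \<in> W \<and> W \<subseteq> V \<inter> V' \<and> restrict (sec V x) W = restrict \<tau> W) \<longleftrightarrow> \<tau> = sec V' x"
    if V': "openin (proj_top R) V'" "V' \<subseteq> U0" "p \<in> V'" and \<tau>: "\<tau> = sec V' y" "y \<in> OU V'" for V' \<tau> y
  proof
    assume "\<exists>W. openin (proj_top R) W \<and> W \<subseteq> U0 \<and> p \<in> W \<and> W \<subseteq> V \<inter> V' \<and> restrict (sec V x) W = restrict \<tau> W"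
    then obtain W where W: "p \<in> W" "W \<subseteq> V \<inter> V'" "restrict (sec V x) W = restrict \<tau> W" by blast
    then have "sec W x p = sec W y p" using \<tau> restrict_sec[of W V x] restrict_sec[of W V' y] by simp
    then have "fr p x = fr p y" using W(1) by (simp add: sec_def)
    then have "x = y" using fr_inj x V(3) by (auto simp: OU_def)
    then show "\<tau> = sec V' x" using \<tau> by simp
  next
    assume "\<tau> = sec V' x"
    then show "\<exists>W. openin (proj_top R) W \<and> W \<subseteq> U0 \<and> p \<in> W \<and> W \<subseteq> V \<inter> V' \<and> restrict (sec V x) W = restrict \<tau> W"
      using V V' restrict_sec[of "V \<inter> V'" V x] restrict_sec[of "V \<inter> V'" V' x] by (intro exI[of _ "V \<inter> V'"]) auto
  qed
  note * = this
  have inV': "x \<in> OU V'" if "sec V' x = sec V' y" "y \<in> OU V'" for V' y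
  proof -
    have "x \<in> Oc q" if q: "q \<in> V'" for q
    proof -
      have "fr q y = fr q x" using fun_cong[OF \<open>sec V' x = sec V' y\<close>, of q] q by (simp add: sec_def)
      moreover have "y \<in> Oc q" using \<open>y \<in> OU V'\<close> q by (simp add: OU_def)
      ultimately show ?thesis using fr_inj by metis
    qed
    then show ?thesis by (simp add: OU_def)
  qed
  show ?thesis
  proof (intro equalityI subsetI)
    fix z assume "z \<in> germ (open_subspace (Proj R) U0) p V (sec V x)"
    then obtain V' \<tau> where z: "z = (V', \<tau>)" "openin (proj_top R) V'" "V' \<subseteq> U0" "p \<in> V'" "\<tau> \<in> carrier (proj_sections R V')"
      and ex: "\<exists>W. openin (proj_top R) W \<and> W \<subseteq> U0 \<and> p \<in> W \<and> W \<subseteq> V \<inter> V' \<and> restrict (sec V x) W = restrict \<tau> W"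
      unfolding germ_def openin_sub sections_sub restr_sub by blast
    obtain y where y: "\<tau> = sec V' y" "y \<in> OU V'" using z(5) sections_carrier[OF z(2)] by blast
    then have "\<tau> = sec V' x" using *[OF z(2-4) y] ex by blast
    then show "z \<in> Gm U0 p x" using z inV'[of V' y] y unfolding Gm_def by auto
  next
    fix z assume "z \<in> Gm U0 p x"
    then obtain V' where z: "z = (V', sec V' x)" "openin (proj_top R) V'" "V' \<subseteq> U0" "p \<in> V'" "x \<in> OU V'"
      unfolding Gm_def by blast
    have "\<exists>W. openin (proj_top R) W \<and> W \<subseteq> U0 \<and> p \<in> W \<and> W \<subseteq> V \<inter> V' \<and> restrict (sec V x) W = restrict (sec V' x) W"
      using *[OF z(2-4) refl z(5)] by blast
    moreover have "sec V' x \<in> carrier (proj_sections R V')" using sections_carrier[OF z(2)] z(5) by blast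
    ultimately show "z \<in> germ (open_subspace (Proj R) U0) p V (sec V x)"
      unfolding germ_def openin_sub sections_sub restr_sub z(1) using z(2-4) by blast
  qed
qed

lemma Oc_nbhd:
  assumes p: "p \<in> U0" and x: "x \<in> Oc p"
  obtains V where "openin (proj_top R) V" "V \<subseteq> U0" "p \<in> V" "x \<in> OU V"
proof -
  obtain a s n where a: "a \<in> hpart R n" "s \<in> hpart R n" "s \<notin> p" "x = emb a / emb s" using x by (rule Oc_E)
  have s: "s \<in> homogeneous R" using a by (auto simp: homogeneous_def)
  have "openin (proj_top R) (U0 \<inter> Dp s)" using U0 openin_Dp[OF s] by blast
  moreover have "p \<in> U0 \<inter> Dp s" using p a(3) open_subset_pts[OF U0] by (auto simp: Dp_iff)
  moreover have "x \<in> OU (U0 \<inter> Dp s)" using Oc_I[OF a(1,2)] a(4) by (auto simp: OU_def Dp_iff)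
  ultimately show ?thesis using that by blast
qed

lemma stalk_carrier:
  assumes p: "p \<in> U0"
  shows "carrier (stalk (open_subspace (Proj R) U0) p) = Gm U0 p ` Oc p"
proof (intro equalityI subsetI)
  fix A assume "A \<in> carrier (stalk (open_subspace (Proj R) U0) p)"
  then obtain V \<sigma> where V: "openin (proj_top R) V" "V \<subseteq> U0" "p \<in> V" "\<sigma> \<in> carrier (proj_sections R V)"
    "A = germ (open_subspace (Proj R) U0) p V \<sigma>"
    by (auto simp: stalk_def openin_sub sections_sub)
  obtain x where x: "\<sigma> = sec V x" "x \<in> OU V" using V sections_carrier by blast
  have "A = Gm U0 p x" using germ_sec[OF V(1-3) x(2)] V(5) x(1) by simp
  moreover have "x \<in> Oc p" using x(2) V(3) by (simp add: OU_def)
  ultimately show "A \<in> Gm U0 p ` Oc p" by blast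
next
  fix A assume "A \<in> Gm U0 p ` Oc p"
  then obtain x where x: "x \<in> Oc p" "A = Gm U0 p x" by blast
  obtain V where V: "openin (proj_top R) V" "V \<subseteq> U0" "p \<in> V" "x \<in> OU V" using Oc_nbhd[OF p x(1)] .
  then have "A = germ (open_subspace (Proj R) U0) p V (sec V x)" using germ_sec x by simp
  moreover have "sec V x \<in> carrier (proj_sections R V)" using V sections_carrier by blast
  ultimately show "A \<in> carrier (stalk (open_subspace (Proj R) U0) p)"
    using V by (auto simp: stalk_def openin_sub sections_sub)
qed

lemma Gm_witness:
  assumes "p \<in> U0" "x \<in> Oc p" obtains V where "(V, sec V x) \<in> Gm U0 p x" "p \<in> V"
proof -
  obtain V where "openin (proj_top R) V" "V \<subseteq> U0" "p \<in> V" "x \<in> OU V" using Oc_nbhd[OF assms] .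
  then show ?thesis by (intro that[of V]) (auto simp: Gm_def)
qed

lemma Gm_nonempty: "p \<in> U0 \<Longrightarrow> x \<in> Oc p \<Longrightarrow> Gm U0 p x \<noteq> {}"
  using Gm_witness[of p x] by auto

lemma Gm_inj: assumes p: "p \<in> U0" and x: "x \<in> Oc p" and eq: "Gm U0 p x = Gm U0 p y" shows "x = y"
proof -
  obtain V where V: "(V, sec V x) \<in> Gm U0 p x" "p \<in> V" using Gm_witness[OF p x] .
  then have "sec V x = sec V y" using eq by (auto simp: Gm_def)
  then have "sec V x p = sec V y p" by (rule fun_cong)
  then have "fr p x = fr p y" using V(2) by (simp add: sec_def)
  then show ?thesis using fr_inj x by blast
qed

lemma stalk_ops:
  assumes p: "p \<in> U0" and x: "x \<in> Oc p" and y: "y \<in> Oc p"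
  shows "Gm U0 p x \<otimes>\<^bsub>stalk (open_subspace (Proj R) U0) p\<^esub> Gm U0 p y = Gm U0 p (x * y)"
    and "Gm U0 p x \<oplus>\<^bsub>stalk (open_subspace (Proj R) U0) p\<^esub> Gm U0 p y = Gm U0 p (x + y)"
proof -
  let ?Z = "open_subspace (Proj R) U0"
  have *: "germ ?Z p (fst A \<inter> fst B) (restrict (snd A) (fst A \<inter> fst B) \<otimes>\<^bsub>proj_sections R (fst A \<inter> fst B)\<^esub> restrict (snd B) (fst A \<inter> fst B))
      = Gm U0 p (x * y)"
    "germ ?Z p (fst A \<inter> fst B) (restrict (snd A) (fst A \<inter> fst B) \<oplus>\<^bsub>proj_sections R (fst A \<inter> fst B)\<^esub> restrict (snd B) (fst A \<inter> fst B))
      = Gm U0 p (x + y)" if AB: "A \<in> Gm U0 p x" "B \<in> Gm U0 p y" for A B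
  proof -
    obtain V where V: "A = (V, sec V x)" "openin (proj_top R) V" "V \<subseteq> U0" "p \<in> V" "x \<in> OU V"
      using AB(1) unfolding Gm_def by blast
    obtain W where W: "B = (W, sec W y)" "openin (proj_top R) W" "W \<subseteq> U0" "p \<in> W" "y \<in> OU W"
      using AB(2) unfolding Gm_def by blast
    have VW: "openin (proj_top R) (V \<inter> W)" "V \<inter> W \<subseteq> U0" "p \<in> V \<inter> W" using V W by auto
    have sub: "V \<inter> W \<subseteq> pts" using open_subset_pts VW(1) by blast
    have xy: "x \<in> OU (V \<inter> W)" "y \<in> OU (V \<inter> W)" using V(5) W(5) OU_mono by (meson Int_lower1 Int_lower2)+
    show "germ ?Z p (fst A \<inter> fst B) (restrict (snd A) (fst A \<inter> fst B) \<otimes>\<^bsub>proj_sections R (fst A \<inter> fst B)\<^esub> restrict (snd B) (fst A \<inter> fst B))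
      = Gm U0 p (x * y)"
      using germ_sec[OF VW OU_simps(5)[OF sub xy]] sections_ops(1)[OF sub xy]
      by (simp add: V(1) W(1) restrict_sec)
    show "germ ?Z p (fst A \<inter> fst B) (restrict (snd A) (fst A \<inter> fst B) \<oplus>\<^bsub>proj_sections R (fst A \<inter> fst B)\<^esub> restrict (snd B) (fst A \<inter> fst B))
      = Gm U0 p (x + y)"
      using germ_sec[OF VW OU_simps(4)[OF sub xy]] sections_ops(2)[OF sub xy]
      by (simp add: V(1) W(1) restrict_sec)
  qed
  show "Gm U0 p x \<otimes>\<^bsub>stalk ?Z p\<^esub> Gm U0 p y = Gm U0 p (x * y)"
    unfolding stalk_def by (simp add: case_prod_beta sections_sub restr_sub) (intro UN_const_eq Gm_nonempty p x y *(1))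
  show "Gm U0 p x \<oplus>\<^bsub>stalk ?Z p\<^esub> Gm U0 p y = Gm U0 p (x + y)"
    unfolding stalk_def by (simp add: case_prod_beta sections_sub restr_sub) (intro UN_const_eq Gm_nonempty p x y *(2))
qed

lemma stalk_one_zero:
  assumes p: "p \<in> U0"
  shows "\<one>\<^bsub>stalk (open_subspace (Proj R) U0) p\<^esub> = Gm U0 p 1" "\<zero>\<^bsub>stalk (open_subspace (Proj R) U0) p\<^esub> = Gm U0 p 0"
proof -
  have s: "U0 \<subseteq> pts" using open_subset_pts U0 by blast
  show "\<one>\<^bsub>stalk (open_subspace (Proj R) U0) p\<^esub> = Gm U0 p 1" "\<zero>\<^bsub>stalk (open_subspace (Proj R) U0) p\<^esub> = Gm U0 p 0"
    using germ_sec[OF U0 _ p] OU_simps[OF s]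
    by (simp_all add: stalk_def points_sub sections_sub sections_one[OF s] sections_zero[OF s])
qed

definition sv :: "'a set \<Rightarrow> ('a set set \<times> ('a set \<Rightarrow> ('a \<times> 'a) set)) set \<Rightarrow> 'g" where
  "sv p = inv_into (Oc p) (Gm U0 p)"

lemma Gm_inj_on: "p \<in> U0 \<Longrightarrow> inj_on (Gm U0 p) (Oc p)"
  using Gm_inj by (auto intro: inj_onI)

lemma sv_Gm: "p \<in> U0 \<Longrightarrow> x \<in> Oc p \<Longrightarrow> sv p (Gm U0 p x) = x"
  unfolding sv_def by (simp add: Gm_inj_on)

lemma stalk_embedded:
  assumes p: "p \<in> U0"
  shows "embedded_ring (stalk (open_subspace (Proj R) U0) p) (sv p)"
    and "sv p ` carrier (stalk (open_subspace (Proj R) U0) p) = Oc p"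
proof -
  let ?S = "stalk (open_subspace (Proj R) U0) p"
  have pp: "p \<in> pts" using open_subset_pts[OF U0] p by blast
  show im: "sv p ` carrier ?S = Oc p"
    unfolding stalk_carrier[OF p] using sv_Gm[OF p] by (auto simp: image_iff)
  show "embedded_ring ?S (sv p)"
  proof
    show "inj_on (sv p) (carrier ?S)" unfolding stalk_carrier[OF p] using sv_Gm[OF p] by (auto intro!: inj_onI)
    fix A assume "A \<in> carrier ?S"
    then obtain x where x: "x \<in> Oc p" "A = Gm U0 p x" using stalk_carrier[OF p] by blast
    show "\<exists>B\<in>carrier ?S. sv p B = - sv p A"
      using x Oc_simps(6)[OF pp] sv_Gm[OF p] stalk_carrier[OF p] by (intro bexI[of _ "Gm U0 p (- x)"]) auto
    fix B assume "B \<in> carrier ?S"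
    then obtain y where y: "y \<in> Oc p" "B = Gm U0 p y" using stalk_carrier[OF p] by blast
    show "A \<otimes>\<^bsub>?S\<^esub> B \<in> carrier ?S \<and> sv p (A \<otimes>\<^bsub>?S\<^esub> B) = sv p A * sv p B"
      using x y stalk_ops(1)[OF p x(1) y(1)] Oc_simps(5)[OF pp x(1) y(1)] sv_Gm[OF p] stalk_carrier[OF p] by auto
    show "A \<oplus>\<^bsub>?S\<^esub> B \<in> carrier ?S \<and> sv p (A \<oplus>\<^bsub>?S\<^esub> B) = sv p A + sv p B"
      using x y stalk_ops(2)[OF p x(1) y(1)] Oc_simps(4)[OF pp x(1) y(1)] sv_Gm[OF p] stalk_carrier[OF p] by auto
  next
    show "\<one>\<^bsub>?S\<^esub> \<in> carrier ?S" "sv p \<one>\<^bsub>?S\<^esub> = 1" "\<zero>\<^bsub>?S\<^esub> \<in> carrier ?S" "sv p \<zero>\<^bsub>?S\<^esub> = 0"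
      using stalk_one_zero[OF p] Oc_simps(1,2)[OF pp] sv_Gm[OF p] stalk_carrier[OF p] by auto
  qed
qed

lemma Units_stalk_iff:
  assumes p: "p \<in> U0" and x: "x \<in> Oc p"
  shows "Gm U0 p x \<in> Units (stalk (open_subspace (Proj R) U0) p) \<longleftrightarrow> x \<noteq> 0 \<and> inverse x \<in> Oc p"
proof -
  interpret S: embedded_ring "stalk (open_subspace (Proj R) U0) p" "sv p" by (rule stalk_embedded[OF p])
  have "Gm U0 p x \<in> carrier (stalk (open_subspace (Proj R) U0) p)" using stalk_carrier[OF p] x by blast
  then show ?thesis using S.Units_embedded sv_Gm[OF p x] stalk_embedded(2)[OF p] by (simp add: S.\<O>_def)
qed

end

text \<open>If \<open>b/t\<close> is inverse to \<open>a/s\<close>, then \<open>a b = s t\<close>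
  lies outside the prime \<open>p\<close>, and therefore so does \<open>a\<close>.\<close>

lemma unit_OO_iff:
  assumes p: "p \<in> pts" and a: "a \<in> hpart R n" "s \<in> hpart R n" "s \<notin> p"
  shows "emb a / emb s \<noteq> 0 \<and> inverse (emb a / emb s) \<in> Oc p \<longleftrightarrow> a \<notin> p"
proof
  assume *: "emb a / emb s \<noteq> 0 \<and> inverse (emb a / emb s) \<in> Oc p"
  then obtain b t m where b: "b \<in> hpart R m" "t \<in> hpart R m" "t \<notin> p" "inverse (emb a / emb s) = emb b / emb t"
    using Oc_E by metis
  have n0: "emb s \<noteq> 0" "emb t \<noteq> 0" using notin_pt_emb p a b hc by metis+
  have "emb s * emb t = emb a * emb b" using b(4) n0 * by (simp add: field_simps)
  then have "s \<otimes> t = a \<otimes> b" using a b by (simp add: em_mult flip: em_eq)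
  moreover have "s \<otimes> t \<notin> p" using pts_mult[OF p] a b by simp
  ultimately show "a \<notin> p" using pts_mult[OF p, of a b] a b by auto
next
  assume "a \<notin> p"
  then show "emb a / emb s \<noteq> 0 \<and> inverse (emb a / emb s) \<in> Oc p"
    using notin_pt_emb[OF p] a Oc_I[OF a(2,1)] by simp
qed

end

section \<open>Multivariate polynomials and the homogeneous coordinate ring\<close>

definition monm :: "('v::finite \<Rightarrow> 'r::comm_ring_1) \<Rightarrow> ('v \<Rightarrow>\<^sub>0 nat) \<Rightarrow> 'r" where
  "monm v m = (\<Prod>i\<in>UNIV. v i ^ Poly_Mapping.lookup m i)"

text \<open>The map out of the polynomial ring determined by the images of constants and variables;
  \<open>rhom_mpoly_ext\<close> is the matching uniqueness statement.\<close>

definition mev :: "('k::comm_ring_1 \<Rightarrow> 'r::comm_ring_1) \<Rightarrow> ('v::finite \<Rightarrow> 'r) \<Rightarrow> ('v, 'k) mpoly \<Rightarrow> 'r" where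
  "mev c v p = (\<Sum>m\<in>Poly_Mapping.keys p. c (Poly_Mapping.lookup p m) * monm v m)"

lemma monm_0 [simp]: "monm v 0 = 1"
  by (simp add: monm_def)

lemma monm_add: "monm v (m + n) = monm v m * monm v n"
  by (simp add: monm_def lookup_add power_add prod.distrib)

lemma mpoly_sum_single:
  fixes p :: "'m \<Rightarrow>\<^sub>0 'b::comm_monoid_add"
  shows "p = (\<Sum>m\<in>Poly_Mapping.keys p. Poly_Mapping.single m (Poly_Mapping.lookup p m))"
proof (rule poly_mapping_eqI)
  fix k
  have "Poly_Mapping.lookup (\<Sum>m\<in>Poly_Mapping.keys p. Poly_Mapping.single m (Poly_Mapping.lookup p m)) k = (\<Sum>m\<in>Poly_Mapping.keys p. if m = k then Poly_Mapping.lookup p m else 0)"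
    by (simp add: lookup_sum lookup_single when_def)
  also have "\<dots> = Poly_Mapping.lookup p k" by (simp add: in_keys_iff)
  finally show "Poly_Mapping.lookup p k = Poly_Mapping.lookup (\<Sum>m\<in>Poly_Mapping.keys p. Poly_Mapping.single m (Poly_Mapping.lookup p m)) k" by simp
qed

lemma mpoly_single_induct:
  fixes p :: "'m \<Rightarrow>\<^sub>0 'b::comm_monoid_add"
  assumes "P 0" "\<And>m c. P (Poly_Mapping.single m c)" "\<And>x y. P x \<Longrightarrow> P y \<Longrightarrow> P (x + y)"
  shows "P p"
proof -
  have "P (\<Sum>m\<in>A. Poly_Mapping.single m (Poly_Mapping.lookup p m))" for A
    by (induction A rule: infinite_finite_induct) (use assms in auto)
  then show ?thesis using mpoly_sum_single[of p] by metis
qed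

lemma mev_superset:
  assumes c: "rhom c" and A: "finite A" "Poly_Mapping.keys p \<subseteq> A"
  shows "mev c v p = (\<Sum>m\<in>A. c (Poly_Mapping.lookup p m) * monm v m)"
  unfolding mev_def using A by (intro sum.mono_neutral_left) (auto simp: in_keys_iff rhom_0[OF c])

lemma mev_single: "rhom c \<Longrightarrow> mev c v (Poly_Mapping.single m a) = c a * monm v m"
  by (simp add: mev_superset[of c "{m}"])

lemma mev_add: assumes c: "rhom c" shows "mev c v (p + q) = mev c v p + mev c v q"
proof -
  let ?A = "Poly_Mapping.keys p \<union> Poly_Mapping.keys q"
  have "Poly_Mapping.keys (p + q) \<subseteq> ?A" by (rule Poly_Mapping.keys_add)
  then show ?thesis
    by (simp add: mev_superset[OF c, of ?A] lookup_add rhom_add[OF c] distrib_right sum.distrib)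
qed

lemma rhom_mev: assumes c: "rhom c" shows "rhom (mev c v)"
proof (rule rhomI)
  have "mev c v (Poly_Mapping.single 0 1) = 1" unfolding mev_single[OF c] by (simp add: rhom_1[OF c])
  then show "mev c v 1 = 1" by simp
  show "mev c v (x + y) = mev c v x + mev c v y" for x y by (rule mev_add[OF c])
  have z: "mev c v 0 = 0" by (simp add: mev_def)
  have s: "mev c v (Poly_Mapping.single m a * y) = c a * monm v m * mev c v y" for m a y
    by (induction y rule: mpoly_single_induct)
      (simp_all add: z mult_single mev_single[OF c] mev_add[OF c] rhom_mult[OF c] monm_add algebra_simps)
  show "mev c v (x * y) = mev c v x * mev c v y" for x y
    by (induction x rule: mpoly_single_induct)
      (simp_all add: z s mev_single[OF c] mev_add[OF c] distrib_right)
qed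

lemma mev_Const: "rhom c \<Longrightarrow> mev c v (Const a) = c a"
  by (simp add: Const_def mev_single)

lemma monm_single: "monm v (Poly_Mapping.single i k) = v i ^ k"
proof -
  have "monm v (Poly_Mapping.single i k) = (\<Prod>j\<in>UNIV. if j = i then v i ^ k else 1)"
    unfolding monm_def by (intro prod.cong) (auto simp: lookup_single when_def)
  then show ?thesis by simp
qed

lemma mev_Var: "rhom c \<Longrightarrow> mev c v (Var i) = v i"
  by (simp add: Var_def mev_single rhom_1 monm_single)

lemma rhom_Const: "rhom Const"
  by (rule rhomI) (simp_all add: Const_def single_add mult_single)

lemma Const_0 [simp]: "Const 0 = 0" and Const_1 [simp]: "Const 1 = 1"
  by (simp_all add: Const_def)

lemma single_eq_monm: "Poly_Mapping.single m a = Const a * monm Var m"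
proof -
  have pw: "Var i ^ k = Poly_Mapping.single (Poly_Mapping.single i k) 1" for i k
    by (induction k) (simp_all add: Var_def mult_single flip: single_add)
  have pr: "(\<Prod>i\<in>A. Poly_Mapping.single (f i) (1::'b)) = Poly_Mapping.single (\<Sum>i\<in>A. f i) 1"
    if "finite A" for A and f :: "'a \<Rightarrow> ('a \<Rightarrow>\<^sub>0 nat)"
    using that by (induction A) (simp_all add: mult_single)
  have "(\<Sum>i\<in>UNIV. Poly_Mapping.single i (Poly_Mapping.lookup m i)) = m"
  proof (rule poly_mapping_eqI)
    fix k
    have "Poly_Mapping.lookup (\<Sum>i\<in>UNIV. Poly_Mapping.single i (Poly_Mapping.lookup m i)) k = (\<Sum>i\<in>UNIV. if i = k then Poly_Mapping.lookup m i else 0)"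
      by (simp add: lookup_sum lookup_single when_def)
    then show "Poly_Mapping.lookup (\<Sum>i\<in>UNIV. Poly_Mapping.single i (Poly_Mapping.lookup m i)) k = Poly_Mapping.lookup m k" by simp
  qed
  then have "monm Var m = (Poly_Mapping.single m 1 :: ('a, 'b) mpoly)"
    unfolding monm_def pw using pr[of UNIV] by simp
  then show ?thesis by (simp add: Const_def mult_single)
qed

lemma mpoly_closed_induct:
  fixes p :: "('v::finite, 'k::comm_ring_1) mpoly"
  assumes C: "\<And>c. P (Const c)" and V: "\<And>v. P (Var v)"
    and A: "\<And>x y. P x \<Longrightarrow> P y \<Longrightarrow> P (x + y)" and M: "\<And>x y. P x \<Longrightarrow> P y \<Longrightarrow> P (x * y)"
  shows "P p"
proof (induction p rule: mpoly_single_induct)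
  have one: "P 1" using C[of 1] by simp
  show "P 0" using C[of 0] by simp
  have pw: "P (Var i ^ k)" for i k by (induction k) (use one V M in auto)
  have "P (\<Prod>i\<in>A. Var i ^ k i)" for A k
    by (induction A rule: infinite_finite_induct) (use one pw M in auto)
  then show "P (Poly_Mapping.single m c)" for m c unfolding single_eq_monm monm_def using C M by blast
qed (use A in auto)

lemma rhom_mpoly_ext:
  fixes g h :: "('v::finite, 'k::comm_ring_1) mpoly \<Rightarrow> 'r::comm_ring_1"
  assumes "rhom g" "rhom h" "\<And>c. g (Const c) = h (Const c)" "\<And>v. g (Var v) = h (Var v)"
  shows "g p = h p"
  by (induction p rule: mpoly_closed_induct) (simp_all add: assms rhom_add[OF assms(1)] rhom_add[OF assms(2)]
      rhom_mult[OF assms(1)] rhom_mult[OF assms(2)])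

section \<open>Forms and homogeneous components\<close>

definition mdeg :: "('v::finite \<Rightarrow>\<^sub>0 nat) \<Rightarrow> nat" where
  "mdeg m = (\<Sum>v\<in>UNIV. Poly_Mapping.lookup m v)"

lemma mdeg_keys: "(\<Sum>v\<in>Poly_Mapping.keys m. Poly_Mapping.lookup m v) = mdeg m"
  unfolding mdeg_def by (intro sum.mono_neutral_left) (auto simp: in_keys_iff)

lemma mdeg_add: "mdeg (m + n) = mdeg m + mdeg n"
  by (simp add: mdeg_def lookup_add sum.distrib)

definition forms :: "nat \<Rightarrow> ('v::finite, 'k::comm_ring_1) mpoly set" where
  "forms n = {p. \<forall>m\<in>Poly_Mapping.keys p. mdeg m = n}"

lemma forms_0: "0 \<in> forms n" by (simp add: forms_def)

lemma forms_add: "a \<in> forms n \<Longrightarrow> b \<in> forms n \<Longrightarrow> a + b \<in> forms n"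
  using Poly_Mapping.keys_add[of a b] by (auto simp: forms_def)

lemma forms_neg: "a \<in> forms n \<Longrightarrow> - a \<in> forms n"
  by (auto simp: forms_def)

lemma forms_sum: "(\<And>i. i \<in> A \<Longrightarrow> f i \<in> forms n) \<Longrightarrow> sum f A \<in> forms n"
  by (induction A rule: infinite_finite_induct) (auto intro: forms_0 forms_add)

lemma forms_mult: "a \<in> forms m \<Longrightarrow> b \<in> forms n \<Longrightarrow> a * b \<in> forms (m + n)"
  using keys_mult[of a b] by (fastforce simp: forms_def mdeg_add)

lemma forms_Const: "Const c \<in> forms 0"
  by (auto simp: forms_def Const_def mdeg_def split: if_splits)

lemma forms_1: "1 \<in> forms 0" using forms_Const[of 1] by simp

lemma mdeg_single: "mdeg (Poly_Mapping.single v k) = k"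
proof -
  have "mdeg (Poly_Mapping.single v k) = (\<Sum>i\<in>UNIV. if i = v then k else 0)"
    unfolding mdeg_def by (intro sum.cong) (auto simp: lookup_single when_def)
  then show ?thesis by simp
qed

lemma forms_Var: "Var v \<in> forms 1"
  by (auto simp: forms_def Var_def mdeg_single)

lemma forms_power: "a \<in> forms n \<Longrightarrow> a ^ k \<in> forms (k * n)"
  by (induction k) (auto intro: forms_1 forms_mult)

lemma forms_monm: assumes "\<And>i. v i \<in> forms d" shows "monm v m \<in> forms (mdeg m * d)"
proof -
  have "(\<Prod>i\<in>A. v i ^ Poly_Mapping.lookup m i) \<in> forms ((\<Sum>i\<in>A. Poly_Mapping.lookup m i) * d)" if "finite A" for A
    using that by (induction A) (auto simp: distrib_right intro: forms_1 forms_mult forms_power assms)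
  then show ?thesis by (simp add: monm_def mdeg_def)
qed

lemma mev_forms:
  assumes "\<And>i. v i \<in> forms d" "p \<in> forms n"
  shows "mev Const v p \<in> forms (n * d)"
  unfolding mev_def
proof (rule forms_sum)
  fix m assume "m \<in> Poly_Mapping.keys p"
  then have "mdeg m = n" using assms(2) by (simp add: forms_def)
  then show "Const (Poly_Mapping.lookup p m) * monm v m \<in> forms (n * d)"
    using forms_mult[OF forms_Const forms_monm[of v d m, OF assms(1)]] by simp
qed

text \<open>Every monomial of a form of degree \<open>n\<close> collects exactly \<open>n\<close>
  factors \<open>l\<close>. This drives all passages between homogeneous and affine
  coordinates.\<close>

lemma mev_forms_scale:
  fixes p :: "('v::finite, 'k::comm_ring_1) mpoly"
  assumes c: "rhom c" and p: "p \<in> forms n"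
  shows "mev c (\<lambda>i. l * v i) p = l ^ n * mev c v p"
proof -
  have "monm (\<lambda>i. l * v i) m = l ^ mdeg m * monm v m" for m :: "'v \<Rightarrow>\<^sub>0 nat"
    by (simp add: monm_def mdeg_def power_mult_distrib prod.distrib power_sum)
  then show ?thesis using p by (auto simp: mev_def sum_distrib_left forms_def intro!: sum.cong)
qed

definition hcomp :: "('v::finite, 'k::comm_ring_1) mpoly \<Rightarrow> nat \<Rightarrow> ('v, 'k) mpoly" where
  "hcomp p n = (\<Sum>m\<in>{m\<in>Poly_Mapping.keys p. mdeg m = n}. Poly_Mapping.single m (Poly_Mapping.lookup p m))"

lemma lookup_hcomp: "Poly_Mapping.lookup (hcomp p n) m = (if mdeg m = n then Poly_Mapping.lookup p m else 0)"
proof -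
  have "Poly_Mapping.lookup (hcomp p n) m = (\<Sum>k\<in>{m\<in>Poly_Mapping.keys p. mdeg m = n}. if k = m then Poly_Mapping.lookup p k else 0)"
    unfolding hcomp_def by (simp add: lookup_sum lookup_single when_def)
  also have "\<dots> = (if mdeg m = n then Poly_Mapping.lookup p m else 0)" by (simp add: in_keys_iff)
  finally show ?thesis .
qed

lemma hcomp_forms: "hcomp p n \<in> forms n"
  by (auto simp: forms_def in_keys_iff lookup_hcomp split: if_splits)

lemma hcomp_add: "hcomp (p + q) n = hcomp p n + hcomp q n"
  by (rule poly_mapping_eqI) (simp add: lookup_hcomp lookup_add)

lemma hcomp_0: "hcomp 0 n = 0"
  by (rule poly_mapping_eqI) (simp add: lookup_hcomp)

lemma hcomp_diff: "hcomp (p - q) n = hcomp p n - hcomp q n"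
  by (rule poly_mapping_eqI) (simp add: lookup_hcomp lookup_minus)

lemma hcomp_of_forms: "p \<in> forms m \<Longrightarrow> hcomp p n = (if m = n then p else 0)"
  by (rule poly_mapping_eqI) (auto simp: lookup_hcomp forms_def in_keys_iff)

lemma hcomp_sum: "hcomp (sum f A) n = (\<Sum>i\<in>A. hcomp (f i) n)"
  by (induction A rule: infinite_finite_induct) (simp_all add: hcomp_0 hcomp_add)

lemma hcomp_sum_bound: obtains N where "p = (\<Sum>n\<le>N. hcomp p n)"
proof -
  define N where "N = Max (insert 0 (mdeg ` Poly_Mapping.keys p))"
  have N: "mdeg m \<le> N" if "m \<in> Poly_Mapping.keys p" for m using that by (simp add: N_def)
  have "p = (\<Sum>n\<le>N. hcomp p n)"
  proof (rule poly_mapping_eqI)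
    fix m
    have "Poly_Mapping.lookup (\<Sum>n\<le>N. hcomp p n) m = (\<Sum>n\<le>N. if mdeg m = n then Poly_Mapping.lookup p m else 0)"
      by (simp add: lookup_sum lookup_hcomp)
    also have "\<dots> = Poly_Mapping.lookup p m" using N[of m] by (auto simp: in_keys_iff)
    finally show "Poly_Mapping.lookup p m = Poly_Mapping.lookup (\<Sum>n\<le>N. hcomp p n) m" by simp
  qed
  then show ?thesis using that by blast
qed

text \<open>The case distinction guards the truncated subtraction \<open>n - d\<close>.\<close>

lemma hcomp_forms_mult:
  assumes "r \<in> forms d" shows "hcomp (r * a) n = (if d \<le> n then r * hcomp a (n - d) else 0)"
proof -
  obtain N where N: "a = (\<Sum>i\<le>N. hcomp a i)" by (rule hcomp_sum_bound)
  have z: "hcomp a i = 0" if "i > N" for i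
  proof -
    have "hcomp a i = hcomp (\<Sum>j\<le>N. hcomp a j) i" by (rule arg_cong[OF N])
    then show ?thesis using that by (simp add: hcomp_sum hcomp_of_forms[OF hcomp_forms])
  qed
  have "hcomp (r * a) n = (\<Sum>i\<le>N. hcomp (r * hcomp a i) n)"
    using arg_cong[OF N, of "\<lambda>x. hcomp (r * x) n"] by (simp add: sum_distrib_left hcomp_sum)
  also have "\<dots> = (\<Sum>i\<le>N. if d + i = n then r * hcomp a i else 0)"
    by (intro sum.cong refl hcomp_of_forms forms_mult assms hcomp_forms)
  also have "\<dots> = (\<Sum>i\<le>N. if i = n - d then (if d \<le> n then r * hcomp a i else 0) else 0)"
    by (intro sum.cong refl) auto
  also have "\<dots> = (if d \<le> n then r * hcomp a (n - d) else 0)"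
    using z[of "n - d"] by simp
  finally show ?thesis .
qed

lemma hcomp_mem_idl_mult:
  assumes I: "idl I" and a: "\<And>n. hcomp a n \<in> I" shows "hcomp (r * a) n \<in> I"
proof -
  obtain N where N: "r = (\<Sum>i\<le>N. hcomp r i)" by (rule hcomp_sum_bound)
  have "hcomp (r * a) n = (\<Sum>i\<le>N. hcomp (hcomp r i * a) n)"
    using arg_cong[OF N, of "\<lambda>x. hcomp (x * a) n"] by (simp add: sum_distrib_right hcomp_sum)
  also have "\<dots> \<in> I"
    by (intro idl_sum[OF I]) (auto simp: hcomp_forms_mult[OF hcomp_forms] intro: idl_0[OF I] idl_mult[OF I] a)
  finally show ?thesis .
qed

lemma hcomps_mem: assumes I: "idl I" and "\<And>n. hcomp a n \<in> I" shows "a \<in> I"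
  using hcomp_sum_bound[of a] idl_sum[OF I, of _ "hcomp a"] assms(2) by metis

text \<open>The ring is a quotient of a polynomial ring presented by \<open>\<pi>\<close>, and
  \<open>\<psi>\<close> has the same fibres but values in a field; \<open>ker_hcomp\<close> says
  that the kernel is homogeneous. Points and fractions can then be described by polynomials instead
  of cosets.\<close>

locale poly_model =
  fixes R :: "('a, 'k::field) graded_algebra" and \<pi> :: "('v::finite, 'k) mpoly \<Rightarrow> 'a"
    and \<psi> :: "('v, 'k) mpoly \<Rightarrow> 'g::field"
  assumes cring: "cring R"
    and carrier_R: "carrier R = range \<pi>"
    and pi_add: "\<pi> (a + b) = \<pi> a \<oplus>\<^bsub>R\<^esub> \<pi> b" and pi_mult: "\<pi> (a * b) = \<pi> a \<otimes>\<^bsub>R\<^esub> \<pi> b"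
    and pi_one: "\<pi> 1 = \<one>\<^bsub>R\<^esub>" and pi_zero: "\<pi> 0 = \<zero>\<^bsub>R\<^esub>"
    and hpart_R: "hpart R n = \<pi> ` forms n" and algmap_R: "algmap R c = \<pi> (Const c)"
    and psi: "rhom \<psi>" and pi_eq: "\<pi> a = \<pi> b \<longleftrightarrow> \<psi> a = \<psi> b"
    and ker_hcomp: "\<psi> a = 0 \<Longrightarrow> \<psi> (hcomp a n) = 0"
    and nontrivial: "\<exists>v. \<psi> (Var v) \<noteq> 0"
begin

definition emb :: "'a \<Rightarrow> 'g" where "emb A = \<psi> (SOME a. \<pi> a = A)"

lemma emb_pi [simp]: "emb (\<pi> a) = \<psi> a"
proof -
  have "\<pi> (SOME b. \<pi> b = \<pi> a) = \<pi> a" by (rule someI) (rule refl)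
  then show ?thesis by (simp add: emb_def pi_eq)
qed

lemma pi_neg: "\<pi> (- a) = \<ominus>\<^bsub>R\<^esub> \<pi> a"
proof -
  interpret cring R by (rule cring)
  have "\<pi> (- a) \<oplus>\<^bsub>R\<^esub> \<pi> a = \<zero>\<^bsub>R\<^esub>" by (simp flip: pi_add add: pi_zero)
  then show ?thesis using carrier_R by (intro minus_equality[symmetric]) auto
qed

sublocale proj_model R emb "\<lambda>c. \<psi> (Const c)"
proof (rule proj_model.intro)
  show "cring R" by (rule cring)
  show "inj_on emb (carrier R)" unfolding carrier_R by (auto intro!: inj_onI simp: pi_eq)
  fix x y
  show "x \<in> carrier R \<Longrightarrow> y \<in> carrier R \<Longrightarrow> emb (x \<otimes>\<^bsub>R\<^esub> y) = emb x * emb y"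
    unfolding carrier_R by (auto simp: rhom_mult[OF psi] simp flip: pi_mult)
  show "x \<in> carrier R \<Longrightarrow> y \<in> carrier R \<Longrightarrow> emb (x \<oplus>\<^bsub>R\<^esub> y) = emb x + emb y"
    unfolding carrier_R by (auto simp: rhom_add[OF psi] simp flip: pi_add)
  show "emb \<one>\<^bsub>R\<^esub> = 1" by (simp add: rhom_1[OF psi] flip: pi_one)
  fix m n :: nat and a b
  show "hpart R n \<subseteq> carrier R" unfolding hpart_R carrier_R by blast
  show "\<zero>\<^bsub>R\<^esub> \<in> hpart R n" unfolding hpart_R pi_zero[symmetric] using forms_0 by blast
  show "a \<in> hpart R n \<Longrightarrow> b \<in> hpart R n \<Longrightarrow> a \<oplus>\<^bsub>R\<^esub> b \<in> hpart R n"
    unfolding hpart_R using forms_add by (auto simp flip: pi_add intro!: imageI)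
  show "a \<in> hpart R n \<Longrightarrow> \<ominus>\<^bsub>R\<^esub> a \<in> hpart R n"
    unfolding hpart_R using forms_neg by (auto simp flip: pi_neg intro!: imageI)
  show "a \<in> hpart R m \<Longrightarrow> b \<in> hpart R n \<Longrightarrow> a \<otimes>\<^bsub>R\<^esub> b \<in> hpart R (m + n)"
    unfolding hpart_R using forms_mult by (auto simp flip: pi_mult intro!: imageI)
  show "\<one>\<^bsub>R\<^esub> \<in> hpart R 0" unfolding hpart_R pi_one[symmetric] using forms_1 by blast
  obtain v where v: "\<psi> (Var v) \<noteq> 0" using nontrivial by blast
  then have "\<pi> (Var v) \<noteq> \<zero>\<^bsub>R\<^esub>" unfolding pi_zero[symmetric] pi_eq by (simp add: rhom_0[OF psi])
  then show "\<exists>n>0. \<exists>a\<in>hpart R n. a \<noteq> \<zero>\<^bsub>R\<^esub>" unfolding hpart_R using forms_Var by (intro exI[of _ 1]) auto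
  fix c
  show "algmap R c \<in> hpart R 0" unfolding hpart_R algmap_R using forms_Const by blast
  show "emb (algmap R c) = \<psi> (Const c)" by (simp add: algmap_R)
qed

section \<open>Points as homogeneous primes of the polynomial ring\<close>

definition lft :: "'a set \<Rightarrow> ('v, 'k) mpoly set" where "lft p = {a. \<pi> a \<in> p}"

text \<open>Homogeneity appears as closure under components, which is easier to verify than
  generation by homogeneous elements; missing a variable replaces not containing the irrelevant
  ideal.\<close>

definition hprime :: "('v, 'k) mpoly set \<Rightarrow> bool" where
  "hprime P \<longleftrightarrow> prime_idl P \<and> (\<forall>a. \<psi> a = 0 \<longrightarrow> a \<in> P) \<and> (\<forall>a\<in>P. \<forall>n. hcomp a n \<in> P) \<and> (\<exists>v. Var v \<notin> P)"

lemma lft_iff: "a \<in> lft p \<longleftrightarrow> \<pi> a \<in> p"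
  by (simp add: lft_def)

lemma prime_lft: assumes "p \<in> pts" shows "prime_idl (lft p)"
  unfolding prime_idl_def
proof (intro conjI allI impI idlI)
  show "0 \<in> lft p" using pts_zero[OF assms] by (simp add: lft_iff pi_zero)
  show "x + y \<in> lft p" if "x \<in> lft p" "y \<in> lft p" for x y
    using that pts_add(1)[OF assms] by (simp add: lft_iff pi_add)
  show "r * x \<in> lft p" if "x \<in> lft p" for r x
    using that pts_mult[OF assms] carrier_R by (simp add: lft_iff pi_mult)
  show "1 \<notin> lft p" using pts_one[OF assms] by (simp add: lft_iff pi_one)
  show "x \<in> lft p \<or> y \<in> lft p" if "x * y \<in> lft p" for x y
    using that pts_mult[OF assms] carrier_R by (simp add: lft_iff pi_mult)
qed

lemma pi_lft: assumes "p \<in> pts" shows "\<pi> ` lft p = p"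
proof
  show "p \<subseteq> \<pi> ` lft p"
  proof
    fix A assume A: "A \<in> p"
    then obtain a where "A = \<pi> a" using pts_carrier[OF assms] carrier_R by blast
    then show "A \<in> \<pi> ` lft p" using A by (auto simp: lft_def)
  qed
qed (auto simp: lft_def)

lemma all_Vars_irrelevant:
  fixes P :: "('v, 'k) mpoly set"
  assumes P: "idl P" and V: "\<And>v. Var v \<in> P" and a: "a \<in> forms n" "0 < n" shows "a \<in> P"
proof -
  have mon: "monm Var m \<in> P" if m: "0 < mdeg m" for m :: "'v \<Rightarrow>\<^sub>0 nat"
  proof -
    obtain i where i: "Poly_Mapping.lookup m i \<noteq> 0" using m by (force simp: mdeg_def)
    have "monm Var m = Var i ^ Poly_Mapping.lookup m i * (\<Prod>j\<in>UNIV - {i}. Var j ^ Poly_Mapping.lookup m j :: ('v, 'k) mpoly)"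
      unfolding monm_def by (simp add: prod.remove[of UNIV i])
    moreover have "Var i ^ Poly_Mapping.lookup m i \<in> P"
      using i V[of i] idl_mult_r[OF P] by (cases "Poly_Mapping.lookup m i") auto
    ultimately show ?thesis using idl_mult_r[OF P] by simp
  qed
  have "a = (\<Sum>m\<in>Poly_Mapping.keys a. Const (Poly_Mapping.lookup a m) * monm Var m)"
    using mpoly_sum_single[of a] by (simp add: single_eq_monm)
  also have "\<dots> \<in> P" using a mon by (intro idl_sum[OF P] idl_mult[OF P]) (auto simp: forms_def)
  finally show ?thesis .
qed

lemma hprime_lft: assumes p: "p \<in> pts" shows "hprime (lft p)"
proof -
  have I: "idl (lft p)" using prime_idl_idl[OF prime_lft[OF p]] .
  have pk: "\<psi> a = 0 \<Longrightarrow> a \<in> lft p" for a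
    using pi_eq[of a 0] pts_zero[OF p] by (simp add: lft_iff pi_zero rhom_0[OF psi])
  have gen: "p = genideal R (p \<inter> homogeneous R)" and irr: "\<not> (\<Union>n\<in>{0<..}. hpart R n) \<subseteq> p"
    using p unfolding proj_points_def by blast+
  \<comment> \<open>The classes having a representative with all components in the lifted ideal form
    an ideal containing the homogeneous members of \<open>p\<close>. As these generate
    \<open>p\<close>, it contains all of \<open>p\<close>.\<close>
  define J where "J = {\<pi> a | a. \<forall>n. hcomp a n \<in> lft p}"
  have JC: "J \<subseteq> carrier R" unfolding J_def carrier_R by blast
  have "ideal J R"
  proof (rule idealI)
    show "ring R" by (rule ring_axioms)
    show "subgroup J (add_monoid R)"
    proof (rule group.subgroupI)
      show "group (add_monoid R)" using a_group .
      show "J \<subseteq> carrier (add_monoid R)" using JC by simp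
      have "\<pi> 0 \<in> J" unfolding J_def using idl_0[OF I] by (auto simp: hcomp_0 intro!: exI[of _ 0])
      then show "J \<noteq> {}" by blast
      fix A assume "A \<in> J"
      then obtain a where a: "A = \<pi> a" "\<And>n. hcomp a n \<in> lft p" unfolding J_def by blast
      have "hcomp (- a) n \<in> lft p" for n using hcomp_diff[of 0 a n] idl_minus[OF I a(2)] by (simp add: hcomp_0)
      then show "inv\<^bsub>add_monoid R\<^esub> A \<in> J" unfolding J_def a(1) a_inv_def[symmetric] pi_neg[symmetric] by blast
      fix B assume "B \<in> J"
      then obtain b where b: "B = \<pi> b" "\<And>n. hcomp b n \<in> lft p" unfolding J_def by blast
      have "hcomp (a + b) n \<in> lft p" for n using idl_add[OF I a(2) b(2)] by (simp add: hcomp_add)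
      then show "A \<otimes>\<^bsub>add_monoid R\<^esub> B \<in> J" unfolding J_def a(1) b(1) by (auto simp flip: pi_add)
    qed
    fix A x assume "A \<in> J" "x \<in> carrier R"
    then obtain a r where a: "A = \<pi> a" "\<And>n. hcomp a n \<in> lft p" "x = \<pi> r" unfolding J_def carrier_R by blast
    have "hcomp (r * a) n \<in> lft p" for n using hcomp_mem_idl_mult[OF I a(2)] .
    then show "x \<otimes>\<^bsub>R\<^esub> A \<in> J" "A \<otimes>\<^bsub>R\<^esub> x \<in> J" unfolding J_def a(1,3)
      by (auto simp flip: pi_mult simp: mult.commute[of a r])
  qed
  moreover have "p \<inter> homogeneous R \<subseteq> J"
  proof
    fix A assume A: "A \<in> p \<inter> homogeneous R"
    then obtain n a where a: "A = \<pi> a" "a \<in> forms n" unfolding homogeneous_def hpart_R by blast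
    have "hcomp a m \<in> lft p" for m
      using A a idl_0[OF I] by (auto simp: hcomp_of_forms[OF a(2)] lft_iff)
    then show "A \<in> J" unfolding J_def a(1) by blast
  qed
  ultimately have pJ: "p \<subseteq> J" using gen genideal_minimal by metis
  have "hcomp a n \<in> lft p" if a: "a \<in> lft p" for a n
  proof -
    obtain b where b: "\<pi> a = \<pi> b" "\<And>n. hcomp b n \<in> lft p" using a pJ unfolding lft_iff J_def by blast
    \<comment> \<open>The representative \<open>b\<close> may differ from \<open>a\<close>, but only
      by a kernel element, whose components are kernel elements too.\<close>
    have "\<psi> (a - b) = 0" using b(1) by (simp add: pi_eq rhom_diff[OF psi])
    then have "hcomp (a - b) n \<in> lft p" using ker_hcomp pk by blast
    then show ?thesis using idl_add[OF I _ b(2)[of n], of "hcomp (a - b) n"] by (simp add: hcomp_diff)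
  qed
  moreover have "\<exists>v. Var v \<notin> lft p"
  proof (rule ccontr)
    assume "\<not> ?thesis"
    then have "a \<in> lft p" if "a \<in> forms n" "0 < n" for a n using all_Vars_irrelevant[OF I] that by blast
    then show False using irr unfolding hpart_R lft_iff by blast
  qed
  ultimately show ?thesis unfolding hprime_def using prime_lft[OF p] pk by blast
qed

lemma lft_image: assumes P: "hprime P" shows "lft (\<pi> ` P) = P"
proof
  show "lft (\<pi> ` P) \<subseteq> P"
  proof
    fix a assume "a \<in> lft (\<pi> ` P)"
    then obtain b where b: "\<pi> a = \<pi> b" "b \<in> P" unfolding lft_iff by blast
    then have "\<psi> (a - b) = 0" by (simp add: pi_eq rhom_diff[OF psi])
    then have "a - b \<in> P" "idl P" using P unfolding hprime_def prime_idl_def by blast+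
    then show "a \<in> P" using idl_add[of P "a - b" b] b(2) by simp
  qed
qed (auto simp: lft_iff)

lemma image_pts: assumes P: "hprime P" shows "\<pi> ` P \<in> pts"
proof -
  have pr: "prime_idl P" using P by (simp add: hprime_def)
  note I = prime_idl_idl[OF pr]
  have mem: "\<pi> a \<in> \<pi> ` P \<longleftrightarrow> a \<in> P" for a using lft_image[OF P] by (auto simp: lft_def)
  have ideal: "ideal (\<pi> ` P) R"
  proof (rule idealI)
    show "ring R" by (rule ring_axioms)
    show "subgroup (\<pi> ` P) (add_monoid R)"
    proof (rule group.subgroupI)
      show "group (add_monoid R)" using a_group .
      show "\<pi> ` P \<subseteq> carrier (add_monoid R)" using carrier_R by auto
      show "\<pi> ` P \<noteq> {}" using idl_0[OF I] by blast
      show "inv\<^bsub>add_monoid R\<^esub> A \<in> \<pi> ` P" if "A \<in> \<pi> ` P" for A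
        using that idl_minus[OF I] by (auto simp flip: a_inv_def pi_neg)
      show "A \<otimes>\<^bsub>add_monoid R\<^esub> B \<in> \<pi> ` P" if "A \<in> \<pi> ` P" "B \<in> \<pi> ` P" for A B
        using that idl_add[OF I] by (auto simp flip: pi_add)
    qed
    show "x \<otimes>\<^bsub>R\<^esub> A \<in> \<pi> ` P" "A \<otimes>\<^bsub>R\<^esub> x \<in> \<pi> ` P" if "A \<in> \<pi> ` P" "x \<in> carrier R" for A x
      using that idl_mult[OF I] idl_mult_r[OF I] unfolding carrier_R by (auto simp flip: pi_mult)
  qed
  have "primeideal (\<pi> ` P) R"
  proof (rule primeidealI[OF ideal cring])
    have "\<pi> 1 \<notin> \<pi> ` P" using prime_idl_1[OF pr] mem by blast
    then show "carrier R \<noteq> \<pi> ` P" using carrier_R by blast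
    show "A \<in> \<pi> ` P \<or> B \<in> \<pi> ` P" if AB: "A \<in> carrier R" "B \<in> carrier R" "A \<otimes>\<^bsub>R\<^esub> B \<in> \<pi> ` P" for A B
    proof -
      obtain a b where "A = \<pi> a" "B = \<pi> b" using AB unfolding carrier_R by blast
      then show ?thesis using AB(3) mem prime_idl_mult[OF pr] by (simp flip: pi_mult)
    qed
  qed
  moreover have "\<pi> ` P = genideal R (\<pi> ` P \<inter> homogeneous R)"
  proof
    let ?G = "genideal R (\<pi> ` P \<inter> homogeneous R)"
    have hs: "\<pi> ` P \<inter> homogeneous R \<subseteq> carrier R" using carrier_R by auto
    interpret G: ideal ?G R using genideal_ideal[OF hs] .
    have GI: "idl {a. \<pi> a \<in> ?G}"
      by (rule idlI) (auto simp: pi_zero pi_add pi_mult carrier_R intro: G.I_l_closed)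
    show "\<pi> ` P \<subseteq> ?G"
    proof
      fix A assume "A \<in> \<pi> ` P"
      then obtain a where a: "A = \<pi> a" "a \<in> P" by blast
      have "hcomp a n \<in> {a. \<pi> a \<in> ?G}" for n
      proof -
        have "hcomp a n \<in> P" using P a(2) by (simp add: hprime_def)
        then have "\<pi> (hcomp a n) \<in> \<pi> ` P \<inter> homogeneous R"
          using hcomp_forms unfolding homogeneous_def hpart_R by blast
        then show ?thesis using genideal_self[OF hs] by blast
      qed
      then have "a \<in> {a. \<pi> a \<in> ?G}" by (rule hcomps_mem[OF GI])
      then show "A \<in> ?G" using a(1) by simp
    qed
    show "?G \<subseteq> \<pi> ` P" by (rule genideal_minimal[OF ideal]) blast
  qed
  moreover have "\<not> (\<Union>n\<in>{0<..}. hpart R n) \<subseteq> \<pi> ` P"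
  proof -
    obtain v where "Var v \<notin> P" using P by (auto simp: hprime_def)
    then have "\<pi> (Var v) \<notin> \<pi> ` P" "\<pi> (Var v) \<in> hpart R 1" using mem forms_Var unfolding hpart_R by blast+
    then show ?thesis by (metis UN_I greaterThan_iff subsetD zero_less_one)
  qed
  ultimately show ?thesis unfolding proj_points_def by blast
qed

lemma Oc_psi: "Oc p = {\<psi> a / \<psi> s | a s n. a \<in> forms n \<and> s \<in> forms n \<and> s \<notin> lft p}"
  unfolding Oc_def hpart_R lft_iff by (auto simp: image_iff) (metis emb_pi)+

lemma psi_nz: "p \<in> pts \<Longrightarrow> s \<notin> lft p \<Longrightarrow> \<psi> s \<noteq> 0"
  using hprime_lft unfolding hprime_def by blast

lemma unit_Oc_psi:
  assumes "p \<in> pts" "a \<in> forms n" "s \<in> forms n" "s \<notin> lft p"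
  shows "\<psi> a / \<psi> s \<noteq> 0 \<and> inverse (\<psi> a / \<psi> s) \<in> Oc p \<longleftrightarrow> a \<notin> lft p"
  using unit_OO_iff[OF assms(1), of "\<pi> a" n "\<pi> s"] assms by (simp add: hpart_R lft_iff)

lemma Oc_psiI: "a \<in> forms n \<Longrightarrow> s \<in> forms n \<Longrightarrow> s \<notin> lft p \<Longrightarrow> \<psi> a / \<psi> s \<in> Oc p"
  unfolding Oc_psi by blast

end

lemma polynomial_algebra_simps:
  "carrier polynomial_algebra = UNIV" "\<one>\<^bsub>polynomial_algebra\<^esub> = 1" "\<zero>\<^bsub>polynomial_algebra\<^esub> = 0"
  "x \<otimes>\<^bsub>polynomial_algebra\<^esub> y = x * y" "x \<oplus>\<^bsub>polynomial_algebra\<^esub> y = x + y"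
  "hpart polynomial_algebra n = (forms n :: ('v::finite, 'k::comm_ring_1) mpoly set)" "algmap polynomial_algebra c = Const c"
  by (simp_all add: polynomial_algebra_def ring.defs graded_algebra.defs ring_of_type_algebra_def forms_def mdeg_keys)

lemma cring_polynomial_algebra: "cring (polynomial_algebra :: (('v::finite, 'k::comm_ring_1) mpoly, 'k) graded_algebra)"
proof (rule cringI)
  show "abelian_group (polynomial_algebra :: (('v, 'k) mpoly, 'k) graded_algebra)"
    by (rule abelian_groupI) (auto simp: polynomial_algebra_simps algebra_simps intro: exI[of _ "- x" for x])
  show "Group.comm_monoid (polynomial_algebra :: (('v, 'k) mpoly, 'k) graded_algebra)"
    by (rule comm_monoidI) (auto simp: polynomial_algebra_simps algebra_simps)
qed (auto simp: polynomial_algebra_simps algebra_simps)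

lemma polynomial_model:
  fixes \<psi> :: "('v::finite, 'k::field) mpoly \<Rightarrow> 'g::field"
  assumes "rhom \<psi>" "inj \<psi>"
  shows "poly_model polynomial_algebra (\<lambda>a. a) \<psi>"
proof (rule poly_model.intro)
  have z: "\<psi> a = 0 \<longleftrightarrow> a = 0" for a using assms by (metis injD rhom_0)
  show "\<psi> a = 0 \<Longrightarrow> \<psi> (hcomp a n) = 0" for a n by (simp add: z hcomp_0)
  show "\<exists>v. \<psi> (Var v) \<noteq> 0" proof -
    have "Poly_Mapping.lookup (Var v) (Poly_Mapping.single v 1) = (1 :: 'k)" for v :: 'v by (simp add: Var_def)
    then show ?thesis unfolding z by (metis lookup_zero zero_neq_one)
  qed
qed (use assms cring_polynomial_algebra in \<open>auto simp: polynomial_algebra_simps inj_eq\<close>)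

text \<open>The coset of \<open>a\<close> is the set of \<open>x\<close> with
  \<open>f dvd x - a\<close>, so equality of cosets is divisibility of the difference, which
  \<open>ker\<close> translates into equality of values. The kernel is homogeneous because
  \<open>f\<close> is a form.\<close>

lemma quotient_model:
  fixes f :: "('v::finite, 'k::field) mpoly" and \<psi> :: "('v, 'k) mpoly \<Rightarrow> 'g::field"
  assumes psi: "rhom \<psi>" and ker: "\<And>a. \<psi> a = 0 \<longleftrightarrow> f dvd a" and f: "f \<in> forms d" and nt: "\<exists>v. \<psi> (Var v) \<noteq> 0"
  defines "I \<equiv> PIdl\<^bsub>polynomial_algebra\<^esub> f"
  shows "poly_model (quotient_algebra polynomial_algebra I) (\<lambda>a. I +>\<^bsub>polynomial_algebra\<^esub> a) \<psi>"
proof -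
  let ?S = "polynomial_algebra :: (('v, 'k) mpoly, 'k) graded_algebra"
  let ?Q = "quotient_algebra ?S I"
  interpret S: cring ?S by (rule cring_polynomial_algebra)
  have I: "I = {a. f dvd a}" unfolding I_def cgenideal_def by (auto simp: polynomial_algebra_simps dvd_def mult.commute)
  interpret I: ideal I ?S unfolding I_def by (rule S.cgenideal_ideal) (simp add: polynomial_algebra_simps)
  let ?c = "\<lambda>a. I +>\<^bsub>?S\<^esub> a"
  have ops: "carrier ?Q = carrier (?S Quot I)" "\<And>x y. x \<otimes>\<^bsub>?Q\<^esub> y = x \<otimes>\<^bsub>?S Quot I\<^esub> y" "\<And>x y. x \<oplus>\<^bsub>?Q\<^esub> y = x \<oplus>\<^bsub>?S Quot I\<^esub> y"
    "\<one>\<^bsub>?Q\<^esub> = \<one>\<^bsub>?S Quot I\<^esub>" "\<zero>\<^bsub>?Q\<^esub> = \<zero>\<^bsub>?S Quot I\<^esub>"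
    "\<And>n. hpart ?Q n = ?c ` hpart ?S n" "\<And>c. algmap ?Q c = ?c (algmap ?S c)"
    by (simp_all add: quotient_algebra_def ring.defs graded_algebra.defs)
  interpret Q: cring "?S Quot I" using I.quotient_is_cring[OF S.is_cring] .
  have cQ: "carrier ?Q = range ?c"
    by (auto simp: ops FactRing_def A_RCOSETS_def' polynomial_algebra_simps)
  show ?thesis
  proof (rule poly_model.intro)
    show "cring ?Q"
    proof (rule cringI)
      show "abelian_group ?Q"
        by (rule abelian_groupI) (auto simp: ops Q.a_ac intro: bexI[of _ "\<ominus>\<^bsub>?S Quot I\<^esub> x" for x] Q.l_neg)
      show "Group.comm_monoid ?Q"
        by (rule comm_monoidI) (auto simp: ops Q.m_ac)
    qed (auto simp: ops Q.l_distr)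
    show "carrier ?Q = range ?c" by (rule cQ)
    show "?c (a + b) = ?c a \<oplus>\<^bsub>?Q\<^esub> ?c b" for a b
      using I.a_rcos_sum[of a b] by (simp add: ops FactRing_def polynomial_algebra_simps)
    show "?c (a * b) = ?c a \<otimes>\<^bsub>?Q\<^esub> ?c b" for a b
      using I.rcoset_mult_add[of a b] by (simp add: ops FactRing_def polynomial_algebra_simps)
    show "?c 1 = \<one>\<^bsub>?Q\<^esub>" by (simp add: ops FactRing_def polynomial_algebra_simps)
    show "?c 0 = \<zero>\<^bsub>?Q\<^esub>" by (auto simp: ops FactRing_def a_r_coset_def' polynomial_algebra_simps)
    show "hpart ?Q n = ?c ` forms n" for n by (simp add: ops polynomial_algebra_simps)
    show "algmap ?Q c = ?c (Const c)" for c by (simp add: ops polynomial_algebra_simps)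
    show "rhom \<psi>" by fact
    show "?c a = ?c b \<longleftrightarrow> \<psi> a = \<psi> b" for a b
    proof -
      have "?c a = {x. f dvd x - a}" for a
        by (auto simp: a_r_coset_def' I polynomial_algebra_simps)
      note c = this
      have "?c a = ?c b \<longleftrightarrow> f dvd a - b"
      proof
        assume "?c a = ?c b"
        moreover have "a \<in> ?c a" unfolding c by simp
        ultimately show "f dvd a - b" unfolding c by simp
      next
        assume ab: "f dvd a - b"
        have "f dvd x - a \<longleftrightarrow> f dvd x - b" for x
          using dvd_add_left_iff[OF ab, of "x - a"] by simp
        then show "?c a = ?c b" unfolding c by simp
      qed
      also have "\<dots> \<longleftrightarrow> \<psi> a = \<psi> b" using ker[of "a - b"] by (simp add: rhom_diff[OF psi])
      finally show ?thesis .
    qed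
    show "\<psi> (hcomp a n) = 0" if "\<psi> a = 0" for a n
    proof -
      obtain b where "a = f * b" using \<open>\<psi> a = 0\<close> ker by (auto simp: dvd_def)
      then show ?thesis unfolding ker by (simp add: hcomp_forms_mult[OF f])
    qed
    show "\<exists>v. \<psi> (Var v) \<noteq> 0" by (rule nt)
  qed
qed

section \<open>Derivations and the function field of the cubic\<close>

lemma kaehler_d_add: "kaehler_d (a + b) = kaehler_d a + kaehler_d b"
proof (transfer, unfold kaehler_equiv_def)
  fix a b :: 'a
  have "Poly_Mapping.single (a + b) 1 - Poly_Mapping.single a 1 - Poly_Mapping.single b 1 \<in> (kaehler_generators :: ('a \<Rightarrow>\<^sub>0 'a) set)"
    unfolding kaehler_generators_def by blast
  then show "Poly_Mapping.single (a + b) 1 - (Poly_Mapping.single a 1 + Poly_Mapping.single b 1) \<in> (kaehler_relations :: ('a \<Rightarrow>\<^sub>0 'a) set)"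
    using free_mod.span_base by (simp add: diff_diff_eq)
qed

lemma kaehler_d_mult: "kaehler_d (a * b) = kaehler_scale a (kaehler_d b) + kaehler_scale b (kaehler_d a)"
proof (transfer, unfold kaehler_equiv_def)
  fix a b :: 'a
  have "Poly_Mapping.single (a * b) 1 - free_scale a (Poly_Mapping.single b 1)
        - free_scale b (Poly_Mapping.single a 1) \<in> (kaehler_generators :: ('a \<Rightarrow>\<^sub>0 'a) set)"
    unfolding kaehler_generators_def by blast
  then show "Poly_Mapping.single (a * b) 1 - (free_scale a (Poly_Mapping.single b 1) + free_scale b (Poly_Mapping.single a 1))
      \<in> (kaehler_relations :: ('a \<Rightarrow>\<^sub>0 'a) set)"
    using free_mod.span_base by (simp add: diff_diff_eq)
qed

text \<open>A linear functional on the differentials composed with \<open>kaehler_d\<close> is a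
  derivation, and linear independence of the two differentials permits prescribing the functional on
  both.\<close>

lemma p_independent_derivation:
  fixes t1 t2 a b :: "'f::field"
  assumes "p_independent [t1, t2]"
  obtains D where "derivn D" "D t1 = a" "D t2 = b"
proof -
  interpret vp: vector_space_pair "kaehler_scale :: 'f \<Rightarrow> 'f kaehler \<Rightarrow> _" "(*) :: 'f \<Rightarrow> 'f \<Rightarrow> 'f"
    by unfold_locales (simp_all add: algebra_simps)
  have ind: "kaehler.independent {kaehler_d t1, kaehler_d t2}" and ne: "kaehler_d t1 \<noteq> kaehler_d t2"
    using assms by (simp_all add: p_independent_def)
  obtain g where g: "Vector_Spaces.linear (kaehler_scale :: 'f \<Rightarrow> _) (*) g"
    "\<And>x. x \<in> {kaehler_d t1, kaehler_d t2} \<Longrightarrow> g x = (if x = kaehler_d t1 then a else b)"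
    using vp.linear_independent_extend[OF ind, of "\<lambda>x. if x = kaehler_d t1 then a else b"] by blast
  interpret g: Vector_Spaces.linear "kaehler_scale :: 'f \<Rightarrow> _" "(*)" g by (rule g(1))
  have "derivn (\<lambda>x. g (kaehler_d x))"
    unfolding derivn_def by (simp add: kaehler_d_add kaehler_d_mult g.add g.scale)
  then show ?thesis using that g(2) ne by simp
qed

lemma derivn_square_zero:
  assumes "derivn D" "(2 :: 'a::comm_ring_1) = 0" shows "D ((x :: 'a) ^ 2) = 0"
  using assms by (simp add: derivn_power2)

text \<open>A finite field of characteristic two is perfect, so every element is a square, and
  squares are killed by all derivations.\<close>

lemma infinite_field_derivn:
  fixes D :: "'f::field \<Rightarrow> 'f"
  assumes D: "derivn D" and two: "(2 :: 'f) = 0" and t: "D t \<noteq> 0"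
  shows "infinite (UNIV :: 'f set)"
proof
  assume fin: "finite (UNIV :: 'f set)"
  have "inj (\<lambda>x :: 'f. x ^ 2)"
  proof (rule injI)
    fix x y :: 'f assume "x ^ 2 = y ^ 2"
    then have "(x - y) ^ 2 = 0" by (simp add: power2_diff two)
    then show "x = y" by simp
  qed
  with fin have "surj (\<lambda>x :: 'f. x ^ 2)" by (rule finite_UNIV_inj_surj)
  then obtain x where "t = x ^ 2" by (auto elim: surjE)
  then show False using t derivn_square_zero[OF D two] by simp
qed

instance coord :: finite
proof
  show "finite (UNIV :: coord set)"
    by (rule finite_subset[of _ "{X1, X2, Y1, Y2}"]) (auto intro: coord.exhaust)
qed

section \<open>Polynomials in three variables\<close>

abbreviation cc :: "'a::comm_ring_1 \<Rightarrow> 'a poly poly poly" where "cc c \<equiv> [:[:[:c:]:]:]"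

text \<open>The inner, middle and outer variable of the nested polynomial ring.\<close>

abbreviation vi :: "'a::comm_ring_1 poly poly poly" where "vi \<equiv> [:[:[:0, 1:]:]:]"
abbreviation vm :: "'a::comm_ring_1 poly poly poly" where "vm \<equiv> [:[:0, 1:]:]"
abbreviation vo :: "'a::comm_ring_1 poly poly poly" where "vo \<equiv> [:0, 1:]"

lemma rhom_cc: "rhom (cc :: 'a::comm_ring_1 \<Rightarrow> _)"
  by (intro rhom_comp[OF rhom_const_poly] rhom_const_poly)

definition pev3 :: "('a::comm_ring_1 \<Rightarrow> 'b::comm_ring_1) \<Rightarrow> 'b \<Rightarrow> 'b \<Rightarrow> 'b \<Rightarrow> 'a poly poly poly \<Rightarrow> 'b" where
  "pev3 c r1 r2 r3 = pev (pev (pev c r1) r2) r3"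

lemma rhom_pev3: "rhom c \<Longrightarrow> rhom (pev3 c r1 r2 r3)"
  unfolding pev3_def by (intro rhom_pev)

lemma pev3_simps:
  assumes "rhom c"
  shows "pev3 c r1 r2 r3 (cc a) = c a" "pev3 c r1 r2 r3 vi = r1" "pev3 c r1 r2 r3 vm = r2" "pev3 c r1 r2 r3 vo = r3"
  using assms by (simp_all add: pev3_def pev_const pev_var rhom_pev)

lemma poly3_closed_induct:
  fixes p :: "'a::comm_ring_1 poly poly poly"
  assumes C: "\<And>c. P (cc c)" and V: "P vi" "P vm" "P vo"
    and A: "\<And>x y. P x \<Longrightarrow> P y \<Longrightarrow> P (x + y)" and M: "\<And>x y. P x \<Longrightarrow> P y \<Longrightarrow> P (x * y)"
  shows "P p"
proof (induction p rule: poly_closed_induct)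
  fix c :: "'a poly poly"
  show "P [:c:]"
  proof (induction c rule: poly_closed_induct)
    fix d :: "'a poly"
    show "P [:[:d:]:]"
    proof (induction d rule: poly_closed_induct)
      fix x y :: "'a poly" assume "P [:[:x:]:]" "P [:[:y:]:]"
      then show "P [:[:x + y:]:]" "P [:[:x * y:]:]" using A[of "[:[:x:]:]" "[:[:y:]:]"] M[of "[:[:x:]:]" "[:[:y:]:]"] by (simp_all add: mult.commute)
    qed (use C V in auto)
    fix x y :: "'a poly poly" assume "P [:x:]" "P [:y:]"
    then show "P [:x + y:]" "P [:x * y:]" using A[of "[:x:]" "[:y:]"] M[of "[:x:]" "[:y:]"] by (simp_all add: mult.commute)
  qed (use V in auto)
qed (use V A M in auto)

lemma rhom_to_fract: "rhom (to_fract :: 'a::idom \<Rightarrow> 'a fract)"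
  by (rule rhomI) (simp_all add: to_fract_def One_fract_def)

lemma to_fract_inj: "to_fract (x :: 'a::idom) = to_fract y \<Longrightarrow> x = y"
  by (simp add: to_fract_def eq_fract)

lemma prime_elem_vo: "prime_elem ([:0, 1:] :: 'a::idom poly)"
proof (rule prime_elemI)
  have d: "[:0, 1:] dvd p \<longleftrightarrow> poly p 0 = 0" for p :: "'a poly"
    using poly_eq_0_iff_dvd[of p 0] by simp
  show "\<not> [:0, 1:] dvd (1 :: 'a poly)" unfolding d by simp
  show "[:0, 1:] dvd a \<or> [:0, 1:] dvd b" if "[:0, 1:] dvd a * b" for a b :: "'a poly"
    using that unfolding d by simp
qed simp

lemma prime_elem_power_cancel:
  fixes q :: "'a::idom"
  assumes q: "prime_elem q" and nd: "\<not> q dvd P" and eq: "q ^ k * h = P * w"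
  shows "P dvd h"
  using eq
proof (induction k arbitrary: w)
  case (Suc k)
  have "q dvd P * w" using Suc.prems by (metis dvd_triv_left mult.assoc power_Suc)
  then obtain w' where w': "w = q * w'" using q nd prime_elem_dvd_mult_iff by blast
  have "q * (q ^ k * h) = q * (P * w')" using Suc.prems w' by (simp add: algebra_simps)
  then have "q ^ k * h = P * w'" using q by (simp add: prime_elem_def)
  then show ?case by (rule Suc.IH)
qed simp

text \<open>Pseudo-division by \<open>P\<close> multiplies \<open>h\<close> by a power of the
  leading coefficient, which is a unit times a power of \<open>q\<close>. The remainder vanishes by
  \<open>lin\<close>, and since the prime \<open>q\<close> does not divide \<open>P\<close>, the
  power of \<open>q\<close> can be cancelled again.\<close>

lemma poly_mod_kernel:
  fixes P :: "'c::idom poly" and j :: "'c \<Rightarrow> 'g::field"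
  assumes j: "rhom j" and root: "pev j r P = 0"
    and lin: "\<And>p. p = 0 \<or> degree p < degree P \<Longrightarrow> pev j r p = 0 \<Longrightarrow> p = 0"
    and lc: "lead_coeff P = u * q ^ e" "u * u' = 1" "prime_elem q" "\<not> [:q:] dvd P"
    and h: "pev j r h = 0"
  shows "P dvd h"
proof -
  note J = rhom_pev[OF j, of r]
  have P0: "P \<noteq> 0" using lc by (auto simp: prime_elem_def)
  obtain w p where wp: "pseudo_divmod h P = (w, p)" by force
  define k where "k = Suc (degree h) - degree P"
  have eq: "smult ((u * q ^ e) ^ k) h = P * w + p" "p = 0 \<or> degree p < degree P"
    using pseudo_divmod[OF P0 wp] lc(1) by (simp_all add: k_def)
  have "pev j r (smult ((u * q ^ e) ^ k) h) = 0"
    using h rhom_mult[OF J, of "[:(u * q ^ e) ^ k:]" h] by simp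
  then have "pev j r p = 0" using eq(1) root by (simp add: rhom_add[OF J] rhom_mult[OF J])
  then have "p = 0" using lin eq(2) by blast
  then have "smult (u' ^ k) (smult ((u * q ^ e) ^ k) h) = smult (u' ^ k) (P * w)" using eq(1) by simp
  moreover have "u' ^ k * (u * q ^ e) ^ k = (q ^ e) ^ k"
  proof -
    have "u' ^ k * (u * q ^ e) ^ k = (u * u') ^ k * (q ^ e) ^ k"
      by (simp only: power_mult_distrib mult_ac)
    then show ?thesis using lc(2) by simp
  qed
  ultimately have "[:q:] ^ (e * k) * h = P * smult (u' ^ k) w"
    by (simp add: power_mult rhom_power[OF rhom_const_poly, symmetric])
  then show ?thesis using prime_elem_power_cancel lift_prime_elem_poly[OF lc(3)] lc(4) by blast
qed

text \<open>The algebraic closure serves to provide a square root; the function field of the cubic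
  sits inside it.\<close>

type_synonym 'f ffield = "'f poly poly poly fract alg_closure"

text \<open>A dual pair of derivations is what is used of \<open>p\<close>-independence. As locale
  parameters they make the situation symmetric in the two indices.\<close>

locale cubic_field =
  fixes t1 t2 :: "'f::field" and D1 D2 :: "'f \<Rightarrow> 'f"
  assumes two: "(2 :: 'f) = 0"
    and D1: "derivn D1" "D1 t1 = 1" "D1 t2 = 0"
    and D2: "derivn D2" "D2 t1 = 0" "D2 t2 = 1"
begin

lemma t_nz: "t1 \<noteq> 0" "t2 \<noteq> 0"
  using derivn_0[OF D1(1)] derivn_0[OF D2(1)] D1 D2 by auto

definition jj :: "'f poly poly poly \<Rightarrow> 'f ffield" where "jj c = to_ac (to_fract c)"

lemma rhom_jj: "rhom jj"
  unfolding jj_def by (rule rhom_comp[OF _ rhom_to_fract]) (rule rhomI, simp_all)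

lemma jj_eq_0: "jj c = 0 \<longleftrightarrow> c = 0"
  unfolding jj_def by (simp add: to_fract_def Zero_fract_def eq_fract)

lemma jj_inj: "jj c = jj d \<Longrightarrow> c = d"
  using jj_eq_0[of "c - d"] by (simp add: rhom_diff[OF rhom_jj])

text \<open>The function field is \<open>F(x\<^sub>2,y\<^sub>2,y\<^sub>1)(x\<^sub>1)\<close>, since the cubic is quadratic in \<open>x\<^sub>1\<close>:
  \<open>t\<^sub>1y\<^sub>1x\<^sub>1\<^sup>2 + c\<^sub>0 = 0\<close>.\<close>

definition c0 :: "'f poly poly poly" where "c0 = vo ^ 3 + vm ^ 3 + cc t2 * vi ^ 2 * vm"

text \<open>The value at \<open>y1 = 0\<close>, \<open>y2 = 1\<close>, \<open>x2 = 0\<close> shows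
  at once that \<open>c0\<close> is nonzero and not divisible by \<open>y1\<close>.\<close>

lemma c0_value: "poly (poly (poly c0 0) 1) 0 = 1"
  by (simp add: c0_def)

definition \<rho> :: "'f ffield" where "\<rho> = (SOME r. r ^ 2 = jj c0 / jj (cc t1 * vo))"

text \<open>In characteristic two this is the cubic equation for \<open>x1 = \<rho>\<close>; the
  minus sign disappears.\<close>

lemma rho: "jj (cc t1 * vo) * \<rho> ^ 2 = jj c0"
proof -
  have "\<exists>r. r ^ 2 = jj c0 / jj (cc t1 * vo)" using nth_root_exists[of 2] by simp
  then have "\<rho> ^ 2 = jj c0 / jj (cc t1 * vo)" unfolding \<rho>_def by (rule someI_ex)
  then show ?thesis using t_nz by (simp add: jj_eq_0)
qed

text \<open>The polynomial ring rewritten as \<open>F[x2,y2,y1][x1]\<close>, where division by the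
  cubic is division in the single variable \<open>x1\<close>; \<open>\<Theta>'\<close> leads
  back.\<close>

definition \<Theta> :: "(coord, 'f) mpoly \<Rightarrow> 'f poly poly poly poly" where
  "\<Theta> = mev (\<lambda>c. [:cc c:]) (\<lambda>v. case v of X1 \<Rightarrow> [:0, 1:] | X2 \<Rightarrow> [:vi:] | Y1 \<Rightarrow> [:vo:] | Y2 \<Rightarrow> [:vm:])"

definition \<Theta>' :: "'f poly poly poly poly \<Rightarrow> (coord, 'f) mpoly" where
  "\<Theta>' = pev (pev3 Const (Var X2) (Var Y2) (Var Y1)) (Var X1)"

definition \<psi> :: "(coord, 'f) mpoly \<Rightarrow> 'f ffield" where
  "\<psi> = mev (\<lambda>c. jj (cc c)) (\<lambda>v. case v of X1 \<Rightarrow> \<rho> | X2 \<Rightarrow> jj vi | Y1 \<Rightarrow> jj vo | Y2 \<Rightarrow> jj vm)"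

lemma rhom_cpc: "rhom (\<lambda>c :: 'f. [:cc c:])" and rhom_jc: "rhom (\<lambda>c. jj (cc c))"
  by (intro rhom_comp[OF rhom_const_poly] rhom_comp[OF rhom_jj] rhom_cc)+

lemma rhom_Theta: "rhom \<Theta>" and rhom_psi: "rhom \<psi>" and rhom_Theta': "rhom \<Theta>'"
  unfolding \<Theta>_def \<psi>_def \<Theta>'_def
  by (intro rhom_mev rhom_cpc rhom_jc rhom_pev rhom_pev3 rhom_Const)+

lemma Theta_simps: "\<Theta> (Const c) = [:cc c:]" "\<Theta> (Var X1) = [:0, 1:]" "\<Theta> (Var X2) = [:vi:]"
  "\<Theta> (Var Y1) = [:vo:]" "\<Theta> (Var Y2) = [:vm:]"
  by (simp_all add: \<Theta>_def mev_Const[OF rhom_cpc] mev_Var[OF rhom_cpc])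

lemma psi_simps: "\<psi> (Const c) = jj (cc c)" "\<psi> (Var X1) = \<rho>" "\<psi> (Var X2) = jj vi"
  "\<psi> (Var Y1) = jj vo" "\<psi> (Var Y2) = jj vm"
  by (simp_all add: \<psi>_def mev_Const[OF rhom_jc] mev_Var[OF rhom_jc])

lemma Theta'_Theta: "\<Theta>' (\<Theta> p) = p"
proof (rule rhom_mpoly_ext[of "\<lambda>p. \<Theta>' (\<Theta> p)" "\<lambda>p. p"])
  show "rhom (\<lambda>p. \<Theta>' (\<Theta> p))" by (rule rhom_comp[OF rhom_Theta' rhom_Theta])
  show "rhom (\<lambda>p :: (coord, 'f) mpoly. p)" by (simp add: rhom_def)
  show "\<Theta>' (\<Theta> (Const c)) = Const c" for c
    by (simp add: Theta_simps \<Theta>'_def pev_const rhom_pev3 rhom_Const pev3_simps)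
  show "\<Theta>' (\<Theta> (Var v)) = Var v" for v
    by (cases v) (simp_all add: Theta_simps \<Theta>'_def pev_const pev_var rhom_pev3 rhom_Const pev3_simps)
qed

lemma psi_Theta: "\<psi> p = pev jj \<rho> (\<Theta> p)"
proof (rule rhom_mpoly_ext[OF rhom_psi rhom_comp[OF rhom_pev[OF rhom_jj] rhom_Theta]])
  show "\<psi> (Const c) = pev jj \<rho> (\<Theta> (Const c))" for c
    by (simp add: psi_simps Theta_simps pev_const[OF rhom_jj])
  show "\<psi> (Var v) = pev jj \<rho> (\<Theta> (Var v))" for v
    by (cases v) (simp_all add: psi_simps Theta_simps pev_const[OF rhom_jj] pev_var[OF rhom_jj])
qed

lemma Theta_cubic: "\<Theta> (cubic t1 t2) = [:c0, 0, cc t1 * vo:]"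
proof -
  have "\<Theta> (cubic t1 t2) = [:vo:] ^ 3 + [:cc t1:] * [:0, 1:] ^ 2 * [:vo:] + [:vm:] ^ 3 + [:cc t2:] * [:vi:] ^ 2 * [:vm:]"
    unfolding cubic_def by (simp add: rhom_simps[OF rhom_Theta] Theta_simps)
  also have "\<dots> = [:c0, 0, cc t1 * vo:]"
    by (simp add: c0_def power2_eq_square power3_eq_cube algebra_simps)
  finally show ?thesis .
qed

lemma two_poly: "(2 :: 'f poly poly poly) = 0"
  by (simp add: numeral_poly two)

text \<open>A relation between \<open>1\<close> and \<open>\<rho>\<close> would make
  \<open>c0 / (t1 y1)\<close> a square. The extension of \<open>D1\<close> to coefficients kills all
  squares and \<open>c0\<close>, but sends \<open>t1 y1\<close> to \<open>y1\<close>, which leaves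
  \<open>h0^2 y1 = 0\<close>.\<close>

lemma linear_over_jj:
  assumes "jj h0 + jj h1 * \<rho> = 0" shows "h0 = 0 \<and> h1 = 0"
proof -
  have "jj h0 = - (jj h1 * \<rho>)" using assms by (simp add: eq_neg_iff_add_eq_0)
  then have "jj h0 ^ 2 = jj h1 ^ 2 * \<rho> ^ 2" by (simp add: power_mult_distrib)
  then have "jj (cc t1 * vo) * jj h0 ^ 2 = jj h1 ^ 2 * jj c0" by (simp add: mult_ac flip: rho)
  then have "jj (cc t1 * vo * h0 ^ 2) = jj (h1 ^ 2 * c0)"
    by (simp only: rhom_mult[OF rhom_jj] rhom_power[OF rhom_jj])
  then have eq: "cc t1 * vo * h0 ^ 2 = h1 ^ 2 * c0" by (rule jj_inj)
  define D where "D = map_poly (map_poly (map_poly D1))"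
  have D: "derivn D" unfolding D_def by (intro derivn_map_poly D1)
  have z: "D1 0 = 0" "D1 1 = 0" "map_poly D1 0 = 0" using derivn_0 derivn_1 D1 by auto
  have Dv: "D vo = 0" "D vm = 0" "D (cc t2) = 0" "D (cc t1) = 1"
    unfolding D_def using z by (simp_all add: map_poly_pCons D1 one_pCons)
  have D3: "D (x ^ 3) = x ^ 2 * D x" for x
  proof -
    have "D (x ^ 3) = x * D (x ^ 2) + x ^ 2 * D x"
      using derivn_mult[OF D, of x "x ^ 2"] by (simp add: power3_eq_cube power2_eq_square mult.assoc)
    then show ?thesis using derivn_square_zero[OF D two_poly] by simp
  qed
  have "D c0 = 0" unfolding c0_def
    by (simp add: derivn_add[OF D] derivn_mult[OF D] D3 Dv derivn_square_zero[OF D two_poly] del: mult_pCons_left mult_pCons_right)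
  then have "D (h1 ^ 2 * c0) = 0" by (simp add: derivn_mult[OF D] derivn_square_zero[OF D two_poly])
  moreover have "D (cc t1 * vo * h0 ^ 2) = h0 ^ 2 * vo"
    by (simp add: derivn_mult[OF D] derivn_square_zero[OF D two_poly] Dv del: mult_pCons_left mult_pCons_right)
  ultimately have "h0 = 0" using eq by simp
  moreover have "c0 \<noteq> 0" using c0_value by auto
  ultimately show ?thesis using eq by simp
qed

lemma psi_cubic: "\<psi> (cubic t1 t2) = 0"
proof -
  have "\<psi> (cubic t1 t2) = jj c0 + \<rho> * (\<rho> * jj (cc t1 * vo))"
    by (simp add: psi_Theta Theta_cubic pev_pCons[OF rhom_jj] rhom_0[OF rhom_jj])
  also have "\<dots> = jj c0 + jj c0" using rho by (simp add: power2_eq_square mult_ac)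
  also have "\<dots> = jj (2 * c0)" by (simp only: rhom_add[OF rhom_jj, symmetric] mult_2)
  also have "\<dots> = 0" by (simp add: two_poly rhom_0[OF rhom_jj])
  finally show ?thesis .
qed

lemma psi_ker: "\<psi> a = 0 \<longleftrightarrow> cubic t1 t2 dvd a"
proof
  assume a: "\<psi> a = 0"
  have dP: "degree (\<Theta> (cubic t1 t2)) = 2" "lead_coeff (\<Theta> (cubic t1 t2)) = cc t1 * vo"
    unfolding Theta_cubic using t_nz by simp_all
  have "\<Theta> (cubic t1 t2) dvd \<Theta> a"
  proof (rule poly_mod_kernel[OF rhom_jj])
    show "pev jj \<rho> (\<Theta> (cubic t1 t2)) = 0" using psi_cubic by (simp add: psi_Theta)
    show "pev jj \<rho> (\<Theta> a) = 0" using a by (simp add: psi_Theta)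
    show "p = 0" if p: "p = 0 \<or> degree p < degree (\<Theta> (cubic t1 t2))" "pev jj \<rho> p = 0" for p
    proof -
      have "degree p \<le> 1" using p(1) dP by auto
      obtain h0 q where q: "p = pCons h0 q" by (cases p)
      then have "degree q = 0" using \<open>degree p \<le> 1\<close> by (auto split: if_splits)
      then obtain h1 where "q = [:h1:]" by (rule degree_eq_zeroE)
      then have h: "p = [:h0, h1:]" using q by simp
      then have "jj h0 + jj h1 * \<rho> = 0" using p(2)
        by (simp add: pev_pCons[OF rhom_jj] mult.commute)
      then show ?thesis using linear_over_jj h by simp
    qed
    show "lead_coeff (\<Theta> (cubic t1 t2)) = cc t1 * vo ^ 1" unfolding power_one_right by (rule dP)
    show "cc t1 * cc (inverse t1) = 1" using t_nz by (simp add: one_pCons)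
    show "prime_elem (vo :: 'f poly poly poly)" by (rule prime_elem_vo)
    show "\<not> [:vo:] dvd \<Theta> (cubic t1 t2)"
    proof
      assume "[:vo:] dvd \<Theta> (cubic t1 t2)"
      then have "vo dvd coeff (\<Theta> (cubic t1 t2)) 0" by (simp only: const_poly_dvd_iff)
      then have "vo dvd c0" by (simp add: Theta_cubic)
      then have "poly c0 0 = 0" using poly_eq_0_iff_dvd[of c0 0] by simp
      then show False using c0_value by simp
    qed
  qed
  then have "\<Theta>' (\<Theta> (cubic t1 t2)) dvd \<Theta>' (\<Theta> a)"
    using rhom_mult[OF rhom_Theta'] by (metis dvd_def)
  then show "cubic t1 t2 dvd a" by (simp add: Theta'_Theta)
next
  assume "cubic t1 t2 dvd a"
  then show "\<psi> a = 0" using psi_cubic by (auto simp: dvd_def rhom_mult[OF rhom_psi])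
qed

end

lemma cubic_forms: "cubic t1 t2 \<in> forms 3"
proof -
  have v: "Var v ^ k \<in> forms k" for v :: coord and k using forms_power[OF forms_Var, of v k] by simp
  have m: "Const c * Var v ^ 2 * Var w \<in> forms 3" for c :: 'a and v w :: coord
    using forms_mult[OF forms_mult[OF forms_Const v[of v 2]] forms_Var, of c w] by (simp add: numeral_eq_Suc)
  show ?thesis unfolding cubic_def by (intro forms_add m v)
qed

abbreviation cubic_ring :: "'f::field \<Rightarrow> 'f \<Rightarrow> ((coord, 'f) mpoly set, 'f) graded_algebra" where
  "cubic_ring t1 t2 \<equiv> quotient_algebra polynomial_algebra (PIdl\<^bsub>polynomial_algebra\<^esub> (cubic t1 t2))"

abbreviation cubic_proj :: "'f::field \<Rightarrow> 'f \<Rightarrow> (coord, 'f) mpoly \<Rightarrow> (coord, 'f) mpoly set" where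
  "cubic_proj t1 t2 a \<equiv> PIdl\<^bsub>polynomial_algebra\<^esub> (cubic t1 t2) +>\<^bsub>polynomial_algebra\<^esub> a"

sublocale cubic_field \<subseteq> cub: poly_model "cubic_ring t1 t2" "cubic_proj t1 t2" \<psi>
proof -
  have "\<psi> (Var X2) \<noteq> 0" by (simp add: psi_simps jj_eq_0)
  then show "poly_model (cubic_ring t1 t2) (cubic_proj t1 t2) \<psi>"
    using quotient_model[OF rhom_psi psi_ker cubic_forms] by blast
qed

section \<open>Regularity of the cubic surface\<close>

context cubic_field
begin

section \<open>Affine charts of the cubic\<close>

context
  fixes w a1 a2 a3 :: coord and p
  assumes perm: "distinct [w, a1, a2, a3]" "UNIV = {w, a1, a2, a3}"
    and p: "p \<in> cub.pts" and w: "Var w \<notin> cub.lft p"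
begin

definition chi :: "'f poly poly poly \<Rightarrow> 'f ffield" where
  "chi = pev3 (\<lambda>c. \<psi> (Const c)) (\<psi> (Var a1) / \<psi> (Var w)) (\<psi> (Var a2) / \<psi> (Var w)) (\<psi> (Var a3) / \<psi> (Var w))"

text \<open>Dehomogenization at \<open>w\<close>; \<open>chi\<close> evaluates the resulting affine
  polynomial at the coordinate quotients in the function field.\<close>

definition del :: "(coord, 'f) mpoly \<Rightarrow> 'f poly poly poly" where
  "del = mev cc (\<lambda>v. if v = w then 1 else if v = a1 then vi else if v = a2 then vm else vo)"

lemma rhom_psiC: "rhom (\<lambda>c. \<psi> (Const c))"
  by (rule rhom_comp[OF rhom_psi rhom_Const])

lemma rhom_chi: "rhom chi" and rhom_del: "rhom del"
  unfolding chi_def del_def by (intro rhom_pev3 rhom_psiC rhom_mev rhom_cc)+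

lemma del_simps: "del (Const c) = cc c" "del (Var w) = 1" "del (Var a1) = vi" "del (Var a2) = vm" "del (Var a3) = vo"
  using perm(1) by (auto simp: del_def mev_Const[OF rhom_cc] mev_Var[OF rhom_cc])

lemma chi_simps: "chi (cc c) = \<psi> (Const c)" "chi vi = \<psi> (Var a1) / \<psi> (Var w)"
  "chi vm = \<psi> (Var a2) / \<psi> (Var w)" "chi vo = \<psi> (Var a3) / \<psi> (Var w)"
  by (simp_all add: chi_def pev3_simps[OF rhom_psiC])

lemma psi_w: "\<psi> (Var w) \<noteq> 0"
  using cub.psi_nz[OF p w] .

lemma prime_p: "prime_idl (cub.lft p)"
  using cub.prime_lft[OF p] .

lemma w_power: "Var w ^ n \<notin> cub.lft p" "Var w ^ n \<in> forms n" "\<psi> (Var w ^ n) \<noteq> 0"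
proof -
  show n: "Var w ^ n \<notin> cub.lft p" using prime_idl_power[OF prime_p] w by blast
  show "Var w ^ n \<in> forms n" using forms_power[OF forms_Var, of w n] by simp
  show "\<psi> (Var w ^ n) \<noteq> 0" using cub.psi_nz[OF p n] .
qed

lemma chi_del: assumes "a \<in> forms n" shows "\<psi> a = chi (del a) * \<psi> (Var w) ^ n"
proof -
  let ?v = "\<lambda>i. \<psi> (Var i) / \<psi> (Var w)"
  have "\<psi> a = mev (\<lambda>c. \<psi> (Const c)) (\<lambda>i. \<psi> (Var w) * ?v i) a"
    by (rule rhom_mpoly_ext[OF rhom_psi rhom_mev[OF rhom_psiC]])
      (simp_all add: mev_Const[OF rhom_psiC] mev_Var[OF rhom_psiC] psi_w)
  also have "\<dots> = \<psi> (Var w) ^ n * mev (\<lambda>c. \<psi> (Const c)) ?v a"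
    by (rule mev_forms_scale[OF rhom_psiC assms])
  also have "mev (\<lambda>c. \<psi> (Const c)) ?v a = chi (del a)"
  proof (rule rhom_mpoly_ext[OF rhom_mev[OF rhom_psiC] rhom_comp[OF rhom_chi rhom_del]])
    show "mev (\<lambda>c. \<psi> (Const c)) ?v (Const c) = chi (del (Const c))" for c
      by (simp add: mev_Const[OF rhom_psiC] del_simps chi_simps)
    fix v
    have "v = w \<or> v = a1 \<or> v = a2 \<or> v = a3" using perm(2) by blast
    then show "mev (\<lambda>c. \<psi> (Const c)) ?v (Var v) = chi (del (Var v))"
      by (auto simp: mev_Var[OF rhom_psiC] del_simps chi_simps rhom_1[OF rhom_chi] psi_w)
  qed
  finally show ?thesis by (simp add: mult.commute)
qed

text \<open>Summands of different degrees are equalised by powers of \<open>Var w\<close>, which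
  dehomogenization sends to one.\<close>

lemma homogenize: "\<exists>n a. a \<in> forms n \<and> del a = b"
proof (induction b rule: poly3_closed_induct)
  show "\<exists>n a. a \<in> forms n \<and> del a = cc c" for c using forms_Const del_simps(1) by blast
  show "\<exists>n a. a \<in> forms n \<and> del a = vi" "\<exists>n a. a \<in> forms n \<and> del a = vm" "\<exists>n a. a \<in> forms n \<and> del a = vo"
    using forms_Var del_simps by blast+
  fix x y assume "\<exists>n a. a \<in> forms n \<and> del a = x" "\<exists>n a. a \<in> forms n \<and> del a = y"
  then obtain n a m b where *: "a \<in> forms n" "del a = x" "b \<in> forms m" "del b = y" by blast
  have "a * b \<in> forms (n + m)" "del (a * b) = x * y" using * forms_mult by (auto simp: rhom_mult[OF rhom_del])
  then show "\<exists>n a. a \<in> forms n \<and> del a = x * y" by blast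
  have "a * Var w ^ m + b * Var w ^ n \<in> forms (n + m)"
    using forms_mult[OF *(1) w_power(2)[of m]] forms_mult[OF *(3) w_power(2)[of n]] forms_add by (simp add: add.commute)
  moreover have "del (a * Var w ^ m + b * Var w ^ n) = x + y"
    using * by (simp add: rhom_simps[OF rhom_del] del_simps)
  ultimately show "\<exists>n a. a \<in> forms n \<and> del a = x + y" by blast
qed

lemma chi_ker: "chi b = 0 \<longleftrightarrow> del (cubic t1 t2) dvd b"
proof
  assume b: "chi b = 0"
  obtain n a where a: "a \<in> forms n" "del a = b" using homogenize by blast
  then have "\<psi> a = 0" using chi_del[OF a(1)] b by simp
  then obtain c where "a = cubic t1 t2 * c" using psi_ker by (auto simp: dvd_def)
  then show "del (cubic t1 t2) dvd b" using a(2) rhom_mult[OF rhom_del] by auto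
next
  assume "del (cubic t1 t2) dvd b"
  moreover have "chi (del (cubic t1 t2)) = 0" using chi_del[OF cubic_forms] psi_cubic psi_w by simp
  ultimately show "chi b = 0" by (auto simp: dvd_def rhom_mult[OF rhom_chi])
qed

lemma chi_frac: assumes "a \<in> forms n" "del a = b" shows "chi b = \<psi> a / \<psi> (Var w ^ n)"
  using chi_del[OF assms(1)] assms(2) psi_w by (simp add: rhom_power[OF rhom_psi])

lemma chi_Oc: "chi b \<in> cub.Oc p"
proof -
  obtain n a where a: "a \<in> forms n" "del a = b" using homogenize by blast
  then show ?thesis using chi_frac cub.Oc_psiI[OF a(1) w_power(2) w_power(1)] by simp
qed

definition Qp :: "'f poly poly poly set" where
  "Qp = {b. chi b = 0 \<or> inverse (chi b) \<notin> cub.Oc p}"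

lemma Qp_iff: assumes "a \<in> forms n" "del a = b" shows "b \<in> Qp \<longleftrightarrow> a \<in> cub.lft p"
  using cub.unit_Oc_psi[OF p assms(1) w_power(2) w_power(1)] chi_frac[OF assms] by (auto simp: Qp_def)

lemma idl_Qp: "idl Qp"
proof (rule idlI)
  note I = prime_idl_idl[OF prime_p]
  show "0 \<in> Qp" by (simp add: Qp_def rhom_0[OF rhom_chi])
  show "x + y \<in> Qp" if xy: "x \<in> Qp" "y \<in> Qp" for x y
  proof -
    obtain n a where a: "a \<in> forms n" "del a = x" using homogenize by blast
    obtain m b where b: "b \<in> forms m" "del b = y" using homogenize by blast
    have "a \<in> cub.lft p" "b \<in> cub.lft p" using xy Qp_iff[OF a] Qp_iff[OF b] by auto
    then have "a * Var w ^ m + b * Var w ^ n \<in> cub.lft p" using idl_add[OF I] idl_mult_r[OF I] by blast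
    moreover have "a * Var w ^ m + b * Var w ^ n \<in> forms (n + m)"
      using forms_mult[OF a(1) w_power(2)[of m]] forms_mult[OF b(1) w_power(2)[of n]] forms_add by (simp add: add.commute)
    moreover have "del (a * Var w ^ m + b * Var w ^ n) = x + y"
      using a b by (simp add: rhom_simps[OF rhom_del] del_simps)
    ultimately show ?thesis using Qp_iff by blast
  qed
  show "r * x \<in> Qp" if x: "x \<in> Qp" for r x
  proof -
    obtain n a where a: "a \<in> forms n" "del a = x" using homogenize by blast
    obtain m b where b: "b \<in> forms m" "del b = r" using homogenize by blast
    have "a \<in> cub.lft p" using x Qp_iff[OF a] by auto
    then have "b * a \<in> cub.lft p" using idl_mult[OF I] by blast
    moreover have "b * a \<in> forms (m + n)" "del (b * a) = r * x"
      using forms_mult a b by (auto simp: rhom_mult[OF rhom_del])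
    ultimately show ?thesis using Qp_iff by blast
  qed
qed

lemma prime_Qp: "prime_idl Qp"
  unfolding prime_idl_def
proof (intro conjI allI impI idl_Qp)
  show "1 \<notin> Qp" using Qp_iff[OF forms_1] prime_idl_1[OF prime_p] rhom_1[OF rhom_del] by simp
  show "x \<in> Qp \<or> y \<in> Qp" if xy: "x * y \<in> Qp" for x y
  proof -
    obtain n a where a: "a \<in> forms n" "del a = x" using homogenize by blast
    obtain m b where b: "b \<in> forms m" "del b = y" using homogenize by blast
    have "del (a * b) = x * y" using a b by (simp add: rhom_mult[OF rhom_del])
    then have "a * b \<in> cub.lft p" using Qp_iff[OF forms_mult[OF a(1) b(1)]] xy by blast
    then show ?thesis using prime_idl_mult[OF prime_p] Qp_iff[OF a] Qp_iff[OF b] by blast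
  qed
qed

lemma const_Qp: "cc c \<in> Qp \<Longrightarrow> c = 0"
proof (rule ccontr)
  assume "cc c \<in> Qp" "c \<noteq> 0"
  then have "cc (inverse c) * cc c \<in> Qp" using idl_mult[OF idl_Qp] by blast
  then have "1 \<in> Qp" using \<open>c \<noteq> 0\<close> by (simp add: one_pCons)
  then show False using prime_idl_1[OF prime_Qp] by blast
qed

lemma g_Qp: "del (cubic t1 t2) \<in> Qp"
  using chi_ker[of "del (cubic t1 t2)"] by (simp add: Qp_def)

text \<open>The chart criterion applied to the stalk, with the whole space viewed as its own open
  subspace; forms provide the fractions after dehomogenization.\<close>

lemma regular_from_chart:
  assumes monic: "lead_coeff (del (cubic t1 t2)) = 1" "0 < degree (del (cubic t1 t2))"
    and D: "derivn D" "D (del (cubic t1 t2)) \<notin> Qp"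
  shows "regular_local_ring (stalk (Proj (cubic_ring t1 t2)) p)"
proof -
  let ?S = "stalk (open_subspace (Proj (cubic_ring t1 t2)) cub.pts) p"
  interpret E: embedded_ring ?S "cub.sv cub.pts p" by (rule cub.stalk_embedded(1)[OF cub.openin_pts p])
  have O: "E.\<O> = cub.Oc p" unfolding E.\<O>_def by (rule cub.stalk_embedded(2)[OF cub.openin_pts p])
  have "regular_chart ?S (cub.sv cub.pts p) chi (del (cubic t1 t2)) D"
  proof (unfold_locales, unfold O)
    show "rhom chi" by (rule rhom_chi)
    show "chi b \<in> cub.Oc p" for b by (rule chi_Oc)
    show "\<exists>b t. x * chi t = chi b \<and> chi t \<noteq> 0 \<and> inverse (chi t) \<in> cub.Oc p" if x: "x \<in> cub.Oc p" for x
    proof -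
      obtain a s n where a: "a \<in> forms n" "s \<in> forms n" "s \<notin> cub.lft p" "x = \<psi> a / \<psi> s"
        using x unfolding cub.Oc_psi by blast
      have "\<psi> s \<noteq> 0" using cub.psi_nz[OF p a(3)] .
      then have "x * chi (del s) = chi (del a)"
        using chi_frac[OF a(1) refl] chi_frac[OF a(2) refl] a(4) by simp
      moreover have "del s \<notin> Qp" using Qp_iff[OF a(2) refl] a(3) by blast
      ultimately show ?thesis unfolding Qp_def by blast
    qed
    show "chi (a + b) = 0 \<or> inverse (chi (a + b)) \<notin> cub.Oc p"
      if "chi a = 0 \<or> inverse (chi a) \<notin> cub.Oc p" "chi b = 0 \<or> inverse (chi b) \<notin> cub.Oc p" for a b
      using idl_add[OF idl_Qp, of a b] that by (simp add: Qp_def)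
    show "chi b = 0 \<longleftrightarrow> del (cubic t1 t2) dvd b" for b by (rule chi_ker)
    show "lead_coeff (del (cubic t1 t2)) = 1" "0 < degree (del (cubic t1 t2))" by (fact monic)+
    show "derivn D" by (rule D)
    show "chi (D (del (cubic t1 t2))) \<noteq> 0" "inverse (chi (D (del (cubic t1 t2)))) \<in> cub.Oc p"
      using D(2) by (simp_all add: Qp_def)
  qed
  then have "regular_local_ring ?S" by (rule regular_chart.regular_local_ring_embedded)
  then show ?thesis by (simp add: cub.open_subspace_pts)
qed

end

section \<open>Choice of derivations and regularity at every point\<close>

definition lift_derivn :: "('f \<Rightarrow> 'f) \<Rightarrow> 'f poly poly poly \<Rightarrow> 'f poly poly poly" where
  "lift_derivn D = map_poly (map_poly (map_poly D))"

lemma lift_derivn: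
  assumes "derivn D" shows "derivn (lift_derivn D)" "lift_derivn D vo = 0" "lift_derivn D vm = 0"
    "lift_derivn D vi = 0" "lift_derivn D (cc c) = cc (D c)"
  using derivn_0[OF assms] derivn_1[OF assms] unfolding lift_derivn_def
  by (simp_all add: derivn_map_poly assms map_poly_pCons one_pCons)

lemma derivn_cube: "derivn D \<Longrightarrow> (2 :: 'a::comm_ring_1) = 0 \<Longrightarrow> D ((x :: 'a) ^ 3) = x ^ 2 * D x"
  using derivn_mult[of D x "x ^ 2"] derivn_square_zero[of D x]
  by (simp add: power3_eq_cube power2_eq_square mult.assoc)

text \<open>In the chart \<open>x\<^sub>i = 1\<close>, with \<open>g = y\<^sup>3 + ty + v\<^sup>3 + t'u\<^sup>2v\<close>, the derivation dual to \<open>dt\<close> sends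
  \<open>g\<close> to \<open>y\<close>, while \<open>\<partial>g/\<partial>y = y\<^sup>2 + t\<close>; these two do not vanish simultaneously.\<close>

lemma ex_derivn_chart_x:
  fixes Q :: "'f poly poly poly set" and D :: "'f \<Rightarrow> 'f"
  assumes "prime_idl Q" and const: "\<And>c. cc c \<in> Q \<Longrightarrow> c = 0"
    and D: "derivn D" "D t = 1" "D t' = 0"
    and g: "g = vo ^ 3 + cc t * vo + vm ^ 3 + cc t' * vi ^ 2 * vm"
  shows "\<exists>D. derivn D \<and> D g \<notin> Q"
proof (rule ccontr)
  assume "\<nexists>D. derivn D \<and> D g \<notin> Q"
  then have all: "\<And>D. derivn D \<Longrightarrow> D g \<in> Q" by blast
  note I = prime_idl_idl[OF assms(1)]
  note L = lift_derivn[OF D(1)]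
  have sq: "lift_derivn D (x ^ 2) = 0" for x by (rule derivn_square_zero[OF L(1) two_poly])
  have "lift_derivn D g = vo"
    unfolding g by (simp add: derivn_add[OF L(1)] derivn_mult[OF L(1)] derivn_cube[OF L(1) two_poly] sq L D derivn_0[OF D(1)]
        del: mult_pCons_left mult_pCons_right) (simp add: one_pCons)
  then have y: "vo \<in> Q" using all[OF L(1)] by simp
  have P: "derivn (pderiv :: 'f poly poly poly \<Rightarrow> _)" by (rule derivn_pderiv)
  have sqP: "pderiv (x ^ 2) = 0" for x :: "'f poly poly poly" by (rule derivn_square_zero[OF P two_poly])
  have "pderiv g = vo ^ 2 + cc t"
    unfolding g
    by (simp add: pderiv_add pderiv_mult derivn_cube[OF P two_poly] sqP pderiv_pCons
        one_pCons[symmetric] del: mult_pCons_left mult_pCons_right)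
  then have "vo ^ 2 + cc t \<in> Q" using all[OF P] by simp
  then have "(vo ^ 2 + cc t) - vo * vo \<in> Q" using idl_diff[OF I] idl_mult[OF I y] by blast
  then have "cc t \<in> Q" by (simp add: power2_eq_square)
  then have "t = 0" by (rule const)
  then show False using D(2) derivn_0[OF D(1)] by simp
qed

lemma regular_stalk:
  assumes p: "p \<in> cub.pts"
  shows "regular_local_ring (stalk (Proj (cubic_ring t1 t2)) p)"
proof -
  have pr: "prime_idl (cub.lft p)" using cub.prime_lft[OF p] .
  note I = prime_idl_idl[OF pr]
  have U: "(UNIV :: coord set) = {X1, X2, Y1, Y2}" using coord.exhaust by blast
  consider "Var X1 \<notin> cub.lft p" | "Var X2 \<notin> cub.lft p" | "Var X1 \<in> cub.lft p" "Var X2 \<in> cub.lft p" by blast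
  then show ?thesis
  proof cases
    case 1
    \<comment> \<open>The last coordinate of the list becomes the outer variable; it is chosen so
      that the dehomogenized cubic is monic in it.\<close>
    have perm: "distinct [X1, X2, Y2, Y1]" "UNIV = {X1, X2, Y2, Y1}" using U by auto
    note ctx = perm p 1
    have g: "del X1 X2 Y2 (cubic t1 t2) = vo ^ 3 + cc t1 * vo + vm ^ 3 + cc t2 * vi ^ 2 * vm"
      unfolding cubic_def
      by (simp add: rhom_simps[OF rhom_del[OF ctx]] del_simps[OF ctx] del: mult_pCons_left mult_pCons_right)
    have ge: "del X1 X2 Y2 (cubic t1 t2) = [:[:0, 1:] ^ 3 + [:[:t2:]:] * [:[:0, 1:]:] ^ 2 * [:0, 1:], [:[:t1:]:], 0, 1:]"
      unfolding g by (simp add: power2_eq_square power3_eq_cube)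
    obtain D where D: "derivn D" "D (del X1 X2 Y2 (cubic t1 t2)) \<notin> Qp X1 X2 Y2 Y1 p"
      using ex_derivn_chart_x[OF prime_Qp[OF ctx] const_Qp[OF ctx] D1 g] by blast
    show ?thesis
      by (rule regular_from_chart[OF ctx _ _ D]) (simp_all add: ge)
  next
    case 2
    \<comment> \<open>The indices are interchanged, so that the derivation dual to \<open>t2\<close>
      takes over.\<close>
    have perm: "distinct [X2, X1, Y1, Y2]" "UNIV = {X2, X1, Y1, Y2}" using U by auto
    note ctx = perm p 2
    have g: "del X2 X1 Y1 (cubic t1 t2) = vo ^ 3 + cc t2 * vo + vm ^ 3 + cc t1 * vi ^ 2 * vm"
      unfolding cubic_def
      by (simp add: rhom_simps[OF rhom_del[OF ctx]] del_simps[OF ctx] add_ac del: mult_pCons_left mult_pCons_right)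
    have ge: "del X2 X1 Y1 (cubic t1 t2) = [:[:0, 1:] ^ 3 + [:[:t1:]:] * [:[:0, 1:]:] ^ 2 * [:0, 1:], [:[:t2:]:], 0, 1:]"
      unfolding g by (simp add: power2_eq_square power3_eq_cube)
    obtain D where D: "derivn D" "D (del X2 X1 Y1 (cubic t1 t2)) \<notin> Qp X2 X1 Y1 Y2 p"
      using ex_derivn_chart_x[OF prime_Qp[OF ctx] const_Qp[OF ctx] D2(1,3,2) g] by blast
    show ?thesis
      by (rule regular_from_chart[OF ctx _ _ D]) (simp_all add: ge)
  next
    case 3
    \<comment> \<open>Modulo \<open>x1\<close> and \<open>x2\<close> the equation reads
      \<open>y1^3 + y2^3 = 0\<close>, so with \<open>y1\<close> also \<open>y2\<close> would
      vanish.\<close>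
    have Y1: "Var Y1 \<notin> cub.lft p"
    proof
      assume y: "Var Y1 \<in> cub.lft p"
      have "cubic t1 t2 \<in> cub.lft p" using cub.hprime_lft[OF p] psi_cubic by (simp add: cub.hprime_def)
      moreover have "Var Y1 * (Var Y1 ^ 2 + Const t1 * Var X1 ^ 2) \<in> cub.lft p"
        "Var X2 * (Const t2 * Var X2 * Var Y2) \<in> cub.lft p" using y 3 idl_mult_r[OF I] by blast+
      ultimately have "cubic t1 t2 - Var Y1 * (Var Y1 ^ 2 + Const t1 * Var X1 ^ 2) - Var X2 * (Const t2 * Var X2 * Var Y2) \<in> cub.lft p"
        using idl_diff[OF I] by blast
      moreover have "cubic t1 t2 - Var Y1 * (Var Y1 ^ 2 + Const t1 * Var X1 ^ 2) - Var X2 * (Const t2 * Var X2 * Var Y2) = Var Y2 ^ 3"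
        unfolding cubic_def by (simp add: power2_eq_square power3_eq_cube algebra_simps)
      ultimately have "Var Y2 \<in> cub.lft p" using prime_idl_power[OF pr] by metis
      then have "\<forall>v. Var v \<in> cub.lft p" using y 3 by (metis coord.exhaust)
      then show False using cub.hprime_lft[OF p] by (simp add: cub.hprime_def)
    qed
    have perm: "distinct [Y1, X1, X2, Y2]" "UNIV = {Y1, X1, X2, Y2}" using U by auto
    note ctx = perm p Y1
    have g: "del Y1 X1 X2 (cubic t1 t2) = vo ^ 3 + cc t2 * vm ^ 2 * vo + 1 + cc t1 * vi ^ 2"
      unfolding cubic_def
      by (simp add: rhom_simps[OF rhom_del[OF ctx]] del_simps[OF ctx] add_ac del: mult_pCons_left mult_pCons_right)
    have ge: "del Y1 X1 X2 (cubic t1 t2) = [:1 + [:[:t1:] * [:0, 1:] ^ 2:], [:[:t2:]:] * [:0, 1:] ^ 2, 0, 1:]"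
      unfolding g by (simp add: power2_eq_square power3_eq_cube one_pCons)
    have "vi \<in> Qp Y1 X1 X2 Y2 p" "vm \<in> Qp Y1 X1 X2 Y2 p"
      using Qp_iff[OF ctx forms_Var del_simps(3)[OF ctx]] Qp_iff[OF ctx forms_Var del_simps(4)[OF ctx]] 3 by auto
    note v = this
    note IQ = idl_Qp[OF ctx]
    have P: "derivn (pderiv :: 'f poly poly poly \<Rightarrow> _)" by (rule derivn_pderiv)
    have sqP: "pderiv (x ^ 2) = 0" for x :: "'f poly poly poly" by (rule derivn_square_zero[OF P two_poly])
    have "pderiv (del Y1 X1 X2 (cubic t1 t2)) = vo ^ 2 + cc t2 * vm ^ 2"
      unfolding g
      by (simp add: pderiv_add pderiv_mult derivn_cube[OF P two_poly] sqP pderiv_pCons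
          one_pCons[symmetric] del: mult_pCons_left mult_pCons_right)
    \<comment> \<open>Here the ordinary derivative suffices: modulo \<open>x1\<close> and
      \<open>x2\<close> its vanishing forces \<open>y2 = 0\<close>, and then the equation of the
      chart becomes \<open>1 = 0\<close>.\<close>
    moreover have "vo ^ 2 + cc t2 * vm ^ 2 \<notin> Qp Y1 X1 X2 Y2 p"
    proof
      assume a: "vo ^ 2 + cc t2 * vm ^ 2 \<in> Qp Y1 X1 X2 Y2 p"
      have m: "(cc t2 * vm) * vm \<in> Qp Y1 X1 X2 Y2 p" using idl_mult[OF IQ v(2)] .
      have "(vo ^ 2 + cc t2 * vm ^ 2) - (cc t2 * vm) * vm = vo ^ 2" by (simp only: power2_eq_square mult.assoc) simp
      then have "vo ^ 2 \<in> Qp Y1 X1 X2 Y2 p" using idl_diff[OF IQ a m] by (simp only:)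
      then have vo: "vo \<in> Qp Y1 X1 X2 Y2 p" using prime_idl_power[OF prime_Qp[OF ctx]] by blast
      have "1 = del Y1 X1 X2 (cubic t1 t2) - (vo ^ 2 + cc t2 * vm ^ 2) * vo - (cc t1 * vi) * vi"
        unfolding g by (simp only: power2_eq_square power3_eq_cube algebra_simps)
      also have "\<dots> \<in> Qp Y1 X1 X2 Y2 p"
        using idl_diff[OF IQ idl_diff[OF IQ g_Qp[OF ctx] idl_mult[OF IQ vo]] idl_mult[OF IQ v(1)]] .
      finally show False using prime_idl_1[OF prime_Qp[OF ctx]] by blast
    qed
    ultimately have "pderiv (del Y1 X1 X2 (cubic t1 t2)) \<notin> Qp Y1 X1 X2 Y2 p" by simp
    then show ?thesis
      by (intro regular_from_chart[OF ctx _ _ P]) (simp_all add: ge)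
  qed
qed

theorem regular_hypersurface: "regular_scheme (hypersurface (cubic t1 t2))"
proof -
  have "points (Proj (cubic_ring t1 t2)) = cub.pts"
    using cub.points_sub[OF cub.openin_pts] by (simp add: cub.open_subspace_pts)
  then show ?thesis unfolding regular_scheme_def hypersurface_def using regular_stalk by simp
qed

end

section \<open>Points of the cubic over a rational function field\<close>

lemma ex_prime_factor:
  fixes p :: "'f::field poly"
  assumes "p \<noteq> 0" "degree p \<noteq> 0"
  obtains q where "prime_elem q" "q dvd p"
proof -
  have "\<exists>q. prime_elem q \<and> q dvd p"
    using assms
  proof (induction "degree p" arbitrary: p rule: less_induct)
    case less
    show ?case
    proof (cases "Factorial_Ring.irreducible p")
      case True
      then have "prime_elem p" by (rule field_poly_irreducible_imp_prime)
      then show ?thesis by (intro exI[of _ p]) simp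
    next
      case False
      have "\<not> p dvd 1" using less.prems by (simp add: is_unit_iff_degree)
      then obtain a b where ab: "p = a * b" "\<not> a dvd 1" "\<not> b dvd 1"
        using False less.prems unfolding Factorial_Ring.irreducible_def by blast
      have n: "a \<noteq> 0" "b \<noteq> 0" using ab less.prems by auto
      then have d: "degree a \<noteq> 0" "degree b \<noteq> 0" using ab by (auto simp: is_unit_iff_degree)
      then have "degree a < degree p" using n by (simp add: ab(1) degree_mult_eq)
      then obtain q where "prime_elem q" "q dvd a" using less.hyps n d by blast
      then show ?thesis using ab(1) by auto
    qed
  qed
  then show ?thesis using that by blast
qed

lemma prime_elem_power_dvd_mult:
  fixes q :: "'a::idom"
  assumes q: "prime_elem q" and nd: "\<not> q dvd b" and d: "q ^ n dvd a * b"
  shows "q ^ n dvd a"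
proof -
  obtain w where "q ^ n * w = b * a" using d by (metis dvd_def mult.commute)
  then have "b dvd w" by (rule prime_elem_power_cancel[OF q nd])
  then obtain w' where "w = b * w'" by (rule dvdE)
  then have "b * (q ^ n * w') = b * a" using \<open>q ^ n * w = b * a\<close> by (simp add: algebra_simps)
  moreover have "b \<noteq> 0" using nd by auto
  ultimately have "a = q ^ n * w'" by simp
  then show ?thesis by simp
qed

text \<open>The full power \<open>q^n\<close> in \<open>p\<close> is split off; the cofactor is no
  longer divisible by \<open>q\<close> and has smaller degree, so induction handles it and the two
  divisibilities combine.\<close>

lemma dvd_if_prime_powers_dvd:
  fixes p y :: "'f::field poly"
  assumes "p \<noteq> 0" "\<And>q n. prime_elem q \<Longrightarrow> q ^ n dvd p \<Longrightarrow> q ^ n dvd y"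
  shows "p dvd y"
  using assms
proof (induction "degree p" arbitrary: p rule: less_induct)
  case less
  show ?case
  proof (cases "degree p = 0")
    case True
    then have "p dvd 1" using less.prems(1) by (simp add: is_unit_iff_degree)
    then show ?thesis using dvd_trans one_dvd by blast
  next
    case False
    obtain q where q: "prime_elem q" "q dvd p" using ex_prime_factor[OF less.prems(1) False] .
    have dq: "degree q \<noteq> 0"
      using q(1) by (auto simp: prime_elem_def is_unit_iff_degree)
    have bound: "n \<le> degree p" if "q ^ n dvd p" for n
    proof -
      have "degree (q ^ n) \<le> degree p" using dvd_imp_degree_le[OF that less.prems(1)] .
      moreover have "degree (q ^ n) = n * degree q" using q(1) by (simp add: degree_power_eq prime_elem_def)
      moreover have "n * 1 \<le> n * degree q" using dq by (intro mult_le_mono) auto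
      ultimately show ?thesis by linarith
    qed
    define n where "n = (GREATEST n. q ^ n dvd p)"
    have n: "q ^ n dvd p" unfolding n_def by (rule GreatestI_nat[of _ 0 "degree p"]) (auto intro: bound)
    have max: "m \<le> n" if "q ^ m dvd p" for m unfolding n_def
      by (rule Greatest_le_nat[where P = "\<lambda>n. q ^ n dvd p", OF that]) (rule bound)
    obtain p' where p': "p = q ^ n * p'" using n by (rule dvdE)
    have nd: "\<not> q dvd p'"
    proof
      assume "q dvd p'"
      then have "q ^ Suc n dvd p" unfolding p' by (auto simp: mult_dvd_mono mult.commute)
      then show False using max[of "Suc n"] by simp
    qed
    have p0: "p' \<noteq> 0" "q \<noteq> 0" using p' less.prems(1) q(1) by auto
    have "1 \<le> n" using max[of 1] q(2) by simp
    then have "degree p' < degree p" using p0 dq by (simp add: p' degree_mult_eq degree_power_eq)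
    moreover have "r ^ m dvd y" if "prime_elem r" "r ^ m dvd p'" for r m
      using less.prems(2)[OF that(1), of m] that(2) by (simp add: p')
    ultimately have "p' dvd y" using less.hyps[OF _ p0(1)] by blast
    then obtain y' where y': "y = y' * p'" by (metis dvdE mult.commute)
    have "q ^ n dvd y' * p'" using less.prems(2)[OF q(1) n] y' by simp
    then have "q ^ n dvd y'" by (rule prime_elem_power_dvd_mult[OF q(1) nd])
    then show ?thesis unfolding p' y' by (rule mult_dvd_mono) simp
  qed
qed

text \<open>A common divisor of largest degree serves as greatest common divisor of the set.\<close>

lemma ex_common_divisor_coprime:
  fixes S :: "'f::field poly set"
  assumes "s \<in> S" "s \<noteq> 0"
  obtains d where "d \<noteq> 0" "\<And>x. x \<in> S \<Longrightarrow> d dvd x" "\<And>q. prime_elem q \<Longrightarrow> \<not> (\<forall>x\<in>S. d * q dvd x)"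
proof -
  let ?P = "\<lambda>n. \<exists>d. degree d = n \<and> (\<forall>x\<in>S. d dvd x)"
  have b: "n \<le> degree s" if "?P n" for n using that assms dvd_imp_degree_le by blast
  have "?P 0" by (intro exI[of _ 1]) auto
  then have "?P (GREATEST n. ?P n)" by (rule GreatestI_nat[where P = ?P]) (rule b)
  then obtain d where d: "degree d = (GREATEST n. ?P n)" "\<forall>x\<in>S. d dvd x" by blast
  have d0: "d \<noteq> 0" using d(2) assms by auto
  have "\<not> (\<forall>x\<in>S. d * q dvd x)" if q: "prime_elem q" for q
  proof
    assume "\<forall>x\<in>S. d * q dvd x"
    then have "?P (degree (d * q))" by blast
    then have "degree (d * q) \<le> degree d" unfolding d(1) by (rule Greatest_le_nat[where P = ?P]) (rule b)
    moreover have "degree q \<noteq> 0" "q \<noteq> 0" using q by (auto simp: prime_elem_def is_unit_iff_degree)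
    ultimately show False using d0 by (simp add: degree_mult_eq)
  qed
  then show ?thesis using that d0 d(2) by blast
qed

lemma two_sum_zero: "(2 :: 'a::comm_ring_1) = 0 \<Longrightarrow> x + x = (0 :: 'a)"
  by (metis mult_2 mult_zero_left)

lemma two_minus: "(2 :: 'a::comm_ring_1) = 0 \<Longrightarrow> - x = (x :: 'a)"
  using two_sum_zero[of x] by (simp add: neg_eq_iff_add_eq_0)

section \<open>Primitive solutions in polynomials of one variable\<close>

context cubic_field
begin

lemma two_poly1: "(2 :: 'f poly) = 0"
  by (simp add: numeral_poly two)

definition E1 :: "'f poly \<Rightarrow> 'f poly" where "E1 = map_poly D1"
definition E2 :: "'f poly \<Rightarrow> 'f poly" where "E2 = map_poly D2"

lemma derivn_E: "derivn E1" "derivn E2"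
  unfolding E1_def E2_def by (intro derivn_map_poly D1 D2)+

lemma E_values: "E1 [:t1:] = 1" "E1 [:t2:] = 0" "E2 [:t1:] = 0" "E2 [:t2:] = 1" 
  using derivn_0[OF D1(1)] derivn_0[OF D2(1)] by (simp_all add: E1_def E2_def map_poly_pCons D1 D2 one_pCons)

lemma E_sq: "E1 (x ^ 2) = 0" "E2 (x ^ 2) = 0"
  using derivn_square_zero[OF derivn_E(1) two_poly1] derivn_square_zero[OF derivn_E(2) two_poly1] by auto

definition A :: "'f poly \<Rightarrow> 'f poly \<Rightarrow> 'f poly" where "A x y = y ^ 2 + [:t1:] * x ^ 2"
definition B :: "'f poly \<Rightarrow> 'f poly \<Rightarrow> 'f poly" where "B x y = y ^ 2 + [:t2:] * x ^ 2"

text \<open>As squares are constants for derivations, \<open>E1\<close> sees only the coefficient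
  \<open>t1\<close> and \<open>E2\<close> only \<open>t2\<close>. This duality is what separates
  \<open>A\<close> from \<open>B\<close>.\<close>

lemma E_AB: "E1 (A x y) = x ^ 2" "E2 (A x y) = 0" "E1 (B x y) = 0" "E2 (B x y) = x ^ 2"
  unfolding A_def B_def
  by (simp_all add: derivn_add[OF derivn_E(1)] derivn_add[OF derivn_E(2)] derivn_mult[OF derivn_E(1)]
      derivn_mult[OF derivn_E(2)] E_sq E_values del: mult_pCons_left)

lemma AB_zero: "A x y = 0 \<Longrightarrow> x = 0 \<and> y = 0" "B x y = 0 \<Longrightarrow> x = 0 \<and> y = 0"
proof -
  show "x = 0 \<and> y = 0" if "A x y = 0"
  proof -
    have "x ^ 2 = 0" using E_AB(1)[of x y] that derivn_0[OF derivn_E(1)] by simp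
    then show ?thesis using that by (simp add: A_def)
  qed
  show "x = 0 \<and> y = 0" if "B x y = 0"
  proof -
    have "x ^ 2 = 0" using E_AB(4)[of x y] that derivn_0[OF derivn_E(2)] by simp
    then show ?thesis using that by (simp add: B_def)
  qed
qed

text \<open>No cancellation at the top: a coefficient \<open>b^2 + t1 a^2\<close> vanishes only for
  \<open>a = b = 0\<close>, because \<open>D1\<close> maps it to \<open>a^2\<close>.\<close>

lemma degree_A: "2 * max (degree x) (degree y) \<le> degree (A x y)"
proof (cases "x = 0 \<and> y = 0")
  case False
  define m where "m = max (degree x) (degree y)"
  have cs: "coeff (p ^ 2) (2 * m) = coeff p m ^ 2" if "degree p \<le> m" for p :: "'f poly"
  proof (cases "degree p = m")
    case True
    then show ?thesis using coeff_mult_degree_sum[of p p] by (simp add: power2_eq_square mult_2)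
  next
    case False
    then have "degree p < m" using that by simp
    moreover have "degree (p ^ 2) \<le> degree p * 2" by (rule degree_power_le)
    ultimately show ?thesis by (simp add: coeff_eq_0)
  qed
  have "coeff (A x y) (2 * m) = coeff y m ^ 2 + t1 * coeff x m ^ 2"
    using cs[of x] cs[of y] by (simp add: A_def m_def)
  moreover have "coeff y m ^ 2 + t1 * coeff x m ^ 2 \<noteq> 0"
  proof
    assume z: "coeff y m ^ 2 + t1 * coeff x m ^ 2 = 0"
    have "D1 (coeff y m ^ 2 + t1 * coeff x m ^ 2) = coeff x m ^ 2"
      by (simp add: derivn_add[OF D1(1)] derivn_mult[OF D1(1)] derivn_square_zero[OF D1(1) two] D1)
    then have "coeff x m = 0" using z derivn_0[OF D1(1)] by simp
    then have "coeff y m = 0" using z by simp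
    have "m = degree x \<or> m = degree y" by (auto simp: m_def)
    then have "x = 0 \<or> y = 0" using \<open>coeff x m = 0\<close> \<open>coeff y m = 0\<close> by auto
    then show False using False \<open>coeff x m = 0\<close> \<open>coeff y m = 0\<close> by (auto simp: m_def)
  qed
  ultimately show ?thesis unfolding m_def by (metis le_degree)
qed simp

text \<open>The argument is local at a prime power \<open>q^n\<close> dividing
  \<open>A x1 y1\<close>. If \<open>q\<close> does not divide both \<open>x1\<close> and
  \<open>y1\<close>, then \<open>n = 1\<close> and the derivations force \<open>q\<close> into
  \<open>y2\<close>. If it divides both, it divides \<open>y2\<close>; primitivity keeps it away
  from \<open>x2\<close>, hence from \<open>B x2 y2\<close>, and the whole power passes to
  \<open>y2\<close>.\<close>

lemma A_dvd:
  assumes eq: "y1 * A x1 y1 = y2 * B x2 y2" and n: "A x1 y1 \<noteq> 0"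
    and prim: "\<And>q. prime_elem q \<Longrightarrow> \<not> (q dvd x1 \<and> q dvd x2 \<and> q dvd y1 \<and> q dvd y2)"
  shows "A x1 y1 dvd y2"
proof (rule dvd_if_prime_powers_dvd[OF n])
  fix q :: "'f poly" and n assume q: "prime_elem q" and d: "q ^ n dvd A x1 y1"
  have sq: "q dvd z" if "q dvd z ^ 2" for z using q that prime_elem_dvd_power by blast
  have uq: "q dvd c" if "q dvd [:t2:] * c" for c
    using that t_nz by (simp add: dvd_smult_iff)
  have sd: "q dvd a * z ^ 2" if "q dvd z" for a z
  proof -
    have "q dvd z ^ 2" using that by (simp add: power2_eq_square)
    then show ?thesis by (rule dvd_mult)
  qed
  have qq: "q dvd q ^ 2 * c" for c by (simp add: power2_eq_square)
  \<comment> \<open>A factor \<open>q^2\<close> survives every derivation, since squares are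
    constants; so \<open>q\<close> divides \<open>E1 (A x1 y1) = x1^2\<close>.\<close>
  have A2: "q dvd x1 \<and> q dvd y1" if h: "q ^ 2 dvd A x1 y1"
  proof -
    obtain c where c: "A x1 y1 = q ^ 2 * c" using h by (rule dvdE)
    have "x1 ^ 2 = q ^ 2 * E1 c" using E_AB(1)[of x1 y1] by (simp add: c derivn_mult[OF derivn_E(1)] E_sq)
    moreover have "q dvd q ^ 2 * E1 c" by (simp add: power2_eq_square)
    ultimately have "q dvd x1 ^ 2" by (simp only:)
    then have x: "q dvd x1" by (rule sq)
    have "y1 ^ 2 = q ^ 2 * c - [:t1:] * x1 ^ 2" using c by (simp add: A_def algebra_simps)
    moreover have "q dvd q ^ 2 * c - [:t1:] * x1 ^ 2" using qq sd[OF x] by (rule dvd_diff)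
    ultimately have "q dvd y1 ^ 2" by (simp only:)
    then show ?thesis using x sq by blast
  qed
  have Bx: "q dvd y2" if "q dvd B x2 y2" "q dvd x2"
  proof -
    have "y2 ^ 2 = B x2 y2 - [:t2:] * x2 ^ 2" by (simp add: B_def)
    moreover have "q dvd B x2 y2 - [:t2:] * x2 ^ 2" using that(1) sd[OF that(2)] by (rule dvd_diff)
    ultimately have "q dvd y2 ^ 2" by (simp only:)
    then show ?thesis by (rule sq)
  qed
  have B2: "q dvd x2" if h: "q ^ 2 dvd B x2 y2"
  proof -
    obtain c where c: "B x2 y2 = q ^ 2 * c" using h by (rule dvdE)
    have "x2 ^ 2 = q ^ 2 * E2 c" using E_AB(4)[of x2 y2] by (simp add: c derivn_mult[OF derivn_E(2)] E_sq)
    moreover have "q dvd q ^ 2 * E2 c" by (simp add: power2_eq_square)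
    ultimately have "q dvd x2 ^ 2" by (simp only:)
    then show ?thesis by (rule sq)
  qed
  show "q ^ n dvd y2"
  proof (cases "n = 0")
    case False
    then have "q dvd q ^ n" by (simp add: dvd_power)
    then have qA: "q dvd A x1 y1" using d by (rule dvd_trans)
    show ?thesis
    proof (cases "q dvd x1 \<and> q dvd y1")
      case False
      have "n = 1"
      proof (rule ccontr)
        assume "n \<noteq> 1"
        then have "2 \<le> n" using \<open>n \<noteq> 0\<close> by simp
        then have "q ^ 2 dvd q ^ n" by (rule le_imp_power_dvd)
        then have "q ^ 2 dvd A x1 y1" using d by (rule dvd_trans)
        then show False using A2 False by blast
      qed
      moreover have "q dvd y2"
      proof (rule ccontr)
        assume ny: "\<not> q dvd y2"
        have "q dvd y2 * B x2 y2" unfolding eq[symmetric] using qA by (rule dvd_mult)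
        then have qB: "q dvd B x2 y2" using q ny prime_elem_dvd_mult_iff by blast
        have nx: "\<not> q dvd x2" using Bx qB ny by blast
        obtain a' where a': "A x1 y1 = q * a'" using qA by (rule dvdE)
        obtain b' where b': "B x2 y2 = q * b'" using qB by (rule dvdE)
        have na: "\<not> q dvd a'" using A2 False a' by (auto simp: power2_eq_square)
        \<comment> \<open>\<open>E2\<close> kills \<open>A x1 y1\<close>, in which \<open>q\<close>
          is a simple factor, so \<open>q\<close> divides \<open>E2 q\<close>. Then it also divides
          \<open>E2 (B x2 y2) = x2^2\<close>, contrary to \<open>nx\<close>.\<close>
        have "q * E2 a' + a' * E2 q = 0" using E_AB(2)[of x1 y1] by (simp add: a' derivn_mult[OF derivn_E(2)])
        then have "a' * E2 q = q * (- E2 a')" by (simp add: eq_neg_iff_add_eq_0 add.commute)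
        then have "q dvd a' * E2 q" by simp
        then have "q dvd E2 q" using q na prime_elem_dvd_mult_iff by blast
        moreover have "x2 ^ 2 = q * E2 b' + b' * E2 q" using E_AB(4)[of x2 y2] by (simp add: b' derivn_mult[OF derivn_E(2)])
        ultimately have "q dvd x2 ^ 2" by simp
        then show False using sq nx by blast
      qed
      ultimately show ?thesis by simp
    next
      case True
      have qy2: "q dvd y2"
      proof (rule ccontr)
        assume ny: "\<not> q dvd y2"
        have "q ^ 2 dvd y1 ^ 2" "q ^ 2 dvd x1 ^ 2" using True by (auto intro: dvd_power_same)
        then have "q ^ 2 dvd A x1 y1" unfolding A_def by (intro dvd_add dvd_mult)
        then have "q ^ 2 dvd y1 * A x1 y1" by (rule dvd_mult)
        then have "q ^ 2 dvd B x2 y2 * y2" unfolding eq by (simp only: mult.commute)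
        then have "q ^ 2 dvd B x2 y2" by (rule prime_elem_power_dvd_mult[OF q ny])
        moreover have "q dvd B x2 y2" using dvd_trans[OF _ calculation, of q] by (simp add: power2_eq_square)
        ultimately show False using B2 Bx ny by blast
      qed
      have nB: "\<not> q dvd B x2 y2"
      proof
        assume "q dvd B x2 y2"
        moreover have "[:t2:] * x2 ^ 2 = B x2 y2 - y2 * y2" by (simp add: B_def power2_eq_square)
        moreover have "q dvd y2 * y2" using qy2 by (rule dvd_mult)
        ultimately have "q dvd [:t2:] * x2 ^ 2" using dvd_diff[of q "B x2 y2" "y2 * y2"] by (simp only:)
        then have "q dvd x2" using uq sq by blast
        then show False using prim[OF q] True qy2 by blast
      qed
      have "q ^ n dvd y2 * B x2 y2" unfolding eq[symmetric] using d by (rule dvd_mult)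
      then show ?thesis by (rule prime_elem_power_dvd_mult[OF q nB])
    qed
  qed simp
qed

end

lemma (in cubic_field) swapped: "cubic_field t2 t1 D2 D1"
  by unfold_locales (simp_all add: two D1 D2)

text \<open>After removal of the common divisor the two divisibilities give
  \<open>deg v2 >= 2 deg v1\<close> and \<open>deg v1 >= 2 deg v2\<close>, so all degrees vanish.
  The second one comes from the locale with interchanged indices.\<close>

lemma (in cubic_field) polynomial_points_constant:
  assumes eq: "y1 * A x1 y1 = y2 * B x2 y2" and n: "y1 \<noteq> 0"
  obtains d c c' where "d \<noteq> 0" "x1 = smult c d" "y1 = smult c' d"
proof -
  interpret sw: cubic_field t2 t1 D2 D1 by (rule swapped)
  obtain d where d: "d \<noteq> 0" "\<And>x. x \<in> {x1, x2, y1, y2} \<Longrightarrow> d dvd x"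
    "\<And>q. prime_elem q \<Longrightarrow> \<not> (\<forall>x\<in>{x1, x2, y1, y2}. d * q dvd x)"
    using ex_common_divisor_coprime[of y1 "{x1, x2, y1, y2}"] n by auto
  obtain u1 u2 v1 v2 where uv: "x1 = d * u1" "x2 = d * u2" "y1 = d * v1" "y2 = d * v2"
    using d(2) by (meson dvdE insertI1 insertI2)
  have "d ^ 3 * (v1 * A u1 v1) = d ^ 3 * (v2 * B u2 v2)"
    using eq unfolding uv A_def B_def by (simp add: power2_eq_square power3_eq_cube algebra_simps)
  then have e: "v1 * A u1 v1 = v2 * B u2 v2" using d(1) by simp
  have v1: "v1 \<noteq> 0" using n uv by auto
  have A0: "A u1 v1 \<noteq> 0" using AB_zero(1) v1 by blast
  then have v2: "v2 \<noteq> 0" and B0: "B u2 v2 \<noteq> 0" using e v1 by auto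
  have prim: "\<not> (q dvd u1 \<and> q dvd u2 \<and> q dvd v1 \<and> q dvd v2)" if "prime_elem q" for q
    using d(3)[OF that] uv by auto
  have sA: "sw.A = B" "sw.B = A" by (simp_all add: fun_eq_iff sw.A_def sw.B_def A_def B_def)
  have "A u1 v1 dvd v2" by (rule A_dvd[OF e A0 prim])
  then have 1: "2 * max (degree u1) (degree v1) \<le> degree v2"
    using degree_A[of u1 v1] dvd_imp_degree_le[OF _ v2] by (metis le_trans)
  have "B u2 v2 dvd v1" using sw.A_dvd[of v2 u2 v1 u1] e B0 prim unfolding sA by metis
  then have 2: "2 * max (degree u2) (degree v2) \<le> degree v1"
    using sw.degree_A[of u2 v2] dvd_imp_degree_le[OF _ v1] unfolding sA by (metis le_trans)
  have "degree u1 = 0" "degree v1 = 0" using 1 2 by auto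
  then obtain c c' where "u1 = [:c:]" "v1 = [:c':]" by (metis degree_eq_zeroE)
  then show ?thesis using that[OF d(1), of c c'] uv by simp
qed

section \<open>From one variable to rational functions in three\<close>

lemma pev_id_zero:
  fixes p :: "'f::field poly"
  assumes "infinite (UNIV :: 'f set)" "\<And>r. poly p r = 0" shows "p = 0"
proof (rule ccontr)
  assume "p \<noteq> 0"
  then have "finite {r. poly p r = 0}" by (rule poly_roots_finite)
  then show False using assms by simp
qed

lemma pev_family_zero:
  fixes h :: "'r \<Rightarrow> 'c::comm_ring_1 \<Rightarrow> 'f::field"
  assumes inf: "infinite (UNIV :: 'f set)" and hz: "\<And>x. (\<And>r. h r x = 0) \<Longrightarrow> x = 0"
    and h: "\<And>r. rhom (h r)" and q: "\<And>r s. pev (h r) s q = 0"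
  shows "q = 0"
proof (rule poly_eqI)
  fix i
  have "map_poly (h r) q = 0" for r using pev_id_zero[OF inf] q by (simp add: pev_def)
  then have "h r (coeff q i) = 0" for r
    using coeff_map_poly[of "h r" q i, OF rhom_0[OF h]] by simp
  then show "coeff q i = coeff 0 i" using hz by simp
qed

lemma pev3_zero:
  fixes p :: "'f::field poly poly poly"
  assumes inf: "infinite (UNIV :: 'f set)" and z: "\<And>r1 r2 r3. pev3 (\<lambda>c. c) r1 r2 r3 p = 0" shows "p = 0"
proof -
  have id: "rhom (\<lambda>c :: 'f. c)" by (simp add: rhom_def)
  have s1: "x = 0" if "\<And>r1. pev (\<lambda>c. c) r1 x = 0" for x :: "'f poly"
    using pev_family_zero[OF inf, of "\<lambda>_ :: unit. \<lambda>c. c" x] id that by simp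
  have s2: "x = 0" if "\<And>r. pev (pev (\<lambda>c. c) (fst r)) (snd r) x = 0" for x :: "'f poly poly"
    by (rule pev_family_zero[OF inf, of "\<lambda>r. pev (\<lambda>c. c) r" x]) (use s1 rhom_pev[OF id] that[of "(_, _)"] in auto)
  show ?thesis
    by (rule pev_family_zero[OF inf, of "\<lambda>r. pev (pev (\<lambda>c. c) (fst r)) (snd r)" p])
      (use s2 rhom_pev rhom_pev[OF id] z in \<open>auto simp: pev3_def\<close>)
qed

context cubic_field
begin

lemma infinite_F: "infinite (UNIV :: 'f set)"
  using infinite_field_derivn[OF D1(1) two, of t1] D1(2) by simp

text \<open>Each point with \<open>x1\<close> nonzero is joined by a line to a fixed one of this
  kind, and along the line the one-variable result makes \<open>y1/x1\<close> constant. Over an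
  infinite field, agreement at all points gives equality of polynomials.\<close>

lemma polynomial3_points_constant:
  fixes x1 x2 y1 y2 :: "'f poly poly poly"
  assumes eq: "y1 * (y1 ^ 2 + cc t1 * x1 ^ 2) = y2 * (y2 ^ 2 + cc t2 * x2 ^ 2)" and x1: "x1 \<noteq> 0"
  shows "\<exists>c. y1 = cc c * x1"
proof -
  have id: "rhom (\<lambda>c :: 'f. c)" by (simp add: rhom_def)
  let ?e = "\<lambda>r1 r2 r3. pev3 (\<lambda>c. c) r1 r2 r3 :: 'f poly poly poly \<Rightarrow> 'f"
  obtain p1 p2 p3 where p: "?e p1 p2 p3 x1 \<noteq> 0" using pev3_zero[OF infinite_F] x1 by metis
  define c where "c = ?e p1 p2 p3 y1 / ?e p1 p2 p3 x1"
  have van: "?e r1 r2 r3 (y1 - cc c * x1) = 0" if r: "?e r1 r2 r3 x1 \<noteq> 0" for r1 r2 r3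
  proof -
    \<comment> \<open>Restriction to the line that passes through the base point at parameter
      \<open>0\<close> and through \<open>(r1, r2, r3)\<close> at parameter
      \<open>1\<close>.\<close>
    define ln where "ln = pev3 (\<lambda>c :: 'f. [:c:]) [:p1, r1 - p1:] [:p2, r2 - p2:] [:p3, r3 - p3:]"
    have l: "rhom ln" unfolding ln_def by (rule rhom_pev3[OF rhom_const_poly])
    have lc: "ln (cc c) = [:c:]" for c by (simp add: ln_def pev3_simps[OF rhom_const_poly])
    have rp: "rhom (\<lambda>q :: 'f poly. poly q t)" for t by (rule rhomI) simp_all
    have at: "poly (ln q) t = ?e (p1 + t * (r1 - p1)) (p2 + t * (r2 - p2)) (p3 + t * (r3 - p3)) q" for q t
    proof (induction q rule: poly3_closed_induct)
      case (5 x y)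
      then show ?case by (simp add: rhom_add[OF l] rhom_add[OF rhom_pev3[OF id]])
    next
      case (6 x y)
      then show ?case by (simp add: rhom_mult[OF l] rhom_mult[OF rhom_pev3[OF id]])
    qed (simp_all add: ln_def pev3_simps[OF rhom_const_poly] pev3_simps[OF id])
    have at0: "poly (ln q) 0 = ?e p1 p2 p3 q" and at1: "poly (ln q) 1 = ?e r1 r2 r3 q" for q
      using at[of q 0] at[of q 1] by simp_all
    have "ln (y1 * (y1 ^ 2 + cc t1 * x1 ^ 2)) = ln (y2 * (y2 ^ 2 + cc t2 * x2 ^ 2))" using eq by (rule arg_cong)
    then have leq: "ln y1 * A (ln x1) (ln y1) = ln y2 * B (ln x2) (ln y2)"
      unfolding A_def B_def by (simp only: rhom_mult[OF l] rhom_add[OF l] rhom_power[OF l] lc)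
    have "poly (ln y1) 1 = c * poly (ln x1) 1"
    proof (cases "ln y1 = 0")
      case True
      then show ?thesis using at0[of y1] by (simp add: c_def)
    next
      case False
      obtain d a b where d: "d \<noteq> 0" "ln x1 = smult a d" "ln y1 = smult b d"
        using polynomial_points_constant[OF leq False] .
      have "poly d 0 \<noteq> 0" "a \<noteq> 0" using p at0[of x1] d(2) by auto
      moreover have "?e p1 p2 p3 y1 = b * poly d 0" "?e p1 p2 p3 x1 = a * poly d 0"
        using at0[of x1] at0[of y1] d by simp_all
      ultimately have "c = b / a" unfolding c_def by simp
      then show ?thesis using d \<open>a \<noteq> 0\<close> by simp
    qed
    then show ?thesis
      using at1[of y1] at1[of x1] by (simp add: rhom_diff[OF rhom_pev3[OF id]] rhom_mult[OF rhom_pev3[OF id]] pev3_simps[OF id]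
          del: mult_pCons_left)
  qed
  \<comment> \<open>The factor \<open>x1\<close> takes care of the points where the quotient is
    undefined.\<close>
  have "(y1 - cc c * x1) * x1 = 0"
    by (rule pev3_zero[OF infinite_F]) (use van in \<open>auto simp only: rhom_mult[OF rhom_pev3[OF id]] mult_eq_0_iff\<close>)
  then have "y1 = cc c * x1" using x1 by simp
  then show ?thesis by blast
qed

lemma fraction_points_constant:
  fixes a b c :: "'f poly poly poly fract"
  assumes eq: "a * (a ^ 2 + to_fract (cc t1)) = b * (b ^ 2 + to_fract (cc t2) * c ^ 2)"
  shows "\<exists>k. a = to_fract (cc k)"
proof -
  have fr: "\<exists>n d. d \<noteq> 0 \<and> x = to_fract n / to_fract d" for x :: "'f poly poly poly fract"
  proof (cases x)
    case (Fract n d)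
    then show ?thesis by (intro exI[of _ n] exI[of _ d]) (simp add: to_fract_def)
  qed
  obtain n1 e1 where 1: "e1 \<noteq> 0" "a = to_fract n1 / to_fract e1" using fr by blast
  obtain n2 e2 where 2: "e2 \<noteq> 0" "b = to_fract n2 / to_fract e2" using fr by blast
  obtain n3 e3 where 3: "e3 \<noteq> 0" "c = to_fract n3 / to_fract e3" using fr by blast
  define x1 where "x1 = e1 * e2 * e3"
  define y1 where "y1 = n1 * e2 * e3"
  define y2 where "y2 = n2 * e1 * e3"
  define x2 where "x2 = n3 * e1 * e2"
  note F = rhom_to_fract[where ?'a = "'f poly poly poly"]
  have nz: "to_fract e \<noteq> 0" if "e \<noteq> 0" for e :: "'f poly poly poly"
    using that to_fract_inj[of e 0] rhom_0[OF F] by auto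
  have x1: "x1 \<noteq> 0" using 1 2 3 by (simp add: x1_def)
  let ?x = "to_fract x1"
  have r: "to_fract y1 = a * ?x" "to_fract y2 = b * ?x" "to_fract x2 = c * ?x"
    using 1 2 3 nz by (simp_all add: x1_def y1_def y2_def x2_def rhom_mult[OF F] field_simps)
  have "to_fract (y1 * (y1 ^ 2 + cc t1 * x1 ^ 2)) = ?x ^ 3 * (a * (a ^ 2 + to_fract (cc t1)))"
    by (simp only: rhom_mult[OF F] rhom_add[OF F] rhom_power[OF F] r) (simp add: power2_eq_square power3_eq_cube algebra_simps)
  also have "\<dots> = to_fract (y2 * (y2 ^ 2 + cc t2 * x2 ^ 2))"
    unfolding eq
    by (simp only: rhom_mult[OF F] rhom_add[OF F] rhom_power[OF F] r) (simp add: power2_eq_square power3_eq_cube algebra_simps)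
  finally have "y1 * (y1 ^ 2 + cc t1 * x1 ^ 2) = y2 * (y2 ^ 2 + cc t2 * x2 ^ 2)" by (rule to_fract_inj)
  then obtain k where "y1 = cc k * x1" using polynomial3_points_constant[OF _ x1] by blast
  then have "a * ?x = to_fract (cc k) * ?x" using r(1) by (simp only: rhom_mult[OF F, symmetric])
  then have "a = to_fract (cc k)" using nz[OF x1] by simp
  then show ?thesis by blast
qed

end

section \<open>The projective plane\<close>

lemma UNIV_three: "(UNIV :: 3 set) = {0, 1, 2}"
  by (rule sym, rule card_subset_eq) auto

text \<open>The coordinates go to the outer, inner and middle variable in this order to match
  \<open>z\<close>, \<open>x2\<close>, \<open>y2\<close> on the cubic after adjoining the square
  root.\<close>

definition \<Theta>3 :: "(3, 'k::field) mpoly \<Rightarrow> 'k poly poly poly" where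
  "\<Theta>3 = mev cc (\<lambda>v. if v = 0 then vo else if v = 1 then vi else vm)"

definition \<psi>3 :: "(3, 'k::field) mpoly \<Rightarrow> 'k poly poly poly fract" where
  "\<psi>3 a = to_fract (\<Theta>3 a)"

lemma rhom_Theta3: "rhom \<Theta>3"
  unfolding \<Theta>3_def by (rule rhom_mev[OF rhom_cc])

lemma Theta3_simps: "\<Theta>3 (Const c) = cc c" "\<Theta>3 (Var 0) = vo" "\<Theta>3 (Var 1) = vi" "\<Theta>3 (Var 2) = vm"
  by (simp_all add: \<Theta>3_def mev_Const[OF rhom_cc] mev_Var[OF rhom_cc])

lemma rhom_psi3: "rhom \<psi>3"
  unfolding \<psi>3_def by (rule rhom_comp[OF rhom_to_fract rhom_Theta3])

lemma Theta3_inverse: "pev3 Const (Var 1) (Var 2) (Var 0) (\<Theta>3 p) = p"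
proof (rule rhom_mpoly_ext[of "\<lambda>p. pev3 Const (Var 1) (Var 2) (Var 0) (\<Theta>3 p)" "\<lambda>p. p"])
  show "rhom (\<lambda>p. pev3 Const (Var 1) (Var 2) (Var 0) (\<Theta>3 p))"
    by (rule rhom_comp[OF rhom_pev3[OF rhom_Const] rhom_Theta3])
  show "rhom (\<lambda>p :: (3, 'a) mpoly. p)" by (simp add: rhom_def)
  show "pev3 Const (Var 1) (Var 2) (Var 0) (\<Theta>3 (Const c)) = Const c" for c :: 'a
    by (simp add: Theta3_simps pev3_simps[OF rhom_Const])
  fix v :: 3
  have "v \<in> {0, 1, 2}" using UNIV_three by blast
  then show "pev3 Const (Var 1) (Var 2) (Var 0) (\<Theta>3 (Var v)) = Var v"
    by (auto simp: Theta3_simps pev3_simps[OF rhom_Const] simp del: One_nat_def)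
qed

lemma inj_psi3: "inj \<psi>3"
  by (rule injI) (metis Theta3_inverse \<psi>3_def to_fract_inj)

global_interpretation pl: poly_model "polynomial_algebra :: ((3, 'k::field) mpoly, 'k) graded_algebra" "\<lambda>a. a" \<psi>3
  by (rule polynomial_model[OF rhom_psi3 inj_psi3])

section \<open>Rational maps from the plane to the cubic are not dominant\<close>

locale dominant_map = cubic_field t1 t2 D1 D2
  for t1 t2 :: "'f::field" and D1 D2 :: "'f \<Rightarrow> 'f" +
  fixes U :: "(3, 'f) mpoly set set" and f and g
  assumes rep: "represents_rational_map (Proj polynomial_algebra) (Proj (cubic_ring t1 t2)) U f g"
    and dom: "ptop (Proj (cubic_ring t1 t2)) closure_of (f ` U) = points (Proj (cubic_ring t1 t2))"
begin

abbreviation "Z \<equiv> open_subspace (Proj (polynomial_algebra :: ((3, 'f) mpoly, 'f) graded_algebra)) U"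
abbreviation "Y \<equiv> Proj (cubic_ring t1 t2)"

lemma mor: "morphism_over Z Y f g" and U_dense: "dense_open (Proj polynomial_algebra) U"
  using rep by (simp_all add: represents_rational_map_def)

lemma U: "openin (proj_top polynomial_algebra) U"
  using U_dense by (simp add: dense_open_def pl.ptop_Proj)

definition W :: "_ \<Rightarrow> (3, 'f) mpoly set set" where "W V = preim Z f V"

lemma points_Y: "points Y = cub.pts"
  using cub.points_sub[OF cub.openin_pts] by (simp add: cub.open_subspace_pts)

lemma W_eq: "W V = {x \<in> U. f x \<in> V}"
  by (simp add: W_def preim_def pl.points_sub[OF U])

lemma openin_W: assumes V: "openin (proj_top (cubic_ring t1 t2)) V" shows "openin (proj_top polynomial_algebra) (W V)" "W V \<subseteq> U"
proof -
  have "continuous_map (ptop Z) (ptop Y) f" using mor by (simp add: morphism_over_def)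
  then have "openin (ptop Z) {x \<in> topspace (ptop Z). f x \<in> V}"
    using V by (intro openin_continuous_map_preimage) (auto simp: cub.ptop_Proj)
  then have "openin (ptop Z) (W V)" by (simp add: W_def preim_def)
  then show "openin (proj_top polynomial_algebra) (W V)" "W V \<subseteq> U" using pl.openin_sub[OF U] by auto
qed

lemma W_pts: "openin (proj_top (cubic_ring t1 t2)) V \<Longrightarrow> W V \<subseteq> pl.pts"
  using openin_W(1) pl.openin_proj_iff by blast

text \<open>Here dominance enters: preimages of nonempty open sets are nonempty, and so contain the
  generic point of the plane.\<close>

lemma eta_W:
  assumes V: "openin (proj_top (cubic_ring t1 t2)) V" "V \<noteq> {}" shows "pl.\<eta> \<in> W V"
proof -
  obtain y where y: "y \<in> V" using V(2) by blast
  have "y \<in> cub.pts" using V(1) y cub.openin_proj_iff by blast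
  then have "y \<in> ptop Y closure_of (f ` U)" unfolding dom points_Y .
  then have "\<forall>T. y \<in> T \<and> openin (proj_top (cubic_ring t1 t2)) T \<longrightarrow> (\<exists>z. z \<in> f ` U \<and> z \<in> T)"
    unfolding in_closure_of cub.ptop_Proj by (rule conjunct2)
  then obtain z where "z \<in> f ` U" "z \<in> V" using V(1) y by meson
  then have "W V \<noteq> {}" by (auto simp: W_eq)
  then show ?thesis using pl.eta_open openin_W(1)[OF V(1)] by blast
qed

text \<open>The comorphism seen on function fields. It is a relation, because \<open>g\<close> is
  given separately on every open set.\<close>

definition is_val :: "(coord, 'f) mpoly set set set \<Rightarrow> 'f ffield \<Rightarrow> 'f poly poly poly fract \<Rightarrow> bool" where
  "is_val V x y \<longleftrightarrow> x \<in> cub.OU V \<and> y \<in> pl.OU (W V) \<and> g V (cub.sec V x) = pl.sec (W V) y"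

lemma is_val_unique:
  assumes V: "openin (proj_top (cubic_ring t1 t2)) V" "V \<noteq> {}" and "is_val V x y" "is_val V x y'"
  shows "y = y'"
proof -
  have e: "pl.\<eta> \<in> W V" using eta_W[OF V] .
  have "pl.sec (W V) y = pl.sec (W V) y'" using assms(3,4) by (simp add: is_val_def)
  then have "pl.sec (W V) y pl.\<eta> = pl.sec (W V) y' pl.\<eta>" by (rule fun_cong)
  then have "pl.fr pl.\<eta> y = pl.fr pl.\<eta> y'" using e by (simp add: pl.sec_def)
  moreover have "y \<in> pl.Oc pl.\<eta>" using assms(3) e by (simp add: is_val_def pl.OU_def)
  ultimately show ?thesis using pl.fr_inj by metis
qed

context
  fixes V assumes V: "openin (proj_top (cubic_ring t1 t2)) V"
begin

lemma gV: "g V \<in> ring_hom (proj_sections (cubic_ring t1 t2) V) (proj_sections polynomial_algebra (W V))"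
  using mor V by (simp add: morphism_over_def cub.sections_Proj pl.sections_sub[OF U] W_def cub.ptop_Proj)

lemma V_pts: "V \<subseteq> cub.pts"
  using V cub.openin_proj_iff by blast

lemma sec_mem: "x \<in> cub.OU V \<Longrightarrow> cub.sec V x \<in> carrier (proj_sections (cubic_ring t1 t2) V)"
  using cub.sections_carrier[OF V] by blast

lemma is_val_ex: assumes x: "x \<in> cub.OU V" shows "\<exists>y. is_val V x y"
proof -
  have "g V (cub.sec V x) \<in> carrier (proj_sections polynomial_algebra (W V))"
    using ring_hom_closed[OF gV sec_mem[OF x]] .
  then show ?thesis using pl.sections_carrier[OF openin_W(1)[OF V]] x by (auto simp: is_val_def)
qed

lemma is_val_mult: assumes "is_val V x y" "is_val V x' y'" shows "is_val V (x * x') (y * y')"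
proof -
  have o: "x \<in> cub.OU V" "x' \<in> cub.OU V" "y \<in> pl.OU (W V)" "y' \<in> pl.OU (W V)" using assms by (simp_all add: is_val_def)
  have "g V (cub.sec V (x * x')) = g V (cub.sec V x \<otimes>\<^bsub>proj_sections (cubic_ring t1 t2) V\<^esub> cub.sec V x')"
    using cub.sections_ops(1)[OF V_pts o(1,2)] by simp
  also have "\<dots> = g V (cub.sec V x) \<otimes>\<^bsub>proj_sections polynomial_algebra (W V)\<^esub> g V (cub.sec V x')"
    by (rule ring_hom_mult[OF gV sec_mem[OF o(1)] sec_mem[OF o(2)]])
  also have "\<dots> = pl.sec (W V) (y * y')"
    using pl.sections_ops(1)[OF W_pts[OF V] o(3,4)] assms by (simp add: is_val_def)
  finally show ?thesis using o cub.OU_simps(5)[OF V_pts] pl.OU_simps(5)[OF W_pts[OF V]] by (simp add: is_val_def)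
qed

lemma is_val_add: assumes "is_val V x y" "is_val V x' y'" shows "is_val V (x + x') (y + y')"
proof -
  have o: "x \<in> cub.OU V" "x' \<in> cub.OU V" "y \<in> pl.OU (W V)" "y' \<in> pl.OU (W V)" using assms by (simp_all add: is_val_def)
  have "g V (cub.sec V (x + x')) = g V (cub.sec V x \<oplus>\<^bsub>proj_sections (cubic_ring t1 t2) V\<^esub> cub.sec V x')"
    using cub.sections_ops(2)[OF V_pts o(1,2)] by simp
  also have "\<dots> = g V (cub.sec V x) \<oplus>\<^bsub>proj_sections polynomial_algebra (W V)\<^esub> g V (cub.sec V x')"
    by (rule ring_hom_add[OF gV sec_mem[OF o(1)] sec_mem[OF o(2)]])
  also have "\<dots> = pl.sec (W V) (y + y')"
    using pl.sections_ops(2)[OF W_pts[OF V] o(3,4)] assms by (simp add: is_val_def)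
  finally show ?thesis using o cub.OU_simps(4)[OF V_pts] pl.OU_simps(4)[OF W_pts[OF V]] by (simp add: is_val_def)
qed

lemma is_val_one: "is_val V 1 1"
proof -
  have "g V (cub.sec V 1) = g V \<one>\<^bsub>proj_sections (cubic_ring t1 t2) V\<^esub>" using cub.sections_one[OF V_pts] by simp
  also have "\<dots> = \<one>\<^bsub>proj_sections polynomial_algebra (W V)\<^esub>" by (rule ring_hom_one[OF gV])
  also have "\<dots> = pl.sec (W V) 1" by (rule pl.sections_one[OF W_pts[OF V]])
  finally show ?thesis using cub.OU_simps(2)[OF V_pts] pl.OU_simps(2)[OF W_pts[OF V]] by (simp add: is_val_def)
qed

lemma is_val_restrict:
  assumes V': "openin (proj_top (cubic_ring t1 t2)) V'" "V' \<subseteq> V" and x: "is_val V x y"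
  shows "is_val V' x y"
proof -
  have o: "x \<in> cub.OU V" "y \<in> pl.OU (W V)" using x by (simp_all add: is_val_def)
  have WW: "W V' \<subseteq> W V" using V'(2) by (auto simp: W_eq)
  have "g V' (restr Y V V' (cub.sec V x)) = restr Z (preim Z f V) (preim Z f V') (g V (cub.sec V x))"
    using mor V V' sec_mem[OF o(1)] by (simp add: morphism_over_def cub.ptop_Proj cub.sections_Proj)
  then have "g V' (cub.sec V' x) = pl.sec (W V') y"
    using x by (simp add: cub.restr_Proj pl.restr_sub[OF U] cub.restrict_sec[OF V'(2)] is_val_def
        W_def[symmetric] pl.restrict_sec[OF WW])
  then show ?thesis using o cub.OU_mono[OF V'(2)] pl.OU_mono[OF WW] by (simp add: is_val_def)
qed

end

lemma is_val_const:
  assumes V: "openin (proj_top (cubic_ring t1 t2)) V"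
  shows "is_val V (\<psi> (Const c)) (\<psi>3 (Const c))"
proof -
  have "g (points Y) (scalar Y c) = scalar Z c" using mor by (simp add: morphism_over_def)
  moreover have "W cub.pts = U"
    using mor cub.topspace_proj by (auto simp: W_eq morphism_over_def continuous_map_def cub.ptop_Proj pl.points_sub[OF U])
  ultimately have "is_val cub.pts (\<psi> (Const c)) (\<psi>3 (Const c))"
    unfolding is_val_def points_Y cub.scalar_sec pl.scalar_sub[OF U]
    using cub.OU_simps(3)[of cub.pts] pl.OU_simps(3)[of U] pl.open_subset_pts[OF U] U by simp
  then show ?thesis using is_val_restrict[OF cub.openin_pts V] V cub.openin_proj_iff by blast
qed

lemma psi_nonzero: "\<psi> (Var X1) \<noteq> 0" "\<psi> (Var Y1 - Const k * Var X1) \<noteq> 0"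
proof -
  have r: "jj h0 + jj h1 * \<rho> = 0 \<Longrightarrow> h0 = 0 \<and> h1 = 0" for h0 h1 by (rule linear_over_jj)
  show "\<psi> (Var X1) \<noteq> 0"
    using r[of 0 1] by (auto simp: psi_simps rhom_0[OF rhom_jj] rhom_1[OF rhom_jj])
  have "jj vo + jj (- cc k) * \<rho> \<noteq> 0" using r[of vo "- cc k"] by auto
  then show "\<psi> (Var Y1 - Const k * Var X1) \<noteq> 0"
    by (simp only: rhom_diff[OF rhom_psi] rhom_mult[OF rhom_psi] psi_simps rhom_minus[OF rhom_jj]) simp
qed

lemma pi_homogeneous: "a \<in> forms n \<Longrightarrow> cubic_proj t1 t2 a \<in> homogeneous (cubic_ring t1 t2)"
  unfolding homogeneous_def cub.hpart_R by blast

abbreviation "Da a \<equiv> cub.Dp (cubic_proj t1 t2 a)"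

lemma open_Da: "a \<in> forms n \<Longrightarrow> openin (proj_top (cubic_ring t1 t2)) (Da a)"
  by (rule cub.openin_Dp[OF pi_homogeneous])

lemma Da_nonempty: assumes "\<psi> a \<noteq> 0" shows "Da a \<noteq> {}"
proof -
  have "cubic_proj t1 t2 a \<noteq> cubic_proj t1 t2 0" using assms by (simp add: cub.pi_eq rhom_0[OF rhom_psi])
  then have "cubic_proj t1 t2 a \<noteq> \<zero>\<^bsub>cubic_ring t1 t2\<^esub>" by (simp add: cub.pi_zero)
  then show ?thesis using cub.eta_Dp by blast
qed

lemma frac_Da: "a \<in> forms n \<Longrightarrow> s \<in> forms n \<Longrightarrow> \<psi> a / \<psi> s \<in> cub.OU (Da s)"
  using cub.Oc_psiI[of a n s] by (auto simp: cub.OU_def cub.Dp_iff cub.lft_iff)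

text \<open>The images of the affine coordinates satisfy the cubic equation in rational functions,
  so that of \<open>y1/x1\<close> is a constant \<open>r\<close>. But \<open>y1/x1 - r\<close> is
  invertible on a nonempty open set, and a unit cannot be sent to zero in a nonzero ring.\<close>

lemma contradiction: False
proof -
  let ?V = "Da (Var X1)"
  have V: "openin (proj_top (cubic_ring t1 t2)) ?V" using open_Da[OF forms_Var] .
  have Vn: "?V \<noteq> {}" using Da_nonempty psi_nonzero(1) by blast
  define a where "a = \<psi> (Var Y1) / \<psi> (Var X1)"
  define b where "b = \<psi> (Var Y2) / \<psi> (Var X1)"
  define c where "c = \<psi> (Var X2) / \<psi> (Var X1)"
  obtain a' where a': "is_val ?V a a'" using is_val_ex[OF V frac_Da[OF forms_Var forms_Var]] unfolding a_def by blast
  obtain b' where b': "is_val ?V b b'" using is_val_ex[OF V frac_Da[OF forms_Var forms_Var]] unfolding b_def by blast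
  obtain c' where c': "is_val ?V c c'" using is_val_ex[OF V frac_Da[OF forms_Var forms_Var]] unfolding c_def by blast
  note m = is_val_mult[OF V] and ad = is_val_add[OF V] and k = is_val_const[OF V]
  have "is_val ?V (a * (a * a + \<psi> (Const t1))) (a' * (a' * a' + \<psi>3 (Const t1)))"
    by (intro m ad k a')
  moreover have "is_val ?V (b * (b * b + \<psi> (Const t2) * (c * c))) (b' * (b' * b' + \<psi>3 (Const t2) * (c' * c')))"
    by (intro m ad k b' c')
  moreover have "a * (a * a + \<psi> (Const t1)) = b * (b * b + \<psi> (Const t2) * (c * c))"
  proof -
    have "\<psi> (cubic t1 t2) = 0" by (rule psi_cubic)
    then have "\<psi> (Var Y1) * (\<psi> (Var Y1) ^ 2 + \<psi> (Const t1) * \<psi> (Var X1) ^ 2)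
        = - (\<psi> (Var Y2) * (\<psi> (Var Y2) ^ 2 + \<psi> (Const t2) * \<psi> (Var X2) ^ 2))"
      unfolding cubic_def eq_neg_iff_add_eq_0
      by (simp only: rhom_add[OF rhom_psi] rhom_mult[OF rhom_psi] rhom_power[OF rhom_psi])
        (simp add: power2_eq_square power3_eq_cube algebra_simps)
    also have "\<dots> = \<psi> (Var Y2) * (\<psi> (Var Y2) ^ 2 + \<psi> (Const t2) * \<psi> (Var X2) ^ 2)"
    proof (rule two_minus)
      have "\<psi> (Const 2) = 2" by (metis (no_types) numeral_One one_add_one rhom_add[OF rhom_psi] rhom_1[OF rhom_psi] Const_1 rhom_add[OF rhom_Const])
      then show "(2 :: 'f ffield) = 0" using two by (simp add: rhom_0[OF rhom_psi])
    qed
    finally have e: "\<psi> (Var Y1) * (\<psi> (Var Y1) ^ 2 + \<psi> (Const t1) * \<psi> (Var X1) ^ 2)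
        = \<psi> (Var Y2) * (\<psi> (Var Y2) ^ 2 + \<psi> (Const t2) * \<psi> (Var X2) ^ 2)" .
    have r: "\<psi> (Var Y1) = a * \<psi> (Var X1)" "\<psi> (Var Y2) = b * \<psi> (Var X1)" "\<psi> (Var X2) = c * \<psi> (Var X1)"
      using psi_nonzero(1) by (simp_all add: a_def b_def c_def)
    have "\<psi> (Var X1) ^ 3 * (a * (a * a + \<psi> (Const t1))) = \<psi> (Var X1) ^ 3 * (b * (b * b + \<psi> (Const t2) * (c * c)))"
      using e unfolding r by (simp only: power2_eq_square power3_eq_cube algebra_simps)
    then show ?thesis using psi_nonzero(1) by simp
  qed
  ultimately have "a' * (a' * a' + \<psi>3 (Const t1)) = b' * (b' * b' + \<psi>3 (Const t2) * (c' * c'))"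
    using is_val_unique[OF V Vn] by metis
  then have "a' * (a' ^ 2 + to_fract (cc t1)) = b' * (b' ^ 2 + to_fract (cc t2) * c' ^ 2)"
    by (simp only: power2_eq_square \<psi>3_def Theta3_simps)
  then obtain r where r: "a' = \<psi>3 (Const r)" using fraction_points_constant unfolding \<psi>3_def Theta3_simps by blast
  \<comment> \<open>The plane section \<open>l = 0\<close> would contain the image; where
    \<open>l\<close> and \<open>x1\<close> do not vanish, \<open>y1/x1 - r\<close> has the inverse
    \<open>x1/l\<close>.\<close>
  define l where "l = Var Y1 - Const r * (Var X1 :: (coord, 'f) mpoly)"
  have "Const r * (Var X1 :: (coord, 'f) mpoly) \<in> forms 1"
    using forms_mult[OF forms_Const forms_Var, of r X1] by simp
  then have lf: "l \<in> forms 1" using forms_add[OF forms_Var[of Y1] forms_neg] by (simp add: l_def)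
  have ln: "\<psi> l \<noteq> 0" using psi_nonzero(2) by (simp add: l_def)
  let ?V' = "Da (Var X1 * l)"
  have V': "openin (proj_top (cubic_ring t1 t2)) ?V'" using open_Da[OF forms_mult[OF forms_Var lf]] .
  have Vn': "?V' \<noteq> {}" using Da_nonempty psi_nonzero(1) ln by (simp add: rhom_mult[OF rhom_psi])
  have sub: "?V' \<subseteq> ?V" "?V' \<subseteq> Da l"
    using cub.pts_mult cub.carrier_R by (auto simp: cub.Dp_iff cub.pi_mult)
  have 1: "is_val ?V' (a + \<psi> (Const (- r))) (a' + \<psi>3 (Const (- r)))"
    using is_val_add[OF V' is_val_restrict[OF V V' sub(1) a'] is_val_const[OF V']] .
  have "\<psi>3 (Const (- r)) = - \<psi>3 (Const r)" by (simp add: rhom_minus[OF rhom_comp[OF rhom_psi3 rhom_Const]])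
  then have a0: "is_val ?V' (a + \<psi> (Const (- r))) 0" using 1 r by simp
  have "\<psi> (Var X1) / \<psi> l \<in> cub.OU ?V'" using frac_Da[OF forms_Var lf] cub.OU_mono[OF sub(2)] by blast
  then obtain y where "is_val ?V' (\<psi> (Var X1) / \<psi> l) y" using is_val_ex[OF V'] by blast
  then have "is_val ?V' ((a + \<psi> (Const (- r))) * (\<psi> (Var X1) / \<psi> l)) (0 * y)" using is_val_mult[OF V' a0] by blast
  moreover have "a + \<psi> (Const (- r)) = \<psi> l / \<psi> (Var X1)"
    using psi_nonzero(1)
    by (simp add: a_def l_def rhom_diff[OF rhom_psi] rhom_mult[OF rhom_psi] rhom_minus[OF rhom_comp[OF rhom_psi rhom_Const]] field_simps)
  ultimately have "is_val ?V' 1 0" using ln psi_nonzero(1) by simp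
  then have "(1 :: 'f poly poly poly fract) = 0" by (rule is_val_unique[OF V' Vn' is_val_one[OF V']])
  then show False by simp
qed

end

theorem (in cubic_field) no_dominant_rational_map:
  "\<not> ex_dominant_rational_map (projective_plane :: ('f, _, _) ringed_space) (hypersurface (cubic t1 t2))"
proof
  assume "ex_dominant_rational_map (projective_plane :: ('f, _, _) ringed_space) (hypersurface (cubic t1 t2))"
  then obtain U f g where "represents_rational_map (Proj (polynomial_algebra :: ((3, 'f) mpoly, 'f) graded_algebra)) (Proj (cubic_ring t1 t2)) U f g"
    "ptop (Proj (cubic_ring t1 t2)) closure_of (f ` U) = points (Proj (cubic_ring t1 t2))"
    unfolding ex_dominant_rational_map_def projective_plane_def hypersurface_def by blast
  then interpret dominant_map t1 t2 D1 D2 U f g by unfold_locales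
  show False by (rule contradiction)
qed

section \<open>Rationality after adjoining the square root\<close>

text \<open>Irreducibility: any two nonempty open sets share the generic point.\<close>

lemma (in proj_model) dense_open_Proj:
  assumes U: "openin (proj_top R) U" "U \<noteq> {}" shows "dense_open (Proj R) U"
proof -
  have e: "\<eta> \<in> U" using eta_open[OF U] .
  have "points (Proj R) \<subseteq> ptop (Proj R) closure_of U"
  proof
    fix x assume x: "x \<in> points (Proj R)"
    show "x \<in> ptop (Proj R) closure_of U"
      unfolding in_closure_of
    proof (intro conjI allI impI x)
      fix T assume T: "x \<in> T \<and> openin (ptop (Proj R)) T"
      then have "\<eta> \<in> T" using eta_open by (auto simp: ptop_Proj)
      then show "\<exists>y. y \<in> U \<and> y \<in> T" using e by blast
    qed
  qed
  moreover have "ptop (Proj R) closure_of U \<subseteq> points (Proj R)" by (rule closure_of_subset_topspace)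
  ultimately show ?thesis using U(1) by (auto simp: dense_open_def ptop_Proj)
qed

text \<open>Substituting forms of degree \<open>d\<close> multiplies degrees by \<open>d\<close>,
  and positivity of \<open>d\<close> keeps different components apart.\<close>

lemma mev_hcomp:
  assumes v: "\<And>i. v i \<in> forms d" and d: "0 < d"
  shows "hcomp (mev Const v h) (n * d) = mev Const v (hcomp h n)"
proof -
  obtain N where N: "h = (\<Sum>i\<le>N. hcomp h i)" by (rule hcomp_sum_bound)
  let ?m = "mev Const v"
  note m = rhom_mev[OF rhom_Const, of v]
  have "hcomp (?m h) (n * d) = hcomp (?m (\<Sum>i\<le>N. hcomp h i)) (n * d)" by (rule arg_cong[OF N])
  also have "\<dots> = (\<Sum>i\<le>N. hcomp (?m (hcomp h i)) (n * d))" by (simp add: rhom_sum[OF m] hcomp_sum)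
  also have "\<dots> = (\<Sum>i\<le>N. if i * d = n * d then ?m (hcomp h i) else 0)"
    by (intro sum.cong refl hcomp_of_forms mev_forms v hcomp_forms)
  also have "\<dots> = (\<Sum>i\<le>N. ?m (if i = n then hcomp h i else 0))"
    using d by (intro sum.cong refl) (simp add: rhom_0[OF m])
  also have "\<dots> = ?m (\<Sum>i\<le>N. if i = n then hcomp h i else 0)" by (simp only: rhom_sum[OF m])
  also have "(\<Sum>i\<le>N. if i = n then hcomp h i else 0) = (\<Sum>i\<le>N. hcomp (hcomp h i) n)"
    by (intro sum.cong refl hcomp_of_forms[symmetric] hcomp_forms)
  also have "\<dots> = hcomp (\<Sum>i\<le>N. hcomp h i) n" by (simp only: hcomp_sum)
  also have "\<dots> = hcomp h n" by (rule arg_cong[OF N[symmetric]])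
  finally show ?thesis .
qed

locale cubic_sqrt =
  fixes s t2 :: "'e::field"
  assumes two: "(2 :: 'e) = 0" and s: "s \<noteq> 0"
begin

text \<open>With \<open>z = y\<^sub>1 + sx\<^sub>1\<close> the cubic becomes \<open>y\<^sub>1z\<^sup>2 + y\<^sub>2\<^sup>3 + t\<^sub>2x\<^sub>2\<^sup>2y\<^sub>2 = 0\<close>, which is linear in \<open>y\<^sub>1\<close>;
  the outer, inner and middle variables of \<open>E[z,x\<^sub>2,y\<^sub>2]\<close> are \<open>z\<close>, \<open>x\<^sub>2\<close> and \<open>y\<^sub>2\<close>.\<close>

definition c1 :: "'e poly poly poly" where "c1 = vm ^ 3 + cc t2 * vi ^ 2 * vm"

definition yy :: "'e poly poly poly fract" where "yy = to_fract c1 / to_fract vo ^ 2"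

definition zz :: "(coord, 'e) mpoly" where "zz = Var Y1 + Const s * Var X1"

text \<open>The generic point of the surface in the coordinates \<open>z\<close>, \<open>x2\<close>,
  \<open>y2\<close>: \<open>yy\<close> solves the equation for \<open>y1\<close>, and
  \<open>x1 = (z + y1) / s\<close>. The target is the field used for the plane, so that the local
  rings of both schemes can be compared directly.\<close>

definition \<psi> :: "(coord, 'e) mpoly \<Rightarrow> 'e poly poly poly fract" where
  "\<psi> = mev (\<lambda>c. to_fract (cc c)) (\<lambda>v. case v of X1 \<Rightarrow> to_fract (cc (1 / s)) * (to_fract vo + yy)
     | X2 \<Rightarrow> to_fract vi | Y1 \<Rightarrow> yy | Y2 \<Rightarrow> to_fract vm)"

definition \<Theta> :: "(coord, 'e) mpoly \<Rightarrow> 'e poly poly poly poly" where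
  "\<Theta> = mev (\<lambda>c. [:cc c:]) (\<lambda>v. case v of X1 \<Rightarrow> [:cc (1 / s):] * ([:vo:] + [:0, 1:]) | X2 \<Rightarrow> [:vi:]
     | Y1 \<Rightarrow> [:0, 1:] | Y2 \<Rightarrow> [:vm:])"

definition \<Theta>' :: "'e poly poly poly poly \<Rightarrow> (coord, 'e) mpoly" where
  "\<Theta>' = pev (pev3 Const (Var X2) (Var Y2) zz) (Var Y1)"

lemma rhom_cpc: "rhom (\<lambda>c :: 'e. [:cc c:])" and rhom_fc: "rhom (\<lambda>c :: 'e. to_fract (cc c))"
  by (intro rhom_comp[OF rhom_const_poly] rhom_comp[OF rhom_to_fract] rhom_cc)+

lemma rhom_Theta: "rhom \<Theta>" and rhom_psi: "rhom \<psi>" and rhom_Theta': "rhom \<Theta>'"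
  unfolding \<Theta>_def \<psi>_def \<Theta>'_def
  by (intro rhom_mev rhom_cpc rhom_fc rhom_pev rhom_pev3 rhom_Const)+

lemma Theta_simps: "\<Theta> (Const c) = [:cc c:]" "\<Theta> (Var X1) = [:cc (1 / s):] * ([:vo:] + [:0, 1:])" "\<Theta> (Var X2) = [:vi:]"
  "\<Theta> (Var Y1) = [:0, 1:]" "\<Theta> (Var Y2) = [:vm:]"
  unfolding \<Theta>_def by (simp_all only: mev_Const[OF rhom_cpc] mev_Var[OF rhom_cpc] coord.case)

lemma psi_simps: "\<psi> (Const c) = to_fract (cc c)" "\<psi> (Var X1) = to_fract (cc (1 / s)) * (to_fract vo + yy)"
  "\<psi> (Var X2) = to_fract vi" "\<psi> (Var Y1) = yy" "\<psi> (Var Y2) = to_fract vm"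
  unfolding \<psi>_def by (simp_all only: mev_Const[OF rhom_fc] mev_Var[OF rhom_fc] coord.case)

lemma two_any: "rhom h \<Longrightarrow> h (2 :: 'e) = (2 :: 'a::comm_ring_1) \<Longrightarrow> (2 :: 'a) = 0"
  by (simp add: two rhom_0)

lemma twos: "(2 :: (coord, 'e) mpoly) = 0" "(2 :: 'e poly poly poly) = 0" "(2 :: 'e poly poly poly poly) = 0"
  "(2 :: 'e poly poly poly fract) = 0" "(2 :: (3, 'e) mpoly) = 0"
proof -
  have t: "h (2 :: 'e) = (2 :: 'a::comm_ring_1)" if "rhom h" for h
    using rhom_add[OF that, of 1 1] by (simp add: rhom_1[OF that])
  show "(2 :: (coord, 'e) mpoly) = 0" "(2 :: (3, 'e) mpoly) = 0" by (rule two_any[OF rhom_Const t[OF rhom_Const]])+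
  show "(2 :: 'e poly poly poly) = 0" "(2 :: 'e poly poly poly poly) = 0" by (simp_all add: numeral_poly two)
  show "(2 :: 'e poly poly poly fract) = 0" by (rule two_any[OF rhom_fc t[OF rhom_fc]])
qed

lemma Const_s: "Const s * Const (1 / s) = (1 :: ('v::finite, 'e) mpoly)" "Const (1 / s) * Const s = (1 :: ('v, 'e) mpoly)"
  using s by (simp_all add: rhom_mult[OF rhom_Const, symmetric])

lemma Theta'_Theta: "\<Theta>' (\<Theta> p) = p"
proof (rule rhom_mpoly_ext[of "\<lambda>p. \<Theta>' (\<Theta> p)" "\<lambda>p. p"])
  have R: "rhom (pev3 Const (Var X2) (Var Y2) zz)" by (rule rhom_pev3[OF rhom_Const])
  note P = pev3_simps[OF rhom_Const, of "Var X2" "Var Y2" zz]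
  show "rhom (\<lambda>p. \<Theta>' (\<Theta> p))" by (rule rhom_comp[OF rhom_Theta' rhom_Theta])
  show "rhom (\<lambda>p :: (coord, 'e) mpoly. p)" by (simp add: rhom_def)
  have C: "\<Theta>' [:c:] = pev3 Const (Var X2) (Var Y2) zz c" "\<Theta>' [:0, 1:] = Var Y1" for c
    unfolding \<Theta>'_def by (rule pev_const[OF R], rule pev_var[OF R])
  show "\<Theta>' (\<Theta> (Const c)) = Const c" for c by (simp only: Theta_simps C P)
  have "\<Theta>' (\<Theta> (Var X1)) = Const (1 / s) * (zz + Var Y1)"
    by (simp only: Theta_simps rhom_mult[OF rhom_Theta'] rhom_add[OF rhom_Theta'] C P)
  also have "\<dots> = (Const (1 / s) * Const s) * Var X1 + Const (1 / s) * (Var Y1 + Var Y1)"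
    by (simp only: zz_def algebra_simps)
  also have "\<dots> = Var X1" unfolding Const_s two_sum_zero[OF twos(1)] by simp
  finally have x1: "\<Theta>' (\<Theta> (Var X1)) = Var X1" .
  show "\<Theta>' (\<Theta> (Var v)) = Var v" for v
    by (cases v) (simp_all only: x1 Theta_simps(3-5) C P)
qed

lemma psi_Theta: "\<psi> p = pev to_fract yy (\<Theta> p)"
proof (rule rhom_mpoly_ext[OF rhom_psi rhom_comp[OF rhom_pev[OF rhom_to_fract] rhom_Theta]])
  note P = rhom_pev[OF rhom_to_fract, of yy]
  note C = pev_const[OF rhom_to_fract, of yy] pev_var[OF rhom_to_fract, of yy]
  show "\<psi> (Const c) = pev to_fract yy (\<Theta> (Const c))" for c by (simp only: psi_simps Theta_simps C)
  show "\<psi> (Var v) = pev to_fract yy (\<Theta> (Var v))" for v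
    by (cases v) (simp_all only: psi_simps Theta_simps rhom_mult[OF P] rhom_add[OF P] C)
qed

lemma fract_nz: "to_fract (c :: 'a::idom) = 0 \<longleftrightarrow> c = 0"
  using to_fract_inj[of c 0] rhom_0[OF rhom_to_fract] by auto

text \<open>In characteristic two \<open>s^2 x1^2 = (z + y1)^2 = z^2 + y1^2\<close>, so the two
  cubes of \<open>y1\<close> cancel and the polynomial becomes linear in \<open>y1\<close>.\<close>

lemma Theta_cubic: "\<Theta> (cubic (s ^ 2) t2) = [:c1, vo ^ 2:]"
proof -
  define z y x m :: "'e poly poly poly poly" where "z = [:vo:]" and "y = [:0, 1:]" and "x = [:vi:]" and "m = [:vm:]"
  note d = z_def y_def x_def m_def
  have "[:cc (s ^ 2):] * [:cc (1 / s):] ^ 2 = 1"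
    using s by (simp add: rhom_power[OF rhom_cpc, symmetric] rhom_mult[OF rhom_cpc, symmetric] power_divide one_pCons)
  then have sq: "[:cc (s ^ 2):] * ([:cc (1 / s):] * (z + y)) ^ 2 = (z + y) ^ 2"
    by (simp only: power_mult_distrib mult.assoc[symmetric] mult_1)
  have "(z + y) ^ 2 = z ^ 2 + y ^ 2 + 2 * z * y" by (rule power2_sum)
  then have zy: "(z + y) ^ 2 = z ^ 2 + y ^ 2" by (simp only: twos mult_zero_left add_0_right)
  have "\<Theta> (cubic (s ^ 2) t2) = y ^ 3 + [:cc (s ^ 2):] * ([:cc (1 / s):] * (z + y)) ^ 2 * y + m ^ 3 + [:cc t2:] * x ^ 2 * m"
    unfolding cubic_def d by (simp only: rhom_add[OF rhom_Theta] rhom_mult[OF rhom_Theta] rhom_power[OF rhom_Theta] Theta_simps)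
  also have "\<dots> = (y ^ 3 + y ^ 3) + (z ^ 2 * y + (m ^ 3 + [:cc t2:] * x ^ 2 * m))"
    unfolding sq zy by (simp only: power2_eq_square power3_eq_cube algebra_simps)
  also have "\<dots> = z ^ 2 * y + (m ^ 3 + [:cc t2:] * x ^ 2 * m)" by (simp only: two_sum_zero[OF twos(3)] add_0_left)
  also have "\<dots> = [:c1, vo ^ 2:]" unfolding d by (simp add: c1_def power2_eq_square power3_eq_cube)
  finally show ?thesis .
qed

lemma psi_ker: "\<psi> a = 0 \<longleftrightarrow> cubic (s ^ 2) t2 dvd a"
proof -
  have vo: "to_fract (vo :: 'e poly poly poly) \<noteq> 0" by (simp add: fract_nz)
  have "pev to_fract yy [:c1, vo ^ 2:] = to_fract c1 + yy * to_fract vo ^ 2"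
    by (simp only: pev_pCons[OF rhom_to_fract] pev_0 mult_zero_right add_0_right rhom_power[OF rhom_to_fract])
  also have "\<dots> = to_fract c1 + to_fract c1" using vo by (simp add: yy_def)
  also have "\<dots> = 0" by (rule two_sum_zero[OF twos(4)])
  finally have root: "pev to_fract yy (\<Theta> (cubic (s ^ 2) t2)) = 0" by (simp only: Theta_cubic)
  show ?thesis
  proof
    assume a: "\<psi> a = 0"
    have "\<Theta> (cubic (s ^ 2) t2) dvd \<Theta> a"
    proof (rule poly_mod_kernel[OF rhom_to_fract root])
      show "pev to_fract yy (\<Theta> a) = 0" using a by (simp only: psi_Theta)
      show "p = 0" if p: "p = 0 \<or> degree p < degree (\<Theta> (cubic (s ^ 2) t2))" "pev to_fract yy p = 0" for p
      proof -
        have "degree p = 0" using p(1) unfolding Theta_cubic by (auto split: if_splits)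
        then obtain h where h: "p = [:h:]" by (rule degree_eq_zeroE)
        then show ?thesis using p(2) by (simp add: pev_const[OF rhom_to_fract] fract_nz)
      qed
      show "lead_coeff (\<Theta> (cubic (s ^ 2) t2)) = 1 * vo ^ 2" unfolding Theta_cubic by simp
      show "1 * 1 = (1 :: 'e poly poly poly)" by simp
      show "prime_elem (vo :: 'e poly poly poly)" by (rule prime_elem_vo)
      show "\<not> [:vo:] dvd \<Theta> (cubic (s ^ 2) t2)"
      proof
        assume "[:vo:] dvd \<Theta> (cubic (s ^ 2) t2)"
        then have "vo dvd coeff (\<Theta> (cubic (s ^ 2) t2)) 0" by (simp only: const_poly_dvd_iff)
        then have "vo dvd c1" by (simp add: Theta_cubic)
        then have "poly c1 0 = 0" using poly_eq_0_iff_dvd[of c1 0] by simp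
        moreover have "poly (poly (poly c1 0) 1) 0 = 1" by (simp add: c1_def)
        ultimately show False by simp
      qed
    qed
    then obtain w where "\<Theta> a = \<Theta> (cubic (s ^ 2) t2) * w" by (rule dvdE)
    then have "\<Theta>' (\<Theta> a) = \<Theta>' (\<Theta> (cubic (s ^ 2) t2)) * \<Theta>' w" by (simp only: rhom_mult[OF rhom_Theta'])
    then have "a = cubic (s ^ 2) t2 * \<Theta>' w" by (simp only: Theta'_Theta)
    then show "cubic (s ^ 2) t2 dvd a" by (rule dvdI)
  next
    assume "cubic (s ^ 2) t2 dvd a"
    then obtain b where "a = cubic (s ^ 2) t2 * b" by (rule dvdE)
    then show "\<psi> a = 0" using root by (simp only: rhom_mult[OF rhom_psi] psi_Theta[of "cubic (s ^ 2) t2"] mult_zero_left)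
  qed
qed

sublocale ce: poly_model "cubic_ring (s ^ 2) t2" "cubic_proj (s ^ 2) t2" \<psi>
proof -
  have "\<psi> (Var X2) \<noteq> 0" by (simp add: psi_simps fract_nz)
  then show "poly_model (cubic_ring (s ^ 2) t2) (cubic_proj (s ^ 2) t2) \<psi>"
    using quotient_model[OF rhom_psi psi_ker cubic_forms] by blast
qed

section \<open>Mutually inverse substitutions between plane and surface\<close>

definition \<phi> :: "(3, 'e) mpoly \<Rightarrow> (coord, 'e) mpoly" where
  "\<phi> = mev Const (\<lambda>v. if v = 0 then zz else if v = 1 then Var X2 else Var Y2)"

definition cz :: "(3, 'e) mpoly" where "cz = Var 2 ^ 3 + Const t2 * Var 1 ^ 2 * Var 2"

text \<open>The parametrization of the surface by the plane, multiplied by \<open>z^2\<close> to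
  clear denominators; this makes all four coordinates forms of degree three.\<close>

definition \<theta> :: "(coord, 'e) mpoly \<Rightarrow> (3, 'e) mpoly" where
  "\<theta> = mev Const (\<lambda>v. case v of X1 \<Rightarrow> Const (1 / s) * (Var 0 ^ 3 + cz) | X2 \<Rightarrow> Var 1 * Var 0 ^ 2
     | Y1 \<Rightarrow> cz | Y2 \<Rightarrow> Var 2 * Var 0 ^ 2)"

lemma rhom_phi: "rhom \<phi>" and rhom_theta: "rhom \<theta>"
  unfolding \<phi>_def \<theta>_def by (intro rhom_mev[OF rhom_Const])+

lemma phi_simps: "\<phi> (Const c) = Const c" "\<phi> (Var 0) = zz" "\<phi> (Var 1) = Var X2" "\<phi> (Var 2) = Var Y2"
  by (simp_all add: \<phi>_def mev_Const[OF rhom_Const] mev_Var[OF rhom_Const])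

lemma theta_simps: "\<theta> (Const c) = Const c" "\<theta> (Var X1) = Const (1 / s) * (Var 0 ^ 3 + cz)"
  "\<theta> (Var X2) = Var 1 * Var 0 ^ 2" "\<theta> (Var Y1) = cz" "\<theta> (Var Y2) = Var 2 * Var 0 ^ 2"
  unfolding \<theta>_def by (simp_all only: mev_Const[OF rhom_Const] mev_Var[OF rhom_Const] coord.case)

lemma zz_forms: "zz \<in> forms 1"
proof -
  have "Const s * Var X1 \<in> forms 1" using forms_mult[OF forms_Const forms_Var, of s X1] by simp
  then show ?thesis unfolding zz_def by (rule forms_add[OF forms_Var])
qed

lemma var_power_forms: "Var v ^ k \<in> forms k"
  using forms_power[OF forms_Var, of v k] by simp

lemma cz_forms: "cz \<in> forms 3"
proof -
  have "Const t2 * Var 1 ^ 2 * Var 2 \<in> forms (0 + 2 + 1)"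
    by (intro forms_mult forms_Const var_power_forms forms_Var)
  moreover have "0 + 2 + 1 = (3 :: nat)" by simp
  ultimately have "Const t2 * Var 1 ^ 2 * Var 2 \<in> (forms 3 :: (3, 'e) mpoly set)" by (simp only:)
  then show ?thesis unfolding cz_def by (rule forms_add[OF var_power_forms])
qed

lemma phi_gen_forms: "(if v = 0 then zz else if v = 1 then Var X2 else Var Y2) \<in> forms 1"
  by (auto intro: zz_forms forms_Var simp del: One_nat_def)

lemma theta_gen_forms: "(case v of X1 \<Rightarrow> Const (1 / s) * (Var 0 ^ 3 + cz) | X2 \<Rightarrow> Var 1 * Var 0 ^ 2
     | Y1 \<Rightarrow> cz | Y2 \<Rightarrow> Var 2 * Var 0 ^ 2) \<in> forms 3"
proof -
  have "Const (1 / s) * (Var 0 ^ 3 + cz) \<in> forms (0 + 3)"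
    by (intro forms_mult forms_Const forms_add var_power_forms cz_forms)
  moreover have "Var i * Var 0 ^ 2 \<in> (forms (1 + 2) :: (3, 'e) mpoly set)" for i
    by (intro forms_mult forms_Var var_power_forms)
  moreover have "0 + 3 = (3 :: nat)" "1 + 2 = (3 :: nat)" by simp_all
  ultimately show ?thesis using cz_forms by (cases v) (simp_all only: coord.case)
qed

lemma phi_forms: "h \<in> forms n \<Longrightarrow> \<phi> h \<in> forms n"
  using mev_forms[OF phi_gen_forms, of h n] by (simp add: \<phi>_def)

lemma theta_forms: "a \<in> forms n \<Longrightarrow> \<theta> a \<in> forms (n * 3)"
  using mev_forms[OF theta_gen_forms, of a n] by (simp add: \<theta>_def)

lemma phi_hcomp: "\<phi> (hcomp h n) = hcomp (\<phi> h) n"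
  using mev_hcomp[of "\<lambda>v :: 3. if v = 0 then zz else if v = 1 then Var X2 else Var Y2" 1 h n, OF phi_gen_forms] by (simp add: \<phi>_def)

lemma theta_hcomp: "\<theta> (hcomp h n) = hcomp (\<theta> h) (n * 3)"
  using mev_hcomp[of "\<lambda>v. case v of X1 \<Rightarrow> Const (1 / s) * (Var 0 ^ 3 + cz) | X2 \<Rightarrow> Var 1 * Var 0 ^ 2
     | Y1 \<Rightarrow> cz | Y2 \<Rightarrow> Var 2 * Var 0 ^ 2" 3 h n, OF theta_gen_forms] by (simp add: \<theta>_def)

lemma psi_zz: "\<psi> zz = to_fract vo"
proof -
  have "to_fract (cc s) * to_fract (cc (1 / s)) = (1 :: 'e poly poly poly fract)"
    using s by (simp only: rhom_mult[OF rhom_fc, symmetric]) (simp add: rhom_1[OF rhom_fc])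
  then have "\<psi> zz = yy + (to_fract vo + yy)"
    by (simp only: zz_def rhom_add[OF rhom_psi] rhom_mult[OF rhom_psi] psi_simps mult.assoc[symmetric] mult_1)
  also have "\<dots> = to_fract vo + (yy + yy)" by (simp only: add_ac)
  also have "\<dots> = to_fract vo" by (simp add: two_sum_zero[OF twos(4)])
  finally show ?thesis .
qed

lemma three_cases: "(v :: 3) = 0 \<or> v = 1 \<or> v = 2"
proof -
  have "v \<in> {0, 1, 2}" using UNIV_three by blast
  then show ?thesis by blast
qed

lemma psi_phi: "\<psi> (\<phi> h) = \<psi>3 h"
proof (rule rhom_mpoly_ext[OF rhom_comp[OF rhom_psi rhom_phi] rhom_psi3])
  show "\<psi> (\<phi> (Const c)) = \<psi>3 (Const c)" for c by (simp add: phi_simps psi_simps \<psi>3_def Theta3_simps)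
  show "\<psi> (\<phi> (Var v)) = \<psi>3 (Var v)" for v
    using three_cases[of v] by (auto simp: phi_simps psi_simps psi_zz \<psi>3_def Theta3_simps simp del: One_nat_def)
qed

lemma psi3_cz: "\<psi>3 cz = to_fract c1"
  by (simp only: cz_def c1_def rhom_add[OF rhom_psi3] rhom_mult[OF rhom_psi3] rhom_power[OF rhom_psi3] rhom_add[OF rhom_to_fract]
      rhom_mult[OF rhom_to_fract] rhom_power[OF rhom_to_fract]) (simp only: \<psi>3_def Theta3_simps)

lemma psi3_vars: "\<psi>3 (Const c) = to_fract (cc c)" "\<psi>3 (Var 0) = to_fract vo" "\<psi>3 (Var 1) = to_fract vi" "\<psi>3 (Var 2) = to_fract vm"
  by (simp_all add: \<psi>3_def Theta3_simps)

text \<open>The factor \<open>z^2\<close> that cleared the denominators reappears once per degree.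
  Thus \<open>\<theta>\<close> and \<open>\<phi>\<close> are inverse up to powers of
  \<open>z\<close>, which are harmless where \<open>z\<close> does not vanish.\<close>

lemma psi3_theta: assumes a: "a \<in> forms n" shows "\<psi>3 (\<theta> a) = \<psi> zz ^ (2 * n) * \<psi> a"
proof -
  let ?z = "to_fract vo :: 'e poly poly poly fract"
  have z0: "?z \<noteq> 0" by (simp add: fract_nz)
  have y: "?z ^ 2 * yy = to_fract c1" using z0 by (simp add: yy_def)
  have x: "?z ^ 2 * (to_fract (cc (1 / s)) * (?z + yy)) = to_fract (cc (1 / s)) * (?z ^ 3 + to_fract c1)"
    unfolding y[symmetric] by (simp only: power2_eq_square power3_eq_cube algebra_simps)
  have "\<psi>3 (\<theta> a) = mev (\<lambda>c. to_fract (cc c)) (\<lambda>v. ?z ^ 2 * \<psi> (Var v)) a"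
  proof (rule rhom_mpoly_ext[OF rhom_comp[OF rhom_psi3 rhom_theta] rhom_mev[OF rhom_fc]])
    show "\<psi>3 (\<theta> (Const c)) = mev (\<lambda>c. to_fract (cc c)) (\<lambda>v. ?z ^ 2 * \<psi> (Var v)) (Const c)" for c
      by (simp only: theta_simps mev_Const[OF rhom_fc] psi3_vars)
    show "\<psi>3 (\<theta> (Var v)) = mev (\<lambda>c. to_fract (cc c)) (\<lambda>v. ?z ^ 2 * \<psi> (Var v)) (Var v)" for v
      unfolding mev_Var[OF rhom_fc]
      by (cases v) (simp_all only: theta_simps psi_simps rhom_mult[OF rhom_psi3] rhom_add[OF rhom_psi3] rhom_power[OF rhom_psi3]
          psi3_vars psi3_cz x y, simp_all only: mult.commute)
  qed
  also have "\<dots> = (?z ^ 2) ^ n * mev (\<lambda>c. to_fract (cc c)) (\<lambda>v. \<psi> (Var v)) a"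
    by (rule mev_forms_scale[OF rhom_fc a])
  also have "mev (\<lambda>c. to_fract (cc c)) (\<lambda>v. \<psi> (Var v)) a = \<psi> a"
    by (rule rhom_mpoly_ext[OF rhom_mev[OF rhom_fc] rhom_psi]) (simp_all only: mev_Const[OF rhom_fc] mev_Var[OF rhom_fc] psi_simps)
  finally show ?thesis by (simp only: psi_zz power_mult)
qed

lemma theta_zz: "\<theta> zz = Var 0 ^ 3"
proof -
  have "\<theta> zz = cz + (Const s * Const (1 / s)) * (Var 0 ^ 3 + cz)"
    by (simp only: zz_def rhom_add[OF rhom_theta] rhom_mult[OF rhom_theta] theta_simps mult.assoc)
  also have "\<dots> = Var 0 ^ 3 + (cz + cz)" unfolding Const_s by (simp only: mult_1 add_ac)
  also have "\<dots> = Var 0 ^ 3" by (simp add: two_sum_zero[OF twos(5)])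
  finally show ?thesis .
qed

lemma theta_phi: assumes h: "h \<in> forms n" shows "\<theta> (\<phi> h) = (Var 0 ^ 2) ^ n * h"
proof -
  have "\<theta> (\<phi> h) = mev Const (\<lambda>v. Var 0 ^ 2 * Var v) h"
  proof (rule rhom_mpoly_ext[OF rhom_comp[OF rhom_theta rhom_phi] rhom_mev[OF rhom_Const]])
    show "\<theta> (\<phi> (Const c)) = mev Const (\<lambda>v. Var 0 ^ 2 * Var v) (Const c)" for c
      by (simp only: phi_simps theta_simps mev_Const[OF rhom_Const])
    have "\<theta> (\<phi> (Var 0)) = Var 0 ^ 2 * Var 0" "\<theta> (\<phi> (Var 1)) = Var 0 ^ 2 * Var 1" "\<theta> (\<phi> (Var 2)) = Var 0 ^ 2 * Var 2"
      by (simp_all only: phi_simps theta_simps theta_zz power2_eq_square power3_eq_cube mult_ac)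
    then show "\<theta> (\<phi> (Var v)) = mev Const (\<lambda>v. Var 0 ^ 2 * Var v) (Var v)" for v
      unfolding mev_Var[OF rhom_Const] using three_cases[of v] by blast
  qed
  also have "\<dots> = (Var 0 ^ 2) ^ n * mev Const Var h" by (rule mev_forms_scale[OF rhom_Const h])
  also have "mev Const Var h = h"
    by (rule rhom_mpoly_ext[OF rhom_mev[OF rhom_Const], of "\<lambda>p. p"])
      (simp_all add: mev_Const[OF rhom_Const] mev_Var[OF rhom_Const] rhom_def)
  finally show ?thesis .
qed

lemma psi3_eq_0: "\<psi>3 (a :: (3, 'e) mpoly) = 0 \<longleftrightarrow> a = 0"
  using inj_psi3 rhom_0[OF rhom_psi3] by (metis injD)

lemma lft_pl: "pl.lft q = q"
  by (simp add: pl.lft_def)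

text \<open>An ideal closed under components is determined by the forms in it, and on forms
  \<open>\<theta>\<close> and \<open>\<phi>\<close> are controlled.\<close>

lemma hprime_eqI:
  assumes "\<And>a n. a \<in> P \<Longrightarrow> hcomp a n \<in> P" "\<And>a n. a \<in> P' \<Longrightarrow> hcomp a n \<in> P'" "idl P" "idl P'"
    "\<And>a n. a \<in> forms n \<Longrightarrow> a \<in> P \<longleftrightarrow> a \<in> P'"
  shows "P = P'"
proof (intro equalityI subsetI)
  fix a assume a: "a \<in> P"
  have "hcomp a n \<in> P'" for n using assms(1)[OF a] assms(5)[OF hcomp_forms] by simp
  then show "a \<in> P'" by (rule hcomps_mem[OF assms(4)])
next
  fix a assume a: "a \<in> P'"
  have "hcomp a n \<in> P" for n using assms(2)[OF a] assms(5)[OF hcomp_forms] by simp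
  then show "a \<in> P" by (rule hcomps_mem[OF assms(3)])
qed

section \<open>The homeomorphism between the open sets where z does not vanish\<close>

definition FF :: "(coord, 'e) mpoly set set \<Rightarrow> (3, 'e) mpoly set" where
  "FF p = {h. \<phi> h \<in> ce.lft p}"

definition GG :: "(3, 'e) mpoly set \<Rightarrow> (coord, 'e) mpoly set set" where
  "GG q = cubic_proj (s ^ 2) t2 ` {a. \<theta> a \<in> q}"

definition U0 :: "(coord, 'e) mpoly set set set" where "U0 = ce.Dp (cubic_proj (s ^ 2) t2 zz)"

definition V0 :: "(3, 'e) mpoly set set" where "V0 = pl.Dp (Var 0)"

lemma U0_iff: "p \<in> U0 \<longleftrightarrow> p \<in> ce.pts \<and> zz \<notin> ce.lft p"
  by (simp add: U0_def ce.Dp_iff ce.lft_iff)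

lemma V0_iff: "q \<in> V0 \<longleftrightarrow> q \<in> pl.pts \<and> Var 0 \<notin> q"
  by (simp add: V0_def pl.Dp_iff)

lemma open_U0: "openin (proj_top (cubic_ring (s ^ 2) t2)) U0" "U0 \<noteq> {}"
proof -
  have "cubic_proj (s ^ 2) t2 zz \<in> homogeneous (cubic_ring (s ^ 2) t2)"
    unfolding homogeneous_def ce.hpart_R using zz_forms by blast
  then show "openin (proj_top (cubic_ring (s ^ 2) t2)) U0" unfolding U0_def by (rule ce.openin_Dp)
  have "cubic_proj (s ^ 2) t2 zz \<noteq> cubic_proj (s ^ 2) t2 0"
    by (simp add: ce.pi_eq rhom_0[OF rhom_psi] psi_zz fract_nz)
  then show "U0 \<noteq> {}" unfolding U0_def using ce.eta_Dp by (auto simp: ce.pi_zero)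
qed

lemma open_V0: "openin (proj_top polynomial_algebra) V0" "V0 \<noteq> {}"
proof -
  have "(Var 0 :: (3, 'e) mpoly) \<in> homogeneous polynomial_algebra"
    unfolding homogeneous_def pl.hpart_R using forms_Var by blast
  then show "openin (proj_top polynomial_algebra) V0" unfolding V0_def by (rule pl.openin_Dp)
  have "\<psi>3 (Var 0) \<noteq> (0 :: 'e poly poly poly fract)" by (simp add: psi3_vars fract_nz)
  then have "(Var 0 :: (3, 'e) mpoly) \<noteq> 0" using psi3_eq_0 by blast
  then show "V0 \<noteq> {}" unfolding V0_def using pl.eta_Dp by (auto simp: polynomial_algebra_simps)
qed

lemma FF_mem: assumes p: "p \<in> U0" shows "FF p \<in> V0"
proof -
  have pp: "p \<in> ce.pts" and z: "zz \<notin> ce.lft p" using p by (simp_all add: U0_iff)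
  have h: "ce.hprime (ce.lft p)" using ce.hprime_lft[OF pp] .
  have z0: "Var 0 \<notin> FF p" using z by (simp add: FF_def phi_simps)
  have "pl.hprime (FF p)" unfolding pl.hprime_def
  proof (intro conjI allI ballI impI)
    show pr: "prime_idl (FF p)" unfolding FF_def by (rule prime_idl_vimage[OF rhom_phi ce.prime_lft[OF pp]])
    show "a \<in> FF p" if "\<psi>3 a = 0" for a using that psi3_eq_0 idl_0[OF prime_idl_idl[OF pr]] by simp
    show "hcomp a n \<in> FF p" if "a \<in> FF p" for a n
      using that h by (simp add: FF_def phi_hcomp ce.hprime_def)
    show "\<exists>v. Var v \<notin> FF p" using z0 by blast
  qed
  from pl.image_pts[OF this] show ?thesis using z0 by (simp add: V0_iff)
qed

lemma GG_hprime: assumes q: "q \<in> V0" shows "ce.hprime {a. \<theta> a \<in> q}"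
proof -
  have qq: "q \<in> pl.pts" and z: "Var 0 \<notin> q" using q by (simp_all add: V0_iff)
  have h: "pl.hprime q" using pl.hprime_lft[OF qq] by (simp add: lft_pl)
  have pq: "prime_idl q" using h by (simp add: pl.hprime_def)
  have pr: "prime_idl {a. \<theta> a \<in> q}" by (rule prime_idl_vimage[OF rhom_theta pq])
  note I = prime_idl_idl[OF pr]
  have nz: "zz \<notin> {a. \<theta> a \<in> q}" using z prime_idl_power[OF pq] by (auto simp: theta_zz)
  have th: "\<theta> (cubic (s ^ 2) t2) = 0"
  proof -
    have "\<psi> (cubic (s ^ 2) t2) = 0" by (simp add: psi_ker)
    then have "\<psi>3 (\<theta> (cubic (s ^ 2) t2)) = 0" using psi3_theta[OF cubic_forms] by simp
    then show ?thesis by (simp add: psi3_eq_0)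
  qed
  show ?thesis unfolding ce.hprime_def
  proof (intro conjI allI ballI impI pr)
    show "a \<in> {a. \<theta> a \<in> q}" if "\<psi> a = 0" for a
      using that idl_0[OF prime_idl_idl[OF pq]] unfolding psi_ker
      by (auto elim!: dvdE simp: rhom_mult[OF rhom_theta] th)
    show "hcomp a n \<in> {a. \<theta> a \<in> q}" if "a \<in> {a. \<theta> a \<in> q}" for a n
      using that h by (simp add: theta_hcomp pl.hprime_def)
    show "\<exists>v. Var v \<notin> {a. \<theta> a \<in> q}"
    proof (rule ccontr)
      assume "\<not> ?thesis"
      then have "Var Y1 + Const s * Var X1 \<in> {a. \<theta> a \<in> q}" by (intro idl_add[OF I] idl_mult[OF I]) blast+
      then show False using nz by (simp add: zz_def)
    qed
  qed
qed

lemma lft_GG: "q \<in> V0 \<Longrightarrow> ce.lft (GG q) = {a. \<theta> a \<in> q}"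
  unfolding GG_def by (rule ce.lft_image[OF GG_hprime])

lemma GG_mem: assumes q: "q \<in> V0" shows "GG q \<in> U0"
proof -
  have "pl.hprime q" using pl.hprime_lft[of q] q by (simp add: lft_pl V0_iff)
  then have "\<theta> zz \<notin> q" using q prime_idl_power[of q "Var 0" 3] by (auto simp: theta_zz V0_iff pl.hprime_def)
  then show ?thesis using ce.image_pts[OF GG_hprime[OF q]] lft_GG[OF q] unfolding U0_iff by (simp add: GG_def)
qed

lemma FF_GG: assumes q: "q \<in> V0" shows "FF (GG q) = q"
proof (rule hprime_eqI)
  have hq: "pl.hprime q" using pl.hprime_lft[of q] q by (simp add: lft_pl V0_iff)
  have hF: "pl.hprime (FF (GG q))" using pl.hprime_lft[of "FF (GG q)"] FF_mem[OF GG_mem[OF q]] by (simp add: lft_pl V0_iff)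
  show "hcomp a n \<in> FF (GG q)" if "a \<in> FF (GG q)" for a n using that hF by (simp add: pl.hprime_def)
  show "hcomp a n \<in> q" if "a \<in> q" for a n using that hq by (simp add: pl.hprime_def)
  show "idl (FF (GG q))" "idl q" using hF hq by (simp_all add: pl.hprime_def prime_idl_def)
  show "a \<in> FF (GG q) \<longleftrightarrow> a \<in> q" if a: "a \<in> forms n" for a n
  proof -
    have pq: "prime_idl q" using hq by (simp add: pl.hprime_def)
    have "a \<in> FF (GG q) \<longleftrightarrow> (Var 0 ^ 2) ^ n * a \<in> q" by (simp add: FF_def lft_GG[OF q] theta_phi[OF a])
    moreover have "(Var 0 ^ 2) ^ n \<notin> q" using q prime_idl_power[OF pq] by (auto simp: V0_iff)
    ultimately show ?thesis using prime_idl_mult[OF pq] idl_mult[OF prime_idl_idl[OF pq]] by blast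
  qed
qed

lemma phi_theta_mem:
  assumes p: "p \<in> U0" and a: "a \<in> forms n" shows "\<phi> (\<theta> a) \<in> ce.lft p \<longleftrightarrow> a \<in> ce.lft p"
proof -
  have pp: "p \<in> ce.pts" and z: "zz \<notin> ce.lft p" using p by (simp_all add: U0_iff)
  have pr: "prime_idl (ce.lft p)" using ce.prime_lft[OF pp] .
  have "\<psi> (\<phi> (\<theta> a)) = \<psi> (zz ^ (2 * n) * a)"
    by (simp only: psi_phi psi3_theta[OF a] rhom_mult[OF rhom_psi] rhom_power[OF rhom_psi])
  then have "\<phi> (\<theta> a) \<in> ce.lft p \<longleftrightarrow> zz ^ (2 * n) * a \<in> ce.lft p"
    unfolding ce.lft_iff by (simp only: ce.pi_eq[symmetric])
  moreover have "zz ^ (2 * n) \<notin> ce.lft p" using z prime_idl_power[OF pr] by blast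
  ultimately show ?thesis using prime_idl_mult[OF pr] idl_mult[OF prime_idl_idl[OF pr]] by blast
qed

lemma GG_FF: assumes p: "p \<in> U0" shows "GG (FF p) = p"
proof -
  have pp: "p \<in> ce.pts" using p by (simp add: U0_iff)
  have h: "ce.hprime (ce.lft p)" using ce.hprime_lft[OF pp] .
  have "{a. \<theta> a \<in> FF p} = ce.lft p"
  proof (rule hprime_eqI)
    have hG: "ce.hprime {a. \<theta> a \<in> FF p}" using GG_hprime[OF FF_mem[OF p]] .
    show "hcomp a n \<in> {a. \<theta> a \<in> FF p}" if "a \<in> {a. \<theta> a \<in> FF p}" for a n using that hG unfolding ce.hprime_def by blast
    show "hcomp a n \<in> ce.lft p" if "a \<in> ce.lft p" for a n using that h unfolding ce.hprime_def by blast
    show "idl {a. \<theta> a \<in> FF p}" "idl (ce.lft p)" using hG h unfolding ce.hprime_def prime_idl_def by blast+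
    show "a \<in> {a. \<theta> a \<in> FF p} \<longleftrightarrow> a \<in> ce.lft p" if "a \<in> forms n" for a n
      using phi_theta_mem[OF p that] by (simp add: FF_def)
  qed
  then show ?thesis unfolding GG_def using ce.pi_lft[OF pp] by simp
qed

text \<open>Both local rings lie in the same field. Fractions are carried over by
  \<open>\<theta>\<close> in one direction, where the powers of \<open>z\<close> cancel, and by
  \<open>\<phi>\<close> in the other.\<close>

lemma Oc_eq: assumes p: "p \<in> U0" shows "ce.Oc p = pl.Oc (FF p)"
proof (intro equalityI subsetI)
  have pp: "p \<in> ce.pts" using p by (simp add: U0_iff)
  fix x assume "x \<in> ce.Oc p"
  then obtain a t n where a: "a \<in> forms n" "t \<in> forms n" "t \<notin> ce.lft p" "x = \<psi> a / \<psi> t" unfolding ce.Oc_psi by blast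
  have "\<psi> zz \<noteq> 0" by (simp add: psi_zz fract_nz)
  then have "x = \<psi>3 (\<theta> a) / \<psi>3 (\<theta> t)" by (simp add: psi3_theta[OF a(1)] psi3_theta[OF a(2)] a(4))
  moreover have "\<theta> t \<notin> FF p" using phi_theta_mem[OF p a(2)] a(3) by (simp add: FF_def)
  ultimately show "x \<in> pl.Oc (FF p)"
    using pl.Oc_psiI[OF theta_forms[OF a(1)] theta_forms[OF a(2)]] by (simp add: lft_pl)
next
  fix x assume "x \<in> pl.Oc (FF p)"
  then obtain a t n where a: "a \<in> forms n" "t \<in> forms n" "t \<notin> FF p" "x = \<psi>3 a / \<psi>3 t"
    unfolding pl.Oc_psi lft_pl by blast
  then have "x = \<psi> (\<phi> a) / \<psi> (\<phi> t)" "\<phi> t \<notin> ce.lft p" by (simp_all add: psi_phi FF_def)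
  then show "x \<in> ce.Oc p" using ce.Oc_psiI[OF phi_forms[OF a(1)] phi_forms[OF a(2)]] by simp
qed

abbreviation "ZX \<equiv> open_subspace (Proj (cubic_ring (s ^ 2) t2)) U0"
abbreviation "ZP \<equiv> open_subspace (Proj (polynomial_algebra :: ((3, 'e) mpoly, 'e) graded_algebra)) V0"

definition WW :: "(3, 'e) mpoly set set \<Rightarrow> _" where "WW V = {p \<in> U0. FF p \<in> V}"

lemma preim_WW: "preim ZX FF V = WW V"
  by (simp add: preim_def WW_def ce.points_sub[OF open_U0(1)])

lemma open_WW: assumes V: "openin (proj_top polynomial_algebra) V" shows "openin (proj_top (cubic_ring (s ^ 2) t2)) (WW V)"
  unfolding ce.openin_proj_iff
proof (intro conjI ballI)
  show "WW V \<subseteq> ce.pts" by (auto simp: WW_def U0_iff)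
  fix p assume p: "p \<in> WW V"
  then have p0: "p \<in> U0" and pp: "p \<in> ce.pts" and z: "zz \<notin> ce.lft p" and F: "FF p \<in> V" by (simp_all add: WW_def U0_iff)
  obtain h where h: "h \<in> homogeneous polynomial_algebra" "h \<notin> FF p" "pl.Dp h \<subseteq> V"
    using V F unfolding pl.openin_proj_iff by blast
  then obtain n where n: "h \<in> forms n" unfolding homogeneous_def pl.hpart_R by blast
  \<comment> \<open>The factor \<open>zz\<close> keeps the basic open set inside
    \<open>U0\<close>.\<close>
  let ?k = "zz * \<phi> h"
  have k: "?k \<in> forms (1 + n)" by (rule forms_mult[OF zz_forms phi_forms[OF n]])
  have kp: "?k \<in> ce.lft p' \<longleftrightarrow> zz \<in> ce.lft p' \<or> h \<in> FF p'" if "p' \<in> ce.pts" for p'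
    using prime_idl_mult[OF ce.prime_lft[OF that]] idl_mult[OF prime_idl_idl[OF ce.prime_lft[OF that]]]
      idl_mult_r[OF prime_idl_idl[OF ce.prime_lft[OF that]]] unfolding FF_def by blast
  have "ce.Dp (cubic_proj (s ^ 2) t2 ?k) \<subseteq> WW V"
  proof
    fix p' assume "p' \<in> ce.Dp (cubic_proj (s ^ 2) t2 ?k)"
    then have p': "p' \<in> ce.pts" "?k \<notin> ce.lft p'" by (simp_all add: ce.Dp_iff ce.lft_iff)
    then have "p' \<in> U0" "h \<notin> FF p'" using kp[OF p'(1)] by (auto simp: U0_iff)
    then have "FF p' \<in> pl.Dp h" using FF_mem by (auto simp: pl.Dp_iff V0_iff)
    then show "p' \<in> WW V" using \<open>p' \<in> U0\<close> h(3) by (auto simp: WW_def)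
  qed
  moreover have "cubic_proj (s ^ 2) t2 ?k \<notin> p" using kp[OF pp] z h(2) by (simp add: ce.lft_iff)
  moreover have "cubic_proj (s ^ 2) t2 ?k \<in> homogeneous (cubic_ring (s ^ 2) t2)"
    unfolding homogeneous_def ce.hpart_R using k by blast
  ultimately show "\<exists>h\<in>homogeneous (cubic_ring (s ^ 2) t2). h \<notin> p \<and> ce.Dp h \<subseteq> WW V" by blast
qed

lemma open_GG_vimage:
  assumes V: "openin (proj_top (cubic_ring (s ^ 2) t2)) V"
  shows "openin (proj_top polynomial_algebra) {q \<in> V0. GG q \<in> V}"
  unfolding pl.openin_proj_iff
proof (intro conjI ballI)
  show "{q \<in> V0. GG q \<in> V} \<subseteq> pl.pts" by (auto simp: V0_iff)
  fix q assume "q \<in> {q \<in> V0. GG q \<in> V}"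
  then have q0: "q \<in> V0" and qq: "q \<in> pl.pts" and z: "Var 0 \<notin> q" and G: "GG q \<in> V" by (simp_all add: V0_iff)
  obtain A where A: "A \<in> homogeneous (cubic_ring (s ^ 2) t2)" "A \<notin> GG q" "ce.Dp A \<subseteq> V"
    using V G unfolding ce.openin_proj_iff by blast
  then obtain n a where n: "a \<in> forms n" "A = cubic_proj (s ^ 2) t2 a" unfolding homogeneous_def ce.hpart_R by blast
  let ?k = "Var 0 * \<theta> a"
  have k: "?k \<in> forms (1 + n * 3)" by (rule forms_mult[OF forms_Var theta_forms[OF n(1)]])
  have prq: "prime_idl q'" if "q' \<in> pl.pts" for q' using pl.prime_lft[OF that] by (simp add: lft_pl)
  have kp: "?k \<in> q' \<longleftrightarrow> Var 0 \<in> q' \<or> \<theta> a \<in> q'" if "q' \<in> pl.pts" for q'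
    using prime_idl_mult[OF prq[OF that]] idl_mult[OF prime_idl_idl[OF prq[OF that]]]
      idl_mult_r[OF prime_idl_idl[OF prq[OF that]]] by blast
  have Aq: "A \<in> GG q' \<longleftrightarrow> \<theta> a \<in> q'" if "q' \<in> V0" for q'
    using lft_GG[OF that] unfolding n(2) ce.lft_iff[symmetric] by simp
  have "pl.Dp ?k \<subseteq> {q \<in> V0. GG q \<in> V}"
  proof
    fix q' assume "q' \<in> pl.Dp ?k"
    then have q': "q' \<in> pl.pts" "?k \<notin> q'" by (simp_all add: pl.Dp_iff)
    then have q'0: "q' \<in> V0" "\<theta> a \<notin> q'" using kp[OF q'(1)] by (auto simp: V0_iff)
    then have "GG q' \<in> ce.Dp A" using GG_mem[OF q'0(1)] Aq[OF q'0(1)] by (auto simp: ce.Dp_iff U0_iff)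
    then show "q' \<in> {q \<in> V0. GG q \<in> V}" using q'0 A(3) by blast
  qed
  moreover have "?k \<notin> q" using kp[OF qq] z A(2) Aq[OF q0] by blast
  moreover have "?k \<in> homogeneous polynomial_algebra" unfolding homogeneous_def pl.hpart_R using k by blast
  ultimately show "\<exists>h\<in>homogeneous polynomial_algebra. h \<notin> q \<and> pl.Dp h \<subseteq> {q \<in> V0. GG q \<in> V}" by blast
qed

text \<open>The comorphism is the identity on values: the field element of a section is read off,
  and the section of the same value on the preimage is returned. On the empty set this choice is not
  unique, but there all sections coincide.\<close>

definition gg where
  "gg V f = ce.sec (WW V) (SOME x. x \<in> pl.OU V \<and> f = pl.sec V x)"

lemma WW_empty_iff: assumes "V \<subseteq> V0" shows "WW V = {} \<longleftrightarrow> V = {}"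
proof
  assume "WW V = {}"
  then show "V = {}" using GG_mem FF_GG assms unfolding WW_def by (metis (mono_tags, lifting) Collect_empty_eq equals0I subsetD)
qed (auto simp: WW_def)

lemma pl_sec_inj:
  assumes V: "V \<noteq> {}" and x: "x \<in> pl.OU V" "pl.sec V x = pl.sec V y" shows "x = y"
proof -
  obtain q where q: "q \<in> V" using V by blast
  have "pl.sec V x q = pl.sec V y q" using x(2) by (rule fun_cong)
  then have "pl.fr q x = pl.fr q y" using q by (simp add: pl.sec_def)
  moreover have "x \<in> pl.Oc q" using x(1) q by (simp add: pl.OU_def)
  ultimately show ?thesis using pl.fr_inj by metis
qed

lemma ce_sec_inj:
  assumes V: "V \<noteq> {}" and x: "x \<in> ce.OU V" "ce.sec V x = ce.sec V y" shows "x = y"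
proof -
  obtain q where q: "q \<in> V" using V by blast
  have "ce.sec V x q = ce.sec V y q" using x(2) by (rule fun_cong)
  then have "ce.fr q x = ce.fr q y" using q by (simp add: ce.sec_def)
  moreover have "x \<in> ce.Oc q" using x(1) q by (simp add: ce.OU_def)
  ultimately show ?thesis using ce.fr_inj by metis
qed

lemma gg_sec: assumes V: "V \<subseteq> V0" and x: "x \<in> pl.OU V" shows "gg V (pl.sec V x) = ce.sec (WW V) x"
proof (cases "V = {}")
  case True
  then have "WW V = {}" by (auto simp: WW_def)
  then show ?thesis by (simp add: gg_def ce.sec_def restrict_def)
next
  case False
  let ?P = "\<lambda>y. y \<in> pl.OU V \<and> pl.sec V x = pl.sec V y"
  have "?P (SOME y. ?P y)" by (rule someI[of ?P x]) (use x in simp)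
  then have "x = (SOME y. ?P y)" using pl_sec_inj[OF False x] by blast
  then show ?thesis by (simp add: gg_def)
qed

lemma OU_eq: assumes V: "V \<subseteq> V0" shows "pl.OU V = ce.OU (WW V)"
proof (intro equalityI subsetI)
  fix x assume "x \<in> pl.OU V"
  then show "x \<in> ce.OU (WW V)" by (auto simp: pl.OU_def ce.OU_def WW_def Oc_eq)
next
  fix x assume x: "x \<in> ce.OU (WW V)"
  have "x \<in> pl.Oc q" if q: "q \<in> V" for q
  proof -
    have q0: "q \<in> V0" using q V by blast
    have "GG q \<in> WW V" using GG_mem[OF q0] FF_GG[OF q0] q by (simp add: WW_def)
    then have "x \<in> ce.Oc (GG q)" using x by (simp add: ce.OU_def)
    then show ?thesis using Oc_eq[OF GG_mem[OF q0]] FF_GG[OF q0] by simp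
  qed
  then show "x \<in> pl.OU V" by (simp add: pl.OU_def)
qed

lemma gg_iso:
  assumes V: "openin (proj_top polynomial_algebra) V" "V \<subseteq> V0"
  shows "gg V \<in> ring_iso (proj_sections polynomial_algebra V) (proj_sections (cubic_ring (s ^ 2) t2) (WW V))"
proof -
  have W: "openin (proj_top (cubic_ring (s ^ 2) t2)) (WW V)" using open_WW[OF V(1)] .
  have sub: "V \<subseteq> pl.pts" "WW V \<subseteq> ce.pts" using V(1) W pl.openin_proj_iff ce.openin_proj_iff by blast+
  have cV: "carrier (proj_sections polynomial_algebra V) = pl.sec V ` pl.OU V" by (rule pl.sections_carrier[OF V(1)])
  have cW: "carrier (proj_sections (cubic_ring (s ^ 2) t2) (WW V)) = ce.sec (WW V) ` ce.OU (WW V)" by (rule ce.sections_carrier[OF W])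
  note eq = OU_eq[OF V(2)] and gs = gg_sec[OF V(2)]
  show ?thesis
  proof (rule ring_iso_memI)
    fix f assume "f \<in> carrier (proj_sections polynomial_algebra V)"
    then obtain x where x: "x \<in> pl.OU V" "f = pl.sec V x" unfolding cV by blast
    show "gg V f \<in> carrier (proj_sections (cubic_ring (s ^ 2) t2) (WW V))"
      unfolding cW x(2) gs[OF x(1)] using x(1) eq by blast
    fix f' assume "f' \<in> carrier (proj_sections polynomial_algebra V)"
    then obtain y where y: "y \<in> pl.OU V" "f' = pl.sec V y" unfolding cV by blast
    have xy: "x \<in> ce.OU (WW V)" "y \<in> ce.OU (WW V)" using x(1) y(1) eq by auto
    show "gg V (f \<otimes>\<^bsub>proj_sections polynomial_algebra V\<^esub> f') = gg V f \<otimes>\<^bsub>proj_sections (cubic_ring (s ^ 2) t2) (WW V)\<^esub> gg V f'"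
      unfolding x(2) y(2) pl.sections_ops(1)[OF sub(1) x(1) y(1)] gs[OF x(1)] gs[OF y(1)] ce.sections_ops(1)[OF sub(2) xy]
      by (rule gs[OF pl.OU_simps(5)[OF sub(1) x(1) y(1)]])
    show "gg V (f \<oplus>\<^bsub>proj_sections polynomial_algebra V\<^esub> f') = gg V f \<oplus>\<^bsub>proj_sections (cubic_ring (s ^ 2) t2) (WW V)\<^esub> gg V f'"
      unfolding x(2) y(2) pl.sections_ops(2)[OF sub(1) x(1) y(1)] gs[OF x(1)] gs[OF y(1)] ce.sections_ops(2)[OF sub(2) xy]
      by (rule gs[OF pl.OU_simps(4)[OF sub(1) x(1) y(1)]])
  next
    show "gg V \<one>\<^bsub>proj_sections polynomial_algebra V\<^esub> = \<one>\<^bsub>proj_sections (cubic_ring (s ^ 2) t2) (WW V)\<^esub>"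
      unfolding pl.sections_one[OF sub(1)] ce.sections_one[OF sub(2)] by (rule gs[OF pl.OU_simps(2)[OF sub(1)]])
    show "bij_betw (gg V) (carrier (proj_sections polynomial_algebra V)) (carrier (proj_sections (cubic_ring (s ^ 2) t2) (WW V)))"
      unfolding bij_betw_def
    proof
      show "inj_on (gg V) (carrier (proj_sections polynomial_algebra V))"
      proof (rule inj_onI)
        fix f f' assume "f \<in> carrier (proj_sections polynomial_algebra V)" "f' \<in> carrier (proj_sections polynomial_algebra V)"
          and g: "gg V f = gg V f'"
        then obtain x y where xy: "x \<in> pl.OU V" "f = pl.sec V x" "y \<in> pl.OU V" "f' = pl.sec V y" unfolding cV by blast
        show "f = f'"
        proof (cases "V = {}")
          case True then show ?thesis using xy by (simp add: pl.sec_def restrict_def)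
        next
          case False
          then have "WW V \<noteq> {}" using WW_empty_iff[OF V(2)] by blast
          moreover have "ce.sec (WW V) x = ce.sec (WW V) y" using g xy gs by simp
          ultimately have "x = y" using ce_sec_inj[of "WW V" x y] xy(1) eq by blast
          then show ?thesis using xy by simp
        qed
      qed
      show "gg V ` carrier (proj_sections polynomial_algebra V) = carrier (proj_sections (cubic_ring (s ^ 2) t2) (WW V))"
        unfolding cV cW eq[symmetric] image_image by (rule image_cong[OF refl]) (rule gs)
    qed
  qed
qed

lemma continuous_FF: "continuous_map (ptop ZX) (ptop ZP) FF"
  unfolding continuous_map_def
proof (intro conjI allI impI)
  show "FF \<in> topspace (ptop ZX) \<rightarrow> topspace (ptop ZP)"
    using FF_mem by (simp add: ce.points_sub[OF open_U0(1)] pl.points_sub[OF open_V0(1)])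
  fix V assume "openin (ptop ZP) V"
  then have "openin (proj_top polynomial_algebra) V" by (simp add: pl.openin_sub[OF open_V0(1)])
  then have "openin (ptop ZX) (WW V)" using open_WW by (auto simp: ce.openin_sub[OF open_U0(1)] WW_def)
  then show "openin (ptop ZX) {x \<in> topspace (ptop ZX). FF x \<in> V}" by (simp add: ce.points_sub[OF open_U0(1)] WW_def)
qed

lemma continuous_GG: "continuous_map (ptop ZP) (ptop ZX) GG"
  unfolding continuous_map_def
proof (intro conjI allI impI)
  show "GG \<in> topspace (ptop ZP) \<rightarrow> topspace (ptop ZX)"
    using GG_mem by (simp add: ce.points_sub[OF open_U0(1)] pl.points_sub[OF open_V0(1)])
  fix V assume "openin (ptop ZX) V"
  then have "openin (proj_top (cubic_ring (s ^ 2) t2)) V" by (simp add: ce.openin_sub[OF open_U0(1)])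
  then have "openin (ptop ZP) {q \<in> V0. GG q \<in> V}" using open_GG_vimage by (auto simp: pl.openin_sub[OF open_V0(1)])
  then show "openin (ptop ZP) {x \<in> topspace (ptop ZP). GG x \<in> V}" by (simp add: pl.points_sub[OF open_V0(1)])
qed

lemma homeomorphic_FF: "homeomorphic_map (ptop ZX) (ptop ZP) FF"
proof -
  have "homeomorphic_maps (ptop ZX) (ptop ZP) FF GG"
    unfolding homeomorphic_maps_def using continuous_FF continuous_GG FF_GG GG_FF
    by (simp add: ce.points_sub[OF open_U0(1)] pl.points_sub[OF open_V0(1)])
  then show ?thesis by (rule homeomorphic_maps_imp_map)
qed

lemma morphism_FF: "morphism_over ZX ZP FF gg"
  unfolding morphism_over_def preim_WW
proof (intro conjI allI impI ballI)
  show "continuous_map (ptop ZX) (ptop ZP) FF" by (rule continuous_FF)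
  note oV = pl.openin_sub[OF open_V0(1)] and sV = pl.sections_sub[of V0] and sU = ce.sections_sub[of U0]
  show "gg V \<in> ring_hom (sections ZP V) (sections ZX (WW V))" if "openin (ptop ZP) V" for V
    using gg_iso[of V] that by (simp add: oV pl.sections_sub[OF open_V0(1)] ce.sections_sub[OF open_U0(1)] ring_iso_def)
  show "gg W (restr ZP V W \<tau>) = restr ZX (WW V) (WW W) (gg V \<tau>)"
    if VW: "openin (ptop ZP) V \<and> openin (ptop ZP) W \<and> W \<subseteq> V" and \<tau>: "\<tau> \<in> carrier (sections ZP V)" for V W \<tau>
  proof -
    have V: "openin (proj_top polynomial_algebra) V" "V \<subseteq> V0" "W \<subseteq> V0" "W \<subseteq> V" using VW by (auto simp: oV)
    obtain x where x: "x \<in> pl.OU V" "\<tau> = pl.sec V x"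
      using \<tau> pl.sections_carrier[OF V(1)] by (auto simp: pl.sections_sub[OF open_V0(1)])
    have WW: "WW W \<subseteq> WW V" using V(4) by (auto simp: WW_def)
    have "gg W (restr ZP V W \<tau>) = gg W (pl.sec W x)"
      by (simp add: x(2) pl.restr_sub[OF open_V0(1)] pl.restrict_sec[OF V(4)])
    also have "\<dots> = ce.sec (WW W) x" by (rule gg_sec[OF V(3) pl.OU_mono[OF V(4) x(1)]])
    also have "\<dots> = restr ZX (WW V) (WW W) (gg V \<tau>)"
      by (simp add: x(2) gg_sec[OF V(2) x(1)] ce.restr_sub[OF open_U0(1)] ce.restrict_sec[OF WW])
    finally show ?thesis .
  qed
  have WV: "WW V0 = U0" using FF_mem by (auto simp: WW_def)
  show "gg (points ZP) (scalar ZP c) = scalar ZX c" for c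
  proof -
    have "\<psi>3 (Const c) \<in> pl.OU V0" using pl.OU_simps(3)[OF pl.open_subset_pts[OF open_V0(1) open_V0(1)]] .
    then have "gg V0 (pl.sec V0 (\<psi>3 (Const c))) = ce.sec U0 (\<psi>3 (Const c))" using gg_sec[of V0] WV by simp
    then show ?thesis
      by (simp add: pl.points_sub[OF open_V0(1)] pl.scalar_sub[OF open_V0(1)] ce.scalar_sub[OF open_U0(1)] psi_simps psi3_vars)
  qed
  \<comment> \<open>A germ is a unit when the inverse of its value lies in the local ring, and the
    two local rings coincide.\<close>
  show "germ ZP (FF x) V \<tau> \<in> Units (stalk ZP (FF x))"
    if x: "x \<in> points ZX" and V: "openin (ptop ZP) V \<and> FF x \<in> V" and \<tau>: "\<tau> \<in> carrier (sections ZP V)"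
      and u: "germ ZX x (WW V) (gg V \<tau>) \<in> Units (stalk ZX x)" for x V \<tau>
  proof -
    have x0: "x \<in> U0" using x by (simp add: ce.points_sub[OF open_U0(1)])
    have V': "openin (proj_top polynomial_algebra) V" "V \<subseteq> V0" "FF x \<in> V" using V by (simp_all add: oV)
    obtain y where y: "y \<in> pl.OU V" "\<tau> = pl.sec V y"
      using \<tau> pl.sections_carrier[OF V'(1)] by (auto simp: pl.sections_sub[OF open_V0(1)])
    have W: "openin (proj_top (cubic_ring (s ^ 2) t2)) (WW V)" "WW V \<subseteq> U0" "x \<in> WW V"
      using open_WW[OF V'(1)] x0 V'(3) by (auto simp: WW_def)
    have yW: "y \<in> ce.OU (WW V)" using y(1) OU_eq[OF V'(2)] by simp
    have yx: "y \<in> ce.Oc x" using yW W(3) by (simp add: ce.OU_def)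
    have "ce.Gm U0 x y \<in> Units (stalk ZX x)"
      using u unfolding y(2) gg_sec[OF V'(2) y(1)] ce.germ_sec[OF open_U0(1) W yW] .
    then have "y \<noteq> 0 \<and> inverse y \<in> pl.Oc (FF x)"
      using ce.Units_stalk_iff[OF open_U0(1) x0 yx] Oc_eq[OF x0] by simp
    then have "pl.Gm V0 (FF x) y \<in> Units (stalk ZP (FF x))"
      using pl.Units_stalk_iff[OF open_V0(1) FF_mem[OF x0]] yx Oc_eq[OF x0] by simp
    then show ?thesis unfolding y(2) pl.germ_sec[OF open_V0(1) V' y(1)] .
  qed
qed

theorem birational_plane:
  "birational_over (hypersurface (cubic (s ^ 2) t2)) (projective_plane :: ('e, _, _) ringed_space)"
proof -
  have "isomorphism_over ZX ZP FF gg" unfolding isomorphism_over_def preim_WW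
    using morphism_FF homeomorphic_FF gg_iso
    by (simp add: pl.openin_sub[OF open_V0(1)] pl.sections_sub[OF open_V0(1)] ce.sections_sub[OF open_U0(1)])
  moreover have "dense_open (Proj (cubic_ring (s ^ 2) t2)) U0" using ce.dense_open_Proj[OF open_U0] .
  moreover have "dense_open (Proj polynomial_algebra) V0" using pl.dense_open_Proj[OF open_V0] .
  ultimately show ?thesis unfolding birational_over_def hypersurface_def projective_plane_def by blast
qed

end

section \<open>Rational points\<close>

text \<open>Cosets of \<open>M\<close> coincide exactly when the values differ by a value of
  \<open>M\<close>; so \<open>k\<close> makes the scalars hit every residue class, and
  \<open>inj\<close> makes them hit it once.\<close>

lemma (in embedded_ring) residue_bij:
  fixes \<kappa> :: "'k \<Rightarrow> 'r"
  assumes M: "M = carrier R - Units R" and m: "\<And>x y. x \<in> \<epsilon> ` M \<Longrightarrow> y \<in> \<epsilon> ` M \<Longrightarrow> x - y \<in> \<epsilon> ` M" "0 \<in> \<epsilon> ` M"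
    and k: "\<And>c. \<kappa> c \<in> carrier R" "\<And>x. x \<in> carrier R \<Longrightarrow> \<exists>c. \<epsilon> x - \<epsilon> (\<kappa> c) \<in> \<epsilon> ` M"
    and inj: "\<And>c d. \<epsilon> (\<kappa> c) - \<epsilon> (\<kappa> d) \<in> \<epsilon> ` M \<Longrightarrow> c = d"
  shows "bij_betw (\<lambda>c. M +> \<kappa> c) UNIV (carrier (R Quot M))"
proof -
  have coset: "M +> a = {x \<in> carrier R. \<epsilon> x - \<epsilon> a \<in> \<epsilon> ` M}" if a: "a \<in> carrier R" for a
  proof (intro equalityI subsetI)
    fix x assume "x \<in> M +> a"
    then obtain h where h: "h \<in> M" "x = h \<oplus> a" by (auto simp: a_r_coset_def')
    then have "x \<in> carrier R" "\<epsilon> x = \<epsilon> h + \<epsilon> a" using M a emb_add[of h a] by auto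
    then show "x \<in> {x \<in> carrier R. \<epsilon> x - \<epsilon> a \<in> \<epsilon> ` M}" using h by simp
  next
    fix x assume "x \<in> {x \<in> carrier R. \<epsilon> x - \<epsilon> a \<in> \<epsilon> ` M}"
    then obtain h where h: "x \<in> carrier R" "h \<in> M" "\<epsilon> x - \<epsilon> a = \<epsilon> h" by blast
    have hc: "h \<in> carrier R" using h M by blast
    have "\<epsilon> (h \<oplus> a) = \<epsilon> x" using emb_add[OF hc a] h(3) by (simp add: algebra_simps)
    then have "x = h \<oplus> a" using emb_eq h(1) emb_add[OF hc a] by metis
    then show "x \<in> M +> a" using h(2) by (auto simp: a_r_coset_def')
  qed
  have eq: "M +> a = M +> b \<longleftrightarrow> \<epsilon> a - \<epsilon> b \<in> \<epsilon> ` M" if ab: "a \<in> carrier R" "b \<in> carrier R" for a b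
  proof
    assume "M +> a = M +> b"
    moreover have "a \<in> M +> a" unfolding coset[OF ab(1)] using ab(1) m(2) by simp
    ultimately show "\<epsilon> a - \<epsilon> b \<in> \<epsilon> ` M" unfolding coset[OF ab(2)] by simp
  next
    assume ab': "\<epsilon> a - \<epsilon> b \<in> \<epsilon> ` M"
    have n: "- y \<in> \<epsilon> ` M" if "y \<in> \<epsilon> ` M" for y using m(1)[OF m(2) that] by simp
    have "\<epsilon> x - \<epsilon> a \<in> \<epsilon> ` M \<longleftrightarrow> \<epsilon> x - \<epsilon> b \<in> \<epsilon> ` M" for x
      using m(1)[of "\<epsilon> x - \<epsilon> a" "- (\<epsilon> a - \<epsilon> b)"] m(1)[of "\<epsilon> x - \<epsilon> b" "\<epsilon> a - \<epsilon> b"] n[OF ab'] ab' by auto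
    then show "M +> a = M +> b" unfolding coset[OF ab(1)] coset[OF ab(2)] by simp
  qed
  have car: "carrier (R Quot M) = {M +> a | a. a \<in> carrier R}"
    by (auto simp: FactRing_def A_RCOSETS_def')
  show ?thesis unfolding bij_betw_def
  proof
    show "inj (\<lambda>c. M +> \<kappa> c)" using eq[OF k(1) k(1)] inj by (auto intro: injI)
    show "range (\<lambda>c. M +> \<kappa> c) = carrier (R Quot M)"
    proof
      show "range (\<lambda>c. M +> \<kappa> c) \<subseteq> carrier (R Quot M)" unfolding car using k(1) by blast
      show "carrier (R Quot M) \<subseteq> range (\<lambda>c. M +> \<kappa> c)"
      proof
        fix A assume "A \<in> carrier (R Quot M)"
        then obtain a where a: "A = M +> a" "a \<in> carrier R" unfolding car by blast
        obtain c where "\<epsilon> a - \<epsilon> (\<kappa> c) \<in> \<epsilon> ` M" using k(2)[OF a(2)] by blast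
        then have "A = M +> \<kappa> c" using eq[OF a(2) k(1)] a(1) by simp
        then show "A \<in> range (\<lambda>c. M +> \<kappa> c)" by blast
      qed
    qed
  qed
qed

context poly_model
begin

text \<open>The maximal ideal of the local ring at \<open>p\<close>, as a set of values.\<close>

definition mx :: "'a set \<Rightarrow> 'g set" where
  "mx p = {\<psi> a / \<psi> t | a t n. a \<in> forms n \<and> t \<in> forms n \<and> t \<notin> lft p \<and> a \<in> lft p}"

lemma mx_iff:
  assumes "p \<in> pts" "a \<in> forms n" "t \<in> forms n" "t \<notin> lft p"
  shows "\<psi> a / \<psi> t \<in> mx p \<longleftrightarrow> a \<in> lft p"
proof
  assume "\<psi> a / \<psi> t \<in> mx p"
  then obtain b u m where b: "b \<in> forms m" "u \<in> forms m" "u \<notin> lft p" "b \<in> lft p" "\<psi> a / \<psi> t = \<psi> b / \<psi> u"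
    unfolding mx_def by blast
  then show "a \<in> lft p" using unit_Oc_psi[OF assms] unit_Oc_psi[OF assms(1) b(1-3)] by simp
qed (use assms mx_def in blast)

text \<open>A fraction \<open>a/t\<close> agrees with the scalar \<open>c\<close> at
  \<open>p\<close> when the form \<open>a - c t\<close> lies in the prime, so surjectivity onto the
  residue field reduces to forms. Injectivity is automatic, since a nonzero constant in a prime
  would make it improper.\<close>

lemma rational_criterion:
  assumes p: "p \<in> pts"
    and c: "\<And>n a t. a \<in> forms n \<Longrightarrow> t \<in> forms n \<Longrightarrow> t \<notin> lft p \<Longrightarrow> \<exists>c. a - Const c * t \<in> lft p"
  shows "p \<in> rational_points (Proj R)"
proof -
  let ?Z = "open_subspace (Proj R) pts"
  let ?S = "stalk ?Z p"
  interpret E: embedded_ring ?S "sv pts p" by (rule stalk_embedded(1)[OF openin_pts p])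
  note Gc = stalk_carrier[OF openin_pts p] and svG = sv_Gm[OF openin_pts p]
  have pr: "prime_idl (lft p)" using prime_lft[OF p] .
  note I = prime_idl_idl[OF pr]
  let ?M = "carrier ?S - Units ?S"
  have eM: "sv pts p ` ?M = mx p"
  proof (intro equalityI subsetI)
    fix x assume "x \<in> sv pts p ` ?M"
    then obtain y where y: "y \<in> Oc p" "Gm pts p y \<notin> Units ?S" "x = y" using svG unfolding Gc by auto
    then obtain a t n where a: "a \<in> forms n" "t \<in> forms n" "t \<notin> lft p" "y = \<psi> a / \<psi> t" unfolding Oc_psi by blast
    have "\<not> (y \<noteq> 0 \<and> inverse y \<in> Oc p)" using Units_stalk_iff[OF openin_pts p y(1)] y(2) by blast
    then have "a \<in> lft p" using unit_Oc_psi[OF p a(1-3)] unfolding a(4)[symmetric] by blast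
    then show "x \<in> mx p" unfolding mx_def y(3) a(4) using a by blast
  next
    fix x assume "x \<in> mx p"
    then obtain a t n where a: "a \<in> forms n" "t \<in> forms n" "t \<notin> lft p" "a \<in> lft p" "x = \<psi> a / \<psi> t" unfolding mx_def by blast
    have xO: "x \<in> Oc p" unfolding a(5) by (rule Oc_psiI[OF a(1-3)])
    have "\<not> (x \<noteq> 0 \<and> inverse x \<in> Oc p)" using unit_Oc_psi[OF p a(1-3)] a(4,5) by simp
    then have "Gm pts p x \<in> ?M" using Units_stalk_iff[OF openin_pts p xO] xO unfolding Gc by blast
    then show "x \<in> sv pts p ` ?M" using svG[OF xO] by (metis imageI)
  qed
  have constO: "\<psi> (Const k) \<in> Oc p" for k using Oc_simps(3)[OF p] .
  have zero: "0 \<in> mx p"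
  proof -
    have "\<psi> 0 / \<psi> 1 \<in> mx p" unfolding mx_def using forms_0 forms_1 prime_idl_1[OF pr] idl_0[OF I] by blast
    then show ?thesis by (simp add: rhom_0[OF psi])
  qed
  have "bij_betw (\<lambda>k. ?M +>\<^bsub>?S\<^esub> Gm pts p (\<psi> (Const k))) UNIV (carrier (?S Quot ?M))"
  proof (rule E.residue_bij[OF refl], unfold eM)
    show "0 \<in> mx p" by (rule zero)
    show "Gm pts p (\<psi> (Const k)) \<in> carrier ?S" for k unfolding Gc using constO by blast
    show "x - y \<in> mx p" if xy: "x \<in> mx p" "y \<in> mx p" for x y
    proof -
      obtain a t n where a: "a \<in> forms n" "t \<in> forms n" "t \<notin> lft p" "a \<in> lft p" "x = \<psi> a / \<psi> t"
        using xy(1) unfolding mx_def by blast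
      obtain b u m where b: "b \<in> forms m" "u \<in> forms m" "u \<notin> lft p" "b \<in> lft p" "y = \<psi> b / \<psi> u"
        using xy(2) unfolding mx_def by blast
      have nz: "\<psi> t \<noteq> 0" "\<psi> u \<noteq> 0" using psi_nz p a(3) b(3) by blast+
      have "x - y = \<psi> (a * u + - (b * t)) / \<psi> (t * u)"
        using nz by (simp add: a(5) b(5) rhom_simps[OF psi] field_simps)
      moreover have "a * u + - (b * t) \<in> forms (n + m)"
        using forms_mult[OF a(1) b(2)] forms_mult[OF b(1) a(2)] forms_add forms_neg by (metis add.commute)
      moreover have "t * u \<in> forms (n + m)" "t * u \<notin> lft p" "a * u + - (b * t) \<in> lft p"
        using forms_mult[OF a(2) b(2)] prime_idl_mult[OF pr] a(3,4) b(3,4) idl_add[OF I] idl_minus[OF I] idl_mult_r[OF I] by blast+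
      ultimately show ?thesis unfolding mx_def by blast
    qed
    show "\<exists>k. sv pts p x - sv pts p (Gm pts p (\<psi> (Const k))) \<in> mx p" if x: "x \<in> carrier ?S" for x
    proof -
      obtain y where y: "y \<in> Oc p" "x = Gm pts p y" using x unfolding Gc by blast
      then obtain a t n where a: "a \<in> forms n" "t \<in> forms n" "t \<notin> lft p" "y = \<psi> a / \<psi> t" unfolding Oc_psi by blast
      obtain k where k: "a - Const k * t \<in> lft p" using c[OF a(1-3)] by blast
      have "\<psi> t \<noteq> 0" using psi_nz p a(3) by blast
      then have "y - \<psi> (Const k) = \<psi> (a - Const k * t) / \<psi> t"
        by (simp add: a(4) rhom_simps[OF psi] field_simps)
      moreover have "a - Const k * t \<in> forms n"
        using forms_add[OF a(1) forms_neg[of "Const k * t" n]] forms_mult[OF forms_Const a(2)] by simp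
      ultimately have "y - \<psi> (Const k) \<in> mx p" unfolding mx_def using a k by blast
      then show ?thesis using svG[OF y(1)] svG[OF constO] y(2) by auto
    qed
    show "k = l" if "sv pts p (Gm pts p (\<psi> (Const k))) - sv pts p (Gm pts p (\<psi> (Const l))) \<in> mx p" for k l
    proof (rule ccontr)
      assume kl: "k \<noteq> l"
      have "\<psi> (Const (k - l)) / \<psi> 1 \<in> mx p"
        using that unfolding svG[OF constO] by (simp add: rhom_diff[OF rhom_Const] rhom_diff[OF psi] rhom_1[OF psi])
      then have "Const (k - l) \<in> lft p"
        using mx_iff[OF p forms_Const forms_1] prime_idl_1[OF pr] by blast
      then have "Const (inverse (k - l)) * Const (k - l) \<in> lft p" by (rule idl_mult[OF I])
      then have "1 \<in> lft p" using kl by (simp add: rhom_mult[OF rhom_Const, symmetric])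
      then show False using prime_idl_1[OF pr] by blast
    qed
  qed
  moreover have "germ ?Z p (points ?Z) (scalar ?Z k) = Gm pts p (\<psi> (Const k))" for k
    unfolding points_sub[OF openin_pts] scalar_sub[OF openin_pts]
    by (rule germ_sec[OF openin_pts openin_pts order.refl p]) (rule OU_simps(3)[OF order.refl])
  ultimately show ?thesis using p points_sub[OF openin_pts]
    unfolding rational_points_def residue_field_def by (simp add: open_subspace_pts)
qed

end

section \<open>Points given by coordinate vectors\<close>

context cubic_field
begin

definition evl :: "(coord \<Rightarrow> 'f) \<Rightarrow> (coord, 'f) mpoly \<Rightarrow> 'f" where
  "evl v = mev (\<lambda>c. c) v"

text \<open>Restriction to the line through the origin and \<open>v\<close>, the affine cone over
  the point. Its kernel is prime as the preimage of zero in a domain, and on forms it amounts to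
  evaluation at \<open>v\<close>.\<close>

definition cone :: "(coord \<Rightarrow> 'f) \<Rightarrow> (coord, 'f) mpoly \<Rightarrow> 'f poly" where
  "cone v = mev (\<lambda>c. [:c:]) (\<lambda>i. [:0, 1:] * [:v i:])"

definition pt :: "(coord \<Rightarrow> 'f) \<Rightarrow> (coord, 'f) mpoly set set" where
  "pt v = cubic_proj t1 t2 ` {a. cone v a = 0}"

lemma rhom_id: "rhom (\<lambda>c :: 'f. c)"
  by (simp add: rhom_def)

lemma rhom_evl: "rhom (evl v)" and rhom_cone: "rhom (cone v)"
  unfolding evl_def cone_def by (intro rhom_mev rhom_id rhom_const_poly)+

lemma evl_simps: "evl v (Const c) = c" "evl v (Var i) = v i"
  by (simp_all add: evl_def mev_Const[OF rhom_id] mev_Var[OF rhom_id])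

lemma cone_forms: assumes a: "a \<in> forms n" shows "cone v a = monom (evl v a) n"
proof -
  have "cone v a = [:0, 1:] ^ n * mev (\<lambda>c. [:c:]) (\<lambda>i. [:v i:]) a"
    unfolding cone_def by (rule mev_forms_scale[OF rhom_const_poly a])
  also have "mev (\<lambda>c. [:c:]) (\<lambda>i. [:v i:]) a = [:evl v a:]"
    by (rule rhom_mpoly_ext[OF rhom_mev[OF rhom_const_poly] rhom_comp[OF rhom_const_poly rhom_evl]])
      (simp_all add: mev_Const[OF rhom_const_poly] mev_Var[OF rhom_const_poly] evl_simps)
  finally show ?thesis by (simp add: monom_altdef mult.commute)
qed

lemma cone_forms_0: "a \<in> forms n \<Longrightarrow> cone v a = 0 \<longleftrightarrow> evl v a = 0"
  by (simp add: cone_forms)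

lemma pt_hprime:
  assumes f: "evl v (cubic t1 t2) = 0" and v: "v i \<noteq> 0"
  shows "cub.hprime {a. cone v a = 0}"
  unfolding cub.hprime_def
proof (intro conjI allI ballI impI)
  have "prime_idl {0 :: 'f poly}" by (auto simp: prime_idl_def idl_def)
  from prime_idl_vimage[OF rhom_cone this] show "prime_idl {a. cone v a = 0}" by simp
  have "cone v (cubic t1 t2) = 0" using f cone_forms_0[OF cubic_forms] by blast
  then show "a \<in> {a. cone v a = 0}" if "\<psi> a = 0" for a
    using that unfolding psi_ker by (auto elim!: dvdE simp: rhom_mult[OF rhom_cone])
  have "cone v (Var i) \<noteq> 0" using v cone_forms_0[OF forms_Var] by (simp add: evl_simps)
  then show "\<exists>i. Var i \<notin> {a. cone v a = 0}" by blast
  show "hcomp a n \<in> {a. cone v a = 0}" if a: "a \<in> {a. cone v a = 0}" for a n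
  proof -
    obtain N where N: "a = (\<Sum>i\<le>N. hcomp a i)" by (rule hcomp_sum_bound)
    have "cone v (\<Sum>i\<le>N. hcomp a i) = 0" using a N by simp
    then have "(\<Sum>i\<le>N. monom (evl v (hcomp a i)) i) = 0"
      by (simp add: rhom_sum[OF rhom_cone] cone_forms[OF hcomp_forms])
    \<comment> \<open>The components of \<open>a\<close> end up at different powers of the line
      parameter, so each of them vanishes separately.\<close>
    then have "coeff (\<Sum>i\<le>N. monom (evl v (hcomp a i)) i) n = 0" by simp
    then have z: "n \<le> N \<Longrightarrow> evl v (hcomp a n) = 0" by (simp add: coeff_sum)
    have "n > N \<Longrightarrow> hcomp a n = 0"
    proof -
      assume "n > N"
      have "hcomp a n = hcomp (\<Sum>i\<le>N. hcomp a i) n" by (rule arg_cong[OF N])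
      then show ?thesis using \<open>n > N\<close> by (simp add: hcomp_sum hcomp_of_forms[OF hcomp_forms])
    qed
    then show ?thesis using z cone_forms_0[OF hcomp_forms] rhom_0[OF rhom_evl] rhom_0[OF rhom_cone] by (cases "n \<le> N") auto
  qed
qed

lemma pt_lft:
  assumes "evl v (cubic t1 t2) = 0" "v i \<noteq> 0"
  shows "pt v \<in> cub.pts" "a \<in> forms n \<Longrightarrow> a \<in> cub.lft (pt v) \<longleftrightarrow> evl v a = 0"
  unfolding pt_def using cub.image_pts[OF pt_hprime[OF assms]] cub.lft_image[OF pt_hprime[OF assms]] cone_forms_0 by auto

lemma pt_rational:
  assumes v: "evl v (cubic t1 t2) = 0" "v i \<noteq> 0"
  shows "pt v \<in> rational_points (hypersurface (cubic t1 t2))"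
  unfolding hypersurface_def
proof (rule cub.rational_criterion[OF pt_lft(1)[OF v]])
  fix n and a t :: "(coord, 'f) mpoly" assume a: "a \<in> forms n" "t \<in> forms n" "t \<notin> cub.lft (pt v)"
  define k where "k = evl v a / evl v t"
  have "a - Const k * t \<in> forms n"
    using forms_add[OF a(1) forms_neg[of "Const k * t" n]] forms_mult[OF forms_Const a(2)] by simp
  moreover have "evl v (a - Const k * t) = 0"
    using a(3) pt_lft(2)[OF v a(2)] by (simp add: rhom_simps[OF rhom_evl] evl_simps k_def)
  ultimately show "\<exists>c. a - Const c * t \<in> cub.lft (pt v)" using pt_lft(2)[OF v] by blast
qed

lemma evl_cubic: "evl v (cubic t1 t2) = v Y1 * (v Y1 ^ 2 + t1 * v X1 ^ 2) + v Y2 * (v Y2 ^ 2 + t2 * v X2 ^ 2)"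
  unfolding cubic_def by (simp add: rhom_simps[OF rhom_evl] evl_simps power2_eq_square power3_eq_cube algebra_simps)

text \<open>The line \<open>y\<^sub>1 = y\<^sub>2 = 0\<close> lies on the surface.\<close>

theorem infinite_rational_points: "infinite (rational_points (hypersurface (cubic t1 t2)))"
proof
  assume fin: "finite (rational_points (hypersurface (cubic t1 t2)))"
  define v :: "'f \<Rightarrow> coord \<Rightarrow> 'f" where "v c i = (case i of X1 \<Rightarrow> 1 | X2 \<Rightarrow> c | Y1 \<Rightarrow> 0 | Y2 \<Rightarrow> 0)" for c i
  have v: "evl (v c) (cubic t1 t2) = 0" "v c X1 \<noteq> 0" for c by (simp_all add: evl_cubic v_def)
  have "inj (\<lambda>c. pt (v c))"
  proof (rule injI)
    fix c d assume eq: "pt (v c) = pt (v d)"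
    \<comment> \<open>This linear form vanishes at \<open>(1, c, 0, 0)\<close> and at no other
      member of the family.\<close>
    let ?a = "Var X2 - Const c * Var X1"
    have "Const c * Var X1 \<in> forms 1" using forms_mult[OF forms_Const forms_Var, of c X1] by simp
    then have a: "?a \<in> forms 1" using forms_add[OF forms_Var forms_neg] by fastforce
    have "evl (v c) ?a = 0" by (simp add: rhom_simps[OF rhom_evl] evl_simps v_def)
    then have "evl (v d) ?a = 0" using pt_lft(2)[OF v a, of c] pt_lft(2)[OF v a, of d] eq by simp
    then show "c = d" by (simp add: rhom_simps[OF rhom_evl] evl_simps v_def)
  qed
  moreover have "range (\<lambda>c. pt (v c)) \<subseteq> rational_points (hypersurface (cubic t1 t2))"
    using pt_rational[OF v] by blast
  then have "finite (range (\<lambda>c. pt (v c)))" using fin by (rule finite_subset)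
  ultimately show False using infinite_F finite_imageD by blast
qed

end

section \<open>Roots over a separably closed field\<close>

lemma separably_closed_root:
  fixes q :: "'f::field poly"
  assumes sc: "separably_closed TYPE('f)" and q: "coprime q (pderiv q)" "degree q \<noteq> 0"
  obtains x where "poly q x = 0"
proof -
  have "q \<noteq> 0" using q(2) by auto
  then obtain r where r: "prime_elem r" "r dvd q" using ex_prime_factor[OF _ q(2)] by metis
  obtain w where w: "q = r * w" using r(2) by (rule dvdE)
  \<comment> \<open>A factor of a separable polynomial is separable, so the prime factor
    \<open>r\<close> must be linear.\<close>
  have "coprime r (pderiv r)"
  proof (rule coprimeI)
    fix d assume d: "d dvd r" "d dvd pderiv r"
    then have "d dvd q" "d dvd pderiv q" unfolding w pderiv_mult by (simp_all only: dvd_mult dvd_mult2 dvd_add dvd_triv_left)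
    then show "d dvd 1" using q(1) coprime_common_divisor by blast
  qed
  moreover have "Factorial_Ring.irreducible r" using r(1) by (rule prime_elem_imp_irreducible)
  ultimately have "degree r = 1" using sc unfolding separably_closed_def by blast
  then obtain a b where ab: "r = [:a, b:]" "b \<noteq> 0"
    by (metis degree_pCons_eq_if degree_eq_zeroE One_nat_def Suc_inject nat.distinct(1) pCons_cases pCons_eq_0_iff degree_0)
  have "poly r (- a / b) = 0" unfolding ab(1) using ab(2) by simp
  then have "poly q (- a / b) = 0" by (simp only: w poly_mult mult_zero_left)
  then show ?thesis by (rule that)
qed

text \<open>Linear factors are split off one by one; the cofactor inherits separability and does not
  vanish again at the removed root.\<close>

lemma separably_closed_card_roots:
  fixes q :: "'f::field poly"
  assumes sc: "separably_closed TYPE('f)" and "coprime q (pderiv q)" "q \<noteq> 0"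
  shows "card {x. poly q x = 0} = degree q"
  using assms(2,3)
proof (induction "degree q" arbitrary: q)
  case 0
  then obtain c where "q = [:c:]" "c \<noteq> 0" by (metis degree_eq_zeroE pCons_0_0)
  then show ?case by simp
next
  case (Suc n)
  obtain x where x: "poly q x = 0" using separably_closed_root[OF sc Suc.prems(1)] Suc.hyps(2) by (metis nat.distinct(1))
  then obtain w where w: "q = [:- x, 1:] * w" using poly_eq_0_iff_dvd by (metis dvdE)
  have w0: "w \<noteq> 0" using Suc.prems(2) w by auto
  have dw: "n = degree w" using Suc.hyps(2) w0 by (simp add: w degree_mult_eq del: mult_pCons_left)
  have cw: "coprime w (pderiv w)"
  proof (rule coprimeI)
    fix d assume d: "d dvd w" "d dvd pderiv w"
    then have "d dvd q" "d dvd pderiv q" unfolding w pderiv_mult by (simp_all only: dvd_mult dvd_mult2 dvd_add dvd_triv_left)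
    then show "d dvd 1" using Suc.prems(1) coprime_common_divisor by blast
  qed
  have wx: "poly w x \<noteq> 0"
  proof
    assume "poly w x = 0"
    then have "[:- x, 1:] dvd w" using poly_eq_0_iff_dvd by blast
    then have "[:- x, 1:] dvd pderiv q" "[:- x, 1:] dvd q" unfolding w pderiv_mult by (simp_all only: dvd_mult dvd_mult2 dvd_add dvd_triv_left)
    then have "[:- x, 1:] dvd 1" using Suc.prems(1) coprime_common_divisor by blast
    then show False using poly_eq_0_iff_dvd[of 1 x] by simp
  qed
  have "{y. poly q y = 0} = insert x {y. poly w y = 0}" by (auto simp: w)
  moreover have "finite {y. poly w y = 0}" using poly_roots_finite[OF w0] .
  ultimately have "card {y. poly q y = 0} = Suc (card {y. poly w y = 0})" using wx by simp
  then show ?case using Suc.hyps(1)[OF dw cw w0] dw Suc.hyps(2) by simp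
qed

context cubic_field
begin

text \<open>Scaling a point of the surface so that \<open>y\<^sub>2 = y\<^sub>1\<^sup>2 + t\<^sub>1x\<^sub>1\<^sup>2\<close> turns the cubic equation into
  \<open>y\<^sub>1\<^sup>4 + y\<^sub>1 + t\<^sub>1\<^sup>2x\<^sub>1\<^sup>4 + t\<^sub>2x\<^sub>2\<^sup>2 = 0\<close>, which is separable in \<open>y\<^sub>1\<close>. The inner, middle and outer
  variables below are \<open>x\<^sub>1\<close>, \<open>x\<^sub>2\<close> and \<open>y\<^sub>1\<close>.\<close>

definition cc0 :: "'f poly poly" where "cc0 = [:[:t1:] ^ 2 * [:0, 1:] ^ 4:] + [:[:t2:]:] * [:0, 1:] ^ 2"

definition PP :: "'f poly poly poly" where "PP = [:cc0, 1, 0, 0, 1:]"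

text \<open>Pullback along the rescaled parametrization: \<open>y2\<close> is replaced by
  \<open>y1^2 + t1 x1^2\<close>, and zeros of the quartic \<open>PP\<close> go to points of the
  surface.\<close>

definition HH :: "(coord, 'f) mpoly \<Rightarrow> 'f poly poly poly" where
  "HH = mev cc (\<lambda>i. case i of X1 \<Rightarrow> vi | X2 \<Rightarrow> vm | Y1 \<Rightarrow> vo | Y2 \<Rightarrow> vo ^ 2 + cc t1 * vi ^ 2)"

definition vv :: "'f \<Rightarrow> 'f \<Rightarrow> 'f \<Rightarrow> coord \<Rightarrow> 'f" where
  "vv m c n i = (case i of X1 \<Rightarrow> m | X2 \<Rightarrow> c | Y1 \<Rightarrow> n | Y2 \<Rightarrow> n ^ 2 + t1 * m ^ 2)"

lemma HH_simps: "HH (Const c) = cc c" "HH (Var X1) = vi" "HH (Var X2) = vm" "HH (Var Y1) = vo"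
    "HH (Var Y2) = vo ^ 2 + cc t1 * vi ^ 2"
  unfolding HH_def by (simp_all only: mev_Const[OF rhom_cc] mev_Var[OF rhom_cc] coord.case)

lemma rhom_HH: "rhom HH"
  unfolding HH_def by (rule rhom_mev[OF rhom_cc])

lemma evl_HH: "pev3 (\<lambda>c. c) m c n (HH a) = evl (vv m c n) a"
proof (rule rhom_mpoly_ext[OF rhom_comp[OF rhom_pev3[OF rhom_id] rhom_HH] rhom_evl])
  note R = rhom_pev3[OF rhom_id, of m c n] and P = pev3_simps[OF rhom_id, of m c n]
  show "pev3 (\<lambda>c. c) m c n (HH (Const k)) = evl (vv m c n) (Const k)" for k
    by (simp only: HH_simps P evl_simps)
  show "pev3 (\<lambda>c. c) m c n (HH (Var i)) = evl (vv m c n) (Var i)" for i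
    by (cases i) (simp_all only: HH_simps P evl_simps vv_def coord.case rhom_add[OF R] rhom_mult[OF R] rhom_power[OF R])
qed

lemma PP_altdef: "PP = vo ^ 4 + vo + cc t1 ^ 2 * vi ^ 4 + cc t2 * vm ^ 2"
  by (simp add: PP_def cc0_def power2_eq_square power4_eq_xxxx)

lemma pev3_PP:
  assumes "rhom c" shows "pev3 c m k n PP = n ^ 4 + n + c t1 ^ 2 * m ^ 4 + c t2 * k ^ 2"
  unfolding PP_altdef
  by (simp only: rhom_add[OF rhom_pev3[OF assms]] rhom_mult[OF rhom_pev3[OF assms]] rhom_power[OF rhom_pev3[OF assms]] pev3_simps[OF assms])

text \<open>For \<open>y2 = y1^2 + t1 x1^2\<close> the cubic becomes \<open>y2\<close> times the
  quartic \<open>PP\<close>, because squaring is additive in characteristic two.\<close>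

lemma vv_cubic: assumes "pev3 (\<lambda>c. c) m c n PP = 0" shows "evl (vv m c n) (cubic t1 t2) = 0"
proof -
  let ?\<alpha> = "n ^ 2 + t1 * m ^ 2"
  have "?\<alpha> ^ 2 = n ^ 4 + t1 ^ 2 * m ^ 4 + 2 * (n ^ 2 * (t1 * m ^ 2))"
    by (simp add: power2_sum power_mult_distrib mult.assoc flip: power_mult)
  then have "?\<alpha> ^ 2 + t2 * c ^ 2 + n = 0" using assms unfolding pev3_PP[OF rhom_id] by (simp add: two algebra_simps)
  moreover have "evl (vv m c n) (cubic t1 t2) = ?\<alpha> * (?\<alpha> ^ 2 + t2 * c ^ 2 + n)"
    unfolding evl_cubic by (simp add: vv_def algebra_simps)
  ultimately show ?thesis by simp
qed

text \<open>If \<open>b\<close> vanished at all these points, its pullback \<open>HH b\<close> would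
  be divisible by \<open>PP\<close>; evaluation at a suitably rescaled generic point of the surface
  would then give \<open>\<psi> b = 0\<close>.\<close>

lemma rational_points_meet_open:
  assumes sc: "separably_closed TYPE('f)" and b: "b \<in> forms n" "\<psi> b \<noteq> 0"
  shows "\<exists>m c k. pev3 (\<lambda>c. c) m c k PP = 0 \<and> evl (vv m c k) b \<noteq> 0"
proof (rule ccontr)
  assume "\<not> ?thesis"
  then have van: "\<And>m c k. pev3 (\<lambda>c. c) m c k PP = 0 \<Longrightarrow> evl (vv m c k) b = 0" by blast
  have lcP: "lead_coeff PP = 1" "degree PP = 4" by (simp_all add: PP_def)
  obtain w r where wr: "HH b = PP * w + r" "r = 0 \<or> degree r < degree PP" using monic_division[OF lcP(1)] .
  \<comment> \<open>For each choice of \<open>x1\<close> and \<open>x2\<close> the specialised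
    quartic has four distinct roots, too many for a nonzero remainder of degree below four.\<close>
  have "map_poly (pev (pev (\<lambda>c. c) m) c) r = 0" for m c
  proof (rule ccontr)
    let ?h = "pev (pev (\<lambda>c. c) m) c :: 'f poly poly \<Rightarrow> 'f"
    let ?q = "map_poly ?h PP"
    have h: "rhom ?h" by (intro rhom_pev rhom_id)
    assume nz: "map_poly ?h r \<noteq> 0"
    have q: "?q = [:?h cc0, 1, 0, 0, 1:]"
      by (simp add: PP_def map_poly_pCons rhom_0[OF h] rhom_1[OF h])
    \<comment> \<open>The derivative is \<open>4 y^3 + 1\<close> with \<open>4 = 0\<close>, so the
      quartic is separable for every choice of the parameters.\<close>
    have "pderiv ?q = 1"
    proof -
      have "(4 :: 'f) = 2 * 2" by simp
      then have "(4 :: 'f) = 0" using two by simp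
      then show ?thesis unfolding q by (simp add: pderiv_pCons one_pCons)
    qed
    then have "card {x. poly ?q x = 0} = degree ?q"
      by (intro separably_closed_card_roots[OF sc]) (auto simp: q)
    then have c4: "card {x. poly ?q x = 0} = 4" by (simp add: q)
    have sub: "{x. poly ?q x = 0} \<subseteq> {x. poly (map_poly ?h r) x = 0}"
    proof clarify
      fix x assume "poly ?q x = 0"
      then have P0: "pev3 (\<lambda>c. c) m c x PP = 0" by (simp add: pev3_def pev_def)
      then have "pev3 (\<lambda>c. c) m c x (HH b) = 0" unfolding evl_HH by (rule van)
      then have "pev3 (\<lambda>c. c) m c x r = 0" using P0 unfolding wr(1)
        by (simp add: rhom_add[OF rhom_pev3[OF rhom_id]] rhom_mult[OF rhom_pev3[OF rhom_id]])
      then show "poly (map_poly ?h r) x = 0" by (simp add: pev3_def pev_def)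
    qed
    have "card {x. poly ?q x = 0} \<le> card {x. poly (map_poly ?h r) x = 0}"
      by (rule card_mono[OF poly_roots_finite[OF nz] sub])
    also have "\<dots> \<le> degree (map_poly ?h r)" using nz by (rule card_poly_roots_bound)
    also have "\<dots> \<le> degree r" by (rule degree_le) (simp add: coeff_map_poly rhom_0 h coeff_eq_0)
    finally have "4 \<le> degree r" using c4 by simp
    then show False using wr(2) lcP nz by auto
  qed
  then have "pev3 (\<lambda>c. c) m c k r = 0" for m c k by (simp add: pev3_def pev_def[of "pev (pev (\<lambda>c. c) m) c"])
  then have "r = 0" using pev3_zero[OF infinite_F] by blast
  then have H: "HH b = PP * w" using wr(1) by simp
  let ?C = "\<lambda>c. \<psi> (Const c)"
  have C: "rhom ?C" by (rule rhom_comp[OF rhom_psi rhom_Const])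
  define x1 x2 y1 y2 where "x1 = \<psi> (Var X1)" and "x2 = \<psi> (Var X2)" and "y1 = \<psi> (Var Y1)" and "y2 = \<psi> (Var Y2)"
  define \<alpha> where "\<alpha> = y1 ^ 2 + ?C t1 * x1 ^ 2"
  \<comment> \<open>The scaling for which \<open>l y2 = (l y1)^2 + t1 (l x1)^2\<close>, so that the
    generic point takes the form required by the parametrization.\<close>
  define l where "l = y2 / \<alpha>"
  have cub: "y1 * \<alpha> + y2 * (y2 ^ 2 + ?C t2 * x2 ^ 2) = 0"
  proof -
    have "\<psi> (cubic t1 t2) = y1 * \<alpha> + y2 * (y2 ^ 2 + ?C t2 * x2 ^ 2)"
      unfolding cubic_def \<alpha>_def x1_def x2_def y1_def y2_def
      by (simp only: rhom_add[OF rhom_psi] rhom_mult[OF rhom_psi] rhom_power[OF rhom_psi] power2_eq_square power3_eq_cube algebra_simps)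
    then show ?thesis using psi_cubic by simp
  qed
  have y2: "y2 \<noteq> 0" unfolding y2_def psi_simps by (simp add: jj_eq_0)
  have \<alpha>: "\<alpha> \<noteq> 0"
  proof
    assume "\<alpha> = 0"
    then have "y2 ^ 2 + ?C t2 * x2 ^ 2 = 0" using cub y2 by simp
    then have "jj (vm ^ 2 + cc t2 * vi ^ 2) = 0"
      unfolding y2_def x2_def psi_simps by (simp only: rhom_add[OF rhom_jj] rhom_mult[OF rhom_jj] rhom_power[OF rhom_jj])
    then have "vm ^ 2 + cc t2 * vi ^ 2 = (0 :: 'f poly poly poly)" by (simp only: jj_eq_0)
    then have "poly (poly (poly (vm ^ 2 + cc t2 * vi ^ 2) 0) 1) 0 = (0 :: 'f)" by simp
    then show False by simp
  qed
  have l0: "l \<noteq> 0" using y2 \<alpha> by (simp add: l_def)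
  have la: "l * \<alpha> = y2" using \<alpha> by (simp add: l_def)
  let ?E = "pev3 ?C (l * x1) (l * x2) (l * y1)"
  note R = rhom_pev3[OF C, of "l * x1" "l * x2" "l * y1"] and P = pev3_simps[OF C, of "l * x1" "l * x2" "l * y1"]
  have sq: "(l * y1) ^ 2 + ?C t1 * (l * x1) ^ 2 = l * y2"
    unfolding la[symmetric] \<alpha>_def by (simp only: power2_eq_square algebra_simps)
  have "?E PP = 0"
  proof -
    have two': "(2 :: 'f ffield) = 0"
      using rhom_add[OF C, of 1 1] by (simp only: one_add_one two rhom_0[OF C] rhom_1[OF C])
    have "((l * y1) ^ 2 + ?C t1 * (l * x1) ^ 2) ^ 2 = (l * y1) ^ 4 + ?C t1 ^ 2 * (l * x1) ^ 4 + 2 * ((l * y1) ^ 2 * (?C t1 * (l * x1) ^ 2))"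
      by (simp add: power2_sum power_mult_distrib mult.assoc flip: power_mult)
    then have "(l * y1) ^ 4 + ?C t1 ^ 2 * (l * x1) ^ 4 = (l * y2) ^ 2" unfolding sq by (simp add: two')
    then have "?E PP = (l * y2) ^ 2 + (l * y1 + ?C t2 * (l * x2) ^ 2)"
      unfolding pev3_PP[OF C] by (simp only: add_ac)
    also have "\<dots> = l * (l * (y2 ^ 2 + ?C t2 * x2 ^ 2) + y1)" by (simp only: power2_eq_square algebra_simps)
    also have "\<alpha> * (l * (y2 ^ 2 + ?C t2 * x2 ^ 2) + y1) = y1 * \<alpha> + (l * \<alpha>) * (y2 ^ 2 + ?C t2 * x2 ^ 2)" by (simp only: algebra_simps)
    then have "l * (y2 ^ 2 + ?C t2 * x2 ^ 2) + y1 = 0" unfolding la cub using \<alpha> by simp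
    finally show ?thesis by simp
  qed
  then have "?E (HH b) = 0" unfolding H by (simp add: rhom_mult[OF R])
  moreover have "?E (HH b) = mev ?C (\<lambda>i. l * \<psi> (Var i)) b"
  proof (rule rhom_mpoly_ext[OF rhom_comp[OF R rhom_HH] rhom_mev[OF C]])
    show "?E (HH (Const c)) = mev ?C (\<lambda>i. l * \<psi> (Var i)) (Const c)" for c by (simp only: HH_simps P mev_Const[OF C])
    show "?E (HH (Var i)) = mev ?C (\<lambda>i. l * \<psi> (Var i)) (Var i)" for i
      unfolding mev_Var[OF C]
      by (cases i) (simp_all only: HH_simps P rhom_add[OF R] rhom_mult[OF R] rhom_power[OF R] sq, simp_all only: x1_def x2_def y1_def y2_def)
  qed
  moreover have "mev ?C (\<lambda>i. l * \<psi> (Var i)) b = l ^ n * mev ?C (\<lambda>i. \<psi> (Var i)) b" by (rule mev_forms_scale[OF C b(1)])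
  moreover have "mev ?C (\<lambda>i. \<psi> (Var i)) b = \<psi> b"
    by (rule rhom_mpoly_ext[OF rhom_mev[OF C] rhom_psi]) (simp_all only: mev_Const[OF C] mev_Var[OF C])
  ultimately show False using l0 b(2) by simp
qed

theorem dense_rational_points:
  assumes sc: "separably_closed TYPE('f)"
  shows "ptop (hypersurface (cubic t1 t2)) closure_of rational_points (hypersurface (cubic t1 t2))
    = points (hypersurface (cubic t1 t2))"
proof
  let ?Y = "hypersurface (cubic t1 t2)"
  show "ptop ?Y closure_of rational_points ?Y \<subseteq> points ?Y" by (rule closure_of_subset_topspace)
  show "points ?Y \<subseteq> ptop ?Y closure_of rational_points ?Y"
  proof
    fix x assume x: "x \<in> points ?Y"
    show "x \<in> ptop ?Y closure_of rational_points ?Y" unfolding in_closure_of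
    proof (intro conjI allI impI x)
      fix T assume T: "x \<in> T \<and> openin (ptop ?Y) T"
      then have "openin (proj_top (cubic_ring t1 t2)) T" by (simp add: hypersurface_def cub.ptop_Proj)
      then obtain A where A: "x \<in> cub.pts" "A \<in> homogeneous (cubic_ring t1 t2)" "A \<notin> x" "cub.Dp A \<subseteq> T"
        using T unfolding cub.openin_proj_iff by blast
      then obtain n a where a: "a \<in> forms n" "A = cubic_proj t1 t2 a" unfolding homogeneous_def cub.hpart_R by blast
      have ax: "a \<notin> cub.lft x" using A(3) a(2) by (simp add: cub.lft_iff)
      \<comment> \<open>The extra factor guarantees a nonzero coordinate, so that the vector found
        defines a point.\<close>
      have "\<psi> (a * Var Y1) \<noteq> 0"
        using cub.psi_nz[OF A(1) ax] by (simp add: rhom_mult[OF rhom_psi] psi_simps jj_eq_0)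
      then obtain m c k where k: "pev3 (\<lambda>c. c) m c k PP = 0" "evl (vv m c k) (a * Var Y1) \<noteq> 0"
        using rational_points_meet_open[OF sc forms_mult[OF a(1) forms_Var]] by blast
      let ?v = "vv m c k"
      have v: "evl ?v (cubic t1 t2) = 0" "?v Y1 \<noteq> 0" "evl ?v a \<noteq> 0"
        using vv_cubic[OF k(1)] k(2) by (simp_all add: rhom_mult[OF rhom_evl] evl_simps)
      have "pt ?v \<in> cub.Dp A"
        using pt_lft(1)[OF v(1,2)] pt_lft(2)[OF v(1,2) a(1)] v(3) unfolding a(2) by (simp add: cub.Dp_iff cub.lft_iff)
      then show "\<exists>y. y \<in> rational_points ?Y \<and> y \<in> T" using pt_rational[OF v(1,2)] A(4) by blast
    qed
  qed
qed

end

text \<open>Applying a ring homomorphism to the coefficients is an evaluation and hence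
  multiplicative, so the base change of the cubic can be computed factor by factor.\<close>

lemma map_poly_mapping_mev:
  assumes "rhom c" shows "Poly_Mapping.map c p = mev (\<lambda>a. Const (c a)) Var p"
proof (rule poly_mapping_eqI)
  fix k
  have "Poly_Mapping.lookup (mev (\<lambda>a. Const (c a)) Var p) k
      = (\<Sum>m\<in>Poly_Mapping.keys p. if m = k then c (Poly_Mapping.lookup p m) else 0)"
    by (simp add: mev_def lookup_sum single_eq_monm[symmetric] lookup_single when_def)
  also have "\<dots> = Poly_Mapping.lookup (Poly_Mapping.map c p) k"
    by (simp add: map.rep_eq when_def in_keys_iff)
  finally show "Poly_Mapping.lookup (Poly_Mapping.map c p) k = Poly_Mapping.lookup (mev (\<lambda>a. Const (c a)) Var p) k" by simp
qed

lemma map_cubic: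
  assumes "rhom c" shows "Poly_Mapping.map c (cubic a b) = cubic (c a) (c b)"
proof -
  have C: "rhom (\<lambda>a. Const (c a))" by (rule rhom_comp[OF rhom_Const assms])
  show ?thesis unfolding map_poly_mapping_mev[OF assms] cubic_def
    by (simp only: rhom_add[OF rhom_mev[OF C]] rhom_mult[OF rhom_mev[OF C]] rhom_power[OF rhom_mev[OF C]] mev_Const[OF C] mev_Var[OF C])
qed

lemma ring_hom_rhom:
  assumes "\<iota> \<in> ring_hom ring_of_type_algebra ring_of_type_algebra" shows "rhom \<iota>"
  using ring_hom_add[OF assms] ring_hom_mult[OF assms] ring_hom_one[OF assms]
  by (intro rhomI) (simp_all add: ring_of_type_algebra_def)

theorem theorem4p4:
  fixes t1 t2 :: "'f::field"
    and \<iota> :: "'f \<Rightarrow> 'e::field" and s :: 'e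
  assumes "CHAR('f) = 2"
    and "p_independent [t1, t2]"
    and "adjoins_sqrt \<iota> t1 s"
  shows "regular_scheme (hypersurface (cubic t1 t2))
    \<and> \<not> ex_dominant_rational_map (projective_plane :: ('f, _, _) ringed_space)
          (hypersurface (cubic t1 t2))
    \<and> birational_over (hypersurface_base_change \<iota> (cubic t1 t2))
          (projective_plane :: ('e, _, _) ringed_space)
    \<and> infinite (rational_points (hypersurface (cubic t1 t2)))
    \<and> (separably_closed TYPE('f) \<longrightarrow>
          ptop (hypersurface (cubic t1 t2)) closure_of
            rational_points (hypersurface (cubic t1 t2))
          = points (hypersurface (cubic t1 t2)))"
proof -
  have two: "(2 :: 'f) = 0" using of_nat_CHAR[where ?'a = 'f] assms(1) by simp
  obtain D1 where D1: "derivn D1" "D1 t1 = 1" "D1 t2 = 0" using p_independent_derivation[OF assms(2)] by metis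
  obtain D2 where D2: "derivn D2" "D2 t1 = 0" "D2 t2 = 1" using p_independent_derivation[OF assms(2)] by metis
  interpret cubic_field t1 t2 D1 D2 by unfold_locales (simp_all add: two D1 D2)
  have \<iota>: "rhom \<iota>" and s: "s ^ 2 = \<iota> t1" using assms(3) ring_hom_rhom unfolding adjoins_sqrt_def by auto
  have "(2 :: 'e) = 0" using rhom_add[OF \<iota>, of 1 1] two by (simp add: rhom_1[OF \<iota>] rhom_0[OF \<iota>])
  moreover have "s \<noteq> 0" using s t_nz(1) rhom_inj_field[OF \<iota>, of t1] by auto
  ultimately interpret E: cubic_sqrt s "\<iota> t2" by unfold_locales
  have "birational_over (hypersurface_base_change \<iota> (cubic t1 t2)) (projective_plane :: ('e, _, _) ringed_space)"
    using E.birational_plane unfolding hypersurface_base_change_def map_cubic[OF \<iota>] s .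
  then show ?thesis
    using regular_hypersurface no_dominant_rational_map infinite_rational_points dense_rational_points by blast
qed

end
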